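(* Let $A$ be a regular weak multiplier Hopf algebra of discrete type and let $H$ be its faithful set of left cointegrals. Let $\widetilde A=\{\omega(\cdot\,a): a\in A,\ \omega\in A'\}\subset A'$. Then the two maps $$f_s:\widetilde A\otimes_{A_s}H\to A,\quad \omega\otimes h\mapsto(\omega\otimes id)\Delta(h),$$ $$f_t:\widetilde A\otimes_{A_t}H\to A,\quad \omega\otimes h\mapsto(id\otimes\omega)\Delta(h)$$ are bijective.
   Context: All algebras are over $\mathbb{C}$, associative, possibly non-unital, with non-degenerate product. $A$ is idempotent if $A^2=A$; $M(A)$ is the multiplier algebra (identity $1$); $A'$ is the space of all linear functionals on $A$. A coproduct is a homomorphism $\Delta:A\to M(A\otimes A)$ with $\Delta(a)(1\otimes b),(a\otimes 1)\Delta(b)\in A\otimes A$, coassociative: $(a\otimes1\otimes1)(\Delta\otimes id)(\Delta(b)(1\otimes c))=(id\otimes\Delta)((a\otimes1)\Delta(b))(1\otimes1\otimes c)$. Put $T_1(a\otimes b)=\Delta(a)(1\otimes b)$, $T_2(a\otimes b)=(a\otimes1)\Delta(b)$. $\Delta$ is full if the smallest subspaces $V,W\subset A$ with $\Delta(A)(1\otimes A)\subset V\otimes A$ and $(A\otimes1)\Delta(A)\subset A\otimes W$ both equal $A$. A counit is a linear functional $\varepsilon$ with $(\varepsilon\otimes id)(\Delta(a)(1\otimes b))=ab$, $(id\otimes\varepsilon)((c\otimes1)\Delta(a))=ca$. A weak multiplier Hopf algebra is a non-degenerate idempotent algebra $A$ with a full coproduct $\Delta$ and a counit such that: (i) there is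 an idempotent $E\in M(A\otimes A)$ with $T_1(A\otimes A)=E(A\otimes A)$, $T_2(A\otimes A)=(A\otimes A)E$; (ii) $(id\otimes\Delta)E=(E\otimes1)(1\otimes E)=(1\otimes E)(E\otimes1)$; (iii) $\mathrm{Ker}(T_i)=(1-G_i)(A\otimes A)$, $i=1,2$, where $G_1,G_2$ are the linear maps on $A\otimes A$ given by $(G_1\otimes id)(\Delta_{13}(a)(1\otimes b\otimes c))=\Delta_{13}(a)(1\otimes E)(1\otimes b\otimes c)$ and $(id\otimes G_2)((a\otimes b\otimes1)\Delta_{13}(c))=(a\otimes b\otimes1)(E\otimes1)\Delta_{13}(c)$. Here $\Delta$ (and likewise $id\otimes\Delta$) is uniquely extended to multipliers, with $\Delta(1)=E$. With Sweedler notation $\Delta(a)=\sum a_{(1)}\otimes a_{(2)}$, the antipode $S$ is the non-degenerate anti-homomorphism $A\to M(A)$ with $E(a\otimes b)=\sum a_{(1)}\otimes a_{(2)}S(a_{(3)})b$, $(a\otimes b)E=\sum aS(b_{(1)})b_{(2)}\otimes b_{(3)}$, $G_1(a\otimes b)=\sum a_{(1)}\otimes S(a_{(2)})a_{(3)}b$, $G_2(a\otimes b)=\sum ab_{(1)}S(b_{(2)})\otimes b_{(3)}$, $\sum S(a_{(1)})a_{(2)}S(a_{(3)})=S(a)$; it extends to $M(A)$. $A$ is regular if $S$ is bijective from $A$ to $A$; then also $\Delta(a)(b\otimes1),(1\otimes a)\Delta(b)\in A\otimes A$. Put $\varepsilon_t(a)=\sum a_{(1)}S(a_{(2)})$, $A_s=\{y\in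 M(A):\Delta(y)=E(1\otimes y)\}$, $A_t=\{x\in M(A):\Delta(x)=(x\otimes1)E\}$. For $m\in M(A)$, $\omega(\cdot\,m)$ is the functional $a\mapsto\omega(am)$. A left cointegral is a non-zero $h\in M(A)$ with $ah=\varepsilon_t(a)h$ for all $a\in A$. $H$ is the space of left cointegrals in $A$ (together with $0$). The left (right) leg of $\Delta(H)$ is the smallest subspace $V$ (resp. $W$) of $A$ with $\Delta(h)(1\otimes a)\in V\otimes A$ (resp. $(a\otimes1)\Delta(h)\in A\otimes W$) for all $a\in A$, $h\in H$. $H$ is a faithful set of left cointegrals if both legs equal $A$; $A$ is of discrete type if it has a faithful set of left cointegrals. Balanced tensor products: $A_s$ acts on functionals from the right by $\omega\leftharpoonup y=\omega(\cdot\,S(y))$ and on $H$ from the left by $y\rightharpoonup h=hS(y)$; likewise $A_t$ acts by $\omega\leftharpoonup x=\omega(\cdot\,S(x))$ and $x\rightharpoonup h=hS(x)$. *)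

theory Defs
  imports Complex_Main "HOL-Library.Poly_Mapping" "HOL-Library.Function_Algebras"
begin

section \<open>Complex vector spaces and algebras\<close>

class complex_vector = ab_group_add +
  fixes scaleC :: "complex \<Rightarrow> 'a \<Rightarrow> 'a"  (infixr \<open>*\<^sub>C\<close> 75)
  assumes scaleC_add_right: "c *\<^sub>C (x + y) = c *\<^sub>C x + c *\<^sub>C y"
    and scaleC_add_left: "(c + d) *\<^sub>C x = c *\<^sub>C x + d *\<^sub>C x"
    and scaleC_scaleC: "c *\<^sub>C d *\<^sub>C x = (c * d) *\<^sub>C x"
    and scaleC_one: "1 *\<^sub>C x = x"

global_interpretation cvec: vector_space "scaleC :: complex \<Rightarrow> 'a \<Rightarrow> 'a::complex_vector"
  defines csubspace = cvec.subspace and cspan = cvec.span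
  by standard (simp_all add: scaleC_add_right scaleC_add_left scaleC_scaleC scaleC_one)

abbreviation clinear :: "('a::complex_vector \<Rightarrow> 'b::complex_vector) \<Rightarrow> bool"
  where "clinear f \<equiv> Vector_Spaces.linear scaleC scaleC f"

definition cbilinear :: "('a::complex_vector \<Rightarrow> 'b::complex_vector \<Rightarrow> 'c::complex_vector) \<Rightarrow> bool"
  where "cbilinear f \<longleftrightarrow> (\<forall>x. clinear (f x)) \<and> (\<forall>y. clinear (\<lambda>x. f x y))"

text \<open>Algebras are associative and not assumed to be unital.\<close>

class complex_algebra = complex_vector + ring +
  assumes scaleC_mult_left: "(c *\<^sub>C x) * y = c *\<^sub>C (x * y)"
    and scaleC_mult_right: "x * (c *\<^sub>C y) = c *\<^sub>C (x * y)"

instantiation complex :: complex_algebra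
begin
definition scaleC_complex :: "complex \<Rightarrow> complex \<Rightarrow> complex"
  where "scaleC_complex = (*)"
instance by standard (simp_all add: scaleC_complex_def algebra_simps)
end

instantiation "fun" :: (type, complex_vector) complex_vector
begin
definition scaleC_fun :: "complex \<Rightarrow> ('a \<Rightarrow> 'b) \<Rightarrow> 'a \<Rightarrow> 'b"
  where "scaleC_fun c f = (\<lambda>x. c *\<^sub>C f x)"
instance
  by standard (simp_all add: scaleC_fun_def fun_eq_iff scaleC_add_right scaleC_add_left
      scaleC_scaleC scaleC_one)
end

instantiation poly_mapping :: (type, complex_vector) complex_vector
begin
definition scaleC_poly_mapping :: "complex \<Rightarrow> ('a \<Rightarrow>\<^sub>0 'b) \<Rightarrow> 'a \<Rightarrow>\<^sub>0 'b"
  where "scaleC_poly_mapping c = Poly_Mapping.map (scaleC c)"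
lemma lookup_scaleC: "Poly_Mapping.lookup (c *\<^sub>C p) k = c *\<^sub>C Poly_Mapping.lookup p k"
  by (simp add: scaleC_poly_mapping_def Poly_Mapping.map.rep_eq when_def)
instance
  by standard (simp_all add: poly_mapping_eq_iff fun_eq_iff lookup_scaleC lookup_add
      scaleC_add_right scaleC_add_left scaleC_scaleC scaleC_one)
end

lemma clinearI:
  assumes "\<And>x y. f (x + y) = f x + f y" "\<And>c x. f (c *\<^sub>C x) = c *\<^sub>C f x"
  shows "clinear f"
  using assms by (simp add: Vector_Spaces.linear_iff cvec.vector_space_axioms)

lemma clinearD:
  assumes "clinear f"
  shows clinear_add: "f (x + y) = f x + f y" and clinear_scale: "f (c *\<^sub>C x) = c *\<^sub>C f x"
    and clinear_zero: "f 0 = 0" and clinear_minus: "f (- x) = - f x"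
    and clinear_diff: "f (x - y) = f x - f y"
proof -
  interpret Vector_Spaces.linear scaleC scaleC f by fact
  show "f (x + y) = f x + f y" "f (c *\<^sub>C x) = c *\<^sub>C f x" "f 0 = 0" "f (- x) = - f x"
    "f (x - y) = f x - f y"
    by (simp_all add: add scale zero neg diff)
qed

lemma cbilinearD:
  assumes "cbilinear f"
  shows "f (x + y) z = f x z + f y z" "f x (z + w) = f x z + f x w"
    "f (c *\<^sub>C x) z = c *\<^sub>C f x z" "f x (c *\<^sub>C z) = c *\<^sub>C f x z" "f 0 z = 0" "f x 0 = 0"
  using assms clinearD[of "f x"] clinearD[of "\<lambda>x. f x z"]
  by (simp_all add: cbilinear_def)

section \<open>Tensor products\<close>

abbreviation free_gen :: "'v \<Rightarrow> 'w \<Rightarrow> ('v \<times> 'w) \<Rightarrow>\<^sub>0 complex"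
  where "free_gen v w \<equiv> Poly_Mapping.single (v, w) 1"

definition free_on :: "'v set \<Rightarrow> 'w set \<Rightarrow> (('v \<times> 'w) \<Rightarrow>\<^sub>0 complex) set"
  where "free_on V W = {p. Poly_Mapping.keys p \<subseteq> V \<times> W}"

definition free_lift ::
  "('v \<Rightarrow> 'w \<Rightarrow> 'c::complex_vector) \<Rightarrow> (('v \<times> 'w) \<Rightarrow>\<^sub>0 complex) \<Rightarrow> 'c"
  where "free_lift f p =
    (\<Sum>k\<in>Poly_Mapping.keys p. Poly_Mapping.lookup p k *\<^sub>C f (fst k) (snd k))"

definition bilinear_relators ::
  "'v::complex_vector set \<Rightarrow> 'w::complex_vector set \<Rightarrow> (('v \<times> 'w) \<Rightarrow>\<^sub>0 complex) set"
  where "bilinear_relators V W =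
      {free_gen (v + v') w - free_gen v w - free_gen v' w |v v' w.
          v \<in> V \<and> v' \<in> V \<and> v + v' \<in> V \<and> w \<in> W}
    \<union> {free_gen v (w + w') - free_gen v w - free_gen v w' |v w w'.
          v \<in> V \<and> w \<in> W \<and> w' \<in> W \<and> w + w' \<in> W}
    \<union> {free_gen (c *\<^sub>C v) w - c *\<^sub>C free_gen v w |c v w. v \<in> V \<and> c *\<^sub>C v \<in> V \<and> w \<in> W}
    \<union> {free_gen v (c *\<^sub>C w) - c *\<^sub>C free_gen v w |c v w. v \<in> V \<and> w \<in> W \<and> c *\<^sub>C w \<in> W}"

subsection \<open>The balanced tensor product of subspaces\<close>

text \<open>Here V is a subspace carrying a right action of the set R, and W one carrying a left
  action; the balanced tensor product is the set of cosets of the relations in the free vector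
  space on \<^term>\<open>V \<times> W\<close>.\<close>

definition balanced_relators ::
  "'v::complex_vector set \<Rightarrow> 'r set \<Rightarrow> 'w::complex_vector set \<Rightarrow>
   ('v \<Rightarrow> 'r \<Rightarrow> 'v) \<Rightarrow> ('r \<Rightarrow> 'w \<Rightarrow> 'w) \<Rightarrow> (('v \<times> 'w) \<Rightarrow>\<^sub>0 complex) set"
  where "balanced_relators V R W ra la = bilinear_relators V W
    \<union> {free_gen (ra v r) w - free_gen v (la r w) |v r w. v \<in> V \<and> r \<in> R \<and> w \<in> W}"

definition balanced_equiv ::
  "'v::complex_vector set \<Rightarrow> 'r set \<Rightarrow> 'w::complex_vector set \<Rightarrow>
   ('v \<Rightarrow> 'r \<Rightarrow> 'v) \<Rightarrow> ('r \<Rightarrow> 'w \<Rightarrow> 'w) \<Rightarrow> (('v \<times> 'w) \<Rightarrow>\<^sub>0 complex) rel"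
  where "balanced_equiv V R W ra la =
    {(p, q). p \<in> free_on V W \<and> q \<in> free_on V W \<and> p - q \<in> cspan (balanced_relators V R W ra la)}"

definition balanced_tensor ::
  "'v::complex_vector set \<Rightarrow> 'r set \<Rightarrow> 'w::complex_vector set \<Rightarrow>
   ('v \<Rightarrow> 'r \<Rightarrow> 'v) \<Rightarrow> ('r \<Rightarrow> 'w \<Rightarrow> 'w) \<Rightarrow> (('v \<times> 'w) \<Rightarrow>\<^sub>0 complex) set set"
  where "balanced_tensor V R W ra la = free_on V W // balanced_equiv V R W ra la"

text \<open>The map on cosets induced by \<^term>\<open>free_lift f\<close>; meaningful once \<^term>\<open>free_lift f\<close>
  respects the relation.\<close>

definition balanced_lift ::
  "('v \<Rightarrow> 'w \<Rightarrow> 'c::complex_vector) \<Rightarrow> (('v \<times> 'w) \<Rightarrow>\<^sub>0 complex) set \<Rightarrow> 'c"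
  where "balanced_lift f X = the_elem (free_lift f ` X)"

subsection \<open>The tensor product over the complex numbers as a type\<close>

definition tensor_eq ::
  "(('a::complex_vector \<times> 'b::complex_vector) \<Rightarrow>\<^sub>0 complex) \<Rightarrow> (('a \<times> 'b) \<Rightarrow>\<^sub>0 complex) \<Rightarrow> bool"
  where "tensor_eq p q \<longleftrightarrow> p - q \<in> cspan (bilinear_relators UNIV UNIV)"

lemma tensor_eq_refl: "tensor_eq p p"
  by (simp add: tensor_eq_def cvec.span_zero)

lemma equivp_tensor_eq:
  "equivp (tensor_eq :: (('a::complex_vector \<times> 'b::complex_vector) \<Rightarrow>\<^sub>0 complex) \<Rightarrow> _)"
proof (rule equivpI)
  show "reflp (tensor_eq :: (('a \<times> 'b) \<Rightarrow>\<^sub>0 complex) \<Rightarrow> _)" by (simp add: reflp_def tensor_eq_refl)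
  show "symp (tensor_eq :: (('a \<times> 'b) \<Rightarrow>\<^sub>0 complex) \<Rightarrow> _)" unfolding symp_def tensor_eq_def
    by (metis cvec.span_neg minus_diff_eq)
  show "transp (tensor_eq :: (('a \<times> 'b) \<Rightarrow>\<^sub>0 complex) \<Rightarrow> _)"
  proof (rule transpI)
    fix p q r :: "('a \<times> 'b) \<Rightarrow>\<^sub>0 complex"
    assume "tensor_eq p q" "tensor_eq q r"
    then have "(p - q) + (q - r) \<in> cspan (bilinear_relators UNIV UNIV)"
      unfolding tensor_eq_def by (rule cvec.span_add)
    then show "tensor_eq p r" by (simp add: tensor_eq_def)
  qed
qed

quotient_type (overloaded) ('a, 'b) tensor =
  "(('a::complex_vector \<times> 'b::complex_vector) \<Rightarrow>\<^sub>0 complex)" / tensor_eq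
  by (rule equivp_tensor_eq)

instantiation tensor :: (complex_vector, complex_vector) complex_vector
begin

lift_definition zero_tensor :: "('a, 'b) tensor" is 0 .

lift_definition plus_tensor :: "('a, 'b) tensor \<Rightarrow> ('a, 'b) tensor \<Rightarrow> ('a, 'b) tensor" is "(+)"
proof -
  fix p q r s :: "('a \<times> 'b) \<Rightarrow>\<^sub>0 complex"
  assume "tensor_eq p q" "tensor_eq r s"
  then have "(p - q) + (r - s) \<in> cspan (bilinear_relators UNIV UNIV)"
    unfolding tensor_eq_def by (rule cvec.span_add)
  then show "tensor_eq (p + r) (q + s)" by (simp add: tensor_eq_def algebra_simps)
qed

lift_definition uminus_tensor :: "('a, 'b) tensor \<Rightarrow> ('a, 'b) tensor" is uminus
proof -
  fix p q :: "('a \<times> 'b) \<Rightarrow>\<^sub>0 complex"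
  assume "tensor_eq p q"
  then have "- (p - q) \<in> cspan (bilinear_relators UNIV UNIV)"
    unfolding tensor_eq_def by (rule cvec.span_neg)
  then show "tensor_eq (- p) (- q)" by (simp add: tensor_eq_def)
qed

lift_definition minus_tensor :: "('a, 'b) tensor \<Rightarrow> ('a, 'b) tensor \<Rightarrow> ('a, 'b) tensor" is "(-)"
proof -
  fix p q r s :: "('a \<times> 'b) \<Rightarrow>\<^sub>0 complex"
  assume "tensor_eq p q" "tensor_eq r s"
  then have "(p - q) - (r - s) \<in> cspan (bilinear_relators UNIV UNIV)"
    unfolding tensor_eq_def by (rule cvec.span_diff)
  then show "tensor_eq (p - r) (q - s)" by (simp add: tensor_eq_def algebra_simps)
qed

lift_definition scaleC_tensor :: "complex \<Rightarrow> ('a, 'b) tensor \<Rightarrow> ('a, 'b) tensor" is scaleC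
proof -
  fix c and p q :: "('a \<times> 'b) \<Rightarrow>\<^sub>0 complex"
  assume "tensor_eq p q"
  then have "c *\<^sub>C (p - q) \<in> cspan (bilinear_relators UNIV UNIV)"
    unfolding tensor_eq_def by (rule cvec.span_scale)
  then show "tensor_eq (c *\<^sub>C p) (c *\<^sub>C q)"
    by (simp add: tensor_eq_def cvec.scale_right_diff_distrib)
qed

instance
proof
  fix a b c :: "('a, 'b) tensor" and s t :: complex
  show "a + b + c = a + (b + c)" by transfer (simp add: add.assoc tensor_eq_refl)
  show "a + b = b + a" by transfer (simp add: add.commute tensor_eq_refl)
  show "0 + a = a" by transfer (simp add: tensor_eq_refl)
  show "- a + a = 0" by transfer (simp add: tensor_eq_refl)
  show "a - b = a + - b" by transfer (simp add: tensor_eq_refl)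
  show "s *\<^sub>C (a + b) = s *\<^sub>C a + s *\<^sub>C b"
    by transfer (simp add: tensor_eq_refl scaleC_add_right)
  show "(s + t) *\<^sub>C a = s *\<^sub>C a + t *\<^sub>C a"
    by transfer (simp add: tensor_eq_refl scaleC_add_left)
  show "s *\<^sub>C t *\<^sub>C a = (s * t) *\<^sub>C a"
    by transfer (simp add: tensor_eq_refl scaleC_scaleC)
  show "1 *\<^sub>C a = a" by transfer (simp add: tensor_eq_refl scaleC_one)
qed

end

lift_definition tensor_pair ::
  "'a::complex_vector \<Rightarrow> 'b::complex_vector \<Rightarrow> ('a, 'b) tensor"  (infixr \<open>\<otimes>\<close> 72)
  is "\<lambda>a b. free_gen a b" .

text \<open>For bilinear f this is the linear map sending \<^term>\<open>a \<otimes> b\<close> to \<^term>\<open>f a b\<close>.\<close>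

definition tensor_lift ::
  "('a::complex_vector \<Rightarrow> 'b::complex_vector \<Rightarrow> 'c::complex_vector) \<Rightarrow> ('a, 'b) tensor \<Rightarrow> 'c"
  where "tensor_lift f t = free_lift f (rep_tensor t)"

lemma free_lift_superset:
  assumes "finite S" "Poly_Mapping.keys p \<subseteq> S"
  shows "free_lift f p = (\<Sum>k\<in>S. Poly_Mapping.lookup p k *\<^sub>C f (fst k) (snd k))"
  unfolding free_lift_def using assms
  by (intro sum.mono_neutral_left) (auto simp: in_keys_iff)

lemma clinear_free_lift:
  fixes f :: "'a \<Rightarrow> 'b \<Rightarrow> 'c::complex_vector"
  shows "clinear (free_lift f)"
proof (rule clinearI)
  fix p q :: "('a \<times> 'b) \<Rightarrow>\<^sub>0 complex"
  let ?S = "Poly_Mapping.keys p \<union> Poly_Mapping.keys q"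
  have "free_lift f (p + q)
      = (\<Sum>k\<in>?S. Poly_Mapping.lookup (p + q) k *\<^sub>C f (fst k) (snd k))"
    by (rule free_lift_superset) (simp_all add: keys_add)
  also have "\<dots> = free_lift f p + free_lift f q"
    by (simp add: free_lift_superset[of ?S] lookup_add scaleC_add_left sum.distrib)
  finally show "free_lift f (p + q) = free_lift f p + free_lift f q" .
next
  fix c and p :: "('a \<times> 'b) \<Rightarrow>\<^sub>0 complex"
  have "free_lift f (c *\<^sub>C p)
      = (\<Sum>k\<in>Poly_Mapping.keys p. Poly_Mapping.lookup (c *\<^sub>C p) k *\<^sub>C f (fst k) (snd k))"
    by (rule free_lift_superset) (auto simp: in_keys_iff lookup_scaleC)
  also have "\<dots> = c *\<^sub>C free_lift f p"
    by (simp add: free_lift_def lookup_scaleC scaleC_complex_def scaleC_scaleC cvec.scale_sum_right)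
  finally show "free_lift f (c *\<^sub>C p) = c *\<^sub>C free_lift f p" .
qed

lemma free_lift_gen: "free_lift f (free_gen v w) = f v w"
  by (simp add: free_lift_def scaleC_one)

lemma free_lift_eq_0:
  assumes f: "cbilinear f" and p: "p \<in> cspan (bilinear_relators UNIV UNIV)"
  shows "free_lift f p = 0"
  using p
proof (rule cvec.span_induct)
  show "csubspace {p. free_lift f p = 0}"
    by (rule cvec.subspaceI)
      (simp_all add: clinear_add[OF clinear_free_lift] clinear_scale[OF clinear_free_lift]
        clinear_zero[OF clinear_free_lift])
  show "free_lift f x = 0" if "x \<in> bilinear_relators UNIV UNIV" for x
    using that unfolding bilinear_relators_def
    by (auto simp: clinear_diff[OF clinear_free_lift] clinear_scale[OF clinear_free_lift]
        free_lift_gen cbilinearD[OF f])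
qed

lemma tensor_lift_abs:
  assumes "cbilinear f"
  shows "tensor_lift f (abs_tensor p) = free_lift f p"
proof -
  have "tensor_eq (rep_tensor (abs_tensor p)) p"
    by (rule Quotient3_rep_abs[OF Quotient3_tensor tensor_eq_refl])
  then have "free_lift f (rep_tensor (abs_tensor p) - p) = 0"
    unfolding tensor_eq_def by (rule free_lift_eq_0[OF assms])
  then show ?thesis
    by (simp add: tensor_lift_def clinear_diff[OF clinear_free_lift])
qed

lemma tensor_lift_pair [simp]: "cbilinear f \<Longrightarrow> tensor_lift f (a \<otimes> b) = f a b"
  by (simp add: tensor_pair.abs_eq tensor_lift_abs free_lift_gen)

lemma clinear_tensor_lift [intro]:
  assumes f: "cbilinear f"
  shows "clinear (tensor_lift f)"
proof (rule clinearI)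
  fix x y :: "('a, 'b) tensor" and c
  obtain p q where x: "x = abs_tensor p" and y: "y = abs_tensor q"
    by (metis Quotient3_abs_rep[OF Quotient3_tensor])
  show "tensor_lift f (x + y) = tensor_lift f x + tensor_lift f y"
    unfolding x y plus_tensor.abs_eq tensor_lift_abs[OF f]
    by (rule clinear_add[OF clinear_free_lift])
  show "tensor_lift f (c *\<^sub>C x) = c *\<^sub>C tensor_lift f x"
    unfolding x scaleC_tensor.abs_eq tensor_lift_abs[OF f]
    by (rule clinear_scale[OF clinear_free_lift])
qed

lemma clinear_tensor_lift_param [intro]:
  assumes "\<And>a b. clinear (\<lambda>x. G x a b)"
  shows "clinear (\<lambda>x. tensor_lift (G x) t)"
  by (rule clinearI)
    (simp_all add: tensor_lift_def free_lift_def clinear_add[OF assms] clinear_scale[OF assms]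
      sum.distrib cvec.scale_sum_right scaleC_add_right scaleC_scaleC mult.commute)

lemma cbilinear_tensor_pair: "cbilinear (\<otimes>)"
proof -
  have *: "tensor_eq x y" if "x - y \<in> bilinear_relators UNIV UNIV"
    for x y :: "('a \<times> 'b) \<Rightarrow>\<^sub>0 complex"
    unfolding tensor_eq_def using that by (rule cvec.span_base)
  have "a \<otimes> (b + b') = a \<otimes> b + a \<otimes> b'" for a :: 'a and b b' :: 'b
    by transfer (rule *, simp add: bilinear_relators_def diff_diff_eq[symmetric], blast)
  moreover have "(a + a') \<otimes> b = a \<otimes> b + a' \<otimes> b" for a a' :: 'a and b :: 'b
    by transfer (rule *, simp add: bilinear_relators_def diff_diff_eq[symmetric], blast)
  moreover have "a \<otimes> (c *\<^sub>C b) = c *\<^sub>C (a \<otimes> b)" for a :: 'a and b :: 'b and c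
    by transfer (rule *, simp add: bilinear_relators_def, blast)
  moreover have "(c *\<^sub>C a) \<otimes> b = c *\<^sub>C (a \<otimes> b)" for a :: 'a and b :: 'b and c
    by transfer (rule *, simp add: bilinear_relators_def, blast)
  ultimately show ?thesis unfolding cbilinear_def by (auto intro!: clinearI)
qed

lemmas tensor_pair_simps = cbilinearD[OF cbilinear_tensor_pair]

lemma tensor_induct [case_names pair add]:
  fixes t :: "('a::complex_vector, 'b::complex_vector) tensor"
  assumes pair: "\<And>a b. P (a \<otimes> b)" and add: "\<And>s t. P s \<Longrightarrow> P t \<Longrightarrow> P (s + t)"
  shows "P t"
proof -
  have "P (abs_tensor p)" for p :: "('a \<times> 'b) \<Rightarrow>\<^sub>0 complex"
  proof (induction p rule: update_induct)
    case const
    show ?case using pair[of 0 0] by (simp add: tensor_pair_simps zero_tensor_def)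
  next
    case (update p k c)
    obtain a b where k: "k = (a, b)" by fastforce
    have "Poly_Mapping.update k c p = p + c *\<^sub>C free_gen a b"
      by (rule poly_mapping_eqI)
        (use update(1) in \<open>auto simp: k lookup_update lookup_add lookup_scaleC lookup_single
          scaleC_complex_def in_keys_iff\<close>)
    then have "abs_tensor (Poly_Mapping.update k c p) = abs_tensor p + (c *\<^sub>C a) \<otimes> b"
      by (simp add: tensor_pair_simps plus_tensor.abs_eq[symmetric]
          scaleC_tensor.abs_eq[symmetric] tensor_pair.abs_eq[symmetric])
    then show ?case using add[OF update(3) pair] by simp
  qed
  then show ?thesis by (metis Quotient3_abs_rep[OF Quotient3_tensor])
qed

lemma clinear_tensor_eqI:
  assumes "clinear f" "clinear g" "\<And>a b. f (a \<otimes> b) = g (a \<otimes> b)"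
  shows "f = g"
proof
  fix t show "f t = g t"
    by (induction t rule: tensor_induct)
      (simp_all add: assms(3) clinear_add[OF assms(1)] clinear_add[OF assms(2)])
qed

lemma clinear_compose: "clinear f \<Longrightarrow> clinear g \<Longrightarrow> clinear (\<lambda>x. f (g x))"
  by (intro clinearI) (simp_all add: clinearD)

lemma clinear_id: "clinear (\<lambda>x. x)"
  by (rule clinearI) simp_all

lemma clinear_pair_left: "clinear f \<Longrightarrow> clinear (\<lambda>x. f x \<otimes> b)"
  by (rule clinearI) (simp_all add: clinear_add clinear_scale tensor_pair_simps)

lemma clinear_pair_right: "clinear f \<Longrightarrow> clinear (\<lambda>x. a \<otimes> f x)"
  by (rule clinearI) (simp_all add: clinear_add clinear_scale tensor_pair_simps)

lemma clinear_mult_left: "clinear f \<Longrightarrow> clinear (\<lambda>x. f x * (b::'a::complex_algebra))"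
  by (rule clinearI) (simp_all add: clinear_add clinear_scale distrib_right scaleC_mult_left)

lemma clinear_mult_right: "clinear f \<Longrightarrow> clinear (\<lambda>x. (b::'a::complex_algebra) * f x)"
  by (rule clinearI) (simp_all add: clinear_add clinear_scale distrib_left scaleC_mult_right)

lemmas clinear_intros = clinear_id clinear_pair_left clinear_pair_right clinear_mult_left
  clinear_mult_right

definition tensor_map ::
  "('a::complex_vector \<Rightarrow> 'c::complex_vector) \<Rightarrow> ('b::complex_vector \<Rightarrow> 'd::complex_vector) \<Rightarrow>
   ('a, 'b) tensor \<Rightarrow> ('c, 'd) tensor"
  where "tensor_map f g = tensor_lift (\<lambda>a b. f a \<otimes> g b)"

lemma
  assumes "clinear f" "clinear g"
  shows tensor_map_pair [simp]: "tensor_map f g (a \<otimes> b) = f a \<otimes> g b"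
    and clinear_tensor_map: "clinear (tensor_map f g)"
  using assms unfolding tensor_map_def
  by (auto simp: cbilinear_def clinear_intros)

text \<open>The subspace \<open>V \<otimes> W\<close> of \<open>A \<otimes> B\<close>.\<close>

definition tensor_sub ::
  "'a::complex_vector set \<Rightarrow> 'b::complex_vector set \<Rightarrow> ('a, 'b) tensor set"
  where "tensor_sub V W = cspan {v \<otimes> w |v w. v \<in> V \<and> w \<in> W}"

instantiation tensor :: (complex_algebra, complex_algebra) complex_algebra
begin

definition times_tensor :: "('a, 'b) tensor \<Rightarrow> ('a, 'b) tensor \<Rightarrow> ('a, 'b) tensor"
  where "s * t = tensor_lift (\<lambda>a b. tensor_lift (\<lambda>c d. (a * c) \<otimes> (b * d)) t) s"

lemma cbilinear_times_inner:
  "cbilinear (\<lambda>(c::'a) (d::'b). (a * c) \<otimes> (b * d))"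
  by (simp add: cbilinear_def clinear_intros)

lemma cbilinear_times_outer:
  "cbilinear (\<lambda>(a::'a) (b::'b). tensor_lift (\<lambda>c d. (a * c) \<otimes> (b * d)) t)"
  unfolding cbilinear_def by (auto intro!: clinear_intros clinear_tensor_lift_param)

lemma tensor_times_pair [simp]:
  "((a::'a) \<otimes> (b::'b)) * (c \<otimes> d) = (a * c) \<otimes> (b * d)"
  by (simp add: times_tensor_def cbilinear_times_inner cbilinear_def clinear_intros)

lemma clinear_times_left: "clinear (\<lambda>s. s * (t::('a, 'b) tensor))"
  unfolding times_tensor_def by (rule clinear_tensor_lift[OF cbilinear_times_outer])

lemma clinear_times_right: "clinear (\<lambda>t. s * (t::('a, 'b) tensor))"
  unfolding times_tensor_def
  by (intro clinear_tensor_lift_param clinear_tensor_lift cbilinear_times_inner)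

instance
proof
  fix s t u :: "('a, 'b) tensor" and c
  show l: "(s + t) * u = s * u + t * u" for s t u :: "('a, 'b) tensor"
    by (rule clinear_add[OF clinear_times_left])
  show r: "s * (t + u) = s * t + s * u" for s t u :: "('a, 'b) tensor"
    by (rule clinear_add[OF clinear_times_right])
  show "(c *\<^sub>C s) * t = c *\<^sub>C (s * t)" by (rule clinear_scale[OF clinear_times_left])
  show "s * (c *\<^sub>C t) = c *\<^sub>C (s * t)" by (rule clinear_scale[OF clinear_times_right])
  show "s * t * u = s * (t * u)"
  proof (induction s rule: tensor_induct)
    case (pair a b)
    show ?case
    proof (induction t rule: tensor_induct)
      case (pair c d)
      show ?case
        by (induction u rule: tensor_induct) (simp_all add: r mult.assoc)
    qed (simp add: l r)
  qed (simp add: l)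
qed

end

subsection \<open>Rearrangements of threefold tensor products\<close>

text \<open>Threefold tensor products are written \<open>A \<otimes> (B \<otimes> C)\<close>.\<close>

definition tensor_assoc ::
  "(('a::complex_vector, 'b::complex_vector) tensor, 'c::complex_vector) tensor \<Rightarrow>
   ('a, ('b, 'c) tensor) tensor"
  where "tensor_assoc = tensor_lift (\<lambda>s c. tensor_lift (\<lambda>a b. a \<otimes> (b \<otimes> c)) s)"

definition tensor_insert ::
  "(('a::complex_vector, 'b::complex_vector) tensor, 'c::complex_vector) tensor \<Rightarrow>
   ('a, ('c, 'b) tensor) tensor"
  where "tensor_insert = tensor_lift (\<lambda>s c. tensor_lift (\<lambda>a b. a \<otimes> (c \<otimes> b)) s)"

lemma
  shows tensor_assoc_pair [simp]: "tensor_assoc ((a \<otimes> b) \<otimes> c) = a \<otimes> (b \<otimes> c)"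
    and clinear_tensor_assoc: "clinear tensor_assoc"
    and tensor_insert_pair [simp]: "tensor_insert ((a \<otimes> b) \<otimes> c) = a \<otimes> (c \<otimes> b)"
    and clinear_tensor_insert: "clinear tensor_insert"
proof -
  have b1: "cbilinear (\<lambda>a b. a \<otimes> (b \<otimes> c))" and b2: "cbilinear (\<lambda>a b. a \<otimes> (c \<otimes> b))" for c
    by (auto simp: cbilinear_def intro!: clinear_intros)
  have o1: "cbilinear (\<lambda>s c. tensor_lift (\<lambda>a b. a \<otimes> (b \<otimes> c)) s)"
    and o2: "cbilinear (\<lambda>s c. tensor_lift (\<lambda>a b. a \<otimes> (c \<otimes> b)) s)"
    unfolding cbilinear_def
    by (auto intro!: clinear_intros clinear_tensor_lift_param clinear_tensor_lift b1 b2)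
  show "tensor_assoc ((a \<otimes> b) \<otimes> c) = a \<otimes> (b \<otimes> c)" "clinear tensor_assoc"
    "tensor_insert ((a \<otimes> b) \<otimes> c) = a \<otimes> (c \<otimes> b)" "clinear tensor_insert"
    by (simp_all add: tensor_assoc_def tensor_insert_def b1 b2 o1 o2 clinear_tensor_lift)
qed

lemma bij_tensor_assoc:
  "bij (tensor_assoc :: (('a::complex_vector, 'b::complex_vector) tensor, 'c::complex_vector) tensor \<Rightarrow> _)"
proof -
  define g :: "('a, ('b, 'c) tensor) tensor \<Rightarrow> (('a, 'b) tensor, 'c) tensor"
    where "g = tensor_lift (\<lambda>a s. tensor_lift (\<lambda>b c. (a \<otimes> b) \<otimes> c) s)"
  have b: "cbilinear (\<lambda>b c. (a \<otimes> b) \<otimes> c)" for a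
    by (auto simp: cbilinear_def intro!: clinear_intros)
  have o: "cbilinear (\<lambda>a s. tensor_lift (\<lambda>b c. (a \<otimes> b) \<otimes> c) s)"
    unfolding cbilinear_def
    by (auto intro!: clinear_intros clinear_tensor_lift_param clinear_tensor_lift b)
  have g: "g (a \<otimes> (b \<otimes> c)) = (a \<otimes> b) \<otimes> c" "clinear g" for a b c
    by (simp_all add: g_def b o clinear_tensor_lift)
  note add = clinear_add[OF g(2)] clinear_add[OF clinear_tensor_assoc] tensor_pair_simps(1,2)
  have "g (tensor_assoc t) = t" for t
  proof (induction t rule: tensor_induct)
    case (pair s c) then show ?case
      by (induction s rule: tensor_induct) (simp_all add: g add)
  qed (simp add: add)
  moreover have "tensor_assoc (g t) = t" for t
  proof (induction t rule: tensor_induct)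
    case (pair a s) then show ?case
      by (induction s rule: tensor_induct) (simp_all add: g add)
  qed (simp add: add)
  ultimately show ?thesis by (auto intro!: o_bij[of g] simp: fun_eq_iff)
qed

lemma bij_tensor_insert:
  "bij (tensor_insert :: (('a::complex_vector, 'b::complex_vector) tensor, 'c::complex_vector) tensor \<Rightarrow> _)"
proof -
  define g :: "('a, ('c, 'b) tensor) tensor \<Rightarrow> (('a, 'b) tensor, 'c) tensor"
    where "g = tensor_lift (\<lambda>a s. tensor_lift (\<lambda>c b. (a \<otimes> b) \<otimes> c) s)"
  have b: "cbilinear (\<lambda>c b. (a \<otimes> b) \<otimes> c)" for a
    by (auto simp: cbilinear_def intro!: clinear_intros)
  have o: "cbilinear (\<lambda>a s. tensor_lift (\<lambda>c b. (a \<otimes> b) \<otimes> c) s)"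
    unfolding cbilinear_def
    by (auto intro!: clinear_intros clinear_tensor_lift_param clinear_tensor_lift b)
  have g: "g (a \<otimes> (c \<otimes> b)) = (a \<otimes> b) \<otimes> c" "clinear g" for a b c
    by (simp_all add: g_def b o clinear_tensor_lift)
  note add = clinear_add[OF g(2)] clinear_add[OF clinear_tensor_insert] tensor_pair_simps(1,2)
  have "g (tensor_insert t) = t" for t
  proof (induction t rule: tensor_induct)
    case (pair s c) then show ?case
      by (induction s rule: tensor_induct) (simp_all add: g add)
  qed (simp add: add)
  moreover have "tensor_insert (g t) = t" for t
  proof (induction t rule: tensor_induct)
    case (pair a s) then show ?case
      by (induction s rule: tensor_induct) (simp_all add: g add)
  qed (simp add: add)
  ultimately show ?thesis by (auto intro!: o_bij[of g] simp: fun_eq_iff)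
qed

lemma tensor_assoc_mult: "tensor_assoc (s * t) = tensor_assoc s * tensor_assoc t"
proof (induction s rule: tensor_induct)
  case (pair x c)
  show ?case
  proof (induction x rule: tensor_induct)
    case (pair a b)
    show ?case
    proof (induction t rule: tensor_induct)
      case (pair y c')
      show ?case
        by (induction y rule: tensor_induct)
          (simp_all add: tensor_pair_simps clinear_add[OF clinear_tensor_assoc] distrib_left)
    qed (simp add: distrib_left clinear_add[OF clinear_tensor_assoc])
  qed (simp add: tensor_pair_simps distrib_right clinear_add[OF clinear_tensor_assoc])
qed (simp add: distrib_right clinear_add[OF clinear_tensor_assoc])

lemma tensor_insert_mult: "tensor_insert (s * t) = tensor_insert s * tensor_insert t"
proof (induction s rule: tensor_induct)
  case (pair x c)
  show ?case
  proof (induction x rule: tensor_induct)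
    case (pair a b)
    show ?case
    proof (induction t rule: tensor_induct)
      case (pair y c')
      show ?case
        by (induction y rule: tensor_induct)
          (simp_all add: tensor_pair_simps clinear_add[OF clinear_tensor_insert] distrib_left)
    qed (simp add: distrib_left clinear_add[OF clinear_tensor_insert])
  qed (simp add: tensor_pair_simps distrib_right clinear_add[OF clinear_tensor_insert])
qed (simp add: distrib_right clinear_add[OF clinear_tensor_insert])

section \<open>The multiplier algebra\<close>

text \<open>A multiplier is a double centralizer: a pair of linear maps, written \<^term>\<open>L a = m a\<close>
  and \<^term>\<open>R a = a m\<close>, with \<^term>\<open>a * L b = R a * b\<close>.\<close>

definition is_multiplier :: "('a::complex_algebra \<Rightarrow> 'a) \<Rightarrow> ('a \<Rightarrow> 'a) \<Rightarrow> bool"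
  where "is_multiplier L R \<longleftrightarrow> clinear L \<and> clinear R
    \<and> (\<forall>a b. L (a * b) = L a * b) \<and> (\<forall>a b. R (a * b) = a * R b) \<and> (\<forall>a b. a * L b = R a * b)"

typedef (overloaded) 'a mult =
  "{(L, R). is_multiplier (L :: 'a::complex_algebra \<Rightarrow> 'a) R}"
  by (rule exI[of _ "(\<lambda>x. x, \<lambda>x. x)"]) (simp add: is_multiplier_def clinear_id)

text \<open>The products of a multiplier with an element of the algebra, as elements of the algebra.\<close>

definition lact :: "'a::complex_algebra mult \<Rightarrow> 'a \<Rightarrow> 'a"  (infixr \<open>\<rhd>\<close> 71)
  where "m \<rhd> a = fst (Rep_mult m) a"

definition ract :: "'a::complex_algebra \<Rightarrow> 'a mult \<Rightarrow> 'a"  (infixl \<open>\<lhd>\<close> 71)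
  where "a \<lhd> m = snd (Rep_mult m) a"

lemma is_multiplier_act: "is_multiplier (\<lambda>a. m \<rhd> a) (\<lambda>a. a \<lhd> m)"
  using Rep_mult[of m] by (simp add: lact_def ract_def case_prod_beta)

lemma
  shows clinear_lact: "clinear (\<lambda>a. m \<rhd> a)" and clinear_ract: "clinear (\<lambda>a. a \<lhd> m)"
    and lact_mult: "m \<rhd> (a * b) = (m \<rhd> a) * b" and ract_mult: "(a * b) \<lhd> m = a * (b \<lhd> m)"
    and mult_lact: "a * (m \<rhd> b) = (a \<lhd> m) * b"
  using is_multiplier_act[of m] by (simp_all add: is_multiplier_def)

lemma mult_eqI:
  assumes "\<And>a. m \<rhd> a = n \<rhd> a" "\<And>a. a \<lhd> m = a \<lhd> n"
  shows "m = n"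
  using assms by (simp add: Rep_mult_inject[symmetric] prod_eq_iff lact_def ract_def fun_eq_iff)

lemma
  assumes "is_multiplier L R"
  shows Abs_mult_lact: "Abs_mult (L, R) \<rhd> a = L a" and Abs_mult_ract: "a \<lhd> Abs_mult (L, R) = R a"
  using assms by (simp_all add: lact_def ract_def Abs_mult_inverse)

lemmas act_linear = clinearD[OF clinear_lact] clinearD[OF clinear_ract]

instantiation mult :: (complex_algebra) "{complex_algebra, monoid_mult}"
begin

definition "0 = Abs_mult (\<lambda>a::'a. 0, \<lambda>a. 0)"
definition "1 = Abs_mult (\<lambda>a::'a. a, \<lambda>a. a)"
definition "m + n = Abs_mult (\<lambda>a::'a. (m \<rhd> a) + (n \<rhd> a), \<lambda>a. (a \<lhd> m) + (a \<lhd> n))"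
definition "m - n = Abs_mult (\<lambda>a::'a. (m \<rhd> a) - (n \<rhd> a), \<lambda>a. (a \<lhd> m) - (a \<lhd> n))"
definition "- m = Abs_mult (\<lambda>a::'a. - (m \<rhd> a), \<lambda>a. - (a \<lhd> m))"
definition "c *\<^sub>C m = Abs_mult (\<lambda>a::'a. c *\<^sub>C (m \<rhd> a), \<lambda>a. c *\<^sub>C (a \<lhd> m))"
definition "m * n = Abs_mult (\<lambda>a::'a. m \<rhd> (n \<rhd> a), \<lambda>a. (a \<lhd> m) \<lhd> n)"

lemma act_simps [simp]:
  fixes a :: 'a
  shows "0 \<rhd> a = 0" "a \<lhd> 0 = 0" "1 \<rhd> a = a" "a \<lhd> 1 = a"
    "(m + n) \<rhd> a = (m \<rhd> a) + (n \<rhd> a)" "a \<lhd> (m + n) = (a \<lhd> m) + (a \<lhd> n)"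
    "(m - n) \<rhd> a = (m \<rhd> a) - (n \<rhd> a)" "a \<lhd> (m - n) = (a \<lhd> m) - (a \<lhd> n)"
    "(- m) \<rhd> a = - (m \<rhd> a)" "a \<lhd> (- m) = - (a \<lhd> m)"
    "(c *\<^sub>C m) \<rhd> a = c *\<^sub>C (m \<rhd> a)" "a \<lhd> (c *\<^sub>C m) = c *\<^sub>C (a \<lhd> m)"
    "(m * n) \<rhd> a = m \<rhd> (n \<rhd> a)" "a \<lhd> (m * n) = (a \<lhd> m) \<lhd> n"
proof -
  note defs = zero_mult_def one_mult_def plus_mult_def minus_mult_def uminus_mult_def
    scaleC_mult_def times_mult_def
  have m: "is_multiplier (\<lambda>a::'a. 0) (\<lambda>a. 0)" "is_multiplier (\<lambda>a::'a. a) (\<lambda>a. a)"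
    "is_multiplier (\<lambda>a. (m \<rhd> a) + (n \<rhd> a)) (\<lambda>a. (a \<lhd> m) + (a \<lhd> n))"
    "is_multiplier (\<lambda>a. (m \<rhd> a) - (n \<rhd> a)) (\<lambda>a. (a \<lhd> m) - (a \<lhd> n))"
    "is_multiplier (\<lambda>a. - (m \<rhd> a)) (\<lambda>a. - (a \<lhd> m))"
    "is_multiplier (\<lambda>a. c *\<^sub>C (m \<rhd> a)) (\<lambda>a. c *\<^sub>C (a \<lhd> m))"
    "is_multiplier (\<lambda>a. m \<rhd> (n \<rhd> a)) (\<lambda>a. (a \<lhd> m) \<lhd> n)"
    by (auto simp: is_multiplier_def act_linear lact_mult ract_mult mult_lact algebra_simps
        scaleC_mult_left scaleC_mult_right scaleC_add_right mult.commute scaleC_scaleC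
        cvec.scale_right_diff_distrib intro!: clinearI)
  show "0 \<rhd> a = 0" "a \<lhd> 0 = 0" "1 \<rhd> a = a" "a \<lhd> 1 = a"
    "(m + n) \<rhd> a = (m \<rhd> a) + (n \<rhd> a)" "a \<lhd> (m + n) = (a \<lhd> m) + (a \<lhd> n)"
    "(m - n) \<rhd> a = (m \<rhd> a) - (n \<rhd> a)" "a \<lhd> (m - n) = (a \<lhd> m) - (a \<lhd> n)"
    "(- m) \<rhd> a = - (m \<rhd> a)" "a \<lhd> (- m) = - (a \<lhd> m)"
    "(c *\<^sub>C m) \<rhd> a = c *\<^sub>C (m \<rhd> a)" "a \<lhd> (c *\<^sub>C m) = c *\<^sub>C (a \<lhd> m)"
    "(m * n) \<rhd> a = m \<rhd> (n \<rhd> a)" "a \<lhd> (m * n) = (a \<lhd> m) \<lhd> n"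
    by (simp_all add: defs Abs_mult_lact Abs_mult_ract m)
qed

instance
  by standard
    (auto intro!: mult_eqI simp: act_linear scaleC_add_right scaleC_add_left scaleC_scaleC
      scaleC_one algebra_simps)

end

text \<open>The canonical map of A into M(A), injective when the product of A is non-degenerate.\<close>

definition emb :: "'a::complex_algebra \<Rightarrow> 'a mult"
  where "emb a = Abs_mult (\<lambda>x. a * x, \<lambda>x. x * a)"

lemma emb_act [simp]: "emb a \<rhd> x = a * x" "x \<lhd> emb a = x * a"
proof -
  have "is_multiplier (\<lambda>x. a * x) (\<lambda>x. x * a)"
    by (simp add: is_multiplier_def clinear_intros mult.assoc)
  then show "emb a \<rhd> x = a * x" "x \<lhd> emb a = x * a"
    by (simp_all add: emb_def Abs_mult_lact Abs_mult_ract)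
qed

text \<open>The element of A represented by a multiplier that lies in A.\<close>

definition unemb :: "'a::complex_algebra mult \<Rightarrow> 'a"
  where "unemb m = inv emb m"

text \<open>The canonical map \<open>M(A) \<otimes> M(B) \<rightarrow> M(A \<otimes> B)\<close>.\<close>

definition mtensor ::
  "'a::complex_algebra mult \<Rightarrow> 'b::complex_algebra mult \<Rightarrow> ('a, 'b) tensor mult"
  (infixr \<open>\<otimes>\<^sub>M\<close> 72)
  where "m \<otimes>\<^sub>M n =
    Abs_mult (tensor_map (\<lambda>a. m \<rhd> a) (\<lambda>b. n \<rhd> b), tensor_map (\<lambda>a. a \<lhd> m) (\<lambda>b. b \<lhd> n))"

lemma is_multiplier_mtensor:
  "is_multiplier (tensor_map (\<lambda>a. m \<rhd> a) (\<lambda>b. n \<rhd> b)) (tensor_map (\<lambda>a. a \<lhd> m) (\<lambda>b. b \<lhd> n))"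
  (is "is_multiplier ?L ?R")
proof -
  have lin: "clinear ?L" "clinear ?R"
    by (intro clinear_tensor_map clinear_lact clinear_ract)+
  have [simp]: "?L (a \<otimes> b) = (m \<rhd> a) \<otimes> (n \<rhd> b)" "?R (a \<otimes> b) = (a \<lhd> m) \<otimes> (b \<lhd> n)" for a b
    by (simp_all add: clinear_lact clinear_ract)
  note add = clinear_add[OF lin(1)] clinear_add[OF lin(2)]
  have "?L (s * t) = ?L s * t \<and> ?R (s * t) = s * ?R t \<and> s * ?L t = ?R s * t" for s t
  proof (induction s rule: tensor_induct)
    case (pair a b)
    show ?case
      by (induction t rule: tensor_induct)
        (simp_all add: lact_mult ract_mult mult_lact add distrib_left)
  qed (simp add: add distrib_right)
  then show ?thesis by (simp add: is_multiplier_def lin)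
qed

lemma mtensor_act [simp]:
  "(m \<otimes>\<^sub>M n) \<rhd> (a \<otimes> b) = (m \<rhd> a) \<otimes> (n \<rhd> b)"
  "(a \<otimes> b) \<lhd> (m \<otimes>\<^sub>M n) = (a \<lhd> m) \<otimes> (b \<lhd> n)"
  by (simp_all add: mtensor_def Abs_mult_lact[OF is_multiplier_mtensor]
      Abs_mult_ract[OF is_multiplier_mtensor] clinear_lact clinear_ract)

text \<open>Transport of multipliers along an isomorphism of algebras.\<close>

definition mult_transport ::
  "('a::complex_algebra \<Rightarrow> 'b::complex_algebra) \<Rightarrow> 'a mult \<Rightarrow> 'b mult"
  where "mult_transport \<phi> m = Abs_mult (\<lambda>b. \<phi> (m \<rhd> inv \<phi> b), \<lambda>b. \<phi> (inv \<phi> b \<lhd> m))"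

lemma
  assumes bij: "bij \<phi>" and lin: "clinear \<phi>" and mult: "\<And>s t. \<phi> (s * t) = \<phi> s * \<phi> t"
  shows mult_transport_lact: "mult_transport \<phi> m \<rhd> \<phi> a = \<phi> (m \<rhd> a)"
    and mult_transport_ract: "\<phi> a \<lhd> mult_transport \<phi> m = \<phi> (a \<lhd> m)"
proof -
  have [simp]: "\<phi> (inv \<phi> b) = b" "inv \<phi> (\<phi> a) = a" for a b
    using bij by (simp_all add: bij_is_surj bij_is_inj surj_f_inv_f)
  have "clinear (inv \<phi>)"
    by (rule clinearI; rule injD[OF bij_is_inj[OF bij]]) (simp_all add: clinearD[OF lin])
  note lin_inv = clinearD[OF this]
  have inv_mult: "inv \<phi> (x * y) = inv \<phi> x * inv \<phi> y" for x y
    by (rule injD[OF bij_is_inj[OF bij]]) (simp add: mult)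
  have eq: "x * \<phi> y = \<phi> (inv \<phi> x * y)" "\<phi> y * x = \<phi> (y * inv \<phi> x)" for x y
    by (simp_all add: mult)
  have "is_multiplier (\<lambda>b. \<phi> (m \<rhd> inv \<phi> b)) (\<lambda>b. \<phi> (inv \<phi> b \<lhd> m))"
    by (auto simp: is_multiplier_def inv_mult lact_mult ract_mult eq mult_lact clinearD[OF lin]
        lin_inv act_linear intro!: clinearI)
  then show "mult_transport \<phi> m \<rhd> \<phi> a = \<phi> (m \<rhd> a)" "\<phi> a \<lhd> mult_transport \<phi> m = \<phi> (a \<lhd> m)"
    by (simp_all add: mult_transport_def Abs_mult_lact Abs_mult_ract)
qed

text \<open>Identification of \<open>M((A \<otimes> B) \<otimes> C)\<close> with \<open>M(A \<otimes> (B \<otimes> C))\<close>, and the leg-numbered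
  multiplier \<open>m\<^sub>1\<^sub>3\<close> in \<open>M(A \<otimes> B \<otimes> C)\<close> of m in \<open>M(A \<otimes> C)\<close>.\<close>

definition mult_assoc ::
  "(('a::complex_algebra, 'b::complex_algebra) tensor, 'c::complex_algebra) tensor mult \<Rightarrow>
   ('a, ('b, 'c) tensor) tensor mult"
  where "mult_assoc = mult_transport tensor_assoc"

definition leg13 ::
  "('a::complex_algebra, 'c::complex_algebra) tensor mult \<Rightarrow>
   ('a, ('b::complex_algebra, 'c) tensor) tensor mult"
  where "leg13 m = mult_transport tensor_insert (m \<otimes>\<^sub>M 1)"

subsection \<open>Extension of homomorphisms to multiplier algebras\<close>

definition alg_hom :: "('a::complex_algebra \<Rightarrow> 'b::complex_algebra) \<Rightarrow> bool"
  where "alg_hom f \<longleftrightarrow> clinear f \<and> (\<forall>a b. f (a * b) = f a * f b)"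

definition alg_antihom :: "('a::complex_algebra \<Rightarrow> 'b::complex_algebra) \<Rightarrow> bool"
  where "alg_antihom f \<longleftrightarrow> clinear f \<and> (\<forall>a b. f (a * b) = f b * f a)"

text \<open>The extension of a homomorphism \<open>\<gamma> : A \<rightarrow> M(B)\<close> to \<open>M(A) \<rightarrow> M(B)\<close> with \<open>1 \<mapsto> e\<close>. It is
  unique when \<open>\<gamma>(A) B = e B\<close> and \<open>B \<gamma>(A) = B e\<close> for an idempotent e.\<close>

definition extend_hom ::
  "('a::complex_algebra \<Rightarrow> 'b::complex_algebra mult) \<Rightarrow> 'b mult \<Rightarrow> 'a mult \<Rightarrow> 'b mult"
  where "extend_hom \<gamma> e = (THE g. alg_hom g \<and> (\<forall>a. g (emb a) = \<gamma> a) \<and> g 1 = e)"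

definition extend_antihom ::
  "('a::complex_algebra \<Rightarrow> 'b::complex_algebra mult) \<Rightarrow> 'a mult \<Rightarrow> 'b mult"
  where "extend_antihom \<gamma> = (THE g. alg_antihom g \<and> (\<forall>a. g (emb a) = \<gamma> a) \<and> g 1 = 1)"

section \<open>Weak multiplier Hopf algebras\<close>

type_synonym 'a coprod = "'a \<Rightarrow> ('a, 'a) tensor mult"

definition T1 :: "'a::complex_algebra coprod \<Rightarrow> ('a, 'a) tensor \<Rightarrow> ('a, 'a) tensor"
  where "T1 \<Delta> = tensor_lift (\<lambda>a b. unemb (\<Delta> a * (1 \<otimes>\<^sub>M emb b)))"

definition T2 :: "'a::complex_algebra coprod \<Rightarrow> ('a, 'a) tensor \<Rightarrow> ('a, 'a) tensor"
  where "T2 \<Delta> = tensor_lift (\<lambda>a b. unemb ((emb a \<otimes>\<^sub>M 1) * \<Delta> b))"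

definition slice_left :: "('a \<Rightarrow> complex) \<Rightarrow> ('a::complex_vector, 'a) tensor \<Rightarrow> 'a"
  where "slice_left \<omega> = tensor_lift (\<lambda>a b. \<omega> a *\<^sub>C b)"

definition slice_right :: "('a \<Rightarrow> complex) \<Rightarrow> ('a::complex_vector, 'a) tensor \<Rightarrow> 'a"
  where "slice_right \<omega> = tensor_lift (\<lambda>a b. \<omega> b *\<^sub>C a)"

text \<open>The maps \<open>\<Delta> \<otimes> id\<close> and \<open>id \<otimes> \<Delta>\<close> from \<open>A \<otimes> A\<close> to \<open>M(A \<otimes> A \<otimes> A)\<close>.\<close>

definition coprod_id ::
  "'a::complex_algebra coprod \<Rightarrow> ('a, 'a) tensor \<Rightarrow> ('a, ('a, 'a) tensor) tensor mult"
  where "coprod_id \<Delta> = tensor_lift (\<lambda>a b. mult_assoc (\<Delta> a \<otimes>\<^sub>M emb b))"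

definition id_coprod ::
  "'a::complex_algebra coprod \<Rightarrow> ('a, 'a) tensor \<Rightarrow> ('a, ('a, 'a) tensor) tensor mult"
  where "id_coprod \<Delta> = tensor_lift (\<lambda>a b. emb a \<otimes>\<^sub>M \<Delta> b)"

text \<open>The legs of \<open>\<Delta>(D)\<close>: the smallest subspaces V, W of A with
  \<open>\<Delta>(D)(1 \<otimes> A) \<subseteq> V \<otimes> A\<close> and \<open>(A \<otimes> 1)\<Delta>(D) \<subseteq> A \<otimes> W\<close>.\<close>

definition left_leg :: "'a::complex_algebra coprod \<Rightarrow> 'a set \<Rightarrow> 'a set"
  where "left_leg \<Delta> D = \<Inter>{V. csubspace V \<and>
    (\<forall>x\<in>D. \<forall>a. \<Delta> x * (1 \<otimes>\<^sub>M emb a) \<in> emb ` tensor_sub V UNIV)}"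

definition right_leg :: "'a::complex_algebra coprod \<Rightarrow> 'a set \<Rightarrow> 'a set"
  where "right_leg \<Delta> D = \<Inter>{W. csubspace W \<and>
    (\<forall>x\<in>D. \<forall>a. (emb a \<otimes>\<^sub>M 1) * \<Delta> x \<in> emb ` tensor_sub UNIV W)}"

locale weak_multiplier_hopf_algebra =
  fixes \<Delta> :: "'a::complex_algebra coprod"
    and \<epsilon> :: "'a \<Rightarrow> complex"
    and E :: "('a, 'a) tensor mult"
    and G1 G2 :: "('a, 'a) tensor \<Rightarrow> ('a, 'a) tensor"
  assumes nondegenerate_left: "(\<And>b. a * b = 0) \<Longrightarrow> a = (0::'a)"
    and nondegenerate_right: "(\<And>b. b * a = 0) \<Longrightarrow> a = (0::'a)"
    and idempotent: "cspan {a * b |a b. True} = (UNIV :: 'a set)"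
    and coprod_hom: "alg_hom \<Delta>"
    and coprod_right: "\<Delta> a * (1 \<otimes>\<^sub>M emb b) \<in> range emb"
    and coprod_left: "(emb a \<otimes>\<^sub>M 1) * \<Delta> b \<in> range emb"
    and coassociative:
      "(emb a \<otimes>\<^sub>M 1) * coprod_id \<Delta> (T1 \<Delta> (b \<otimes> c))
        = id_coprod \<Delta> (T2 \<Delta> (a \<otimes> b)) * (1 \<otimes>\<^sub>M (1 \<otimes>\<^sub>M emb c))"
    and full_left: "left_leg \<Delta> UNIV = UNIV"
    and full_right: "right_leg \<Delta> UNIV = UNIV"
    and counit_linear: "clinear \<epsilon>"
    and counit_left: "slice_left \<epsilon> (T1 \<Delta> (a \<otimes> b)) = a * b"
    and counit_right: "slice_right \<epsilon> (T2 \<Delta> (c \<otimes> a)) = c * a"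
    and E_idempotent: "E * E = E"
    and range_T1: "range (T1 \<Delta>) = range (\<lambda>t. E \<rhd> t)"
    and range_T2: "range (T2 \<Delta>) = range (\<lambda>t. t \<lhd> E)"
    and id_coprod_E_left:
      "extend_hom (id_coprod \<Delta>) (1 \<otimes>\<^sub>M E) E = mult_assoc (E \<otimes>\<^sub>M 1) * (1 \<otimes>\<^sub>M E)"
    and id_coprod_E_right:
      "extend_hom (id_coprod \<Delta>) (1 \<otimes>\<^sub>M E) E = (1 \<otimes>\<^sub>M E) * mult_assoc (E \<otimes>\<^sub>M 1)"
    and G1_linear: "clinear G1"
    and G2_linear: "clinear G2"
    and G1_eq:
      "emb (tensor_assoc (tensor_map G1 id (inv tensor_assoc
          (unemb (leg13 (\<Delta> a) * (1 \<otimes>\<^sub>M (emb b \<otimes>\<^sub>M emb c)))))))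
        = leg13 (\<Delta> a) * (1 \<otimes>\<^sub>M E) * (1 \<otimes>\<^sub>M (emb b \<otimes>\<^sub>M emb c))"
    and G2_eq:
      "emb (tensor_map id G2 (unemb (mult_assoc ((emb a \<otimes>\<^sub>M emb b) \<otimes>\<^sub>M 1) * leg13 (\<Delta> c))))
        = mult_assoc ((emb a \<otimes>\<^sub>M emb b) \<otimes>\<^sub>M 1) * mult_assoc (E \<otimes>\<^sub>M 1) * leg13 (\<Delta> c)"
    and ker_T1: "{t. T1 \<Delta> t = 0} = range (\<lambda>t. t - G1 t)"
    and ker_T2: "{t. T2 \<Delta> t = 0} = range (\<lambda>t. t - G2 t)"

subsection \<open>The antipode\<close>

text \<open>The elements \<open>\<Sum> d a\<^sub>(\<^sub>1\<^sub>) S(a\<^sub>(\<^sub>2\<^sub>))\<close> and \<open>\<Sum> S(a\<^sub>(\<^sub>1\<^sub>)) a\<^sub>(\<^sub>2\<^sub>) d\<close> of A, where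
  \<open>\<Sum> d a\<^sub>(\<^sub>1\<^sub>) \<otimes> a\<^sub>(\<^sub>2\<^sub>) = (d \<otimes> 1)\<Delta>(a)\<close> and \<open>\<Sum> a\<^sub>(\<^sub>1\<^sub>) \<otimes> a\<^sub>(\<^sub>2\<^sub>) d = \<Delta>(a)(1 \<otimes> d)\<close>.\<close>

definition covered_t :: "'a::complex_algebra coprod \<Rightarrow> ('a \<Rightarrow> 'a mult) \<Rightarrow> 'a \<Rightarrow> 'a \<Rightarrow> 'a"
  where "covered_t \<Delta> S d a = tensor_lift (\<lambda>x y. x \<lhd> S y) (T2 \<Delta> (d \<otimes> a))"

definition covered_s :: "'a::complex_algebra coprod \<Rightarrow> ('a \<Rightarrow> 'a mult) \<Rightarrow> 'a \<Rightarrow> 'a \<Rightarrow> 'a"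
  where "covered_s \<Delta> S a d = tensor_lift (\<lambda>x y. S x \<rhd> y) (T1 \<Delta> (a \<otimes> d))"

text \<open>The target map \<open>\<epsilon>\<^sub>t(a) = \<Sum> a\<^sub>(\<^sub>1\<^sub>) S(a\<^sub>(\<^sub>2\<^sub>))\<close> with values in M(A).\<close>

definition target_map :: "'a::complex_algebra coprod \<Rightarrow> ('a \<Rightarrow> 'a mult) \<Rightarrow> 'a \<Rightarrow> 'a mult"
  where "target_map \<Delta> S a = (THE m. \<forall>d. d \<lhd> m = covered_t \<Delta> S d a)"

text \<open>Sweedler formulas are made meaningful by covering: an equation in A or in \<open>A \<otimes> A\<close> is stated
  after multiplication on the appropriate side by elements c, d of A, which by non-degeneracy
  loses nothing. For instance, the first one is
  \<open>(c \<otimes> d) E (a \<otimes> b) = \<Sum> c a\<^sub>(\<^sub>1\<^sub>) \<otimes> d a\<^sub>(\<^sub>2\<^sub>) S(a\<^sub>(\<^sub>3\<^sub>)) b\<close>. In the last one,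
  \<open>\<Sum> a\<^sub>(\<^sub>1\<^sub>) \<otimes> a\<^sub>(\<^sub>2\<^sub>) S(a\<^sub>(\<^sub>3\<^sub>)) b\<close> denotes the element \<open>E (a \<otimes> b)\<close> of \<open>A \<otimes> A\<close>, by the first one.\<close>

locale antipode = weak_multiplier_hopf_algebra \<Delta> \<epsilon> E G1 G2
  for \<Delta> :: "'a::complex_algebra coprod" and \<epsilon> E G1 G2 +
  fixes S :: "'a \<Rightarrow> 'a mult"
  assumes antipode_antihom: "alg_antihom S"
    and antipode_nondegenerate_left: "cspan {S a \<rhd> b |a b. True} = UNIV"
    and antipode_nondegenerate_right: "cspan {b \<lhd> S a |a b. True} = UNIV"
    and antipode_E_left:
      "(c \<otimes> d) * (E \<rhd> (a \<otimes> b))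
        = tensor_lift (\<lambda>p q. p \<otimes> (covered_t \<Delta> S d q * b)) (T2 \<Delta> (c \<otimes> a))"
    and antipode_E_right:
      "((a \<otimes> b) \<lhd> E) * (c \<otimes> d)
        = tensor_lift (\<lambda>p q. (a * covered_s \<Delta> S p c) \<otimes> q) (T1 \<Delta> (b \<otimes> d))"
    and antipode_G1:
      "(emb c \<otimes>\<^sub>M 1) \<rhd> G1 (a \<otimes> b)
        = tensor_lift (\<lambda>p q. p \<otimes> covered_s \<Delta> S q b) (T2 \<Delta> (c \<otimes> a))"
    and antipode_G2:
      "G2 (a \<otimes> b) \<lhd> (1 \<otimes>\<^sub>M emb c)
        = tensor_lift (\<lambda>p q. covered_t \<Delta> S a p \<otimes> q) (T1 \<Delta> (b \<otimes> c))"
    and antipode_inverse: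
      "tensor_lift (\<lambda>x y. S x \<rhd> y) (E \<rhd> (a \<otimes> b)) = S a \<rhd> b"

locale regular_weak_multiplier_hopf_algebra = antipode +
  assumes regular: "bij_betw S UNIV (range emb)"

subsection \<open>Source and target algebras, cointegrals\<close>

definition source_algebra ::
  "'a::complex_algebra coprod \<Rightarrow> ('a, 'a) tensor mult \<Rightarrow> 'a mult set"
  where "source_algebra \<Delta> E = {y. extend_hom \<Delta> E y = E * (1 \<otimes>\<^sub>M y)}"

definition target_algebra ::
  "'a::complex_algebra coprod \<Rightarrow> ('a, 'a) tensor mult \<Rightarrow> 'a mult set"
  where "target_algebra \<Delta> E = {x. extend_hom \<Delta> E x = (x \<otimes>\<^sub>M 1) * E}"

definition left_cointegral ::
  "'a::complex_algebra coprod \<Rightarrow> ('a \<Rightarrow> 'a mult) \<Rightarrow> 'a mult \<Rightarrow> bool"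
  where "left_cointegral \<Delta> S h \<longleftrightarrow> h \<noteq> 0 \<and> (\<forall>a. emb a * h = target_map \<Delta> S a * h)"

definition cointegrals :: "'a::complex_algebra coprod \<Rightarrow> ('a \<Rightarrow> 'a mult) \<Rightarrow> 'a set"
  where "cointegrals \<Delta> S = {h. left_cointegral \<Delta> S (emb h)} \<union> {0}"

definition discrete_type :: "'a::complex_algebra coprod \<Rightarrow> ('a \<Rightarrow> 'a mult) \<Rightarrow> bool"
  where "discrete_type \<Delta> S \<longleftrightarrow>
    left_leg \<Delta> (cointegrals \<Delta> S) = UNIV \<and> right_leg \<Delta> (cointegrals \<Delta> S) = UNIV"

subsection \<open>Reduced functionals and slices of coproducts\<close>

definition functional_times :: "('a::complex_algebra \<Rightarrow> complex) \<Rightarrow> 'a mult \<Rightarrow> 'a \<Rightarrow> complex"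
  where "functional_times \<omega> m = (\<lambda>x. \<omega> (x \<lhd> m))"

definition reduced_dual :: "('a::complex_algebra \<Rightarrow> complex) set"
  where "reduced_dual = {functional_times \<omega> (emb a) |\<omega> a. clinear \<omega>}"

definition act_functional ::
  "('a::complex_algebra \<Rightarrow> 'a mult) \<Rightarrow> ('a \<Rightarrow> complex) \<Rightarrow> 'a mult \<Rightarrow> ('a \<Rightarrow> complex)"
  where "act_functional S \<omega> m = functional_times \<omega> (extend_antihom S m)"

definition act_element ::
  "('a::complex_algebra \<Rightarrow> 'a mult) \<Rightarrow> 'a mult \<Rightarrow> 'a \<Rightarrow> 'a"
  where "act_element S m h = h \<lhd> extend_antihom S m"

text \<open>For \<open>\<rho> = \<omega>(\<cdot> a)\<close> the slices \<open>(\<rho> \<otimes> id)\<Delta>(h)\<close> and \<open>(id \<otimes> \<rho>)\<Delta>(h)\<close> are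
  \<open>(\<omega> \<otimes> id)(\<Delta>(h)(a \<otimes> 1))\<close> and \<open>(id \<otimes> \<omega>)(\<Delta>(h)(1 \<otimes> a))\<close>; here \<open>\<Delta>(h)(a \<otimes> 1)\<close> is in
  \<open>A \<otimes> A\<close> by regularity, and the values do not depend on the choice of \<open>\<omega>\<close> and a.\<close>

definition f_s :: "'a::complex_algebra coprod \<Rightarrow> ('a \<Rightarrow> complex) \<Rightarrow> 'a \<Rightarrow> 'a"
  where "f_s \<Delta> \<rho> h = (THE x. \<exists>\<omega> a t. clinear \<omega> \<and> \<rho> = functional_times \<omega> (emb a) \<and>
    emb t = \<Delta> h * (emb a \<otimes>\<^sub>M 1) \<and> x = slice_left \<omega> t)"

definition f_t :: "'a::complex_algebra coprod \<Rightarrow> ('a \<Rightarrow> complex) \<Rightarrow> 'a \<Rightarrow> 'a"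
  where "f_t \<Delta> \<rho> h = (THE x. \<exists>\<omega> a t. clinear \<omega> \<and> \<rho> = functional_times \<omega> (emb a) \<and>
    emb t = \<Delta> h * (1 \<otimes>\<^sub>M emb a) \<and> x = slice_right \<omega> t)"

end

theory Submission
  imports Defs
begin

text \<open>For a left cointegral h one has \<open>(1 \<otimes> a)\<Delta>(h) = (S(a) \<otimes> 1)\<Delta>(h)\<close>, so \<open>\<Sum> f\<^sub>s(\<omega>\<^sub>i \<otimes> h\<^sub>i) = 0\<close>
  already gives \<open>\<Sum> \<omega>\<^sub>i(v h\<^sub>i\<^sub>(\<^sub>1\<^sub>)) h\<^sub>i\<^sub>(\<^sub>2\<^sub>) = 0\<close> for all v. Applying \<open>\<Delta>\<close> to the free leg and substituting
  \<open>v = z S\<^sup>-\<^sup>1(h\<^sub>i\<^sub>(\<^sub>2\<^sub>))\<close> turns \<open>S\<^sup>-\<^sup>1(h\<^sub>(\<^sub>2\<^sub>)) h\<^sub>(\<^sub>1\<^sub>) \<otimes> h\<^sub>(\<^sub>3\<^sub>)\<close> into \<open>(S\<^sup>-\<^sup>1 \<otimes> id)((1 \<otimes> h) E)\<close>. Since \<open>S \<otimes> S\<close>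
  maps E to its flip, \<open>S\<^sup>-\<^sup>1(E\<^sub>(\<^sub>1\<^sub>)) \<otimes> E\<^sub>(\<^sub>2\<^sub>) = E\<^sub>(\<^sub>2\<^sub>) \<otimes> S(E\<^sub>(\<^sub>1\<^sub>))\<close>, so that \<open>\<Sum> \<omega>\<^sub>i(z E\<^sub>(\<^sub>2\<^sub>)) h\<^sub>i S(y) = 0\<close> for
  all z, where \<open>y = E\<^sub>(\<^sub>1\<^sub>) \<in> A\<^sub>s\<close>. Moving y across the balanced tensor product gives back \<open>\<Sum> \<omega>\<^sub>i \<otimes> h\<^sub>i\<close>, because
  \<open>S(E\<^sub>(\<^sub>1\<^sub>)) E\<^sub>(\<^sub>2\<^sub>) = 1\<close>; hence this tensor vanishes. The same substitution shows \<open>a \<in> A a\<close>, which makes the reduced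
  functionals a subspace. For \<open>f\<^sub>t\<close> the role of \<open>(S\<^sup>-\<^sup>1 \<otimes> id)((1 \<otimes> h) E)\<close> is played by \<open>G\<^sub>1(h \<otimes> a)\<close>. The
  cointegrals are also what makes \<open>A \<otimes> 1\<close> commute with \<open>G\<^sub>1\<close>, on which the flip property of E rests.
  Surjectivity is the faithfulness of H.\<close>

section \<open>Linear maps on tensor products\<close>

text \<open>\<open>E\<close> is only a multiplier, so its legs are not elements that can be named.
  They appear in two forms. The covered formulas
  \<open>E (a \<otimes> 1) = a_1 \<otimes> \<epsilon>\<^sub>t(a_2)\<close> and
  \<open>(1 \<otimes> b) E = \<epsilon>\<^sub>s(b_1) \<otimes> b_2\<close> turn statements about the
  legs into statements about all \<open>\<epsilon>\<^sub>t q\<close> and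
  \<open>\<epsilon>\<^sub>s p\<close>, which fullness allows to be tested on legs of the coproduct.
  Once a is fixed, \<open>E (b \<otimes> a)\<close> and \<open>G1 (h \<otimes> a)\<close> are finite
  sums with coefficients from \<open>A\<^sub>s\<close> and \<open>S(A\<^sub>t)\<close>; only such
  finite sums can be moved across a balanced tensor product of formal sums. The hard point is that
  the coefficients do lie there. For \<open>A\<^sub>t\<close> the source is
  \<open>(id \<otimes> \<Delta>) E = (E \<otimes> 1)(1 \<otimes> E)\<close>. No matching formula for
  \<open>(\<Delta> \<otimes> id) E\<close> is among the axioms, so the result is carried over to
  \<open>A\<^sub>s\<close> by the antipode, and this is where the flip property of E enters.\<close>

lemma cbilinearI:
  "(\<And>x. clinear (f x)) \<Longrightarrow> (\<And>y. clinear (\<lambda>x. f x y)) \<Longrightarrow> cbilinear f"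
  by (simp add: cbilinear_def)

lemma clinear_sum: "clinear h \<Longrightarrow> h (sum g I) = (\<Sum>i\<in>I. h (g i))"
  by (induction I rule: infinite_finite_induct) (simp_all add: clinearD)

text \<open>\<open>tensor_lift\<close> is a finite sum over one chosen representative, and a linear
  map passes through any such sum. Most later manipulations of Sweedler sums are this step followed
  by a rewriting of the summand.\<close>

lemma tensor_lift_commute:
  assumes "clinear h"
  shows "h (tensor_lift f z) = tensor_lift (\<lambda>a b. h (f a b)) z"
  by (simp add: tensor_lift_def free_lift_def clinear_sum[OF assms] clinear_scale[OF assms])

lemma tensor_lift_swap:
  "tensor_lift (\<lambda>a b. tensor_lift (\<lambda>c d. f a b c d) w) z
    = tensor_lift (\<lambda>c d. tensor_lift (\<lambda>a b. f a b c d) z) w"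
  unfolding tensor_lift_def free_lift_def cvec.scale_sum_right
  by (subst sum.swap) (simp add: scaleC_scaleC mult.commute)

lemma tensor_lift_tensor_pair [simp]: "tensor_lift (\<otimes>) z = z"
  by (induction z rule: tensor_induct)
    (simp_all add: cbilinear_tensor_pair clinear_add[OF clinear_tensor_lift[OF cbilinear_tensor_pair]])

lemma tensor_lift_add: "tensor_lift (\<lambda>a b. f a b + g a b) z = tensor_lift f z + tensor_lift g z"
  by (simp add: tensor_lift_def free_lift_def scaleC_add_right sum.distrib)

lemma tensor_lift_scale: "tensor_lift (\<lambda>a b. c *\<^sub>C f a b) z = c *\<^sub>C tensor_lift f z"
  by (rule tensor_lift_commute[symmetric]) (simp add: clinearI scaleC_add_right scaleC_scaleC mult.commute)

lemma tensor_lift_zero [simp]: "tensor_lift (\<lambda>a b. 0) z = 0"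
  by (simp add: tensor_lift_def free_lift_def)

lemma tensor_eqI:
  "clinear F \<Longrightarrow> clinear G \<Longrightarrow> (\<And>a b. F (a \<otimes> b) = G (a \<otimes> b)) \<Longrightarrow> F z = G z"
  using clinear_tensor_eqI by metis

lemma clinear_0: "clinear (\<lambda>x. 0)"
  by (rule clinearI) simp_all

lemma clinear_plus:
  assumes "clinear f" "clinear g"
  shows "clinear (\<lambda>x. f x + g x)"
  by (rule clinearI) (simp_all add: clinearD[OF assms(1)] clinearD[OF assms(2)] scaleC_add_right)

lemma clinear_subtract:
  assumes "clinear f" "clinear g"
  shows "clinear (\<lambda>x. f x - g x)"
  by (rule clinearI)
    (simp_all add: clinearD[OF assms(1)] clinearD[OF assms(2)] cvec.scale_right_diff_distrib)

lemma clinear_scaleC_right: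
  assumes "clinear f"
  shows "clinear (\<lambda>x. c *\<^sub>C f x)"
  by (rule clinearI) (simp_all add: clinearD[OF assms] scaleC_add_right scaleC_scaleC mult.commute)

lemma clinear_scaleC_left:
  fixes f :: "'a::complex_vector \<Rightarrow> complex"
  assumes "clinear f"
  shows "clinear (\<lambda>x. f x *\<^sub>C v)"
  by (rule clinearI)
    (simp_all add: clinearD[OF assms] scaleC_add_left scaleC_scaleC scaleC_complex_def)

lemma clinear_tensor_lift_arg: "cbilinear f \<Longrightarrow> clinear g \<Longrightarrow> clinear (\<lambda>x. tensor_lift f (g x))"
  by (rule clinear_compose) (rule clinear_tensor_lift)

lemma clinear_lact_arg: "clinear f \<Longrightarrow> clinear (\<lambda>x. m \<rhd> f x)"
  by (rule clinear_compose[OF clinear_lact])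

lemma clinear_ract_arg: "clinear f \<Longrightarrow> clinear (\<lambda>x. f x \<lhd> m)"
  by (rule clinear_compose[OF clinear_ract])

lemma clinear_lact_mult:
  assumes "clinear f"
  shows "clinear (\<lambda>x. f x \<rhd> a)"
  by (rule clinearI) (simp_all add: clinearD[OF assms])

lemma clinear_ract_mult:
  assumes "clinear f"
  shows "clinear (\<lambda>x. a \<lhd> f x)"
  by (rule clinearI) (simp_all add: clinearD[OF assms])

lemma clinear_emb_id: "clinear emb"
  by (rule clinearI; rule mult_eqI) (simp_all add: distrib_right distrib_left scaleC_mult_left scaleC_mult_right)

lemma clinear_emb: "clinear f \<Longrightarrow> clinear (\<lambda>x. emb (f x))"
  by (rule clinear_compose[OF clinear_emb_id])

lemma mtensor_lact: "(m \<otimes>\<^sub>M n) \<rhd> z = tensor_lift (\<lambda>a b. (m \<rhd> a) \<otimes> (n \<rhd> b)) z"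
  by (simp add: mtensor_def Abs_mult_lact[OF is_multiplier_mtensor]) (simp add: tensor_map_def)

lemma mtensor_ract: "z \<lhd> (m \<otimes>\<^sub>M n) = tensor_lift (\<lambda>a b. (a \<lhd> m) \<otimes> (b \<lhd> n)) z"
  by (simp add: mtensor_def Abs_mult_ract[OF is_multiplier_mtensor]) (simp add: tensor_map_def)

lemma clinear_fun_apply:
  assumes "clinear f"
  shows "clinear (\<lambda>x. f x v)"
  by (rule clinearI) (simp_all add: clinearD[OF assms] scaleC_fun_def)

lemma clinear_mtensor_left:
  assumes "clinear f"
  shows "clinear (\<lambda>x. f x \<otimes>\<^sub>M n)"
  by (intro clinearI mult_eqI)
    (simp_all add: mtensor_lact mtensor_ract tensor_pair_simps clinearD[OF assms]
      tensor_lift_add tensor_lift_scale)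

lemma clinear_mtensor_right:
  assumes "clinear f"
  shows "clinear (\<lambda>x. n \<otimes>\<^sub>M f x)"
  by (intro clinearI mult_eqI)
    (simp_all add: mtensor_lact mtensor_ract tensor_pair_simps clinearD[OF assms]
      tensor_lift_add tensor_lift_scale)

lemma clinear_tensor_assoc_arg: "clinear f \<Longrightarrow> clinear (\<lambda>x. tensor_assoc (f x))"
  by (rule clinear_compose[OF clinear_tensor_assoc])

lemmas clin = clinear_id clinear_pair_left clinear_pair_right clinear_mult_left
  clinear_mult_right clinear_0 clinear_plus clinear_subtract clinear_scaleC_right clinear_scaleC_left
  clinear_tensor_lift_arg clinear_tensor_lift_param clinear_lact_arg clinear_ract_arg clinear_lact_mult
  clinear_ract_mult clinear_emb clinear_mtensor_left clinear_mtensor_right clinear_tensor_assoc_arg cbilinearI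

lemma tensor_lift_compose:
  assumes "cbilinear f"
  shows "tensor_lift f (tensor_lift g z) = tensor_lift (\<lambda>a b. tensor_lift f (g a b)) z"
  by (rule tensor_lift_commute[OF clinear_tensor_lift[OF assms]])

subsection \<open>Separation by functionals\<close>

text \<open>An arbitrary algebraic basis; its coordinate functionals separate vectors and, one leg
  at a time, tensors.\<close>

definition hamel_basis :: "'v::complex_vector set"
  where "hamel_basis = cvec.extend_basis {}"

definition coord :: "'v::complex_vector \<Rightarrow> 'v \<Rightarrow> complex"
  where "coord b v = cvec.representation hamel_basis v b"

lemma hamel_basis: "\<not> cvec.dependent hamel_basis" "cspan hamel_basis = UNIV"
  unfolding hamel_basis_def
  by (simp_all add: cvec.independent_extend_basis cvec.span_extend_basis cvec.independent_empty)

lemma clinear_coord: "clinear (coord b)"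
  unfolding coord_def
  by (rule clinearI) (simp_all add: hamel_basis cvec.representation_add cvec.representation_scale scaleC_complex_def)

text \<open>The expansion is asserted for every larger finite set so that two expansions can be
  taken over a common index set and added.\<close>

lemma coord_expand:
  obtains F where "finite F" "\<And>F'. finite F' \<Longrightarrow> F \<subseteq> F' \<Longrightarrow> (\<Sum>b\<in>F'. coord b v *\<^sub>C b) = v"
proof
  let ?F = "{b. cvec.representation hamel_basis v b \<noteq> 0}"
  show "finite ?F" by (rule cvec.finite_representation)
  show "(\<Sum>b\<in>F'. coord b v *\<^sub>C b) = v" if "finite F'" "?F \<subseteq> F'" for F'
  proof -
    have "(\<Sum>b\<in>F'. coord b v *\<^sub>C b) = (\<Sum>b\<in>?F. coord b v *\<^sub>C b)"
      using that by (intro sum.mono_neutral_right) (auto simp: coord_def)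
    also have "\<dots> = v"
      unfolding coord_def by (rule cvec.sum_nonzero_representation_eq) (simp_all add: hamel_basis)
    finally show ?thesis .
  qed
qed

lemma tensor_expand_right:
  fixes z :: "('a::complex_vector, 'b::complex_vector) tensor"
  obtains F where "finite F"
    "z = (\<Sum>b\<in>F. tensor_lift (\<lambda>v w. coord b w *\<^sub>C v) z \<otimes> b)"
proof -
  have lin: "clinear (tensor_lift (\<lambda>v w. coord b w *\<^sub>C v))" for b :: 'b
    by (intro clin clinear_tensor_lift clinear_coord)
  have "\<exists>F. finite F \<and> (\<forall>F'. finite F' \<longrightarrow> F \<subseteq> F' \<longrightarrow>
    z = (\<Sum>b\<in>F'. tensor_lift (\<lambda>v w. coord b w *\<^sub>C v) z \<otimes> b))"
  proof (induction z rule: tensor_induct)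
    case (pair v w)
    obtain F where F: "finite F" "\<And>F'. finite F' \<Longrightarrow> F \<subseteq> F' \<Longrightarrow> (\<Sum>b\<in>F'. coord b w *\<^sub>C b) = w"
      using coord_expand by metis
    have "tensor_lift (\<lambda>v w. coord b w *\<^sub>C v) (v \<otimes> w) \<otimes> b = v \<otimes> (coord b w *\<^sub>C b)" for b
      by (subst tensor_lift_pair) (simp_all add: tensor_pair_simps, intro clin clinear_coord)
    moreover have "(\<Sum>b\<in>F'. v \<otimes> (coord b w *\<^sub>C b)) = v \<otimes> w" if "finite F'" "F \<subseteq> F'" for F'
      using F(2)[OF that] clinear_sum[OF clinear_pair_right[OF clinear_id, of v]] by metis
    ultimately show ?case using F(1) by (intro exI[of _ F]) simp
  next
    case (add s t)
    from add(1) obtain F where F: "finite F" "\<And>F'. finite F' \<Longrightarrow> F \<subseteq> F' \<Longrightarrow>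
      s = (\<Sum>b\<in>F'. tensor_lift (\<lambda>v w. coord b w *\<^sub>C v) s \<otimes> b)" by blast
    from add(2) obtain G where G: "finite G" "\<And>F'. finite F' \<Longrightarrow> G \<subseteq> F' \<Longrightarrow>
      t = (\<Sum>b\<in>F'. tensor_lift (\<lambda>v w. coord b w *\<^sub>C v) t \<otimes> b)" by blast
    show ?case
    proof (intro exI[of _ "F \<union> G"] conjI allI impI)
      fix F' assume F': "finite F'" "F \<union> G \<subseteq> F'"
      show "s + t = (\<Sum>b\<in>F'. tensor_lift (\<lambda>v w. coord b w *\<^sub>C v) (s + t) \<otimes> b)"
        unfolding clinear_add[OF lin] tensor_pair_simps sum.distrib
        by (rule arg_cong2[of _ _ _ _ "(+)"]) (rule F(2) G(2); use F' in simp)+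
    qed (use F(1) G(1) in simp)
  qed
  then show thesis using that by blast
qed

lemma cbilinear_flip: "cbilinear (\<lambda>a b. b \<otimes> a)"
  by (intro clin)

lemmas clinear_flip = clinear_tensor_lift[OF cbilinear_flip]

lemma tensor_flip_flip:
  "tensor_lift (\<lambda>a b. b \<otimes> a) (tensor_lift (\<lambda>a b. b \<otimes> a) z) = z"
  by (rule tensor_eqI[where F = "\<lambda>z. tensor_lift (\<lambda>a b. b \<otimes> a) (tensor_lift (\<lambda>a b. b \<otimes> a) z)"
        and G = "\<lambda>z. z"], (intro clin)+)
    (simp add: tensor_lift_pair[OF cbilinear_flip])

text \<open>In the expansion over a basis of the second factor the coefficients are slices by
  coordinate functionals, so all of them vanish.\<close>

lemma tensor_zeroI_left:
  assumes "\<And>\<phi>. clinear \<phi> \<Longrightarrow> tensor_lift (\<lambda>v w. \<phi> w *\<^sub>C v) z = 0"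
  shows "z = 0"
  by (rule tensor_expand_right[of z]) (simp add: assms clinear_coord tensor_pair_simps)

lemma tensor_zeroI_right:
  assumes "\<And>\<phi>. clinear \<phi> \<Longrightarrow> tensor_lift (\<lambda>v w. \<phi> v *\<^sub>C w) z = 0"
  shows "z = 0"
proof -
  let ?f = "tensor_lift (\<lambda>a b. b \<otimes> a)"
  have "?f z = 0"
  proof (rule tensor_zeroI_left)
    fix \<phi> :: "'a \<Rightarrow> complex" assume \<phi>: "clinear \<phi>"
    have "tensor_lift (\<lambda>v w. \<phi> w *\<^sub>C v) (?f z) = tensor_lift (\<lambda>v w. \<phi> v *\<^sub>C w) z"
      by (subst tensor_lift_compose; (intro clin \<phi>)?)
        (subst tensor_lift_pair; (intro clin \<phi>)?; simp)
    then show "tensor_lift (\<lambda>v w. \<phi> w *\<^sub>C v) (?f z) = 0" using assms[OF \<phi>] by simp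
  qed
  then have "?f (?f z) = 0" by (simp add: clinear_zero[OF clinear_flip])
  then show ?thesis by (simp only: tensor_flip_flip)
qed

lemma csubspace_tensor_sub: "csubspace (tensor_sub V W)"
  by (simp add: tensor_sub_def)

lemma tensor_sub_pair: "v \<in> V \<Longrightarrow> w \<in> W \<Longrightarrow> v \<otimes> w \<in> tensor_sub V W"
  unfolding tensor_sub_def by (rule cvec.span_base) blast

lemma tensor_subI_left:
  assumes "\<And>\<phi>. clinear \<phi> \<Longrightarrow> tensor_lift (\<lambda>v w. \<phi> w *\<^sub>C v) z \<in> V"
  shows "z \<in> tensor_sub V UNIV"
proof (rule tensor_expand_right[of z])
  fix F assume "z = (\<Sum>b\<in>F. tensor_lift (\<lambda>v w. coord b w *\<^sub>C v) z \<otimes> b)"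
  moreover have "(\<Sum>b\<in>F. tensor_lift (\<lambda>v w. coord b w *\<^sub>C v) z \<otimes> b) \<in> tensor_sub V UNIV"
    by (intro cvec.subspace_sum csubspace_tensor_sub tensor_sub_pair assms clinear_coord UNIV_I)
  ultimately show ?thesis by simp
qed

lemma tensor_lift_flip:
  assumes "cbilinear f"
  shows "tensor_lift f (tensor_lift (\<lambda>a b. b \<otimes> a) z) = tensor_lift (\<lambda>a b. f b a) z"
  by (simp add: tensor_lift_compose assms)

lemma tensor_sub_flip:
  assumes "tensor_lift (\<lambda>a b. b \<otimes> a) z \<in> tensor_sub V W"
  shows "z \<in> tensor_sub W V"
proof -
  have "tensor_lift (\<lambda>a b. b \<otimes> a) y \<in> tensor_sub W V" if "y \<in> tensor_sub V W" for y
    using that unfolding tensor_sub_def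
  proof (rule cvec.span_induct)
    show "csubspace {y. tensor_lift (\<lambda>a b. b \<otimes> a) y \<in> cspan {v \<otimes> w |v w. v \<in> W \<and> w \<in> V}}"
      by (rule cvec.subspaceI)
       (simp_all add: clinearD[OF clinear_flip] cvec.span_zero cvec.span_add cvec.span_scale)
    show "tensor_lift (\<lambda>a b. b \<otimes> a) x \<in> cspan {v \<otimes> w |v w. v \<in> W \<and> w \<in> V}"
      if "x \<in> {v \<otimes> w |v w. v \<in> V \<and> w \<in> W}" for x
    proof -
      from that obtain v w where x: "x = v \<otimes> w" "v \<in> V" "w \<in> W" by blast
      have "tensor_lift (\<lambda>a b. b \<otimes> a) (v \<otimes> w) = w \<otimes> v"
        by (rule tensor_lift_pair[OF cbilinear_flip])
      then show ?thesis using x by (auto intro: cvec.span_base)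
    qed
  qed
  then show ?thesis using assms tensor_flip_flip by metis
qed

lemma tensor_subI_right:
  assumes "\<And>\<phi>. clinear \<phi> \<Longrightarrow> tensor_lift (\<lambda>v w. \<phi> v *\<^sub>C w) z \<in> W"
  shows "z \<in> tensor_sub UNIV W"
proof (rule tensor_sub_flip, rule tensor_subI_left)
  fix \<phi> :: "'a \<Rightarrow> complex" assume \<phi>: "clinear \<phi>"
  show "tensor_lift (\<lambda>v w. \<phi> w *\<^sub>C v) (tensor_lift (\<lambda>a b. b \<otimes> a) z) \<in> W"
    using assms[OF \<phi>] by (subst tensor_lift_flip; (intro clin \<phi>)?) 
qed

text \<open>After the second leg is sliced by a functional, a function is left, and it is zero when
  its values are. In this way the vanishing of a tensor of functionals is read off from identities
  in the algebra.\<close>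

lemma tensor_eval_zeroI:
  fixes z :: "('x \<Rightarrow> complex, 'w::complex_vector) tensor"
  assumes "\<And>x. tensor_lift (\<lambda>g w. g x *\<^sub>C w) z = 0"
  shows "z = 0"
proof (rule tensor_zeroI_left)
  fix \<phi> :: "'w \<Rightarrow> complex" assume \<phi>: "clinear \<phi>"
  show "tensor_lift (\<lambda>v w. \<phi> w *\<^sub>C v) z = 0"
  proof
    fix x
    have "tensor_lift (\<lambda>v w. \<phi> w *\<^sub>C v) z x = tensor_lift (\<lambda>v w. (\<phi> w *\<^sub>C v) x) z"
      by (rule tensor_lift_commute[where h = "\<lambda>f. f x"]) (rule clinear_fun_apply[OF clinear_id])
    also have "\<dots> = tensor_lift (\<lambda>v w. \<phi> (v x *\<^sub>C w)) z"
      by (simp add: scaleC_fun_def clinearD[OF \<phi>] scaleC_complex_def mult.commute)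
    also have "\<dots> = \<phi> (tensor_lift (\<lambda>v w. v x *\<^sub>C w) z)"
      by (rule tensor_lift_commute[OF \<phi>, symmetric])
    finally show "tensor_lift (\<lambda>v w. \<phi> w *\<^sub>C v) z x = 0 x" using assms clinearD(3)[OF \<phi>] by simp
  qed
qed

section \<open>Non-degenerate idempotent algebras and their multipliers\<close>

text \<open>Stated for a type rather than inside the locale, so that it can be applied to the tensor
  powers of A as well.\<close>

definition nondeg :: "'a::complex_algebra itself \<Rightarrow> bool"
  where "nondeg _ \<longleftrightarrow> (\<forall>a::'a. (\<forall>b. a * b = 0) \<longrightarrow> a = 0) \<and> (\<forall>a::'a. (\<forall>b. b * a = 0) \<longrightarrow> a = 0)"

definition idem :: "'a::complex_algebra itself \<Rightarrow> bool"
  where "idem _ \<longleftrightarrow> cspan {a * b |a b :: 'a. True} = UNIV"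

lemma nondeg_leftD: "nondeg TYPE('a::complex_algebra) \<Longrightarrow> (\<And>b::'a. a * b = 0) \<Longrightarrow> a = 0"
  and nondeg_rightD: "nondeg TYPE('a) \<Longrightarrow> (\<And>b::'a. b * a = 0) \<Longrightarrow> a = 0"
  unfolding nondeg_def by blast+

lemma nondeg_left_eqI:
  assumes "nondeg TYPE('a::complex_algebra)" "\<And>c::'a. a * c = b * c"
  shows "a = b"
  using nondeg_leftD[OF assms(1), of "a - b"] assms(2) by (simp add: left_diff_distrib)

lemma nondeg_right_eqI:
  assumes "nondeg TYPE('a::complex_algebra)" "\<And>c::'a. c * a = c * b"
  shows "a = b"
  using nondeg_rightD[OF assms(1), of "a - b"] assms(2) by (simp add: right_diff_distrib)

lemma idem_induct [consumes 1, case_names mult add]: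
  assumes id: "idem TYPE('a::complex_algebra)"
    and mult: "\<And>a b::'a. P (a * b)" and add: "\<And>x y. P x \<Longrightarrow> P y \<Longrightarrow> P (x + y)"
  shows "P x"
proof -
  have "x \<in> cspan {a * b |a b :: 'a. True}" using id by (simp add: idem_def)
  then show ?thesis
  proof (induction rule: cvec.span_induct_alt)
    case base show ?case using mult[of 0 0] by simp
  next
    case (step c x y)
    then obtain a b where "x = a * b" by blast
    then show ?case using add[OF mult[of "c *\<^sub>C a" b] step(2)] by (simp add: scaleC_mult_left)
  qed
qed

lemma idem_eqI:
  assumes "idem TYPE('a::complex_algebra)" "clinear f" "clinear g" "\<And>a b::'a. f (a * b) = g (a * b)"
  shows "f x = g x"
  by (induction x rule: idem_induct[OF assms(1)])
    (simp_all add: assms(4) clinear_add[OF assms(2)] clinear_add[OF assms(3)])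

text \<open>If \<open>z (x \<otimes> y) = 0\<close>, slicing the second leg leaves an element of the
  first algebra annihilated by every x. Once x is removed, slicing the first leg removes y in the
  same way. The other side is symmetric.\<close>

lemma nondeg_tensor:
  assumes nda: "nondeg TYPE('a::complex_algebra)" and ndb: "nondeg TYPE('b::complex_algebra)"
  shows "nondeg TYPE(('a, 'b) tensor)"
  unfolding nondeg_def
proof (intro conjI allI impI)
  fix z :: "('a, 'b) tensor"
  assume z: "\<forall>w. z * w = 0"
  have zxy: "tensor_lift (\<lambda>p q. (p * x) \<otimes> (q * y)) z = 0" for x y
  proof -
    have "z * (x \<otimes> y) = tensor_lift (\<lambda>p q. (p * x) \<otimes> (q * y)) z"
      by (rule tensor_eqI) ((intro clin clinear_times_left clinear_tensor_lift)+,
        subst tensor_lift_pair, (intro clin)+, simp)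
    then show ?thesis using z by simp
  qed
  have zy: "tensor_lift (\<lambda>p q. p \<otimes> (q * y)) z = 0" for y
  proof (rule tensor_zeroI_left)
    fix \<phi> :: "'b \<Rightarrow> complex" assume \<phi>: "clinear \<phi>"
    have c: "clinear (\<lambda>q. \<phi> (f q))" if "clinear f" for f :: "'b \<Rightarrow> 'b"
      by (rule clinear_compose[OF \<phi> that])
    have "tensor_lift (\<lambda>v w. \<phi> w *\<^sub>C v) (tensor_lift (\<lambda>p q. p \<otimes> (q * y)) z)
        = tensor_lift (\<lambda>p q. \<phi> (q * y) *\<^sub>C p) z"
      by (subst tensor_lift_compose; (intro clin c \<phi>)?) (subst tensor_lift_pair; (intro clin \<phi>)?; simp)
    also have "\<dots> = 0"
    proof (rule nondeg_leftD[OF nda])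
      fix x :: 'a
      have "tensor_lift (\<lambda>p q. \<phi> (q * y) *\<^sub>C p) z * x = tensor_lift (\<lambda>p q. \<phi> (q * y) *\<^sub>C (p * x)) z"
        by (subst tensor_lift_commute[where h = "\<lambda>v. v * x"]) (intro clin, simp add: scaleC_mult_left)
      also have "\<dots> = tensor_lift (\<lambda>v w. \<phi> w *\<^sub>C v) (tensor_lift (\<lambda>p q. (p * x) \<otimes> (q * y)) z)"
        by (subst tensor_lift_compose; (intro clin \<phi>)?) (subst tensor_lift_pair; (intro clin \<phi>)?; simp)
      finally show "tensor_lift (\<lambda>p q. \<phi> (q * y) *\<^sub>C p) z * x = 0"
        by (simp add: zxy clinear_zero[OF clinear_tensor_lift[OF cbilinearI[OF clinear_scaleC_left[OF \<phi>] clinear_scaleC_right[OF clinear_id]]]]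
           clinear_zero[OF clinear_tensor_lift] cbilinearI clinear_scaleC_left clinear_scaleC_right clinear_id \<phi>)
    qed
    finally show "tensor_lift (\<lambda>v w. \<phi> w *\<^sub>C v) (tensor_lift (\<lambda>p q. p \<otimes> (q * y)) z) = 0" .
  qed
  show "z = 0"
  proof (rule tensor_zeroI_right)
    fix \<phi> :: "'a \<Rightarrow> complex" assume \<phi>: "clinear \<phi>"
    show "tensor_lift (\<lambda>v w. \<phi> v *\<^sub>C w) z = 0"
    proof (rule nondeg_leftD[OF ndb])
      fix y :: 'b
      have "tensor_lift (\<lambda>v w. \<phi> v *\<^sub>C w) z * y = tensor_lift (\<lambda>p q. \<phi> p *\<^sub>C (q * y)) z"
        by (subst tensor_lift_commute[where h = "\<lambda>v. v * y"]) (intro clin, simp add: scaleC_mult_left)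
      also have "\<dots> = tensor_lift (\<lambda>v w. \<phi> v *\<^sub>C w) (tensor_lift (\<lambda>p q. p \<otimes> (q * y)) z)"
        by (subst tensor_lift_compose; (intro clin \<phi>)?) (subst tensor_lift_pair; (intro clin \<phi>)?; simp)
      finally show "tensor_lift (\<lambda>v w. \<phi> v *\<^sub>C w) z * y = 0"
        by (simp add: zy clinear_zero[OF clinear_tensor_lift] cbilinearI clinear_scaleC_left clinear_scaleC_right clinear_id \<phi>)
    qed
  qed
next
  fix z :: "('a, 'b) tensor"
  assume z: "\<forall>w. w * z = 0"
  have zxy: "tensor_lift (\<lambda>p q. (x * p) \<otimes> (y * q)) z = 0" for x y
  proof -
    have "(x \<otimes> y) * z = tensor_lift (\<lambda>p q. (x * p) \<otimes> (y * q)) z"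
      by (rule tensor_eqI) ((intro clin clinear_times_right clinear_tensor_lift)+,
        subst tensor_lift_pair, (intro clin)+, simp)
    then show ?thesis using z by simp
  qed
  have zy: "tensor_lift (\<lambda>p q. p \<otimes> (y * q)) z = 0" for y
  proof (rule tensor_zeroI_left)
    fix \<phi> :: "'b \<Rightarrow> complex" assume \<phi>: "clinear \<phi>"
    have c: "clinear (\<lambda>q. \<phi> (f q))" if "clinear f" for f :: "'b \<Rightarrow> 'b"
      by (rule clinear_compose[OF \<phi> that])
    have "tensor_lift (\<lambda>v w. \<phi> w *\<^sub>C v) (tensor_lift (\<lambda>p q. p \<otimes> (y * q)) z)
        = tensor_lift (\<lambda>p q. \<phi> (y * q) *\<^sub>C p) z"
      by (subst tensor_lift_compose; (intro clin c \<phi>)?) (subst tensor_lift_pair; (intro clin \<phi>)?; simp)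
    also have "\<dots> = 0"
    proof (rule nondeg_rightD[OF nda])
      fix x :: 'a
      have "x * tensor_lift (\<lambda>p q. \<phi> (y * q) *\<^sub>C p) z = tensor_lift (\<lambda>p q. \<phi> (y * q) *\<^sub>C (x * p)) z"
        by (subst tensor_lift_commute[where h = "\<lambda>v. x * v"]) (intro clin, simp add: scaleC_mult_right)
      also have "\<dots> = tensor_lift (\<lambda>v w. \<phi> w *\<^sub>C v) (tensor_lift (\<lambda>p q. (x * p) \<otimes> (y * q)) z)"
        by (subst tensor_lift_compose; (intro clin \<phi>)?) (subst tensor_lift_pair; (intro clin \<phi>)?; simp)
      finally show "x * tensor_lift (\<lambda>p q. \<phi> (y * q) *\<^sub>C p) z = 0"
        by (simp add: zxy clinear_zero[OF clinear_tensor_lift] cbilinearI clinear_scaleC_left clinear_scaleC_right clinear_id \<phi>)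
    qed
    finally show "tensor_lift (\<lambda>v w. \<phi> w *\<^sub>C v) (tensor_lift (\<lambda>p q. p \<otimes> (y * q)) z) = 0" .
  qed
  show "z = 0"
  proof (rule tensor_zeroI_right)
    fix \<phi> :: "'a \<Rightarrow> complex" assume \<phi>: "clinear \<phi>"
    show "tensor_lift (\<lambda>v w. \<phi> v *\<^sub>C w) z = 0"
    proof (rule nondeg_rightD[OF ndb])
      fix y :: 'b
      have "y * tensor_lift (\<lambda>v w. \<phi> v *\<^sub>C w) z = tensor_lift (\<lambda>p q. \<phi> p *\<^sub>C (y * q)) z"
        by (subst tensor_lift_commute[where h = "\<lambda>v. y * v"]) (intro clin, simp add: scaleC_mult_right)
      also have "\<dots> = tensor_lift (\<lambda>v w. \<phi> v *\<^sub>C w) (tensor_lift (\<lambda>p q. p \<otimes> (y * q)) z)"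
        by (subst tensor_lift_compose; (intro clin \<phi>)?) (subst tensor_lift_pair; (intro clin \<phi>)?; simp)
      finally show "y * tensor_lift (\<lambda>v w. \<phi> v *\<^sub>C w) z = 0"
        by (simp add: zy clinear_zero[OF clinear_tensor_lift] cbilinearI clinear_scaleC_left clinear_scaleC_right clinear_id \<phi>)
    qed
  qed
qed

lemma idem_tensor:
  assumes ida: "idem TYPE('a::complex_algebra)" and idb: "idem TYPE('b::complex_algebra)"
  shows "idem TYPE(('a, 'b) tensor)"
proof -
  let ?S = "cspan {s * t |s t :: ('a, 'b) tensor. True}"
  have "a \<otimes> b \<in> ?S" for a :: 'a and b :: 'b
    using ida
  proof (induction a rule: idem_induct)
    case (mult x y)
    show ?case
      using idb
    proof (induction b rule: idem_induct)
      case (mult u v)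
      have "(x * y) \<otimes> (u * v) = (x \<otimes> u) * (y \<otimes> v)" by simp
      then show ?case by (intro cvec.span_base) blast
    qed (simp add: tensor_pair_simps cvec.span_add)
  qed (simp add: tensor_pair_simps cvec.span_add)
  then have "z \<in> ?S" for z :: "('a, 'b) tensor"
    by (induction z rule: tensor_induct) (simp_all add: cvec.span_add)
  then show ?thesis by (auto simp: idem_def)
qed

text \<open>Linearity and the module property of \<open>L\<close> can be checked after
  multiplication from the left, where \<open>L\<close> is replaced by \<open>R\<close>, and
  conversely; nondegeneracy then cancels the extra factor.\<close>

lemma is_multiplierI:
  assumes nd: "nondeg TYPE('a::complex_algebra)" and LR: "\<And>c d::'a. c * L d = R c * d"
  shows "is_multiplier L R"
  unfolding is_multiplier_def
proof (intro conjI allI)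
  show "clinear L"
    by (rule clinearI; rule nondeg_right_eqI[OF nd]) (simp_all add: LR distrib_left scaleC_mult_right)
  show "clinear R"
    by (rule clinearI; rule nondeg_left_eqI[OF nd])
      (simp_all add: LR[symmetric] distrib_right scaleC_mult_left)
  show "L (a * b) = L a * b" for a b
    by (rule nondeg_right_eqI[OF nd]) (simp add: LR mult.assoc[symmetric])
  show "R (a * b) = a * R b" for a b
    by (rule nondeg_left_eqI[OF nd]) (simp add: LR[symmetric] mult.assoc)
qed (rule LR)

lemma mult_eqI_left:
  assumes nd: "nondeg TYPE('a::complex_algebra)" and eq: "\<And>a::'a. m \<rhd> a = n \<rhd> a"
  shows "m = n"
proof (rule mult_eqI[OF eq])
  show "a \<lhd> m = a \<lhd> n" for a
    by (rule nondeg_left_eqI[OF nd]) (simp add: mult_lact[symmetric] eq)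
qed

lemma mult_eqI_right:
  assumes nd: "nondeg TYPE('a::complex_algebra)" and eq: "\<And>a::'a. a \<lhd> m = a \<lhd> n"
  shows "m = n"
proof (rule mult_eqI[OF _ eq])
  show "m \<rhd> a = n \<rhd> a" for a
    by (rule nondeg_right_eqI[OF nd]) (simp add: mult_lact eq)
qed

lemma lact_ract:
  assumes nd: "nondeg TYPE('a::complex_algebra)"
  shows "(m \<rhd> (a::'a)) \<lhd> n = m \<rhd> (a \<lhd> n)"
  by (rule nondeg_right_eqI[OF nd]) (simp add: ract_mult[symmetric] mult_lact)

lemma emb_mult: "emb (a * b) = emb a * emb b"
  by (rule mult_eqI) (simp_all add: mult.assoc)

lemma mult_emb: "m * emb a = emb (m \<rhd> a)" and emb_times: "emb a * m = emb (a \<lhd> m)"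
  by (rule mult_eqI; simp add: lact_mult ract_mult mult_lact)+

lemma emb_eq_iff:
  assumes nd: "nondeg TYPE('a::complex_algebra)"
  shows "emb (a::'a) = emb b \<longleftrightarrow> a = b"
proof
  assume "emb a = emb b"
  then have "emb a \<rhd> c = emb b \<rhd> c" for c by simp
  then have "a * c = b * c" for c by (simp only: emb_act)
  then show "a = b" by (rule nondeg_left_eqI[OF nd])
qed simp

lemma emb_unemb: "m \<in> range emb \<Longrightarrow> emb (unemb m) = m"
  unfolding unemb_def by (rule f_inv_into_f)

lemma mtensor_times: "(m \<otimes>\<^sub>M n) * (m' \<otimes>\<^sub>M n') = (m * m') \<otimes>\<^sub>M (n * n')"
proof (rule mult_eqI)
  show "((m \<otimes>\<^sub>M n) * (m' \<otimes>\<^sub>M n')) \<rhd> z = ((m * m') \<otimes>\<^sub>M (n * n')) \<rhd> z" for z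
    by (rule tensor_eqI) (intro clin | simp)+
  show "z \<lhd> ((m \<otimes>\<^sub>M n) * (m' \<otimes>\<^sub>M n')) = z \<lhd> ((m * m') \<otimes>\<^sub>M (n * n'))" for z
    by (rule tensor_eqI) (intro clin | simp)+
qed

lemma emb_tensor_pair: "emb (a \<otimes> b) = emb a \<otimes>\<^sub>M emb b"
proof (rule mult_eqI)
  show "emb (a \<otimes> b) \<rhd> z = (emb a \<otimes>\<^sub>M emb b) \<rhd> z" for z
    by (rule tensor_eqI) (intro clin | simp)+
  show "z \<lhd> emb (a \<otimes> b) = z \<lhd> (emb a \<otimes>\<^sub>M emb b)" for z
    by (rule tensor_eqI) (intro clin | simp)+
qed

lemma one_mtensor_one: "1 \<otimes>\<^sub>M 1 = 1"
proof (rule mult_eqI)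
  show "(1 \<otimes>\<^sub>M 1) \<rhd> z = 1 \<rhd> z" for z :: "('a, 'b) tensor"
    by (rule tensor_eqI) (intro clin | simp)+
  show "z \<lhd> (1 \<otimes>\<^sub>M 1) = z \<lhd> 1" for z :: "('a, 'b) tensor"
    by (rule tensor_eqI) (intro clin | simp)+
qed

subsection \<open>Extension of homomorphisms\<close>

text \<open>On \<open>e B = \<gamma>(A) B\<close> the extension has to send
  \<open>\<gamma>(a) b\<close> to \<open>\<gamma>(m a) b\<close>, and it has to absorb e. The range
  conditions make this a definition and also force uniqueness, which settles the description by
  \<open>THE\<close>.\<close>

lemma
  fixes \<gamma> :: "'a::complex_algebra \<Rightarrow> 'b::complex_algebra mult"
  assumes nd: "nondeg TYPE('b)" and hom: "alg_hom \<gamma>"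
    and e: "\<And>a. e * \<gamma> a = \<gamma> a" "\<And>a. \<gamma> a * e = \<gamma> a"
    and r: "\<And>b. \<exists>z. e \<rhd> b = tensor_lift (\<lambda>a b'. \<gamma> a \<rhd> b') z"
      "\<And>b. \<exists>z. b \<lhd> e = tensor_lift (\<lambda>a b'. b' \<lhd> \<gamma> a) z"
  shows extend_hom_left: "extend_hom \<gamma> e m * \<gamma> a = \<gamma> (m \<rhd> a)"
    and extend_hom_right: "\<gamma> a * extend_hom \<gamma> e m = \<gamma> (a \<lhd> m)"
    and alg_hom_extend_hom: "alg_hom (extend_hom \<gamma> e)"
    and extend_hom_emb: "extend_hom \<gamma> e (emb a) = \<gamma> a"
    and extend_hom_one: "extend_hom \<gamma> e 1 = e"
proof -
  note \<gamma>lin = alg_hom_def[THEN iffD1, OF hom, THEN conjunct1]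
  have \<gamma>mult: "\<gamma> (a * b) = \<gamma> a * \<gamma> b" for a b using hom by (simp add: alg_hom_def)
  have bl: "cbilinear (\<lambda>a b'. \<gamma> a \<rhd> b')" "cbilinear (\<lambda>a b'. b' \<lhd> \<gamma> a)"
    by (intro clin \<gamma>lin)+
  have "\<exists>f. \<forall>b. e \<rhd> b = tensor_lift (\<lambda>a b'. \<gamma> a \<rhd> b') (f b)" using r(1) by metis
  then obtain f where f: "\<And>b. e \<rhd> b = tensor_lift (\<lambda>a b'. \<gamma> a \<rhd> b') (f b)" by blast
  have "\<exists>f. \<forall>b. b \<lhd> e = tensor_lift (\<lambda>a b'. b' \<lhd> \<gamma> a) (f b)" using r(2) by metis
  then obtain f' where f': "\<And>b. b \<lhd> e = tensor_lift (\<lambda>a b'. b' \<lhd> \<gamma> a) (f' b)" by blast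
  have e1: "e \<rhd> (\<gamma> a \<rhd> b) = \<gamma> a \<rhd> b" and e2: "(b \<lhd> \<gamma> a) \<lhd> e = b \<lhd> \<gamma> a"
    and e3: "(b \<lhd> e) \<lhd> \<gamma> a = b \<lhd> \<gamma> a" and e4: "\<gamma> a \<rhd> (e \<rhd> b) = \<gamma> a \<rhd> b" for a b
    using e[of a] by (metis act_simps(13,14))+
  \<comment> \<open>The decompositions of \<open>e b\<close> and \<open>b e\<close> are chosen
    arbitrarily. Independence of the choice comes out of the compatibility of \<open>L m\<close>
    with \<open>R m\<close>, from which \<open>is_multiplierI\<close> also recovers
    linearity.\<close>
  define L where "L m b = tensor_lift (\<lambda>a b'. \<gamma> (m \<rhd> a) \<rhd> b') (f b)" for m b
  define R where "R m b = tensor_lift (\<lambda>a b'. b' \<lhd> \<gamma> (a \<lhd> m)) (f' b)" for m b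
  have eL: "e \<rhd> L m b = L m b" for m b
    unfolding L_def by (subst tensor_lift_commute[OF clinear_lact]) (simp add: e1)
  have eR: "R m b \<lhd> e = R m b" for m b
    unfolding R_def by (subst tensor_lift_commute[OF clinear_ract]) (simp add: e2)
  have mid: "(c \<lhd> \<gamma> (a \<lhd> m)) * (\<gamma> a' \<rhd> b) = (c \<lhd> \<gamma> a) * (\<gamma> (m \<rhd> a') \<rhd> b)" for c a a' b m
  proof -
    have "\<gamma> (a \<lhd> m) * \<gamma> a' = \<gamma> a * \<gamma> (m \<rhd> a')"
      by (simp add: \<gamma>mult[symmetric] mult_lact)
    then have "c \<lhd> (\<gamma> (a \<lhd> m) * \<gamma> a') = c \<lhd> (\<gamma> a * \<gamma> (m \<rhd> a'))" by simp
    then show ?thesis by (simp add: mult_lact)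
  qed
  have key: "R m c * (\<gamma> a' \<rhd> b) = c * (\<gamma> (m \<rhd> a') \<rhd> b)" for m c a' b
  proof -
    have "R m c * (\<gamma> a' \<rhd> b) = (c \<lhd> e) * (\<gamma> (m \<rhd> a') \<rhd> b)"
      unfolding R_def f'
      by (subst (1 2) tensor_lift_commute[where h = "\<lambda>x. x * _"]) (intro clin | simp add: mid)+
    then show ?thesis by (simp add: mult_lact[symmetric] e1)
  qed
  have "c * L m b = R m c * b" for m c b
  proof -
    have "R m c * b = R m c * (e \<rhd> b)" by (simp add: mult_lact eR)
    also have "\<dots> = c * L m b"
      unfolding L_def f
      by (subst (1 2) tensor_lift_commute[where h = "\<lambda>x. _ * x"]) (intro clin | simp add: key)+
    finally show ?thesis by simp
  qed
  then have is_m: "is_multiplier (L m) (R m)" for m by (rule is_multiplierI[OF nd])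
  define g where "g m = Abs_mult (L m, R m)" for m
  have gl: "g m \<rhd> b = L m b" and gr: "b \<lhd> g m = R m b" for m b
    by (simp_all add: g_def Abs_mult_lact Abs_mult_ract is_m)
  have g1: "g m * \<gamma> a = \<gamma> (m \<rhd> a)" for m a
    by (rule mult_eqI_left[OF nd], rule nondeg_right_eqI[OF nd], unfold act_simps(13), subst mult_lact)
      (simp only: gr key)
  have g2: "g m * e = g m" for m
    by (rule mult_eqI_right[OF nd]) (simp add: gr eR)
  have g3: "e * g m = g m" for m
    by (rule mult_eqI_left[OF nd]) (simp add: gl eL)
  have uniq: "n = n'" if n: "n * e = n" "n' * e = n'" "\<And>a. n * \<gamma> a = n' * \<gamma> a" for n n'
  proof (rule mult_eqI_left[OF nd])
    fix b
    have *: "n \<rhd> (\<gamma> a \<rhd> b') = n' \<rhd> (\<gamma> a \<rhd> b')" for a b' using n(3)[of a] by (metis act_simps(13))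
    have "n \<rhd> (e \<rhd> b) = n' \<rhd> (e \<rhd> b)"
      unfolding f by (subst (1 2) tensor_lift_commute[OF clinear_lact]) (simp add: *)
    then show "n \<rhd> b = n' \<rhd> b" using n(1,2) by (metis act_simps(13))
  qed
  have ghom: "alg_hom g"
    unfolding alg_hom_def
  proof (intro conjI allI clinearI)
    show "g (x + y) = g x + g y" for x y
      by (rule uniq) (simp_all add: g1 g2 distrib_right clinear_add[OF \<gamma>lin])
    show "g (c *\<^sub>C x) = c *\<^sub>C g x" for c x
      by (rule uniq) (simp_all add: g1 g2 scaleC_mult_left clinear_scale[OF \<gamma>lin])
    show "g (a * b) = g a * g b" for a b
      by (rule uniq) (simp_all add: g1 g2 mult.assoc)
  qed
  have gemb: "g (emb a) = \<gamma> a" for a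
    by (rule uniq) (simp_all add: g1 g2 e \<gamma>mult)
  have ee: "e * e = e"
  proof (rule mult_eqI_left[OF nd])
    fix b
    have "e \<rhd> tensor_lift (\<lambda>a b'. \<gamma> a \<rhd> b') (f b) = tensor_lift (\<lambda>a b'. \<gamma> a \<rhd> b') (f b)"
      by (subst tensor_lift_commute[OF clinear_lact]) (simp only: e1)
    then have "e \<rhd> (e \<rhd> b) = e \<rhd> b" by (simp only: f[symmetric])
    then show "(e * e) \<rhd> b = e \<rhd> b" by simp
  qed
  have gone: "g 1 = e"
    by (rule uniq) (simp_all add: g1 g2 e ee)
  have ext: "extend_hom \<gamma> e = g"
    unfolding extend_hom_def
  proof (rule the_equality)
    show "alg_hom g \<and> (\<forall>a. g (emb a) = \<gamma> a) \<and> g 1 = e" by (simp add: ghom gemb gone)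
    fix h assume h: "alg_hom h \<and> (\<forall>a. h (emb a) = \<gamma> a) \<and> h 1 = e"
    then have hm: "h (m * n) = h m * h n" for m n by (simp add: alg_hom_def)
    show "h = g"
    proof
      fix m
      show "h m = g m"
      proof (rule uniq)
        show "h m * e = h m" using hm[of m 1] h by simp
        show "h m * \<gamma> a = g m * \<gamma> a" for a
          using hm[of m "emb a"] h by (simp add: g1 mult_emb)
      qed (rule g2)
    qed
  qed
  show "extend_hom \<gamma> e m * \<gamma> a = \<gamma> (m \<rhd> a)" by (simp add: ext g1)
  show "\<gamma> a * extend_hom \<gamma> e m = \<gamma> (a \<lhd> m)"
    using ghom unfolding ext alg_hom_def by (metis emb_times gemb)
  show "alg_hom (extend_hom \<gamma> e)" "extend_hom \<gamma> e (emb a) = \<gamma> a" "extend_hom \<gamma> e 1 = e"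
    by (simp_all add: ext ghom gemb gone)
qed

subsection \<open>Extension of anti-automorphisms\<close>

definition alg_antiaut :: "('a::complex_algebra \<Rightarrow> 'a) \<Rightarrow> bool"
  where "alg_antiaut \<kappa> \<longleftrightarrow> alg_antihom \<kappa> \<and> bij \<kappa>"

text \<open>The formula is forced: an anti-multiplicative extension must send
  \<open>\<kappa>\<^sup>-\<^sup>1(a) m\<close> to \<open>\<kappa>(m) a\<close>.\<close>

definition mult_anti :: "('a::complex_algebra \<Rightarrow> 'a) \<Rightarrow> 'a mult \<Rightarrow> 'a mult"
  where "mult_anti \<kappa> m = Abs_mult (\<lambda>a. \<kappa> (inv \<kappa> a \<lhd> m), \<lambda>a. \<kappa> (m \<rhd> inv \<kappa> a))"

lemma
  assumes "alg_antiaut \<kappa>"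
  shows antiaut_clinear: "clinear \<kappa>" and antiaut_mult: "\<kappa> (a * b) = \<kappa> b * \<kappa> a"
    and antiaut_inv1 [simp]: "\<kappa> (inv \<kappa> a) = a" and antiaut_inv2 [simp]: "inv \<kappa> (\<kappa> a) = a"
  using assms by (simp_all add: alg_antiaut_def alg_antihom_def bij_is_surj surj_f_inv_f bij_is_inj)

lemma alg_antiaut_inv:
  assumes \<kappa>: "alg_antiaut \<kappa>"
  shows "alg_antiaut (inv \<kappa>)" and "inv (inv \<kappa>) = \<kappa>"
proof -
  note [simp] = antiaut_inv1[OF \<kappa>] antiaut_inv2[OF \<kappa>]
  have bij: "bij \<kappa>" using \<kappa> by (simp add: alg_antiaut_def)
  have inj: "\<kappa> a = \<kappa> b \<Longrightarrow> a = b" for a b using bij by (simp add: bij_is_inj inj_eq)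
  show "alg_antiaut (inv \<kappa>)"
    unfolding alg_antiaut_def alg_antihom_def
    by (intro conjI allI clinearI bij_imp_bij_inv bij; rule inj)
      (simp_all add: antiaut_mult[OF \<kappa>] clinearD[OF antiaut_clinear[OF \<kappa>]])
  show "inv (inv \<kappa>) = \<kappa>" by (rule inv_inv_eq[OF bij])
qed

lemma
  assumes nd: "nondeg TYPE('a::complex_algebra)" and \<kappa>: "alg_antiaut (\<kappa> :: 'a \<Rightarrow> 'a)"
  shows mult_anti_lact: "mult_anti \<kappa> m \<rhd> a = \<kappa> (inv \<kappa> a \<lhd> m)"
    and mult_anti_ract: "a \<lhd> mult_anti \<kappa> m = \<kappa> (m \<rhd> inv \<kappa> a)"
proof -
  note [simp] = antiaut_inv1[OF \<kappa>] antiaut_inv2[OF \<kappa>]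
  have "is_multiplier (\<lambda>a. \<kappa> (inv \<kappa> a \<lhd> m)) (\<lambda>a. \<kappa> (m \<rhd> inv \<kappa> a))"
  proof (rule is_multiplierI[OF nd])
    fix c d
    have "c * \<kappa> (inv \<kappa> d \<lhd> m) = \<kappa> ((inv \<kappa> d \<lhd> m) * inv \<kappa> c)" by (simp add: antiaut_mult[OF \<kappa>])
    then show "c * \<kappa> (inv \<kappa> d \<lhd> m) = \<kappa> (m \<rhd> inv \<kappa> c) * d"
      by (simp add: mult_lact[symmetric] antiaut_mult[OF \<kappa>])
  qed
  then show "mult_anti \<kappa> m \<rhd> a = \<kappa> (inv \<kappa> a \<lhd> m)" "a \<lhd> mult_anti \<kappa> m = \<kappa> (m \<rhd> inv \<kappa> a)"
    by (simp_all add: mult_anti_def Abs_mult_lact Abs_mult_ract)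
qed

lemma
  assumes nd: "nondeg TYPE('a::complex_algebra)" and \<kappa>: "alg_antiaut (\<kappa> :: 'a \<Rightarrow> 'a)"
  shows antiaut_ract: "\<kappa> (a \<lhd> m) = mult_anti \<kappa> m \<rhd> \<kappa> a"
    and antiaut_lact: "\<kappa> (m \<rhd> a) = \<kappa> a \<lhd> mult_anti \<kappa> m"
    and mult_anti_mult: "mult_anti \<kappa> (m * n) = mult_anti \<kappa> n * mult_anti \<kappa> m"
    and mult_anti_emb: "mult_anti \<kappa> (emb a) = emb (\<kappa> a)"
    and mult_anti_one: "mult_anti \<kappa> 1 = 1"
    and clinear_mult_anti: "clinear (mult_anti \<kappa>)"
    and mult_anti_inv1: "mult_anti (inv \<kappa>) (mult_anti \<kappa> m) = m"
    and mult_anti_inv2: "mult_anti \<kappa> (mult_anti (inv \<kappa>) m) = m"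
proof -
  note [simp] = antiaut_inv1[OF \<kappa>] antiaut_inv2[OF \<kappa>] mult_anti_lact[OF nd \<kappa>] mult_anti_ract[OF nd \<kappa>]
    mult_anti_lact[OF nd alg_antiaut_inv(1)[OF \<kappa>]] mult_anti_ract[OF nd alg_antiaut_inv(1)[OF \<kappa>]]
    alg_antiaut_inv(2)[OF \<kappa>] antiaut_mult[OF \<kappa>] clinearD[OF antiaut_clinear[OF \<kappa>]]
  show "\<kappa> (a \<lhd> m) = mult_anti \<kappa> m \<rhd> \<kappa> a" "\<kappa> (m \<rhd> a) = \<kappa> a \<lhd> mult_anti \<kappa> m" by simp_all
  show "mult_anti \<kappa> (m * n) = mult_anti \<kappa> n * mult_anti \<kappa> m" "mult_anti \<kappa> (emb a) = emb (\<kappa> a)"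
    "mult_anti \<kappa> 1 = 1" "mult_anti (inv \<kappa>) (mult_anti \<kappa> m) = m" "mult_anti \<kappa> (mult_anti (inv \<kappa>) m) = m"
    by (rule mult_eqI; simp)+
  show "clinear (mult_anti \<kappa>)"
    by (rule clinearI; rule mult_eqI) simp_all
qed

lemma extend_antihom_eq:
  assumes nd: "nondeg TYPE('a::complex_algebra)" and \<kappa>: "alg_antiaut (\<kappa> :: 'a \<Rightarrow> 'a)"
  shows "extend_antihom (\<lambda>a. emb (\<kappa> a)) = mult_anti \<kappa>"
  unfolding extend_antihom_def
proof (rule the_equality)
  show "alg_antihom (mult_anti \<kappa>) \<and> (\<forall>a. mult_anti \<kappa> (emb a) = emb (\<kappa> a)) \<and> mult_anti \<kappa> 1 = 1"
    using nd \<kappa> by (simp add: alg_antihom_def mult_anti_mult mult_anti_emb mult_anti_one clinear_mult_anti)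
  fix g assume g: "alg_antihom g \<and> (\<forall>a. g (emb a) = emb (\<kappa> a)) \<and> g 1 = 1"
  show "g = mult_anti \<kappa>"
  proof
    fix m
    show "g m = mult_anti \<kappa> m"
    proof (rule mult_eqI_left[OF nd])
      fix a
      have "g (emb (inv \<kappa> a) * m) = g m * g (emb (inv \<kappa> a))" using g by (simp add: alg_antihom_def)
      then have "emb (g m \<rhd> a) = emb (\<kappa> (inv \<kappa> a \<lhd> m))"
        using g by (simp add: emb_times mult_emb antiaut_inv1[OF \<kappa>])
      then show "g m \<rhd> a = mult_anti \<kappa> m \<rhd> a"
        by (simp add: emb_eq_iff[OF nd] mult_anti_lact[OF nd \<kappa>])
    qed
  qed
qed

section \<open>Trilinear maps and associators\<close>

definition ctrilinear ::
  "('a::complex_vector \<Rightarrow> 'b::complex_vector \<Rightarrow> 'c::complex_vector \<Rightarrow> 'd::complex_vector) \<Rightarrow> bool"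
  where "ctrilinear F \<longleftrightarrow> (\<forall>y z. clinear (\<lambda>x. F x y z)) \<and> (\<forall>x z. clinear (\<lambda>y. F x y z))
    \<and> (\<forall>x y. clinear (F x y))"

lemma ctrilinearI:
  "(\<And>y z. clinear (\<lambda>x. F x y z)) \<Longrightarrow> (\<And>x z. clinear (\<lambda>y. F x y z)) \<Longrightarrow> (\<And>x y. clinear (\<lambda>z. F x y z))
    \<Longrightarrow> ctrilinear F"
  by (simp add: ctrilinear_def)

lemma ctrilinearD:
  assumes "ctrilinear F"
  shows "clinear (\<lambda>x. F x y z)" "clinear (\<lambda>y. F x y z)" "clinear (F x y)"
    "cbilinear (F x)" "cbilinear (\<lambda>x y. F x y z)" "cbilinear (\<lambda>x z. F x y z)"
  using assms by (simp_all add: ctrilinear_def cbilinear_def)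

lemma ctrilinear_lift:
  assumes "ctrilinear F"
  shows "cbilinear (\<lambda>x w. tensor_lift (F x) w)"
  by (intro clin clinear_tensor_lift ctrilinearD[OF assms])

lemma tensor_lift3_pair:
  assumes "ctrilinear F"
  shows "tensor_lift (\<lambda>x w. tensor_lift (F x) w) (x \<otimes> w) = tensor_lift (F x) w"
  by (simp add: ctrilinear_lift[OF assms])

lemma tensor_lift3_assoc:
  assumes F: "ctrilinear F"
  shows "tensor_lift (\<lambda>x w. tensor_lift (F x) w) (tensor_assoc (z \<otimes> r)) = tensor_lift (\<lambda>x y. F x y r) z"
proof (rule tensor_eqI[where z = z])
  show "clinear (\<lambda>z. tensor_lift (\<lambda>x w. tensor_lift (F x) w) (tensor_assoc (z \<otimes> r)))"
    by (intro clin clinear_tensor_lift ctrilinearD[OF F])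
  show "clinear (tensor_lift (\<lambda>x y. F x y r))"
    by (intro clinear_tensor_lift ctrilinearD[OF F])
qed (simp add: ctrilinear_lift[OF F] ctrilinearD[OF F])

lemma mult_assoc_act:
  "mult_assoc m \<rhd> tensor_assoc t = tensor_assoc (m \<rhd> t)"
  "tensor_assoc t \<lhd> mult_assoc m = tensor_assoc (t \<lhd> m)"
  unfolding mult_assoc_def
  by (rule mult_transport_lact mult_transport_ract; rule bij_tensor_assoc clinear_tensor_assoc tensor_assoc_mult)+

lemma tensor_assoc_cases: obtains t where "u = tensor_assoc t"
  using bij_tensor_assoc by (metis bij_pointE)

lemma mult_assoc_times: "mult_assoc (m * n) = mult_assoc m * mult_assoc n"
proof (rule mult_eqI)
  show "mult_assoc (m * n) \<rhd> u = (mult_assoc m * mult_assoc n) \<rhd> u" for u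
    by (rule tensor_assoc_cases[of u]) (simp add: mult_assoc_act)
  show "u \<lhd> mult_assoc (m * n) = u \<lhd> (mult_assoc m * mult_assoc n)" for u
    by (rule tensor_assoc_cases[of u]) (simp add: mult_assoc_act)
qed

lemma mult_assoc_emb: "mult_assoc (emb t) = emb (tensor_assoc t)"
proof (rule mult_eqI)
  show "mult_assoc (emb t) \<rhd> u = emb (tensor_assoc t) \<rhd> u" for u
    by (rule tensor_assoc_cases[of u]) (simp add: mult_assoc_act tensor_assoc_mult)
  show "u \<lhd> mult_assoc (emb t) = u \<lhd> emb (tensor_assoc t)" for u
    by (rule tensor_assoc_cases[of u]) (simp add: mult_assoc_act tensor_assoc_mult)
qed

lemma mult_assoc_mtensor: "mult_assoc ((m \<otimes>\<^sub>M n) \<otimes>\<^sub>M k) = m \<otimes>\<^sub>M (n \<otimes>\<^sub>M k)"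
proof (rule mult_eqI)
  have "mult_assoc ((m \<otimes>\<^sub>M n) \<otimes>\<^sub>M k) \<rhd> tensor_assoc t = (m \<otimes>\<^sub>M (n \<otimes>\<^sub>M k)) \<rhd> tensor_assoc t" for t
    unfolding mult_assoc_act
  proof (induction t rule: tensor_induct)
    case (pair z c) show ?case
      by (induction z rule: tensor_induct) (simp_all add: tensor_pair_simps act_linear
        clinear_add[OF clinear_tensor_assoc])
  qed (simp_all add: tensor_pair_simps act_linear clinear_add[OF clinear_tensor_assoc])
  then show "mult_assoc ((m \<otimes>\<^sub>M n) \<otimes>\<^sub>M k) \<rhd> u = (m \<otimes>\<^sub>M (n \<otimes>\<^sub>M k)) \<rhd> u" for u
    by (metis tensor_assoc_cases)
  have "tensor_assoc t \<lhd> mult_assoc ((m \<otimes>\<^sub>M n) \<otimes>\<^sub>M k) = tensor_assoc t \<lhd> (m \<otimes>\<^sub>M (n \<otimes>\<^sub>M k))" for t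
    unfolding mult_assoc_act
  proof (induction t rule: tensor_induct)
    case (pair z c) show ?case
      by (induction z rule: tensor_induct) (simp_all add: tensor_pair_simps act_linear
        clinear_add[OF clinear_tensor_assoc])
  qed (simp_all add: tensor_pair_simps act_linear clinear_add[OF clinear_tensor_assoc])
  then show "u \<lhd> mult_assoc ((m \<otimes>\<^sub>M n) \<otimes>\<^sub>M k) = u \<lhd> (m \<otimes>\<^sub>M (n \<otimes>\<^sub>M k))" for u
    by (metis tensor_assoc_cases)
qed

lemma clinear_unemb:
  assumes nd: "nondeg TYPE('b::complex_algebra)" and f: "clinear f"
    and r: "\<And>x. f x \<in> range (emb :: 'b \<Rightarrow> _)"
  shows "clinear (\<lambda>x. unemb (f x) :: 'b)"
proof -
  have *: "f x + f y \<in> range (emb :: 'b \<Rightarrow> _)" "c *\<^sub>C f x \<in> range (emb :: 'b \<Rightarrow> _)" for x y c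
    using r[of "x + y"] r[of "c *\<^sub>C x"] by (simp_all add: clinear_add[OF f] clinear_scale[OF f])
  show ?thesis
    by (rule clinearI; rule emb_eq_iff[OF nd, THEN iffD1])
      (simp_all add: emb_unemb r * clinear_add[OF clinear_emb_id] clinear_scale[OF clinear_emb_id]
        clinear_add[OF f] clinear_scale[OF f])
qed

section \<open>Coassociativity and regularity\<close>

context regular_weak_multiplier_hopf_algebra
begin

lemma nd: "nondeg TYPE('a)"
  using nondegenerate_left nondegenerate_right unfolding nondeg_def by blast

lemma id: "idem TYPE('a)"
  using idempotent by (simp add: idem_def)

lemmas nd2 = nondeg_tensor[OF nd nd] and id2 = idem_tensor[OF id id]
lemmas nd3 = nondeg_tensor[OF nd nd2]

lemma clinear_coprod: "clinear \<Delta>"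
  using coprod_hom by (simp add: alg_hom_def)

lemma coprod_mult: "\<Delta> (a * b) = \<Delta> a * \<Delta> b"
  using coprod_hom by (simp add: alg_hom_def)

lemma clin_coprod: "clinear f \<Longrightarrow> clinear (\<lambda>x. \<Delta> (f x))"
  by (rule clinear_compose[OF clinear_coprod])

abbreviation t1 :: "'a \<Rightarrow> 'a \<Rightarrow> ('a, 'a) tensor" where "t1 a b \<equiv> T1 \<Delta> (a \<otimes> b)"
abbreviation t2 :: "'a \<Rightarrow> 'a \<Rightarrow> ('a, 'a) tensor" where "t2 a b \<equiv> T2 \<Delta> (a \<otimes> b)"

lemma cbilinear_T1: "cbilinear (\<lambda>a b. unemb (\<Delta> a * (1 \<otimes>\<^sub>M emb b)))"
  by (intro clin clinear_unemb nd2 clin_coprod coprod_right)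

lemma cbilinear_T2: "cbilinear (\<lambda>a b. unemb ((emb a \<otimes>\<^sub>M 1) * \<Delta> b))"
  by (intro clin clinear_unemb nd2 clin_coprod coprod_left)

lemma emb_t1: "emb (t1 a b) = \<Delta> a * (1 \<otimes>\<^sub>M emb b)"
  by (simp add: T1_def cbilinear_T1 emb_unemb coprod_right)

lemma emb_t2: "emb (t2 a b) = (emb a \<otimes>\<^sub>M 1) * \<Delta> b"
  by (simp add: T2_def cbilinear_T2 emb_unemb coprod_left)

lemma clin_T1: "clinear f \<Longrightarrow> clinear (\<lambda>x. T1 \<Delta> (f x))"
  unfolding T1_def by (intro clin cbilinear_T1)

lemma clin_T2: "clinear f \<Longrightarrow> clinear (\<lambda>x. T2 \<Delta> (f x))"
  unfolding T2_def by (intro clin cbilinear_T2)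

lemmas lin0 = clin clin_coprod clin_T1 clin_T2 ctrilinearI

lemma coprod_pair_lact: "\<Delta> a \<rhd> (x \<otimes> y) = t1 a y \<lhd> (emb x \<otimes>\<^sub>M 1)"
  by (rule emb_eq_iff[OF nd2, THEN iffD1])
    (simp add: emb_times[symmetric] mult_emb[symmetric] emb_t1 emb_tensor_pair mult.assoc mtensor_times)

lemma coprod_pair_ract: "(x \<otimes> y) \<lhd> \<Delta> a = (1 \<otimes>\<^sub>M emb y) \<rhd> t2 x a"
  by (rule emb_eq_iff[OF nd2, THEN iffD1])
    (simp add: emb_times[symmetric] mult_emb[symmetric] emb_t2 emb_tensor_pair mult.assoc[symmetric] mtensor_times)

lemma t1_t2: "(emb c \<otimes>\<^sub>M 1) \<rhd> t1 a b = t2 c a \<lhd> (1 \<otimes>\<^sub>M emb b)"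
  by (rule emb_eq_iff[OF nd2, THEN iffD1])
    (simp add: emb_times[symmetric] mult_emb[symmetric] emb_t1 emb_t2 mult.assoc)

text \<open>The axiom is an identity of multipliers. Both of its sides come from elements of
  \<open>A \<otimes> (A \<otimes> A)\<close>, namely
  \<open>c a_1 \<otimes> a_2 \<otimes> a_3 e\<close> grouped in two ways, and here it is pulled back
  to them.\<close>

lemma coassociative_tensor:
  "tensor_lift (\<lambda>p q. tensor_assoc (t2 c p \<otimes> q)) (t1 a e) = tensor_lift (\<lambda>p q. p \<otimes> t1 q e) (t2 c a)"
proof (rule emb_eq_iff[OF nd3, THEN iffD1])
  have "emb (tensor_lift (\<lambda>p q. tensor_assoc (t2 c p \<otimes> q)) (t1 a e))
      = tensor_lift (\<lambda>p q. (emb c \<otimes>\<^sub>M 1) * mult_assoc (\<Delta> p \<otimes>\<^sub>M emb q)) (t1 a e)"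
  proof (subst tensor_lift_commute[OF clinear_emb_id], rule arg_cong2[of _ _ _ _ tensor_lift], intro ext)
    fix p q
    have "(emb c \<otimes>\<^sub>M 1) * mult_assoc (\<Delta> p \<otimes>\<^sub>M emb q) = mult_assoc (((emb c \<otimes>\<^sub>M 1) \<otimes>\<^sub>M 1) * (\<Delta> p \<otimes>\<^sub>M emb q))"
      by (simp add: mult_assoc_times mult_assoc_mtensor one_mtensor_one)
    also have "\<dots> = emb (tensor_assoc (t2 c p \<otimes> q))"
      by (simp add: mtensor_times emb_t2[symmetric] emb_tensor_pair[symmetric] mult_assoc_emb)
    finally show "emb (tensor_assoc (t2 c p \<otimes> q)) = (emb c \<otimes>\<^sub>M 1) * mult_assoc (\<Delta> p \<otimes>\<^sub>M emb q)" by simp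
  qed simp
  also have "\<dots> = (emb c \<otimes>\<^sub>M 1) * coprod_id \<Delta> (t1 a e)"
    unfolding coprod_id_def by (rule tensor_lift_commute[symmetric]) (intro clin)
  also have "\<dots> = id_coprod \<Delta> (t2 c a) * (1 \<otimes>\<^sub>M (1 \<otimes>\<^sub>M emb e))" by (rule coassociative)
  also have "\<dots> = tensor_lift (\<lambda>p q. (emb p \<otimes>\<^sub>M \<Delta> q) * (1 \<otimes>\<^sub>M (1 \<otimes>\<^sub>M emb e))) (t2 c a)"
    unfolding id_coprod_def by (rule tensor_lift_commute[where h = "\<lambda>x. x * _"]) (intro clin)
  also have "\<dots> = emb (tensor_lift (\<lambda>p q. p \<otimes> t1 q e) (t2 c a))"
    by (subst tensor_lift_commute[OF clinear_emb_id]) (simp add: mtensor_times emb_tensor_pair emb_t1)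
  finally show "emb (tensor_lift (\<lambda>p q. tensor_assoc (t2 c p \<otimes> q)) (t1 a e))
    = emb (tensor_lift (\<lambda>p q. p \<otimes> t1 q e) (t2 c a))" .
qed

text \<open>Both sides stand for \<open>\<Sum> F(c a\<^sub>(\<^sub>1\<^sub>), a\<^sub>(\<^sub>2\<^sub>), a\<^sub>(\<^sub>3\<^sub>) e)\<close>.\<close>

lemma coassoc:
  assumes F: "ctrilinear F"
  shows "tensor_lift (\<lambda>p q. tensor_lift (\<lambda>x y. F x y q) (t2 c p)) (t1 a e)
    = tensor_lift (\<lambda>p q. tensor_lift (\<lambda>x y. F p x y) (t1 q e)) (t2 c a)"
proof -
  let ?F = "tensor_lift (\<lambda>x w. tensor_lift (F x) w)"
  have lin: "clinear ?F" by (rule clinear_tensor_lift[OF ctrilinear_lift[OF F]])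
  have "?F (tensor_lift (\<lambda>p q. tensor_assoc (t2 c p \<otimes> q)) (t1 a e))
    = ?F (tensor_lift (\<lambda>p q. p \<otimes> t1 q e) (t2 c a))" by (simp only: coassociative_tensor)
  then show ?thesis
    by (simp only: tensor_lift_commute[OF lin] tensor_lift3_assoc[OF F] tensor_lift3_pair[OF F])
qed

section \<open>Absorption of the canonical idempotent by the coproduct\<close>

lemma E_T1: "E \<rhd> T1 \<Delta> z = T1 \<Delta> z"
proof -
  have "T1 \<Delta> z \<in> range (\<lambda>t. E \<rhd> t)" unfolding range_T1[symmetric] by (rule rangeI)
  then obtain t where "T1 \<Delta> z = E \<rhd> t" by blast
  then show ?thesis using arg_cong[OF E_idempotent, of "\<lambda>m. m \<rhd> t"] by simp
qed

lemma T2_E: "T2 \<Delta> z \<lhd> E = T2 \<Delta> z"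
proof -
  have "T2 \<Delta> z \<in> range (\<lambda>t. t \<lhd> E)" unfolding range_T2[symmetric] by (rule rangeI)
  then obtain t where "T2 \<Delta> z = t \<lhd> E" by blast
  then show ?thesis using arg_cong[OF E_idempotent, of "\<lambda>m. t \<lhd> m"] by simp
qed

lemma tensor_mult_eqI_left:
  "(\<And>x y. m \<rhd> (x \<otimes> y) = n \<rhd> (x \<otimes> y)) \<Longrightarrow> m = (n :: ('a, 'a) tensor mult)"
  by (rule mult_eqI_left[OF nd2]) (rule tensor_eqI, (intro clin)+)

lemma tensor_mult_eqI_right:
  "(\<And>x y. (x \<otimes> y) \<lhd> m = (x \<otimes> y) \<lhd> n) \<Longrightarrow> m = (n :: ('a, 'a) tensor mult)"
  by (rule mult_eqI_right[OF nd2]) (rule tensor_eqI, (intro clin)+)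

lemma E_coprod: "E * \<Delta> a = \<Delta> a"
  by (rule tensor_mult_eqI_left) (simp add: coprod_pair_lact lact_ract[OF nd2, symmetric] E_T1)

lemma coprod_E: "\<Delta> a * E = \<Delta> a"
  by (rule tensor_mult_eqI_right) (simp add: coprod_pair_ract lact_ract[OF nd2] T2_E)

section \<open>Induction along the legs of the coproduct\<close>

lemma left_leg_induct:
  assumes leg: "left_leg \<Delta> D = UNIV" and W: "csubspace W"
    and slice: "\<And>x a \<phi>. x \<in> D \<Longrightarrow> clinear \<phi> \<Longrightarrow> tensor_lift (\<lambda>p q. \<phi> q *\<^sub>C p) (t1 x a) \<in> W"
  shows "y \<in> W"
proof -
  have "\<Delta> x * (1 \<otimes>\<^sub>M emb a) \<in> emb ` tensor_sub W UNIV" if "x \<in> D" for x a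
    unfolding emb_t1[symmetric] using tensor_subI_left[of "t1 x a" W] slice[OF that] by blast
  then have "left_leg \<Delta> D \<subseteq> W"
    unfolding left_leg_def using W by (intro Inter_lower) blast
  then show ?thesis using leg by blast
qed

lemma right_leg_induct:
  assumes leg: "right_leg \<Delta> D = UNIV" and W: "csubspace W"
    and slice: "\<And>x a \<phi>. x \<in> D \<Longrightarrow> clinear \<phi> \<Longrightarrow> tensor_lift (\<lambda>p q. \<phi> p *\<^sub>C q) (t2 a x) \<in> W"
  shows "y \<in> W"
proof -
  have "(emb a \<otimes>\<^sub>M 1) * \<Delta> x \<in> emb ` tensor_sub UNIV W" if "x \<in> D" for x a
    unfolding emb_t2[symmetric] using tensor_subI_right[of "t2 a x" W] slice[OF that] by blast
  then have "right_leg \<Delta> D \<subseteq> W"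
    unfolding right_leg_def using W by (intro Inter_lower) blast
  then show ?thesis using leg by blast
qed

lemma csubspace_eq:
  assumes "clinear f" "clinear g"
  shows "csubspace {x. f x = g x}"
  by (rule cvec.subspaceI) (simp_all add: clinearD[OF assms(1)] clinearD[OF assms(2)])

text \<open>With \<open>D\<close> all of A this expresses fullness: an identity linear in y may be
  checked on the first leg of \<open>\<Delta>(x)(1 \<otimes> a)\<close>, where coassociativity
  applies. With \<open>D\<close> the set of cointegrals it expresses discreteness.\<close>

lemma left_leg_eqI:
  assumes leg: "left_leg \<Delta> D = UNIV" and f: "clinear f" and g: "clinear g"
    and eq: "\<And>x a. x \<in> D \<Longrightarrow> tensor_lift (\<lambda>p q. f p \<otimes> q) (t1 x a) = tensor_lift (\<lambda>p q. g p \<otimes> q) (t1 x a)"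
  shows "f y = g y"
proof -
  have "y \<in> {x. f x = g x}"
  proof (rule left_leg_induct[OF leg csubspace_eq[OF f g]])
    fix x a \<phi> assume x: "x \<in> D" and \<phi>: "clinear (\<phi> :: 'a \<Rightarrow> complex)"
    have lin: "clinear (tensor_lift (\<lambda>p q. \<phi> q *\<^sub>C p))"
      by (intro clinear_tensor_lift clin \<phi>)
    have *: "k (tensor_lift (\<lambda>p q. \<phi> q *\<^sub>C p) (t1 x a))
        = tensor_lift (\<lambda>p q. \<phi> q *\<^sub>C p) (tensor_lift (\<lambda>p q. k p \<otimes> q) (t1 x a))"
      if k: "clinear k" for k :: "'a \<Rightarrow> 'b"
      by (simp add: tensor_lift_compose tensor_lift_commute[OF k] clinear_scale[OF k] cbilinearI
          clinear_scaleC_left clinear_scaleC_right clinear_id \<phi>)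
    show "tensor_lift (\<lambda>p q. \<phi> q *\<^sub>C p) (t1 x a) \<in> {x. f x = g x}"
      by (simp add: *[OF f] *[OF g] eq[OF x])
  qed
  then show ?thesis by simp
qed

lemma right_leg_eqI:
  assumes leg: "right_leg \<Delta> D = UNIV" and f: "clinear f" and g: "clinear g"
    and eq: "\<And>x a. x \<in> D \<Longrightarrow> tensor_lift (\<lambda>p q. p \<otimes> f q) (t2 a x) = tensor_lift (\<lambda>p q. p \<otimes> g q) (t2 a x)"
  shows "f y = g y"
proof -
  have "y \<in> {x. f x = g x}"
  proof (rule right_leg_induct[OF leg csubspace_eq[OF f g]])
    fix x a \<phi> assume x: "x \<in> D" and \<phi>: "clinear (\<phi> :: 'a \<Rightarrow> complex)"
    have *: "k (tensor_lift (\<lambda>p q. \<phi> p *\<^sub>C q) (t2 a x))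
        = tensor_lift (\<lambda>p q. \<phi> p *\<^sub>C q) (tensor_lift (\<lambda>p q. p \<otimes> k q) (t2 a x))"
      if k: "clinear k" for k :: "'a \<Rightarrow> 'b"
      by (simp add: tensor_lift_compose tensor_lift_commute[OF k] clinear_scale[OF k] cbilinearI
          clinear_scaleC_left clinear_scaleC_right clinear_id \<phi>)
    show "tensor_lift (\<lambda>p q. \<phi> p *\<^sub>C q) (t2 a x) \<in> {x. f x = g x}"
      by (simp add: *[OF f] *[OF g] eq[OF x])
  qed
  then show ?thesis by simp
qed

end

lemma tensor_lift_lact:
  "cbilinear f \<Longrightarrow> tensor_lift f ((m \<otimes>\<^sub>M n) \<rhd> z) = tensor_lift (\<lambda>a b. f (m \<rhd> a) (n \<rhd> b)) z"
  by (simp add: mtensor_lact tensor_lift_compose)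

lemma tensor_lift_ract:
  "cbilinear f \<Longrightarrow> tensor_lift f (z \<lhd> (m \<otimes>\<^sub>M n)) = tensor_lift (\<lambda>a b. f (a \<lhd> m) (b \<lhd> n)) z"
  by (simp add: mtensor_ract tensor_lift_compose)

lemma assoc_lact: "(m \<otimes>\<^sub>M (n \<otimes>\<^sub>M k)) \<rhd> tensor_assoc (z \<otimes> c) = tensor_assoc (((m \<otimes>\<^sub>M n) \<rhd> z) \<otimes> (k \<rhd> c))"
  by (simp add: mult_assoc_mtensor[symmetric] mult_assoc_act)

lemma assoc_ract: "tensor_assoc (z \<otimes> c) \<lhd> (m \<otimes>\<^sub>M (n \<otimes>\<^sub>M k)) = tensor_assoc ((z \<lhd> (m \<otimes>\<^sub>M n)) \<otimes> (c \<lhd> k))"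
  by (simp add: mult_assoc_mtensor[symmetric] mult_assoc_act)

text \<open>By idempotency every element is a sum of products, so a factor e can be split off from a
  test tensor and handed to z; nondegeneracy of the tensor product does the rest.\<close>

lemma
  fixes z z' :: "('a::complex_algebra, 'b::complex_algebra) tensor"
  assumes nda: "nondeg TYPE('a)" and ndb: "nondeg TYPE('b)"
  shows cancel_ract_right: "idem TYPE('b) \<Longrightarrow> (\<And>e. z \<lhd> (1 \<otimes>\<^sub>M emb e) = z' \<lhd> (1 \<otimes>\<^sub>M emb e)) \<Longrightarrow> z = z'"
    and cancel_ract_left: "idem TYPE('a) \<Longrightarrow> (\<And>e. z \<lhd> (emb e \<otimes>\<^sub>M 1) = z' \<lhd> (emb e \<otimes>\<^sub>M 1)) \<Longrightarrow> z = z'"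
    and cancel_lact_right: "idem TYPE('b) \<Longrightarrow> (\<And>e. (1 \<otimes>\<^sub>M emb e) \<rhd> z = (1 \<otimes>\<^sub>M emb e) \<rhd> z') \<Longrightarrow> z = z'"
    and cancel_lact_left: "idem TYPE('a) \<Longrightarrow> (\<And>e. (emb e \<otimes>\<^sub>M 1) \<rhd> z = (emb e \<otimes>\<^sub>M 1) \<rhd> z') \<Longrightarrow> z = z'"
proof -
  note ndt = nondeg_tensor[OF nda ndb]
  note lin = clinear_times_left clinear_times_right clin
  have L: "z = z'" if "\<And>x y. z * (x \<otimes> y) = z' * (x \<otimes> y)"
    by (rule nondeg_left_eqI[OF ndt], rule tensor_eqI) (intro lin that)+
  have R: "z = z'" if "\<And>x y. (x \<otimes> y) * z = (x \<otimes> y) * z'"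
    by (rule nondeg_right_eqI[OF ndt], rule tensor_eqI) (intro lin that)+
  have rr: "z * (x \<otimes> (e * y)) = (z \<lhd> (1 \<otimes>\<^sub>M emb e)) * (x \<otimes> y)" 
    and rl: "z * ((e' * x) \<otimes> y) = (z \<lhd> (emb e' \<otimes>\<^sub>M 1)) * (x \<otimes> y)"
    and lr: "(x \<otimes> (y * e)) * z = (x \<otimes> y) * ((1 \<otimes>\<^sub>M emb e) \<rhd> z)"
    and ll: "((x * e') \<otimes> y) * z = (x \<otimes> y) * ((emb e' \<otimes>\<^sub>M 1) \<rhd> z)"
    for z :: "('a, 'b) tensor" and x e' y e
    by (simp_all add: mult_lact[symmetric], simp_all add: mult_lact)
  show "z = z'" if id: "idem TYPE('b)" and eq: "\<And>e. z \<lhd> (1 \<otimes>\<^sub>M emb e) = z' \<lhd> (1 \<otimes>\<^sub>M emb e)"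
    by (rule L, rule idem_eqI[OF id]) (intro lin | simp add: rr eq)+
  show "z = z'" if id: "idem TYPE('a)" and eq: "\<And>e. z \<lhd> (emb e \<otimes>\<^sub>M 1) = z' \<lhd> (emb e \<otimes>\<^sub>M 1)"
    by (rule L, rule idem_eqI[OF id]) (intro lin | simp add: rl eq)+
  show "z = z'" if id: "idem TYPE('b)" and eq: "\<And>e. (1 \<otimes>\<^sub>M emb e) \<rhd> z = (1 \<otimes>\<^sub>M emb e) \<rhd> z'"
    by (rule R, rule idem_eqI[OF id]) (intro lin | simp add: lr eq)+
  show "z = z'" if id: "idem TYPE('a)" and eq: "\<And>e. (emb e \<otimes>\<^sub>M 1) \<rhd> z = (emb e \<otimes>\<^sub>M 1) \<rhd> z'"
    by (rule R, rule idem_eqI[OF id]) (intro lin | simp add: ll eq)+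
qed

context regular_weak_multiplier_hopf_algebra
begin

lemma cancel_ract_third:
  fixes z z' :: "('a, ('a, 'a) tensor) tensor"
  assumes "\<And>e. z \<lhd> (1 \<otimes>\<^sub>M (1 \<otimes>\<^sub>M emb e)) = z' \<lhd> (1 \<otimes>\<^sub>M (1 \<otimes>\<^sub>M emb e))"
  shows "z = z'"
proof (rule cancel_ract_right[OF nd nd2 id2])
  fix w :: "('a, 'a) tensor"
  show "z \<lhd> (1 \<otimes>\<^sub>M emb w) = z' \<lhd> (1 \<otimes>\<^sub>M emb w)"
  proof (rule tensor_eqI[where z = w])
    show "z \<lhd> (1 \<otimes>\<^sub>M emb (a \<otimes> b)) = z' \<lhd> (1 \<otimes>\<^sub>M emb (a \<otimes> b))" for a b
    proof -
      have "(1 :: 'a mult) \<otimes>\<^sub>M emb (a \<otimes> b) = (1 \<otimes>\<^sub>M (1 \<otimes>\<^sub>M emb b)) * (1 \<otimes>\<^sub>M (emb a \<otimes>\<^sub>M 1))"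
        by (simp add: emb_tensor_pair mtensor_times)
      then have "y \<lhd> (1 \<otimes>\<^sub>M emb (a \<otimes> b)) = (y \<lhd> (1 \<otimes>\<^sub>M (1 \<otimes>\<^sub>M emb b))) \<lhd> (1 \<otimes>\<^sub>M (emb a \<otimes>\<^sub>M 1))"
        for y :: "('a, ('a, 'a) tensor) tensor"
        by (simp only: act_simps)
      then show ?thesis by (simp only: assms)
    qed
  qed (intro clin)+
qed

section \<open>The antipode as an anti-automorphism of the algebra\<close>

definition \<sigma> :: "'a \<Rightarrow> 'a" where "\<sigma> a = unemb (S a)"

lemma emb_\<sigma>: "emb (\<sigma> a) = S a"
  using regular unfolding \<sigma>_def by (intro emb_unemb) (auto simp: bij_betw_def)

lemma antiaut: "alg_antiaut \<sigma>"
proof -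
  have "bij \<sigma>"
  proof (rule bijI)
    show "inj \<sigma>"
      using regular by (intro injI) (metis bij_betw_def emb_\<sigma> injD)
    show "surj \<sigma>"
    proof (rule surjI)
      fix b
      have "emb b \<in> S ` UNIV" using regular by (simp add: bij_betw_def)
      then have "emb (\<sigma> (inv S (emb b))) = emb b" by (simp add: emb_\<sigma> f_inv_into_f)
      then show "\<sigma> (inv S (emb b)) = b" by (simp add: emb_eq_iff[OF nd])
    qed
  qed
  moreover have lin: "clinear S" and mult: "S (a * b) = S b * S a" for a b
    using antipode_antihom by (simp_all add: alg_antihom_def)
  have "alg_antihom \<sigma>"
    unfolding alg_antihom_def
    by (intro conjI allI clinearI; rule emb_eq_iff[OF nd, THEN iffD1])
      (simp_all add: emb_\<sigma> emb_mult mult clinear_add[OF lin] clinear_scale[OF lin]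
        clinear_add[OF clinear_emb_id] clinear_scale[OF clinear_emb_id])
  ultimately show ?thesis by (simp add: alg_antiaut_def)
qed

abbreviation \<sigma>' :: "'a \<Rightarrow> 'a" where "\<sigma>' \<equiv> inv \<sigma>"
abbreviation S\<^sub>M :: "'a mult \<Rightarrow> 'a mult" where "S\<^sub>M \<equiv> mult_anti \<sigma>"
abbreviation S\<^sub>M' :: "'a mult \<Rightarrow> 'a mult" where "S\<^sub>M' \<equiv> mult_anti \<sigma>'"

lemmas antiaut' = alg_antiaut_inv(1)[OF antiaut]
lemmas \<sigma>_mult = antiaut_mult[OF antiaut] and \<sigma>'_mult = antiaut_mult[OF antiaut']
lemmas \<sigma>_inv [simp] = antiaut_inv1[OF antiaut] antiaut_inv2[OF antiaut]
lemmas \<sigma>_act = antiaut_ract[OF nd antiaut] antiaut_lact[OF nd antiaut]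
lemmas \<sigma>'_act = antiaut_ract[OF nd antiaut'] antiaut_lact[OF nd antiaut']
lemmas S\<^sub>M_inv [simp] = mult_anti_inv1[OF nd antiaut] mult_anti_inv2[OF nd antiaut]

lemma clin_\<sigma>: "clinear f \<Longrightarrow> clinear (\<lambda>x. \<sigma> (f x))"
  by (rule clinear_compose[OF antiaut_clinear[OF antiaut]])

lemma clin_\<sigma>': "clinear f \<Longrightarrow> clinear (\<lambda>x. \<sigma>' (f x))"
  by (rule clinear_compose[OF antiaut_clinear[OF antiaut']])

lemma clin_S\<^sub>M: "clinear f \<Longrightarrow> clinear (\<lambda>x. S\<^sub>M (f x))"
  by (rule clinear_compose[OF clinear_mult_anti[OF nd antiaut]])

lemma clin_S\<^sub>M': "clinear f \<Longrightarrow> clinear (\<lambda>x. S\<^sub>M' (f x))"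
  by (rule clinear_compose[OF clinear_mult_anti[OF nd antiaut']])

lemma clin_G1: "clinear f \<Longrightarrow> clinear (\<lambda>x. G1 (f x))"
  by (rule clinear_compose[OF G1_linear])

abbreviation cs :: "'a \<Rightarrow> 'a \<Rightarrow> 'a" where "cs \<equiv> covered_s \<Delta> S"
abbreviation ct :: "'a \<Rightarrow> 'a \<Rightarrow> 'a" where "ct \<equiv> covered_t \<Delta> S"

lemma cs_eq: "cs a d = tensor_lift (\<lambda>x y. \<sigma> x * y) (t1 a d)"
  by (simp add: covered_s_def emb_\<sigma>[symmetric])

lemma ct_eq: "ct d a = tensor_lift (\<lambda>x y. x * \<sigma> y) (t2 d a)"
  by (simp add: covered_t_def emb_\<sigma>[symmetric])

lemma clin_cs: "clinear f \<Longrightarrow> clinear (\<lambda>x. cs (f x) d)" "clinear f \<Longrightarrow> clinear (\<lambda>x. cs a (f x))"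
  unfolding cs_eq by (intro lin0 clin_\<sigma>; assumption)+

lemma clin_ct: "clinear f \<Longrightarrow> clinear (\<lambda>x. ct (f x) d)" "clinear f \<Longrightarrow> clinear (\<lambda>x. ct a (f x))"
  unfolding ct_eq by (intro lin0 clin_\<sigma>; assumption)+

lemmas lin1 = lin0 clin_\<sigma> clin_\<sigma>' clin_S\<^sub>M clin_S\<^sub>M' clin_G1 clin_cs clin_ct

text \<open>With \<open>Q(u, w, v) = \<Sum> u v\<^sub>(\<^sub>1\<^sub>) \<otimes> w v\<^sub>(\<^sub>2\<^sub>) \<otimes> v\<^sub>(\<^sub>3\<^sub>)\<close>, covered on the left only.\<close>

definition Q :: "'a \<Rightarrow> 'a \<Rightarrow> 'a \<Rightarrow> ('a, ('a, 'a) tensor) tensor"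
  where "Q u w v = tensor_lift (\<lambda>p q. p \<otimes> t2 w q) (t2 u v)"

lemma Q_ract:
  "Q u w v \<lhd> (1 \<otimes>\<^sub>M (1 \<otimes>\<^sub>M emb e)) = tensor_lift (\<lambda>p q. tensor_assoc (((u \<otimes> w) \<lhd> \<Delta> p) \<otimes> q)) (t1 v e)"
proof -
  have "Q u w v \<lhd> (1 \<otimes>\<^sub>M (1 \<otimes>\<^sub>M emb e)) = tensor_lift (\<lambda>p q. p \<otimes> (t2 w q \<lhd> (1 \<otimes>\<^sub>M emb e))) (t2 u v)"
    unfolding Q_def by (subst tensor_lift_commute[OF clinear_ract]) simp
  also have "\<dots> = (1 \<otimes>\<^sub>M (emb w \<otimes>\<^sub>M 1)) \<rhd> tensor_lift (\<lambda>p q. p \<otimes> t1 q e) (t2 u v)"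
    by (subst tensor_lift_commute[OF clinear_lact]) (simp add: t1_t2)
  also have "\<dots> = tensor_lift (\<lambda>p q. tensor_assoc (((u \<otimes> w) \<lhd> \<Delta> p) \<otimes> q)) (t1 v e)"
    unfolding coassociative_tensor[symmetric]
    by (subst tensor_lift_commute[OF clinear_lact]) (simp add: assoc_lact coprod_pair_ract)
  finally show ?thesis .
qed

lemma Q_lift: "ctrilinear G \<Longrightarrow> tensor_lift (\<lambda>x w. tensor_lift (G x) w) (Q u w v)
    = tensor_lift (\<lambda>p q. tensor_lift (\<lambda>x y. G p x y) (t2 w q)) (t2 u v)"
  unfolding Q_def by (simp only: tensor_lift_commute[OF clinear_tensor_lift[OF ctrilinear_lift]] tensor_lift3_pair)

text \<open>Both sides stand for \<open>c a_1 v_1 \<otimes> d a_2 v_2 \<otimes> v_3\<close>. The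
  third leg is covered by e so that coassociativity can be used, and e is cancelled
  afterwards.\<close>

lemma Q_coprod:
  "tensor_lift (\<lambda>u w. Q u w v) ((c \<otimes> d) \<lhd> \<Delta> a)
    = tensor_lift (\<lambda>p q. tensor_assoc (((c \<otimes> d) \<lhd> \<Delta> p) \<otimes> q)) (t2 a v)"
proof (rule cancel_ract_third)
  fix e
  let ?X = "(c \<otimes> d) \<lhd> \<Delta> a"
  have X: "?X \<lhd> \<Delta> p = (c \<otimes> d) \<lhd> \<Delta> (a * p)" for p by (simp add: coprod_mult)
  have X2: "tensor_lift (\<lambda>u w. tensor_assoc (((u \<otimes> w) \<lhd> \<Delta> p) \<otimes> q)) ?X
      = tensor_assoc ((?X \<lhd> \<Delta> p) \<otimes> q)" for p q
    using tensor_lift_commute[where h = "\<lambda>x. tensor_assoc ((x \<lhd> \<Delta> p) \<otimes> q)" and f = "(\<otimes>)" and z = ?X]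
    by (simp add: clin clinear_id)
  have "tensor_lift (\<lambda>u w. Q u w v) ?X \<lhd> (1 \<otimes>\<^sub>M (1 \<otimes>\<^sub>M emb e))
      = tensor_lift (\<lambda>u w. tensor_lift (\<lambda>p q. tensor_assoc (((u \<otimes> w) \<lhd> \<Delta> p) \<otimes> q)) (t1 v e)) ?X"
    by (subst tensor_lift_commute[OF clinear_ract]) (simp only: Q_ract)
  also have "\<dots> = tensor_lift (\<lambda>p q. tensor_assoc ((?X \<lhd> \<Delta> p) \<otimes> q)) (t1 v e)"
    by (subst tensor_lift_swap) (simp only: X2)
  also have "\<dots> = tensor_lift (\<lambda>p q. tensor_assoc (((c \<otimes> d) \<lhd> \<Delta> p) \<otimes> q)) ((emb a \<otimes>\<^sub>M 1) \<rhd> t1 v e)"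
    by (subst tensor_lift_lact) ((intro lin1)+, simp only: X emb_act act_simps)
  also have "\<dots> = tensor_lift (\<lambda>p q. tensor_assoc (((c \<otimes> d) \<lhd> \<Delta> p) \<otimes> q)) (t2 a v \<lhd> (1 \<otimes>\<^sub>M emb e))"
    by (simp only: t1_t2)
  also have "\<dots> = tensor_lift (\<lambda>p q. tensor_assoc (((c \<otimes> d) \<lhd> \<Delta> p) \<otimes> q)) (t2 a v) \<lhd> (1 \<otimes>\<^sub>M (1 \<otimes>\<^sub>M emb e))"
    by (subst tensor_lift_ract, (intro lin1)+, subst tensor_lift_commute[OF clinear_ract])
      (simp add: assoc_ract one_mtensor_one)
  finally show "tensor_lift (\<lambda>u w. Q u w v) ?X \<lhd> (1 \<otimes>\<^sub>M (1 \<otimes>\<^sub>M emb e))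
    = tensor_lift (\<lambda>p q. tensor_assoc (((c \<otimes> d) \<lhd> \<Delta> p) \<otimes> q)) (t2 a v) \<lhd> (1 \<otimes>\<^sub>M (1 \<otimes>\<^sub>M emb e))" .
qed

text \<open>The axioms cover the coproduct as \<open>t1\<close> and \<open>t2\<close>. The other two
  coverings, \<open>\<Delta>(a)(v \<otimes> 1)\<close> and
  \<open>(1 \<otimes> v)\<Delta>(a)\<close>, are \<open>t3\<close> and \<open>t4\<close>; they must
  be built from the antipode, since regularity is assumed as bijectivity of S.\<close>

definition t3 :: "'a \<Rightarrow> 'a \<Rightarrow> ('a, 'a) tensor"
  where "t3 a v = tensor_lift (\<lambda>p q. t1 p (\<sigma> q)) (t2 a v)"

definition t4 :: "'a \<Rightarrow> 'a \<Rightarrow> ('a, 'a) tensor"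
  where "t4 v a = tensor_lift (\<lambda>p q. t2 (\<sigma> p) q) (t1 v a)"

lemma clin_t3: "clinear f \<Longrightarrow> clinear (\<lambda>x. t3 (f x) d)" "clinear f \<Longrightarrow> clinear (\<lambda>x. t3 a (f x))"
  unfolding t3_def by (intro lin1; assumption)+

lemma clin_t4: "clinear f \<Longrightarrow> clinear (\<lambda>x. t4 (f x) d)" "clinear f \<Longrightarrow> clinear (\<lambda>x. t4 a (f x))"
  unfolding t4_def by (intro lin1; assumption)+

lemmas lin2 = lin1 clin_t3 clin_t4

lemma ract_emb_t1: "((c \<otimes> d) \<lhd> \<Delta> p) \<lhd> (1 \<otimes>\<^sub>M emb z) = (c \<otimes> d) * t1 p z"
proof -
  have "(c \<otimes> d) \<lhd> (\<Delta> p * (1 \<otimes>\<^sub>M emb z)) = (c \<otimes> d) * t1 p z" by (simp only: emb_t1[symmetric] emb_act)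
  then show ?thesis by simp
qed

lemma lact_emb_t2: "(emb z \<otimes>\<^sub>M 1) \<rhd> (\<Delta> p \<rhd> t) = t2 z p * t"
proof -
  have "((emb z \<otimes>\<^sub>M 1) * \<Delta> p) \<rhd> t = t2 z p * t" by (simp only: emb_t2[symmetric] emb_act)
  then show ?thesis by simp
qed

text \<open>Regularity of the coproduct: \<open>\<Delta>(a)(v \<otimes> 1) = \<Sum> \<Delta>(a v\<^sub>(\<^sub>1\<^sub>))(1 \<otimes> S(v\<^sub>(\<^sub>2\<^sub>)))\<close>, because
  \<open>E (v \<otimes> 1) = \<Sum> v\<^sub>(\<^sub>1\<^sub>) \<otimes> v\<^sub>(\<^sub>2\<^sub>) S(v\<^sub>(\<^sub>3\<^sub>))\<close>.\<close>

lemma emb_t3: "emb (t3 a v) = \<Delta> a * (emb v \<otimes>\<^sub>M 1)"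
proof (rule tensor_mult_eqI_right)
  fix c d
  let ?X = "(c \<otimes> d) \<lhd> \<Delta> a"
  have "((c \<otimes> d) * t3 a v) \<lhd> (1 \<otimes>\<^sub>M emb b) = (?X \<lhd> (emb v \<otimes>\<^sub>M 1)) \<lhd> (1 \<otimes>\<^sub>M emb b)" for b
  proof -
    \<comment> \<open>\<open>G\<close> multiplies the second leg by the antipode of the third and by
      b, which turns \<open>Q u w v\<close> into
      \<open>(u \<otimes> w) E (v \<otimes> b)\<close>.\<close>
    define G where "G = (\<lambda>(x::'a) (y::'a) (z::'a). x \<otimes> (y * (\<sigma> z * b)))"
    have G: "ctrilinear G" unfolding G_def by (intro lin2)
    let ?G = "tensor_lift (\<lambda>x w. tensor_lift (G x) w)"
    have linG: "clinear ?G" by (rule clinear_tensor_lift[OF ctrilinear_lift[OF G]])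
    have QG: "?G (Q u w v) = (u \<otimes> w) * (E \<rhd> (v \<otimes> b))" for u w
    proof -
      have "tensor_lift (\<lambda>x y. G p x y) (t2 w q) = p \<otimes> (ct w q * b)" for p q
        unfolding G_def ct_eq
        by (subst tensor_lift_commute[where h = "\<lambda>x. p \<otimes> (x * b)"]) (intro lin2, simp add: mult.assoc)
      then show ?thesis by (simp add: Q_lift[OF G] antipode_E_left)
    qed
    have "?G (tensor_lift (\<lambda>u w. Q u w v) ?X) = tensor_lift (\<lambda>u w. (u \<otimes> w) * (E \<rhd> (v \<otimes> b))) ?X"
      by (subst tensor_lift_commute[OF linG]) (simp only: QG)
    also have "\<dots> = ?X * (E \<rhd> (v \<otimes> b))"
      using tensor_lift_commute[OF clinear_times_left, of "(\<otimes>)" ?X "E \<rhd> (v \<otimes> b)"] by simp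
    also have "\<dots> = ((?X \<lhd> E) * (v \<otimes> b))" by (simp only: mult_lact)
    also have "?X \<lhd> E = ?X" using coprod_E[of a] by (metis act_simps(14))
    also have "?X * (v \<otimes> b) = (?X \<lhd> (emb v \<otimes>\<^sub>M 1)) \<lhd> (1 \<otimes>\<^sub>M emb b)"
      by (metis act_simps(14) emb_act(2) emb_tensor_pair mtensor_times mult.right_neutral mult.left_neutral)
    finally have 1: "?G (tensor_lift (\<lambda>u w. Q u w v) ?X) = (?X \<lhd> (emb v \<otimes>\<^sub>M 1)) \<lhd> (1 \<otimes>\<^sub>M emb b)" .
    have "tensor_lift (\<lambda>x y. G x y q) z = z \<lhd> (1 \<otimes>\<^sub>M emb (\<sigma> q * b))" for q z
      by (simp add: G_def mtensor_ract)
    then have "?G (tensor_lift (\<lambda>p q. tensor_assoc (((c \<otimes> d) \<lhd> \<Delta> p) \<otimes> q)) (t2 a v))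
        = tensor_lift (\<lambda>p q. ((c \<otimes> d) \<lhd> \<Delta> p) \<lhd> (1 \<otimes>\<^sub>M emb (\<sigma> q * b))) (t2 a v)"
      by (subst tensor_lift_commute[OF linG]) (simp only: tensor_lift3_assoc[OF G])
    also have "\<dots> = tensor_lift (\<lambda>p q. ((c \<otimes> d) * t1 p (\<sigma> q)) \<lhd> (1 \<otimes>\<^sub>M emb b)) (t2 a v)"
    proof -
      have "(1 :: 'a mult) \<otimes>\<^sub>M emb (\<sigma> q * b) = (1 \<otimes>\<^sub>M emb (\<sigma> q)) * (1 \<otimes>\<^sub>M emb b)" for q
        by (simp add: mtensor_times emb_mult)
      then show ?thesis by (simp only: act_simps(14) ract_emb_t1)
    qed
    also have "\<dots> = ((c \<otimes> d) * t3 a v) \<lhd> (1 \<otimes>\<^sub>M emb b)"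
      unfolding t3_def
      by (rule tensor_lift_commute[where h = "\<lambda>x. ((c \<otimes> d) * x) \<lhd> (1 \<otimes>\<^sub>M emb b)", symmetric]) (intro lin2)
    finally have 2: "?G (tensor_lift (\<lambda>p q. tensor_assoc (((c \<otimes> d) \<lhd> \<Delta> p) \<otimes> q)) (t2 a v))
      = ((c \<otimes> d) * t3 a v) \<lhd> (1 \<otimes>\<^sub>M emb b)" .
    have "?G (tensor_lift (\<lambda>u w. Q u w v) ?X)
      = ?G (tensor_lift (\<lambda>p q. tensor_assoc (((c \<otimes> d) \<lhd> \<Delta> p) \<otimes> q)) (t2 a v))" by (simp only: Q_coprod)
    then show ?thesis by (rule trans[OF sym[OF 2] trans[OF sym 1]])
  qed
  then have "(c \<otimes> d) * t3 a v = ?X \<lhd> (emb v \<otimes>\<^sub>M 1)" by (rule cancel_ract_right[OF nd nd id])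
  then show "(c \<otimes> d) \<lhd> emb (t3 a v) = (c \<otimes> d) \<lhd> (\<Delta> a * (emb v \<otimes>\<^sub>M 1))" by simp
qed

text \<open>Mirror image of \<open>Q_coprod\<close>: both sides stand for
  \<open>v_1 \<otimes> v_2 a_1 x \<otimes> v_3 a_2 y\<close>.\<close>

lemma T1_coprod:
  "tensor_lift (\<lambda>y' z'. tensor_lift (\<lambda>p q. tensor_assoc (t1 p y' \<otimes> q)) (t1 v z')) (\<Delta> a \<rhd> (x \<otimes> y))
    = tensor_lift (\<lambda>p q. p \<otimes> (\<Delta> q \<rhd> (x \<otimes> y))) (t1 v a)"
proof (rule cancel_lact_left[OF nd nd2 id])
  fix c
  let ?X = "\<Delta> a \<rhd> (x \<otimes> y)"
  have X: "tensor_lift (\<lambda>y' z'. p \<otimes> (\<Delta> q \<rhd> (y' \<otimes> z'))) ?X = p \<otimes> (\<Delta> (q * a) \<rhd> (x \<otimes> y))" for p q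
    using tensor_lift_commute[where h = "\<lambda>x. p \<otimes> (\<Delta> q \<rhd> x)" and f = "(\<otimes>)" and z = ?X]
    by (simp add: clin clinear_id coprod_mult)
  have "(emb c \<otimes>\<^sub>M 1) \<rhd> tensor_lift (\<lambda>p q. tensor_assoc (t1 p y' \<otimes> q)) (t1 v z')
      = tensor_lift (\<lambda>p q. p \<otimes> (\<Delta> q \<rhd> (y' \<otimes> z'))) (t2 c v)" for y' z'
  proof -
    have "(emb c \<otimes>\<^sub>M 1) \<rhd> tensor_lift (\<lambda>p q. tensor_assoc (t1 p y' \<otimes> q)) (t1 v z')
      = (emb c \<otimes>\<^sub>M (1 \<otimes>\<^sub>M 1)) \<rhd> tensor_lift (\<lambda>p q. tensor_assoc (t1 p y' \<otimes> q)) (t1 v z')"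
      by (simp add: one_mtensor_one)
    also have "\<dots> = tensor_lift (\<lambda>p q. tensor_assoc (t2 c p \<otimes> q)) (t1 v z') \<lhd> (1 \<otimes>\<^sub>M (emb y' \<otimes>\<^sub>M 1))"
      by (subst tensor_lift_commute[OF clinear_lact], subst tensor_lift_commute[OF clinear_ract])
        (simp add: assoc_lact assoc_ract t1_t2)
    also have "\<dots> = tensor_lift (\<lambda>p q. p \<otimes> (\<Delta> q \<rhd> (y' \<otimes> z'))) (t2 c v)"
      unfolding coassociative_tensor
      by (subst tensor_lift_commute[OF clinear_ract]) (simp add: coprod_pair_lact)
    finally show ?thesis .
  qed
  then have "(emb c \<otimes>\<^sub>M 1) \<rhd> tensor_lift (\<lambda>y' z'. tensor_lift (\<lambda>p q. tensor_assoc (t1 p y' \<otimes> q)) (t1 v z')) ?X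
      = tensor_lift (\<lambda>y' z'. tensor_lift (\<lambda>p q. p \<otimes> (\<Delta> q \<rhd> (y' \<otimes> z'))) (t2 c v)) ?X"
    by (subst tensor_lift_commute[OF clinear_lact]) simp
  also have "\<dots> = tensor_lift (\<lambda>p q. p \<otimes> (\<Delta> (q * a) \<rhd> (x \<otimes> y))) (t2 c v)"
    by (subst tensor_lift_swap) (simp only: X)
  also have "\<dots> = tensor_lift (\<lambda>p q. p \<otimes> (\<Delta> q \<rhd> (x \<otimes> y))) (t2 c v \<lhd> (1 \<otimes>\<^sub>M emb a))"
    by (subst tensor_lift_ract) ((intro lin2)+, simp)
  also have "\<dots> = (emb c \<otimes>\<^sub>M 1) \<rhd> tensor_lift (\<lambda>p q. p \<otimes> (\<Delta> q \<rhd> (x \<otimes> y))) (t1 v a)"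
    unfolding t1_t2[symmetric]
    by (subst tensor_lift_lact, (intro lin2)+, subst tensor_lift_commute[OF clinear_lact]) simp
  finally show "(emb c \<otimes>\<^sub>M 1) \<rhd> tensor_lift (\<lambda>y' z'. tensor_lift (\<lambda>p q. tensor_assoc (t1 p y' \<otimes> q)) (t1 v z')) ?X
    = (emb c \<otimes>\<^sub>M 1) \<rhd> tensor_lift (\<lambda>p q. p \<otimes> (\<Delta> q \<rhd> (x \<otimes> y))) (t1 v a)" .
qed

text \<open>Multiplying \<open>(1 \<otimes> v) E = S(v_1) v_2 \<otimes> v_3\<close> by
  \<open>\<Delta>(a)\<close> from the right gives \<open>(1 \<otimes> v)\<Delta>(a) = (S(v_1)
  \<otimes> 1)\<Delta>(v_2 a)\<close>, which is the formula defining \<open>t4\<close>.\<close>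

lemma emb_t4: "emb (t4 v a) = (1 \<otimes>\<^sub>M emb v) * \<Delta> a"
proof (rule tensor_mult_eqI_left)
  fix x y
  let ?X = "\<Delta> a \<rhd> (x \<otimes> y)"
  have "(emb b \<otimes>\<^sub>M 1) \<rhd> (t4 v a * (x \<otimes> y)) = (emb b \<otimes>\<^sub>M 1) \<rhd> ((1 \<otimes>\<^sub>M emb v) \<rhd> ?X)" for b
  proof -
    define G where "G = (\<lambda>(x::'a) (y::'a) (z::'a). (b * (\<sigma> x * y)) \<otimes> z)"
    have G: "ctrilinear G" unfolding G_def by (intro lin2)
    let ?G = "tensor_lift (\<lambda>x w. tensor_lift (G x) w)"
    have linG: "clinear ?G" by (rule clinear_tensor_lift[OF ctrilinear_lift[OF G]])
    have QG: "?G (tensor_lift (\<lambda>p q. tensor_assoc (t1 p y' \<otimes> q)) (t1 v z'))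
        = ((b \<otimes> v) \<lhd> E) * (y' \<otimes> z')" for y' z'
    proof -
      have "tensor_lift (\<lambda>x y. G x y q) (t1 p y') = (b * cs p y') \<otimes> q" for p q
        unfolding G_def cs_eq
        by (subst tensor_lift_commute[where h = "\<lambda>x. (b * x) \<otimes> q"]) (intro lin2, simp)
      then show ?thesis
        by (subst tensor_lift_commute[OF linG]) (simp add: tensor_lift3_assoc[OF G] antipode_E_right)
    qed
    have "?G (tensor_lift (\<lambda>y' z'. tensor_lift (\<lambda>p q. tensor_assoc (t1 p y' \<otimes> q)) (t1 v z')) ?X)
        = tensor_lift (\<lambda>u w. ((b \<otimes> v) \<lhd> E) * (u \<otimes> w)) ?X"
      by (subst tensor_lift_commute[OF linG]) (simp only: QG)
    also have "\<dots> = ((b \<otimes> v) \<lhd> E) * ?X"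
      using tensor_lift_commute[OF clinear_times_right[of "(b \<otimes> v) \<lhd> E"], of "(\<otimes>)" ?X] by simp
    also have "\<dots> = (b \<otimes> v) * (E \<rhd> ?X)" by (simp only: mult_lact)
    also have "E \<rhd> ?X = ?X" using E_coprod[of a] by (metis act_simps(13))
    also have "(b \<otimes> v) * ?X = (emb b \<otimes>\<^sub>M 1) \<rhd> ((1 \<otimes>\<^sub>M emb v) \<rhd> ?X)"
      by (metis act_simps(13) emb_act(1) emb_tensor_pair mtensor_times mult.right_neutral mult.left_neutral)
    finally have 1: "?G (tensor_lift (\<lambda>y' z'. tensor_lift (\<lambda>p q. tensor_assoc (t1 p y' \<otimes> q)) (t1 v z')) ?X)
      = (emb b \<otimes>\<^sub>M 1) \<rhd> ((1 \<otimes>\<^sub>M emb v) \<rhd> ?X)" .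
    have "tensor_lift (G p) z = (emb b \<otimes>\<^sub>M 1) \<rhd> ((emb (\<sigma> p) \<otimes>\<^sub>M 1) \<rhd> z)" for p z
    proof -
      have "tensor_lift (G p) z = (emb (b * \<sigma> p) \<otimes>\<^sub>M 1) \<rhd> z" by (simp add: G_def mtensor_lact mult.assoc)
      also have "emb (b * \<sigma> p) \<otimes>\<^sub>M (1 :: 'a mult) = (emb b \<otimes>\<^sub>M 1) * (emb (\<sigma> p) \<otimes>\<^sub>M 1)"
        by (simp add: mtensor_times emb_mult)
      finally show ?thesis by simp
    qed
    then have "?G (tensor_lift (\<lambda>p q. p \<otimes> (\<Delta> q \<rhd> (x \<otimes> y))) (t1 v a))
        = tensor_lift (\<lambda>p q. (emb b \<otimes>\<^sub>M 1) \<rhd> ((emb (\<sigma> p) \<otimes>\<^sub>M 1) \<rhd> (\<Delta> q \<rhd> (x \<otimes> y)))) (t1 v a)"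
      by (subst tensor_lift_commute[OF linG]) (simp only: tensor_lift3_pair[OF G])
    also have "\<dots> = tensor_lift (\<lambda>p q. (emb b \<otimes>\<^sub>M 1) \<rhd> (t2 (\<sigma> p) q * (x \<otimes> y))) (t1 v a)"
      by (simp only: lact_emb_t2)
    also have "\<dots> = (emb b \<otimes>\<^sub>M 1) \<rhd> (t4 v a * (x \<otimes> y))"
      unfolding t4_def
      by (rule tensor_lift_commute[where h = "\<lambda>z. (emb b \<otimes>\<^sub>M 1) \<rhd> (z * (x \<otimes> y))", symmetric]) (intro lin2)
    finally have 2: "?G (tensor_lift (\<lambda>p q. p \<otimes> (\<Delta> q \<rhd> (x \<otimes> y))) (t1 v a))
      = (emb b \<otimes>\<^sub>M 1) \<rhd> (t4 v a * (x \<otimes> y))" .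
    have "?G (tensor_lift (\<lambda>y' z'. tensor_lift (\<lambda>p q. tensor_assoc (t1 p y' \<otimes> q)) (t1 v z')) ?X)
      = ?G (tensor_lift (\<lambda>p q. p \<otimes> (\<Delta> q \<rhd> (x \<otimes> y))) (t1 v a))" by (simp only: T1_coprod)
    then show ?thesis by (rule trans[OF sym[OF 2] trans[OF sym 1]])
  qed
  then have "t4 v a * (x \<otimes> y) = (1 \<otimes>\<^sub>M emb v) \<rhd> ?X" by (rule cancel_lact_left[OF nd nd id])
  then show "emb (t4 v a) \<rhd> (x \<otimes> y) = ((1 \<otimes>\<^sub>M emb v) * \<Delta> a) \<rhd> (x \<otimes> y)" by simp
qed

text \<open>\<open>E (a \<otimes> S(e)) = \<Sum> a\<^sub>(\<^sub>1\<^sub>) \<otimes> a\<^sub>(\<^sub>2\<^sub>) S(e a\<^sub>(\<^sub>3\<^sub>))\<close>\<close>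

lemma E_\<sigma>: "E \<rhd> (a \<otimes> \<sigma> e) = tensor_lift (\<lambda>p q. t1 p (\<sigma> q)) (t4 e a)"
proof -
  have main: "(c \<otimes> d) * (E \<rhd> (a \<otimes> \<sigma> e)) = (c \<otimes> d) * tensor_lift (\<lambda>p q. t1 p (\<sigma> q)) (t4 e a)" for c d
  proof -
  have Qe: "(1 \<otimes>\<^sub>M (1 \<otimes>\<^sub>M emb e)) \<rhd> Q c d a
      = tensor_lift (\<lambda>p q. tensor_assoc (((c \<otimes> d) \<lhd> \<Delta> p) \<otimes> q)) (t4 e a)"
  proof (rule cancel_ract_third)
    fix f
    have t4: "(1 \<otimes>\<^sub>M emb e) \<rhd> t1 a f = t4 e a \<lhd> (1 \<otimes>\<^sub>M emb f)"
      by (rule emb_eq_iff[OF nd2, THEN iffD1])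
        (simp add: emb_times[symmetric] mult_emb[symmetric] emb_t1 emb_t4 mult.assoc)
    have "((1 \<otimes>\<^sub>M (1 \<otimes>\<^sub>M emb e)) \<rhd> Q c d a) \<lhd> (1 \<otimes>\<^sub>M (1 \<otimes>\<^sub>M emb f))
        = (1 \<otimes>\<^sub>M (1 \<otimes>\<^sub>M emb e)) \<rhd> tensor_lift (\<lambda>p q. tensor_assoc (((c \<otimes> d) \<lhd> \<Delta> p) \<otimes> q)) (t1 a f)"
      by (simp only: lact_ract[OF nd3] Q_ract)
    also have "\<dots> = tensor_lift (\<lambda>p q. tensor_assoc (((c \<otimes> d) \<lhd> \<Delta> p) \<otimes> q)) ((1 \<otimes>\<^sub>M emb e) \<rhd> t1 a f)"
      by (subst tensor_lift_lact, (intro lin2)+, subst tensor_lift_commute[OF clinear_lact])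
        (simp add: assoc_lact one_mtensor_one)
    also have "\<dots> = tensor_lift (\<lambda>p q. tensor_assoc (((c \<otimes> d) \<lhd> \<Delta> p) \<otimes> q)) (t4 e a) \<lhd> (1 \<otimes>\<^sub>M (1 \<otimes>\<^sub>M emb f))"
      unfolding t4
      by (subst tensor_lift_ract, (intro lin2)+, subst tensor_lift_commute[OF clinear_ract])
        (simp add: assoc_ract one_mtensor_one)
    finally show "((1 \<otimes>\<^sub>M (1 \<otimes>\<^sub>M emb e)) \<rhd> Q c d a) \<lhd> (1 \<otimes>\<^sub>M (1 \<otimes>\<^sub>M emb f))
      = tensor_lift (\<lambda>p q. tensor_assoc (((c \<otimes> d) \<lhd> \<Delta> p) \<otimes> q)) (t4 e a) \<lhd> (1 \<otimes>\<^sub>M (1 \<otimes>\<^sub>M emb f))" .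
  qed
  define G where "G = (\<lambda>(x::'a) (y::'a) (z::'a). x \<otimes> (y * \<sigma> z))"
  have G: "ctrilinear G" unfolding G_def by (intro lin2)
  let ?G = "tensor_lift (\<lambda>x w. tensor_lift (G x) w)"
  have linG: "clinear ?G" by (rule clinear_tensor_lift[OF ctrilinear_lift[OF G]])
  have "?G ((1 \<otimes>\<^sub>M (1 \<otimes>\<^sub>M emb e)) \<rhd> Q c d a) = tensor_lift (\<lambda>p q. p \<otimes> (ct d q * \<sigma> e)) (t2 c a)"
  proof -
    have "tensor_lift (G p) ((1 \<otimes>\<^sub>M emb e) \<rhd> t2 d q) = p \<otimes> (ct d q * \<sigma> e)" for p q
      unfolding G_def ct_eq
      by (subst tensor_lift_lact, (intro lin2)+, subst tensor_lift_commute[where h = "\<lambda>x. p \<otimes> (x * \<sigma> e)"])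
       (intro lin2, simp add: \<sigma>_mult mult.assoc)
    then show ?thesis
      unfolding Q_def
      by (simp add: tensor_lift_commute[OF clinear_lact] tensor_lift_commute[OF linG] tensor_lift3_pair[OF G])
  qed
  moreover have "?G (tensor_lift (\<lambda>p q. tensor_assoc (((c \<otimes> d) \<lhd> \<Delta> p) \<otimes> q)) (t4 e a))
      = tensor_lift (\<lambda>p q. (c \<otimes> d) * t1 p (\<sigma> q)) (t4 e a)"
  proof -
    have "tensor_lift (\<lambda>x y. G x y q) z = z \<lhd> (1 \<otimes>\<^sub>M emb (\<sigma> q))" for q z
      by (simp add: G_def mtensor_ract)
    then show ?thesis
      by (subst tensor_lift_commute[OF linG]) (simp only: tensor_lift3_assoc[OF G] ract_emb_t1)
  qed
  ultimately show "(c \<otimes> d) * (E \<rhd> (a \<otimes> \<sigma> e)) = (c \<otimes> d) * tensor_lift (\<lambda>p q. t1 p (\<sigma> q)) (t4 e a)"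
    unfolding antipode_E_left Qe by (simp add: tensor_lift_commute[OF clinear_times_right])
  qed
  have "w * (E \<rhd> (a \<otimes> \<sigma> e)) = w * tensor_lift (\<lambda>p q. t1 p (\<sigma> q)) (t4 e a)" for w
    by (rule tensor_eqI[where z = w]) (intro clinear_times_left main)+
  then show ?thesis by (rule nondeg_right_eqI[OF nd2])
qed

end

lemma ex_tensor_lift_add:
  assumes "cbilinear f" "\<exists>z. x = tensor_lift f z" "\<exists>z. y = tensor_lift f z"
  shows "\<exists>z. x + y = tensor_lift f z"
  using assms(2,3) clinear_add[OF clinear_tensor_lift[OF assms(1)], symmetric] by blast

context regular_weak_multiplier_hopf_algebra
begin

section \<open>Source and target maps\<close>

lemma t4_t1: "(1 \<otimes>\<^sub>M emb e) \<rhd> t1 a f = t4 e a \<lhd> (1 \<otimes>\<^sub>M emb f)"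
  by (rule emb_eq_iff[OF nd2, THEN iffD1])
    (simp add: emb_times[symmetric] mult_emb[symmetric] emb_t1 emb_t4 mult.assoc)

lemma t4_t2: "(emb c \<otimes>\<^sub>M 1) \<rhd> t4 e a = (1 \<otimes>\<^sub>M emb e) \<rhd> t2 c a"
proof (rule emb_eq_iff[OF nd2, THEN iffD1])
  have "(emb c \<otimes>\<^sub>M 1) * ((1 \<otimes>\<^sub>M emb e) * \<Delta> a) = (1 \<otimes>\<^sub>M emb e) * ((emb c \<otimes>\<^sub>M 1) * \<Delta> a)"
    by (simp add: mult.assoc[symmetric] mtensor_times)
  then show "emb ((emb c \<otimes>\<^sub>M 1) \<rhd> t4 e a) = emb ((1 \<otimes>\<^sub>M emb e) \<rhd> t2 c a)"
    by (simp add: mult_emb[symmetric] emb_t4 emb_t2)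
qed

lemma t3_t1: "t1 a d \<lhd> (emb e \<otimes>\<^sub>M 1) = t3 a e \<lhd> (1 \<otimes>\<^sub>M emb d)"
  by (rule emb_eq_iff[OF nd2, THEN iffD1])
    (simp add: emb_times[symmetric] emb_t1 emb_t3 mult.assoc mtensor_times)

lemma t3_t2: "(emb c \<otimes>\<^sub>M 1) \<rhd> t3 a e = t2 c a \<lhd> (emb e \<otimes>\<^sub>M 1)"
  by (rule emb_eq_iff[OF nd2, THEN iffD1])
    (simp add: emb_times[symmetric] mult_emb[symmetric] emb_t2 emb_t3 mult.assoc)

text \<open>\<open>ct\<close> only gives right multiplication by \<open>a_1 S(a_2)\<close>. For left
  multiplication d is written as \<open>S(e)\<close>, because
  \<open>a_1 S(a_2) S(e) = a_1 S(e a_2)\<close> is covered by \<open>t4 e a\<close>.\<close>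

definition \<epsilon>\<^sub>t :: "'a \<Rightarrow> 'a mult"
  where "\<epsilon>\<^sub>t a = Abs_mult (\<lambda>d. tensor_lift (\<lambda>x y. x * \<sigma> y) (t4 (\<sigma>' d) a), \<lambda>d. ct d a)"

definition \<epsilon>\<^sub>s :: "'a \<Rightarrow> 'a mult"
  where "\<epsilon>\<^sub>s a = Abs_mult (cs a, \<lambda>d. tensor_lift (\<lambda>x y. \<sigma> x * y) (t3 a (\<sigma>' d)))"

lemma \<epsilon>\<^sub>t_ract: "d \<lhd> \<epsilon>\<^sub>t a = ct d a"
proof -
  have "is_multiplier (\<lambda>d. tensor_lift (\<lambda>x y. x * \<sigma> y) (t4 (\<sigma>' d) a)) (\<lambda>d. ct d a)"
  proof (rule is_multiplierI[OF nd])
    fix c d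
    define e where "e = \<sigma>' d"
    have "c * tensor_lift (\<lambda>x y. x * \<sigma> y) (t4 e a)
        = tensor_lift (\<lambda>x y. x * \<sigma> y) ((emb c \<otimes>\<^sub>M 1) \<rhd> t4 e a)"
      by (subst tensor_lift_lact, (intro lin2)+, subst tensor_lift_commute[where h = "\<lambda>x. c * x"])
        (intro lin2, simp add: mult.assoc)
    also have "\<dots> = ct c a * \<sigma> e"
      unfolding t4_t2 ct_eq
      by (subst tensor_lift_lact, (intro lin2)+, subst tensor_lift_commute[where h = "\<lambda>x. x * \<sigma> e"])
        (intro lin2, simp add: \<sigma>_mult mult.assoc)
    finally show "c * tensor_lift (\<lambda>x y. x * \<sigma> y) (t4 (\<sigma>' d) a) = ct c a * d"
      by (simp add: e_def)
  qed
  then show ?thesis by (simp add: \<epsilon>\<^sub>t_def Abs_mult_ract)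
qed

lemma
  shows \<epsilon>\<^sub>s_lact: "\<epsilon>\<^sub>s a \<rhd> d = cs a d"
    and \<epsilon>\<^sub>s_ract: "d \<lhd> \<epsilon>\<^sub>s a = tensor_lift (\<lambda>x y. \<sigma> x * y) (t3 a (\<sigma>' d))"
proof -
  have "is_multiplier (cs a) (\<lambda>d. tensor_lift (\<lambda>x y. \<sigma> x * y) (t3 a (\<sigma>' d)))"
  proof (rule is_multiplierI[OF nd])
    fix c d
    define e where "e = \<sigma>' c"
    have "tensor_lift (\<lambda>x y. \<sigma> x * y) (t3 a e) * d
        = tensor_lift (\<lambda>x y. \<sigma> x * y) (t3 a e \<lhd> (1 \<otimes>\<^sub>M emb d))"
      by (subst tensor_lift_ract, (intro lin2)+, subst tensor_lift_commute[where h = "\<lambda>x. x * d"])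
        (intro lin2, simp add: mult.assoc)
    also have "\<dots> = \<sigma> e * cs a d"
      unfolding t3_t1[symmetric] cs_eq
      by (subst tensor_lift_ract, (intro lin2)+, subst tensor_lift_commute[where h = "\<lambda>x. \<sigma> e * x"])
        (intro lin2, simp add: \<sigma>_mult mult.assoc)
    finally show "c * cs a d = tensor_lift (\<lambda>x y. \<sigma> x * y) (t3 a (\<sigma>' c)) * d"
      by (simp add: e_def)
  qed
  then show "\<epsilon>\<^sub>s a \<rhd> d = cs a d" "d \<lhd> \<epsilon>\<^sub>s a = tensor_lift (\<lambda>x y. \<sigma> x * y) (t3 a (\<sigma>' d))"
    by (simp_all add: \<epsilon>\<^sub>s_def Abs_mult_lact Abs_mult_ract)
qed

lemma target_map_eq: "target_map \<Delta> S a = \<epsilon>\<^sub>t a"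
  unfolding target_map_def
proof (rule the_equality)
  show "\<forall>d. d \<lhd> \<epsilon>\<^sub>t a = ct d a" by (simp add: \<epsilon>\<^sub>t_ract)
  fix m assume "\<forall>d. d \<lhd> m = ct d a"
  then show "m = \<epsilon>\<^sub>t a" by (intro mult_eqI_right[OF nd]) (simp add: \<epsilon>\<^sub>t_ract)
qed

lemma clinear_\<epsilon>\<^sub>t: "clinear \<epsilon>\<^sub>t"
  by (rule clinearI; rule mult_eqI_right[OF nd])
    (simp_all add: \<epsilon>\<^sub>t_ract clinear_add[OF clin_ct(2)[OF clinear_id]] clinear_scale[OF clin_ct(2)[OF clinear_id]])

lemmas clin_\<epsilon>\<^sub>t = clinear_compose[OF clinear_\<epsilon>\<^sub>t]

lemma clinear_\<epsilon>\<^sub>s: "clinear \<epsilon>\<^sub>s"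
  by (rule clinearI; rule mult_eqI_left[OF nd])
    (simp_all add: \<epsilon>\<^sub>s_lact clinear_add[OF clin_cs(1)[OF clinear_id]] clinear_scale[OF clin_cs(1)[OF clinear_id]])

lemmas clin_\<epsilon>\<^sub>s = clinear_compose[OF clinear_\<epsilon>\<^sub>s]

lemmas lin3 = lin2 clin_\<epsilon>\<^sub>t clin_\<epsilon>\<^sub>s

lemma lact_pair: "(m \<otimes>\<^sub>M n) \<rhd> tensor_lift (\<lambda>p q. f p q \<otimes> g p q) z
    = tensor_lift (\<lambda>p q. (m \<rhd> f p q) \<otimes> (n \<rhd> g p q)) z"
  by (subst tensor_lift_commute[OF clinear_lact]) simp

lemma ract_pair: "tensor_lift (\<lambda>p q. f p q \<otimes> g p q) z \<lhd> (m \<otimes>\<^sub>M n)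
    = tensor_lift (\<lambda>p q. (f p q \<lhd> m) \<otimes> (g p q \<lhd> n)) z"
  by (subst tensor_lift_commute[OF clinear_ract]) simp

lemma pair_times: "(a \<otimes> b) * t = (emb a \<otimes>\<^sub>M 1) \<rhd> ((1 \<otimes>\<^sub>M emb b) \<rhd> t)"
  "(a \<otimes> b) * t = (1 \<otimes>\<^sub>M emb b) \<rhd> ((emb a \<otimes>\<^sub>M 1) \<rhd> t)"
  by (metis act_simps(13) emb_act(1) emb_tensor_pair mtensor_times mult.right_neutral mult.left_neutral)+

lemma times_pair: "t * (a \<otimes> b) = (t \<lhd> (emb a \<otimes>\<^sub>M 1)) \<lhd> (1 \<otimes>\<^sub>M emb b)"
  "t * (a \<otimes> b) = (t \<lhd> (1 \<otimes>\<^sub>M emb b)) \<lhd> (emb a \<otimes>\<^sub>M 1)"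
  by (metis act_simps(14) emb_act(2) emb_tensor_pair mtensor_times mult.right_neutral mult.left_neutral)+

text \<open>Here and in the next three lemmas an outer factor is cancelled from the covered antipode
  formulas. What remains is \<open>E (a \<otimes> 1) = a_1 \<otimes> \<epsilon>\<^sub>t(a_2)\<close>
  and \<open>(1 \<otimes> b) E = \<epsilon>\<^sub>s(b_1) \<otimes> b_2\<close>, each in two
  coverings.\<close>

lemma E_ract_left: "((c \<otimes> d) \<lhd> E) \<lhd> (emb a \<otimes>\<^sub>M 1) = tensor_lift (\<lambda>p q. p \<otimes> (d \<lhd> \<epsilon>\<^sub>t q)) (t2 c a)"
proof (rule cancel_ract_right[OF nd nd id])
  fix e
  show "(((c \<otimes> d) \<lhd> E) \<lhd> (emb a \<otimes>\<^sub>M 1)) \<lhd> (1 \<otimes>\<^sub>M emb e)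
      = tensor_lift (\<lambda>p q. p \<otimes> (d \<lhd> \<epsilon>\<^sub>t q)) (t2 c a) \<lhd> (1 \<otimes>\<^sub>M emb e)"
    unfolding times_pair[symmetric] mult_lact[symmetric] antipode_E_left ract_pair
    by (simp add: \<epsilon>\<^sub>t_ract)
qed

lemma E_lact_left: "(emb c \<otimes>\<^sub>M 1) \<rhd> (E \<rhd> (a \<otimes> b)) = tensor_lift (\<lambda>p q. p \<otimes> (\<epsilon>\<^sub>t q \<rhd> b)) (t2 c a)"
proof (rule cancel_lact_right[OF nd nd id])
  fix d
  show "(1 \<otimes>\<^sub>M emb d) \<rhd> ((emb c \<otimes>\<^sub>M 1) \<rhd> (E \<rhd> (a \<otimes> b)))
      = (1 \<otimes>\<^sub>M emb d) \<rhd> tensor_lift (\<lambda>p q. p \<otimes> (\<epsilon>\<^sub>t q \<rhd> b)) (t2 c a)"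
    unfolding pair_times[symmetric] antipode_E_left lact_pair
    by (simp add: \<epsilon>\<^sub>t_ract mult_lact)
qed

lemma E_lact_right: "(1 \<otimes>\<^sub>M emb b) \<rhd> (E \<rhd> (c \<otimes> d)) = tensor_lift (\<lambda>p q. (\<epsilon>\<^sub>s p \<rhd> c) \<otimes> q) (t1 b d)"
proof (rule cancel_lact_left[OF nd nd id])
  fix a
  show "(emb a \<otimes>\<^sub>M 1) \<rhd> ((1 \<otimes>\<^sub>M emb b) \<rhd> (E \<rhd> (c \<otimes> d)))
      = (emb a \<otimes>\<^sub>M 1) \<rhd> tensor_lift (\<lambda>p q. (\<epsilon>\<^sub>s p \<rhd> c) \<otimes> q) (t1 b d)"
    unfolding pair_times[symmetric] mult_lact antipode_E_right lact_pair
    by (simp add: \<epsilon>\<^sub>s_lact)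
qed

lemma E_ract_right: "((a \<otimes> b) \<lhd> E) \<lhd> (1 \<otimes>\<^sub>M emb d) = tensor_lift (\<lambda>p q. (a \<lhd> \<epsilon>\<^sub>s p) \<otimes> q) (t1 b d)"
proof (rule cancel_ract_left[OF nd nd id])
  fix c
  show "(((a \<otimes> b) \<lhd> E) \<lhd> (1 \<otimes>\<^sub>M emb d)) \<lhd> (emb c \<otimes>\<^sub>M 1)
      = tensor_lift (\<lambda>p q. (a \<lhd> \<epsilon>\<^sub>s p) \<otimes> q) (t1 b d) \<lhd> (emb c \<otimes>\<^sub>M 1)"
    unfolding times_pair[symmetric] antipode_E_right ract_pair
    by (simp add: \<epsilon>\<^sub>s_lact mult_lact[symmetric])
qed

lemma E_ract_t4: "(c \<otimes> (e * a)) \<lhd> E = tensor_lift (\<lambda>p q. (c \<lhd> \<epsilon>\<^sub>s p) \<otimes> q) (t4 e a)"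
proof (rule cancel_ract_right[OF nd nd id])
  fix d
  have "((c \<otimes> (e * a)) \<lhd> E) \<lhd> (1 \<otimes>\<^sub>M emb d) = (1 \<otimes>\<^sub>M emb e) \<rhd> (((c \<otimes> a) \<lhd> E) \<lhd> (1 \<otimes>\<^sub>M emb d))"
    by (simp add: lact_ract[OF nd2, symmetric])
  also have "\<dots> = tensor_lift (\<lambda>p q. (c \<lhd> \<epsilon>\<^sub>s p) \<otimes> q) ((1 \<otimes>\<^sub>M emb e) \<rhd> t1 a d)"
    unfolding E_ract_right lact_pair by (subst tensor_lift_lact) ((intro lin3)+, simp)
  also have "\<dots> = tensor_lift (\<lambda>p q. (c \<lhd> \<epsilon>\<^sub>s p) \<otimes> q) (t4 e a) \<lhd> (1 \<otimes>\<^sub>M emb d)"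
    unfolding t4_t1 ract_pair by (subst tensor_lift_ract) ((intro lin3)+, simp)
  finally show "((c \<otimes> (e * a)) \<lhd> E) \<lhd> (1 \<otimes>\<^sub>M emb d)
    = tensor_lift (\<lambda>p q. (c \<lhd> \<epsilon>\<^sub>s p) \<otimes> q) (t4 e a) \<lhd> (1 \<otimes>\<^sub>M emb d)" .
qed

subsection \<open>Extensions of \<open>\<Delta>\<close> and \<open>id \<otimes> \<Delta>\<close>\<close>

text \<open>\<open>\<Delta>(A)(A \<otimes> A)\<close> fills \<open>E (A \<otimes> A)\<close>: for a
  product \<open>s u\<close> the factor \<open>E s\<close> lies in the range of \<open>T1\<close>,
  and u absorbs the covering element. With its mirror image this supplies the range conditions for
  extending \<open>\<Delta>\<close>.\<close>

lemma coprod_range_left: "\<exists>z. E \<rhd> t = tensor_lift (\<lambda>a t'. \<Delta> a \<rhd> t') z"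
proof -
  let ?f = "\<lambda>a (t' :: ('a, 'a) tensor). \<Delta> a \<rhd> t'"
  have bl: "cbilinear ?f" by (intro lin3)
  show ?thesis
    using id2
  proof (induction t rule: idem_induct)
    case (mult s u)
    have "E \<rhd> s \<in> range (T1 \<Delta>)" unfolding range_T1 by blast
    then obtain w where "E \<rhd> s = T1 \<Delta> w" by blast
    moreover have "\<exists>z. T1 \<Delta> w * u = tensor_lift ?f z" for w
    proof (induction w rule: tensor_induct)
      case (pair a b)
      have "t1 a b * u = emb (t1 a b) \<rhd> u" by simp
      also have "\<dots> = \<Delta> a \<rhd> ((1 \<otimes>\<^sub>M emb b) \<rhd> u)" by (simp only: emb_t1 act_simps)
      finally show ?case using tensor_lift_pair[OF bl] by metis
    next
      case (add s t) then show ?case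
        unfolding clinear_add[OF clin_T1[OF clinear_id]] distrib_right by (rule ex_tensor_lift_add[OF bl])
    qed
    ultimately show ?case by (metis lact_mult)
  next
    case (add x y) then show ?case
      unfolding clinear_add[OF clinear_lact] by (rule ex_tensor_lift_add[OF bl])
  qed
qed

lemma coprod_range_right: "\<exists>z. t \<lhd> E = tensor_lift (\<lambda>a t'. t' \<lhd> \<Delta> a) z"
proof -
  let ?f = "\<lambda>a (t' :: ('a, 'a) tensor). t' \<lhd> \<Delta> a"
  have bl: "cbilinear ?f" by (intro lin3)
  show ?thesis
    using id2
  proof (induction t rule: idem_induct)
    case (mult u s)
    have "s \<lhd> E \<in> range (T2 \<Delta>)" unfolding range_T2 by blast
    then obtain w where "s \<lhd> E = T2 \<Delta> w" by blast
    moreover have "\<exists>z. u * T2 \<Delta> w = tensor_lift ?f z" for w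
    proof (induction w rule: tensor_induct)
      case (pair a b)
      have "u * t2 a b = u \<lhd> emb (t2 a b)" by simp
      also have "\<dots> = (u \<lhd> (emb a \<otimes>\<^sub>M 1)) \<lhd> \<Delta> b" by (simp only: emb_t2 act_simps)
      finally show ?case using tensor_lift_pair[OF bl] by metis
    next
      case (add s t) then show ?case
        unfolding clinear_add[OF clin_T2[OF clinear_id]] distrib_left by (rule ex_tensor_lift_add[OF bl])
    qed
    ultimately show ?case by (metis ract_mult)
  next
    case (add x y) then show ?case
      unfolding clinear_add[OF clinear_ract] by (rule ex_tensor_lift_add[OF bl])
  qed
qed

lemmas coprod_ext = extend_hom_left[OF nd2 coprod_hom E_coprod coprod_E coprod_range_left coprod_range_right]
  extend_hom_right[OF nd2 coprod_hom E_coprod coprod_E coprod_range_left coprod_range_right]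
  alg_hom_extend_hom[OF nd2 coprod_hom E_coprod coprod_E coprod_range_left coprod_range_right]
  extend_hom_one[OF nd2 coprod_hom E_coprod coprod_E coprod_range_left coprod_range_right]

lemma cancel_coprod_right:
  assumes "\<And>a. m * \<Delta> a = n * \<Delta> a"
  shows "m * E = n * E"
proof (rule mult_eqI_left[OF nd2])
  fix t
  obtain z where z: "E \<rhd> t = tensor_lift (\<lambda>a t'. \<Delta> a \<rhd> t') z" using coprod_range_left by blast
  have "m \<rhd> (\<Delta> a \<rhd> t') = n \<rhd> (\<Delta> a \<rhd> t')" for a t' by (metis act_simps(13) assms)
  then show "(m * E) \<rhd> t = (n * E) \<rhd> t" by (simp add: z tensor_lift_commute[OF clinear_lact])
qed

lemma cancel_coprod_left:
  assumes "\<And>a. \<Delta> a * m = \<Delta> a * n"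
  shows "E * m = E * n"
proof (rule mult_eqI_right[OF nd2])
  fix t
  obtain z where z: "t \<lhd> E = tensor_lift (\<lambda>a t'. t' \<lhd> \<Delta> a) z" using coprod_range_right by blast
  have "(t' \<lhd> \<Delta> a) \<lhd> m = (t' \<lhd> \<Delta> a) \<lhd> n" for a t' by (metis act_simps(14) assms)
  then show "t \<lhd> (E * m) = t \<lhd> (E * n)" by (simp add: z tensor_lift_commute[OF clinear_ract])
qed

lemma id_coprod_pair: "id_coprod \<Delta> (a \<otimes> b) = emb a \<otimes>\<^sub>M \<Delta> b"
  unfolding id_coprod_def by (rule tensor_lift_pair) (intro lin3)

lemma clin_id_coprod: "clinear f \<Longrightarrow> clinear (\<lambda>x. id_coprod \<Delta> (f x))"
  unfolding id_coprod_def by (intro lin3)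

text \<open>The axiom on E speaks of the extension of \<open>id \<otimes> \<Delta>\<close> to
  multipliers. Multiplied by a value of \<open>id_coprod\<close> it becomes an identity between such
  values, which absorb the factor \<open>1 \<otimes> E\<close>. Most of the proof verifies that the
  extension exists.\<close>

lemma id_coprod_E: "id_coprod \<Delta> (E \<rhd> z) = mult_assoc (E \<otimes>\<^sub>M 1) * id_coprod \<Delta> z"
proof -
  have hom: "alg_hom (id_coprod \<Delta>)"
    unfolding alg_hom_def
  proof (intro conjI allI)
    show lin: "clinear (id_coprod \<Delta>)" by (rule clin_id_coprod[OF clinear_id])
    show "id_coprod \<Delta> (s * t) = id_coprod \<Delta> s * id_coprod \<Delta> t" for s t
    proof (induction s rule: tensor_induct)
      case (pair a b) show ?case
        by (induction t rule: tensor_induct)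
          (simp_all add: id_coprod_pair mtensor_times emb_mult coprod_mult distrib_left clinear_add[OF lin])
    qed (simp add: distrib_right clinear_add[OF lin])
  qed
  have e1: "(1 \<otimes>\<^sub>M E) * id_coprod \<Delta> z = id_coprod \<Delta> z"
    and e2: "id_coprod \<Delta> z * (1 \<otimes>\<^sub>M E) = id_coprod \<Delta> z" for z
    by (rule tensor_eqI[where z = z], (intro clin clin_id_coprod)+,
        simp add: id_coprod_pair mtensor_times E_coprod coprod_E)+
  have bl: "cbilinear (\<lambda>a b'. id_coprod \<Delta> a \<rhd> b')" "cbilinear (\<lambda>a b'. b' \<lhd> id_coprod \<Delta> a)"
    by (intro clin clin_id_coprod)+
  have r1: "\<exists>z. (1 \<otimes>\<^sub>M E) \<rhd> w = tensor_lift (\<lambda>a b'. id_coprod \<Delta> a \<rhd> b') z" for w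
  proof (induction w rule: tensor_induct)
    case (pair x t)
    show ?case
      using id
    proof (induction x rule: idem_induct)
      case (mult x y)
      obtain z where z: "E \<rhd> t = tensor_lift (\<lambda>a t'. \<Delta> a \<rhd> t') z" using coprod_range_left by blast
      have "(1 \<otimes>\<^sub>M E) \<rhd> ((x * y) \<otimes> t) = tensor_lift (\<lambda>a t'. (x * y) \<otimes> (\<Delta> a \<rhd> t')) z"
        by (simp add: z tensor_lift_commute[OF clinear_pair_right[OF clinear_id]])
      also have "\<dots> = tensor_lift (\<lambda>a b'. id_coprod \<Delta> a \<rhd> b') (tensor_lift (\<lambda>a t'. (x \<otimes> a) \<otimes> (y \<otimes> t')) z)"
        by (simp add: tensor_lift_compose bl id_coprod_pair)
      finally show ?case by blast
    next
      case (add x y) then show ?case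
        unfolding tensor_pair_simps(1) clinear_add[OF clinear_lact] by (rule ex_tensor_lift_add[OF bl(1)])
    qed
  next
    case (add s t) then show ?case
      unfolding clinear_add[OF clinear_lact] by (rule ex_tensor_lift_add[OF bl(1)])
  qed
  have r2: "\<exists>z. w \<lhd> (1 \<otimes>\<^sub>M E) = tensor_lift (\<lambda>a b'. b' \<lhd> id_coprod \<Delta> a) z" for w
  proof (induction w rule: tensor_induct)
    case (pair x t)
    show ?case
      using id
    proof (induction x rule: idem_induct)
      case (mult x y)
      obtain z where z: "t \<lhd> E = tensor_lift (\<lambda>a t'. t' \<lhd> \<Delta> a) z" using coprod_range_right by blast
      have "((x * y) \<otimes> t) \<lhd> (1 \<otimes>\<^sub>M E) = tensor_lift (\<lambda>a t'. (x * y) \<otimes> (t' \<lhd> \<Delta> a)) z"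
        by (simp add: z tensor_lift_commute[OF clinear_pair_right[OF clinear_id]])
      also have "\<dots> = tensor_lift (\<lambda>a b'. b' \<lhd> id_coprod \<Delta> a) (tensor_lift (\<lambda>a t'. (y \<otimes> a) \<otimes> (x \<otimes> t')) z)"
        by (simp add: tensor_lift_compose bl id_coprod_pair)
      finally show ?case by blast
    next
      case (add x y) then show ?case
        unfolding tensor_pair_simps(1) clinear_add[OF clinear_ract] by (rule ex_tensor_lift_add[OF bl(2)])
    qed
  next
    case (add s t) then show ?case
      unfolding clinear_add[OF clinear_ract] by (rule ex_tensor_lift_add[OF bl(2)])
  qed
  have "id_coprod \<Delta> (E \<rhd> z) = extend_hom (id_coprod \<Delta>) (1 \<otimes>\<^sub>M E) E * id_coprod \<Delta> z"
    by (rule extend_hom_left[OF nd3 hom e1 e2 r1 r2, symmetric])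
  then show ?thesis by (simp add: id_coprod_E_left mult.assoc e1)
qed

lemma E12_pair: "mult_assoc (E \<otimes>\<^sub>M 1) \<rhd> (y \<otimes> w) = tensor_lift (\<lambda>e f. tensor_assoc ((E \<rhd> (y \<otimes> e)) \<otimes> f)) w"
proof (rule tensor_eqI[where z = w])
  show "mult_assoc (E \<otimes>\<^sub>M 1) \<rhd> (y \<otimes> (a \<otimes> b))
      = tensor_lift (\<lambda>e f. tensor_assoc ((E \<rhd> (y \<otimes> e)) \<otimes> f)) (a \<otimes> b)" for a b
  proof -
    have "mult_assoc (E \<otimes>\<^sub>M 1) \<rhd> tensor_assoc ((y \<otimes> a) \<otimes> b)
      = tensor_lift (\<lambda>e f. tensor_assoc ((E \<rhd> (y \<otimes> e)) \<otimes> f)) (a \<otimes> b)"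
      unfolding mult_assoc_act by (subst tensor_lift_pair) ((intro clin)+, simp)
    then show ?thesis by simp
  qed
qed (intro clin)+

lemma id_coprod_E_act:
  "tensor_lift (\<lambda>p q. (p * x) \<otimes> (\<Delta> q \<rhd> t)) (E \<rhd> (a \<otimes> b))
    = tensor_lift (\<lambda>e f. tensor_assoc ((E \<rhd> ((a * x) \<otimes> e)) \<otimes> f)) (\<Delta> b \<rhd> t)"
proof -
  have "id_coprod \<Delta> z \<rhd> (x \<otimes> t) = tensor_lift (\<lambda>p q. (p * x) \<otimes> (\<Delta> q \<rhd> t)) z" for z
    by (rule tensor_eqI[where z = z]) ((intro lin3 clin_id_coprod)+, subst tensor_lift_pair,
      (intro lin3)+, simp add: id_coprod_pair)
  then have "tensor_lift (\<lambda>p q. (p * x) \<otimes> (\<Delta> q \<rhd> t)) (E \<rhd> (a \<otimes> b))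
      = id_coprod \<Delta> (E \<rhd> (a \<otimes> b)) \<rhd> (x \<otimes> t)" by simp
  also have "\<dots> = mult_assoc (E \<otimes>\<^sub>M 1) \<rhd> ((a * x) \<otimes> (\<Delta> b \<rhd> t))"
    by (simp add: id_coprod_E id_coprod_pair)
  finally show ?thesis by (simp only: E12_pair)
qed

subsection \<open>Source and target algebras\<close>

text \<open>Membership in the target and source algebras expressed on A itself, without the
  extension of \<open>\<Delta>\<close>; the equivalence is \<open>target_algebra_iff\<close> and
  \<open>source_algebra_iff\<close>.\<close>

definition At :: "'a mult \<Rightarrow> bool" where "At x \<longleftrightarrow> (\<forall>b. \<Delta> (x \<rhd> b) = (x \<otimes>\<^sub>M 1) * \<Delta> b)"
definition As :: "'a mult \<Rightarrow> bool" where "As y \<longleftrightarrow> (\<forall>b. \<Delta> (b \<lhd> y) = \<Delta> b * (1 \<otimes>\<^sub>M y))"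

lemma target_algebra_iff: "x \<in> target_algebra \<Delta> E \<longleftrightarrow> At x"
proof
  assume "x \<in> target_algebra \<Delta> E"
  then have "extend_hom \<Delta> E x = (x \<otimes>\<^sub>M 1) * E" by (simp add: target_algebra_def)
  then show "At x" unfolding At_def by (metis coprod_ext(1) mult.assoc E_coprod)
next
  assume x: "At x"
  have "extend_hom \<Delta> E x * E = (x \<otimes>\<^sub>M 1) * E"
    by (rule cancel_coprod_right) (use x in \<open>simp add: coprod_ext At_def\<close>)
  moreover have "extend_hom \<Delta> E x * E = extend_hom \<Delta> E x"
    using coprod_ext(3) unfolding alg_hom_def by (metis coprod_ext(4) mult.right_neutral)
  ultimately show "x \<in> target_algebra \<Delta> E" by (simp add: target_algebra_def)
qed

lemma source_algebra_iff: "y \<in> source_algebra \<Delta> E \<longleftrightarrow> As y"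
proof
  assume "y \<in> source_algebra \<Delta> E"
  then have "extend_hom \<Delta> E y = E * (1 \<otimes>\<^sub>M y)" by (simp add: source_algebra_def)
  then show "As y" unfolding As_def by (metis coprod_ext(2) mult.assoc coprod_E)
next
  assume y: "As y"
  have "E * extend_hom \<Delta> E y = E * (1 \<otimes>\<^sub>M y)"
    by (rule cancel_coprod_left) (use y in \<open>simp add: coprod_ext As_def\<close>)
  moreover have "E * extend_hom \<Delta> E y = extend_hom \<Delta> E y"
    using coprod_ext(3) unfolding alg_hom_def by (metis coprod_ext(4) mult.left_neutral)
  ultimately show "y \<in> source_algebra \<Delta> E" by (simp add: source_algebra_def)
qed

lemma csubspace_As: "csubspace {x. As x}"
  unfolding As_def
  by (rule cvec.subspaceI)
    (simp_all add: clinearD[OF clinear_coprod] clinearD[OF clinear_mtensor_right[OF clinear_id]] distrib_left scaleC_mult_right)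

text \<open>In the covered formula for \<open>E (a \<otimes> b)\<close> the elements c and a enter
  only through \<open>(c \<otimes> 1)\<Delta>(a)\<close>, and there x may be moved from a to
  c.\<close>

lemma At_comm:
  assumes "At x"
  shows "E * (x \<otimes>\<^sub>M 1) = (x \<otimes>\<^sub>M 1) * E"
proof (rule tensor_mult_eqI_left)
  fix a b
  have t2: "t2 c (x \<rhd> a) = t2 (c \<lhd> x) a" for c
    by (rule emb_eq_iff[OF nd2, THEN iffD1])
      (use assms in \<open>simp add: emb_t2 At_def mult.assoc[symmetric] mtensor_times emb_times\<close>)
  have "w * ((E * (x \<otimes>\<^sub>M 1)) \<rhd> (a \<otimes> b)) = w * (((x \<otimes>\<^sub>M 1) * E) \<rhd> (a \<otimes> b))" for w
  proof (rule tensor_eqI[where z = w])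
    show "(c \<otimes> d) * ((E * (x \<otimes>\<^sub>M 1)) \<rhd> (a \<otimes> b)) = (c \<otimes> d) * (((x \<otimes>\<^sub>M 1) * E) \<rhd> (a \<otimes> b))" for c d
      unfolding act_simps mtensor_act antipode_E_left t2
      by (simp add: mult_lact[of _ "x \<otimes>\<^sub>M 1"] antipode_E_left)
  qed (intro clinear_times_left)+
  then show "(E * (x \<otimes>\<^sub>M 1)) \<rhd> (a \<otimes> b) = ((x \<otimes>\<^sub>M 1) * E) \<rhd> (a \<otimes> b)"
    by (rule nondeg_right_eqI[OF nd2])
qed

lemma As_comm:
  assumes "As y"
  shows "E * (1 \<otimes>\<^sub>M y) = (1 \<otimes>\<^sub>M y) * E"
proof (rule tensor_mult_eqI_right)
  fix a b
  have t1: "t1 (b \<lhd> y) d = t1 b (y \<rhd> d)" for d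
    by (rule emb_eq_iff[OF nd2, THEN iffD1])
      (use assms in \<open>simp add: emb_t1 As_def mult.assoc mtensor_times mult_emb\<close>)
  have "((a \<otimes> b) \<lhd> (E * (1 \<otimes>\<^sub>M y))) * w = ((a \<otimes> b) \<lhd> ((1 \<otimes>\<^sub>M y) * E)) * w" for w
  proof (rule tensor_eqI[where z = w])
    show "((a \<otimes> b) \<lhd> (E * (1 \<otimes>\<^sub>M y))) * (c \<otimes> d) = ((a \<otimes> b) \<lhd> ((1 \<otimes>\<^sub>M y) * E)) * (c \<otimes> d)" for c d
      unfolding act_simps mtensor_act antipode_E_right t1
      by (simp add: mult_lact[of _ "1 \<otimes>\<^sub>M y", symmetric] antipode_E_right)
  qed (intro clinear_times_right)+
  then show "(a \<otimes> b) \<lhd> (E * (1 \<otimes>\<^sub>M y)) = (a \<otimes> b) \<lhd> ((1 \<otimes>\<^sub>M y) * E)"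
    by (rule nondeg_left_eqI[OF nd2])
qed

lemma At_right:
  assumes x: "At x"
  shows "\<Delta> (b \<lhd> x) = \<Delta> b * (x \<otimes>\<^sub>M 1)"
proof -
  have "\<Delta> (b \<lhd> x) * E = (\<Delta> b * (x \<otimes>\<^sub>M 1)) * E"
  proof (rule cancel_coprod_right)
    show "\<Delta> (b \<lhd> x) * \<Delta> a = (\<Delta> b * (x \<otimes>\<^sub>M 1)) * \<Delta> a" for a
      using x by (simp add: coprod_mult[symmetric] mult_lact[symmetric]) (simp add: At_def coprod_mult mult.assoc)
  qed
  then show ?thesis by (metis At_comm[OF x] coprod_E mult.assoc)
qed

lemma As_left:
  assumes y: "As y"
  shows "\<Delta> (y \<rhd> b) = (1 \<otimes>\<^sub>M y) * \<Delta> b"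
proof -
  have "E * \<Delta> (y \<rhd> b) = E * ((1 \<otimes>\<^sub>M y) * \<Delta> b)"
  proof (rule cancel_coprod_left)
    show "\<Delta> a * \<Delta> (y \<rhd> b) = \<Delta> a * ((1 \<otimes>\<^sub>M y) * \<Delta> b)" for a
      using y by (simp add: coprod_mult[symmetric] mult_lact) (simp add: As_def coprod_mult mult.assoc)
  qed
  then show ?thesis by (metis As_comm[OF y] E_coprod mult.assoc)
qed

text \<open>By \<open>(id \<otimes> \<Delta>) E = (E \<otimes> 1)(1 \<otimes> E)\<close> the second
  leg of E satisfies the relation defining the target algebra, and that leg is made of the
  \<open>\<epsilon>\<^sub>t(a_2)\<close>. Fullness then reaches every q.\<close>

lemma At_\<epsilon>\<^sub>t: "At (\<epsilon>\<^sub>t q)"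
  unfolding At_def
proof (intro allI mult_eqI_left[OF nd2])
  fix b t
  have "\<Delta> (\<epsilon>\<^sub>t q \<rhd> b) \<rhd> t = (\<epsilon>\<^sub>t q \<otimes>\<^sub>M 1) \<rhd> (\<Delta> b \<rhd> t)"
  proof (rule right_leg_eqI[OF full_right, where y = q])
    fix a c
    show "tensor_lift (\<lambda>p q. p \<otimes> (\<Delta> (\<epsilon>\<^sub>t q \<rhd> b) \<rhd> t)) (t2 c a)
        = tensor_lift (\<lambda>p q. p \<otimes> ((\<epsilon>\<^sub>t q \<otimes>\<^sub>M 1) \<rhd> (\<Delta> b \<rhd> t))) (t2 c a)"
    proof (rule cancel_ract_left[OF nd nd2 id])
      \<comment> \<open>The factor x supplies the vector \<open>x \<otimes> t\<close> on which the
        multiplier \<open>id_coprod \<Delta> (E \<rhd> (a \<otimes> b))\<close> is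
        evaluated.\<close>
      fix x
      have "tensor_lift (\<lambda>p q. p \<otimes> (\<Delta> (\<epsilon>\<^sub>t q \<rhd> b) \<rhd> t)) (t2 c a) \<lhd> (emb x \<otimes>\<^sub>M 1)
          = tensor_lift (\<lambda>p q. (p * x) \<otimes> (\<Delta> q \<rhd> t)) ((emb c \<otimes>\<^sub>M 1) \<rhd> (E \<rhd> (a \<otimes> b)))"
        unfolding ract_pair E_lact_left
        by (subst tensor_lift_compose, (intro lin3)+, subst tensor_lift_pair, (intro lin3)+, simp)
      also have "\<dots> = (emb c \<otimes>\<^sub>M 1) \<rhd> tensor_lift (\<lambda>p q. (p * x) \<otimes> (\<Delta> q \<rhd> t)) (E \<rhd> (a \<otimes> b))"
        by (subst tensor_lift_lact, (intro lin3)+, simp add: lact_pair mult.assoc)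
      also have "\<dots> = (emb c \<otimes>\<^sub>M 1) \<rhd> tensor_lift (\<lambda>e f. tensor_assoc ((E \<rhd> ((a * x) \<otimes> e)) \<otimes> f)) (\<Delta> b \<rhd> t)"
        by (simp only: id_coprod_E_act)
      also have "\<dots> = tensor_lift (\<lambda>e f. tensor_lift (\<lambda>p q. (p * x) \<otimes> ((\<epsilon>\<^sub>t q \<rhd> e) \<otimes> f)) (t2 c a)) (\<Delta> b \<rhd> t)"
      proof -
        have "(emb c \<otimes>\<^sub>M 1) \<rhd> tensor_assoc ((E \<rhd> ((a * x) \<otimes> e)) \<otimes> f)
            = tensor_lift (\<lambda>p q. (p * x) \<otimes> ((\<epsilon>\<^sub>t q \<rhd> e) \<otimes> f)) (t2 c a)" for e and f :: 'a
        proof -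
          have "(emb c \<otimes>\<^sub>M 1) \<rhd> (E \<rhd> ((a * x) \<otimes> e)) = ((emb c \<otimes>\<^sub>M 1) \<rhd> (E \<rhd> (a \<otimes> e))) \<lhd> (emb x \<otimes>\<^sub>M 1)"
            by (simp add: lact_ract[OF nd2])
          also have "\<dots> = tensor_lift (\<lambda>p q. (p * x) \<otimes> (\<epsilon>\<^sub>t q \<rhd> e)) (t2 c a)"
            by (simp add: E_lact_left ract_pair)
          finally have "(emb c \<otimes>\<^sub>M (1 \<otimes>\<^sub>M 1)) \<rhd> tensor_assoc ((E \<rhd> ((a * x) \<otimes> e)) \<otimes> f)
            = tensor_assoc (tensor_lift (\<lambda>p q. (p * x) \<otimes> (\<epsilon>\<^sub>t q \<rhd> e)) (t2 c a) \<otimes> f)"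
            by (simp add: assoc_lact)
          also have "\<dots> = tensor_lift (\<lambda>p q. (p * x) \<otimes> ((\<epsilon>\<^sub>t q \<rhd> e) \<otimes> f)) (t2 c a)"
            by (subst tensor_lift_commute[where h = "\<lambda>z. tensor_assoc (z \<otimes> f)"]) (intro lin3, simp)
          finally show ?thesis by (simp add: one_mtensor_one)
        qed
        then show ?thesis by (simp only: tensor_lift_commute[OF clinear_lact])
      qed
      also have "\<dots> = tensor_lift (\<lambda>p q. p \<otimes> ((\<epsilon>\<^sub>t q \<otimes>\<^sub>M 1) \<rhd> (\<Delta> b \<rhd> t))) (t2 c a) \<lhd> (emb x \<otimes>\<^sub>M 1)"
        unfolding ract_pair
        by (subst tensor_lift_swap)
          (simp add: mtensor_lact tensor_lift_commute[OF clinear_pair_right[OF clinear_id]])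
      finally show "tensor_lift (\<lambda>p q. p \<otimes> (\<Delta> (\<epsilon>\<^sub>t q \<rhd> b) \<rhd> t)) (t2 c a) \<lhd> (emb x \<otimes>\<^sub>M 1)
        = tensor_lift (\<lambda>p q. p \<otimes> ((\<epsilon>\<^sub>t q \<otimes>\<^sub>M 1) \<rhd> (\<Delta> b \<rhd> t))) (t2 c a) \<lhd> (emb x \<otimes>\<^sub>M 1)" .
    qed
  qed (intro lin3)+
  then show "\<Delta> (\<epsilon>\<^sub>t q \<rhd> b) \<rhd> t = ((\<epsilon>\<^sub>t q \<otimes>\<^sub>M 1) * \<Delta> b) \<rhd> t" by simp
qed

text \<open>Since \<open>E \<otimes> 1\<close> and \<open>1 \<otimes> E\<close> commute, E commutes
  with the first leg of a further copy of E placed on its second leg, and that first leg is made of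
  the \<open>\<epsilon>\<^sub>s(c_1)\<close>.\<close>

lemma E_\<epsilon>\<^sub>s_comm: "E * (1 \<otimes>\<^sub>M \<epsilon>\<^sub>s p) = (1 \<otimes>\<^sub>M \<epsilon>\<^sub>s p) * E"
proof (rule tensor_mult_eqI_left)
  fix x b
  have "E \<rhd> (x \<otimes> (\<epsilon>\<^sub>s p \<rhd> b)) = (1 \<otimes>\<^sub>M \<epsilon>\<^sub>s p) \<rhd> (E \<rhd> (x \<otimes> b))"
  proof (rule left_leg_eqI[OF full_left, where y = p])
    fix c d
    have "tensor_assoc (tensor_lift (\<lambda>p q. (E \<rhd> (x \<otimes> (\<epsilon>\<^sub>s p \<rhd> b))) \<otimes> q) (t1 c d))
        = mult_assoc (E \<otimes>\<^sub>M 1) \<rhd> (x \<otimes> tensor_lift (\<lambda>p q. (\<epsilon>\<^sub>s p \<rhd> b) \<otimes> q) (t1 c d))"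
      unfolding E12_pair tensor_lift_commute[OF clinear_tensor_assoc]
      by (subst tensor_lift_compose, (intro lin3)+, subst tensor_lift_pair, (intro lin3)+, simp)
    also have "\<dots> = (mult_assoc (E \<otimes>\<^sub>M 1) * (1 \<otimes>\<^sub>M (1 \<otimes>\<^sub>M emb c)) * (1 \<otimes>\<^sub>M E)) \<rhd> (x \<otimes> (b \<otimes> d))"
      by (simp add: E_lact_right)
    also have "mult_assoc (E \<otimes>\<^sub>M 1) * (1 \<otimes>\<^sub>M (1 \<otimes>\<^sub>M emb c)) = (1 \<otimes>\<^sub>M (1 \<otimes>\<^sub>M emb c)) * mult_assoc (E \<otimes>\<^sub>M 1)"
      by (simp add: mult_assoc_mtensor[symmetric] mult_assoc_times[symmetric] mtensor_times one_mtensor_one)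
    also have "((1 \<otimes>\<^sub>M (1 \<otimes>\<^sub>M emb c)) * mult_assoc (E \<otimes>\<^sub>M 1) * (1 \<otimes>\<^sub>M E)) \<rhd> (x \<otimes> (b \<otimes> d))
      = (1 \<otimes>\<^sub>M ((1 \<otimes>\<^sub>M emb c) * E)) \<rhd> (mult_assoc (E \<otimes>\<^sub>M 1) \<rhd> (x \<otimes> (b \<otimes> d)))"
    proof -
      have "(1 \<otimes>\<^sub>M (1 \<otimes>\<^sub>M emb c)) * mult_assoc (E \<otimes>\<^sub>M 1) * (1 \<otimes>\<^sub>M E)
          = (1 \<otimes>\<^sub>M ((1 \<otimes>\<^sub>M emb c) * E)) * mult_assoc (E \<otimes>\<^sub>M 1)"
      proof -
        have "mult_assoc (E \<otimes>\<^sub>M 1) * (1 \<otimes>\<^sub>M E) = (1 \<otimes>\<^sub>M E) * mult_assoc (E \<otimes>\<^sub>M 1)"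
          using id_coprod_E_left id_coprod_E_right by simp
        then have "(1 \<otimes>\<^sub>M (1 \<otimes>\<^sub>M emb c)) * mult_assoc (E \<otimes>\<^sub>M 1) * (1 \<otimes>\<^sub>M E)
            = ((1 \<otimes>\<^sub>M (1 \<otimes>\<^sub>M emb c)) * (1 \<otimes>\<^sub>M E)) * mult_assoc (E \<otimes>\<^sub>M 1)"
          by (simp only: mult.assoc)
        then show ?thesis by (simp add: mtensor_times)
      qed
      then show ?thesis by (simp only: act_simps)
    qed
    also have "\<dots> = tensor_assoc (tensor_lift (\<lambda>p q. ((1 \<otimes>\<^sub>M \<epsilon>\<^sub>s p) \<rhd> (E \<rhd> (x \<otimes> b))) \<otimes> q) (t1 c d))"
    proof -
      have "(1 \<otimes>\<^sub>M ((1 \<otimes>\<^sub>M emb c) * E)) \<rhd> tensor_assoc (z \<otimes> d)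
          = tensor_assoc (tensor_lift (\<lambda>p q. ((1 \<otimes>\<^sub>M \<epsilon>\<^sub>s p) \<rhd> z) \<otimes> q) (t1 c d))" for z
        by (rule tensor_eqI[where z = z], (intro lin3)+)
          (simp add: E_lact_right tensor_lift_commute[OF clinear_tensor_assoc] tensor_lift_commute[OF clinear_pair_right[OF clinear_id]])
      from this[of "E \<rhd> (x \<otimes> b)"] show ?thesis
        using mult_assoc_act(1)[of "E \<otimes>\<^sub>M 1" "(x \<otimes> b) \<otimes> d"] by simp
    qed
    finally show "tensor_lift (\<lambda>p q. (E \<rhd> (x \<otimes> (\<epsilon>\<^sub>s p \<rhd> b))) \<otimes> q) (t1 c d)
      = tensor_lift (\<lambda>p q. ((1 \<otimes>\<^sub>M \<epsilon>\<^sub>s p) \<rhd> (E \<rhd> (x \<otimes> b))) \<otimes> q) (t1 c d)"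
      by (rule injD[OF bij_is_inj[OF bij_tensor_assoc]])
  qed (intro lin3)+
  then show "(E * (1 \<otimes>\<^sub>M \<epsilon>\<^sub>s p)) \<rhd> (x \<otimes> b) = ((1 \<otimes>\<^sub>M \<epsilon>\<^sub>s p) * E) \<rhd> (x \<otimes> b)" by simp
qed

lemma \<mu>_E: "tensor_lift (\<lambda>x y. \<sigma> x * y) (E \<rhd> (a \<otimes> b)) = \<sigma> a * b"
  using antipode_inverse[of a b] by (simp add: emb_\<sigma>[symmetric])

text \<open>\<open>S(a) b\<close> is the image of \<open>E (a \<otimes> b)\<close> under
  \<open>x \<otimes> y \<mapsto> S(x) y\<close>. This tensor lies in the range of \<open>T1\<close>,
  where the map yields sums of values of \<open>cs\<close>, and the elements \<open>S(a) b\<close>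
  span A.\<close>

lemma cs_span: "cspan {cs a d |a d. True} = UNIV"
proof -
  let ?\<mu> = "tensor_lift (\<lambda>x y. \<sigma> x * y)"
  have lin: "clinear ?\<mu>" by (intro clinear_tensor_lift lin3)
  have T1: "?\<mu> (T1 \<Delta> w) \<in> cspan {cs a d |a d. True}" for w
  proof (induction w rule: tensor_induct)
    case (pair a b)
    have "?\<mu> (t1 a b) = cs a b" by (simp add: cs_eq)
    then show ?case by (intro cvec.span_base) blast
  qed (simp add: clinear_add[OF clin_T1[OF clinear_id]] clinear_add[OF lin] cvec.span_add)
  have "S a \<rhd> b \<in> cspan {cs a d |a d. True}" for a b
  proof -
    have "E \<rhd> (a \<otimes> b) \<in> range (T1 \<Delta>)" unfolding range_T1 by blast
    then obtain w where w: "E \<rhd> (a \<otimes> b) = T1 \<Delta> w" by blast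
    have "S a \<rhd> b = ?\<mu> (E \<rhd> (a \<otimes> b))"
      by (simp only: \<mu>_E emb_\<sigma>[symmetric] emb_act)
    then show ?thesis using T1[of w] by (simp only: w)
  qed
  then have "cspan {S a \<rhd> b |a b. True} \<subseteq> cspan {cs a d |a d. True}"
    by (intro cvec.span_minimal cvec.subspace_span) blast
  then show ?thesis using antipode_nondegenerate_left by blast
qed

lemma cs_eqI:
  assumes "clinear f" "clinear g" "\<And>a d. f (cs a d) = g (cs a d)"
  shows "f x = g x"
proof -
  have "x \<in> cspan {cs a d |a d. True}" by (simp only: cs_span UNIV_I)
  then show ?thesis
    by (rule cvec.span_induct) (use assms csubspace_eq in auto)
qed

subsection \<open>Cointegrals\<close>

lemma cointegrals_iff: "h \<in> cointegrals \<Delta> S \<longleftrightarrow> (\<forall>a. a * h = \<epsilon>\<^sub>t a \<rhd> h)"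
proof -
  have iff: "emb a * emb h = \<epsilon>\<^sub>t a * emb h \<longleftrightarrow> a * h = \<epsilon>\<^sub>t a \<rhd> h" for a
    by (simp add: mult_emb emb_eq_iff[OF nd])
  have zero: "emb h = 0 \<longleftrightarrow> h = 0"
  proof -
    have "emb (0 :: 'a) = 0" by (rule clinear_zero[OF clinear_emb_id])
    then show ?thesis using emb_eq_iff[OF nd, of h 0] by simp
  qed
  show ?thesis
  proof (cases "h = 0")
    case True
    then show ?thesis by (simp add: cointegrals_def act_linear)
  next
    case False
    then show ?thesis
      by (simp only: cointegrals_def left_cointegral_def target_map_eq iff zero Un_iff mem_Collect_eq) simp
  qed
qed

text \<open>Sweedler form: \<open>a_1 \<otimes> a_2 h = a_1 \<otimes> \<epsilon>\<^sub>t(a_2)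
  h\<close>, and the right side is \<open>E (a \<otimes> h)\<close>.\<close>

lemma cointegral_T1:
  assumes h: "h \<in> cointegrals \<Delta> S"
  shows "t1 a h = E \<rhd> (a \<otimes> h)"
proof (rule cancel_lact_left[OF nd nd id])
  fix c
  show "(emb c \<otimes>\<^sub>M 1) \<rhd> t1 a h = (emb c \<otimes>\<^sub>M 1) \<rhd> (E \<rhd> (a \<otimes> h))"
    unfolding t1_t2 E_lact_left mtensor_ract using h by (simp add: cointegrals_iff)
qed

text \<open>By \<open>emb_t4\<close> the left side is
  \<open>(S(a_1) \<otimes> 1)\<Delta>(a_2 h)\<close>, that is,
  \<open>(S(p) \<otimes> 1)\<Delta>(q)\<close> summed over
  \<open>p \<otimes> q = E (a \<otimes> h)\<close>. Applying \<open>id \<otimes> \<Delta>\<close>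
  replaces this by E acting on a and the first leg of \<open>\<Delta>(h)\<close>, where
  \<open>S(E_1) E_2 = 1\<close> leaves \<open>S(a)\<close>.\<close>

lemma cointegral_coprod:
  assumes h: "h \<in> cointegrals \<Delta> S"
  shows "(1 \<otimes>\<^sub>M emb a) * \<Delta> h = (emb (\<sigma> a) \<otimes>\<^sub>M 1) * \<Delta> h"
proof (rule mult_eqI_left[OF nd2])
  fix t
  define Z where "Z = tensor_lift (\<lambda>p q. (emb (\<sigma> p) \<otimes>\<^sub>M 1) \<rhd> (\<Delta> q \<rhd> t)) (E \<rhd> (a \<otimes> h))"
  have "((1 \<otimes>\<^sub>M emb a) * \<Delta> h) \<rhd> t = t4 a h * t" by (simp only: emb_t4[symmetric] emb_act)
  also have "\<dots> = Z"
    unfolding t4_def cointegral_T1[OF h] Z_def lact_emb_t2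
    by (rule tensor_lift_commute[OF clinear_times_left])
  also have "Z = (emb (\<sigma> a) \<otimes>\<^sub>M 1) \<rhd> (\<Delta> h \<rhd> t)"
  proof (rule cancel_lact_left[OF nd nd id])
    fix e
    \<comment> \<open>With \<open>e = S(x)\<close> the covering factor enters the antipode, as
      \<open>e S(p) = S(p x)\<close>, so that \<open>id_coprod_E_act\<close> applies.\<close>
    define x where "x = \<sigma>' e"
    define G where "G = (\<lambda>(x::'a) (y::'a) (z::'a). (\<sigma> x * y) \<otimes> z)"
    have G: "ctrilinear G" unfolding G_def by (intro lin3)
    let ?G = "tensor_lift (\<lambda>x w. tensor_lift (G x) w)"
    have linG: "clinear ?G" by (rule clinear_tensor_lift[OF ctrilinear_lift[OF G]])
    have Gpair: "tensor_lift (G (p * x)) z = (emb (\<sigma> x) \<otimes>\<^sub>M 1) \<rhd> ((emb (\<sigma> p) \<otimes>\<^sub>M 1) \<rhd> z)" for p z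
      unfolding G_def mtensor_lact[of "emb (\<sigma> p)"] lact_pair by (simp add: \<sigma>_mult mult.assoc)
    have "(emb e \<otimes>\<^sub>M 1) \<rhd> Z = ?G (tensor_lift (\<lambda>p q. (p * x) \<otimes> (\<Delta> q \<rhd> t)) (E \<rhd> (a \<otimes> h)))"
      unfolding Z_def tensor_lift_commute[OF linG] tensor_lift3_pair[OF G] Gpair
      by (subst tensor_lift_commute[OF clinear_lact]) (simp add: x_def)
    also have "\<dots> = tensor_lift (\<lambda>e f. (\<sigma> (a * x) * e) \<otimes> f) (\<Delta> h \<rhd> t)"
    proof -
      have "tensor_lift (\<lambda>x y. G x y f) z = tensor_lift (\<lambda>x y. \<sigma> x * y) z \<otimes> f" for f z
        unfolding G_def by (rule tensor_lift_commute[symmetric]) (intro lin3)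
      then show ?thesis
        unfolding id_coprod_E_act tensor_lift_commute[OF linG] tensor_lift3_assoc[OF G] by (simp add: \<mu>_E)
    qed
    also have "\<dots> = (emb e \<otimes>\<^sub>M 1) \<rhd> ((emb (\<sigma> a) \<otimes>\<^sub>M 1) \<rhd> (\<Delta> h \<rhd> t))"
      unfolding mtensor_lact[of "emb (\<sigma> a)"] lact_pair by (simp add: \<sigma>_mult mult.assoc x_def)
    finally show "(emb e \<otimes>\<^sub>M 1) \<rhd> Z = (emb e \<otimes>\<^sub>M 1) \<rhd> ((emb (\<sigma> a) \<otimes>\<^sub>M 1) \<rhd> (\<Delta> h \<rhd> t))" .
  qed
  finally show "((1 \<otimes>\<^sub>M emb a) * \<Delta> h) \<rhd> t = ((emb (\<sigma> a) \<otimes>\<^sub>M 1) * \<Delta> h) \<rhd> t" by simp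
qed

lemma cointegral_T1_lact:
  assumes h: "h \<in> cointegrals \<Delta> S"
  shows "(1 \<otimes>\<^sub>M emb a) \<rhd> t1 h d = (emb (\<sigma> a) \<otimes>\<^sub>M 1) \<rhd> t1 h d"
  by (rule emb_eq_iff[OF nd2, THEN iffD1])
    (simp add: mult_emb[symmetric] emb_t1 mult.assoc[symmetric] cointegral_coprod[OF h])

lemma cointegral_t3_lact:
  assumes h: "h \<in> cointegrals \<Delta> S"
  shows "(1 \<otimes>\<^sub>M emb a) \<rhd> t3 h d = (emb (\<sigma> a) \<otimes>\<^sub>M 1) \<rhd> t3 h d"
  by (rule emb_eq_iff[OF nd2, THEN iffD1])
    (simp add: mult_emb[symmetric] emb_t3 mult.assoc[symmetric] cointegral_coprod[OF h])

subsection \<open>Moving source and target elements through \<open>\<Delta>\<close>\<close>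

lemma
  fixes m n :: "('a, 'a) tensor mult"
  shows mult_cancel_right1: "(\<And>v. m * (emb v \<otimes>\<^sub>M 1) = n * (emb v \<otimes>\<^sub>M 1)) \<Longrightarrow> m = n"
    and mult_cancel_right2: "(\<And>v. m * (1 \<otimes>\<^sub>M emb v) = n * (1 \<otimes>\<^sub>M emb v)) \<Longrightarrow> m = n"
    and mult_cancel_left1: "(\<And>v. (emb v \<otimes>\<^sub>M 1) * m = (emb v \<otimes>\<^sub>M 1) * n) \<Longrightarrow> m = n"
    and mult_cancel_left2: "(\<And>v. (1 \<otimes>\<^sub>M emb v) * m = (1 \<otimes>\<^sub>M emb v) * n) \<Longrightarrow> m = n"
proof -
  have r1: "m \<rhd> ((v * x) \<otimes> y) = (m * (emb v \<otimes>\<^sub>M 1)) \<rhd> (x \<otimes> y)"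
    and r2: "m \<rhd> (y \<otimes> (v * x)) = (m * (1 \<otimes>\<^sub>M emb v)) \<rhd> (y \<otimes> x)"
    and l1: "((x * v) \<otimes> y) \<lhd> m = (x \<otimes> y) \<lhd> ((emb v \<otimes>\<^sub>M 1) * m)"
    and l2: "(y \<otimes> (x * v)) \<lhd> m = (y \<otimes> x) \<lhd> ((1 \<otimes>\<^sub>M emb v) * m)"
    for m :: "('a, 'a) tensor mult" and v x y by simp_all
  show "m = n" if "\<And>v. m * (emb v \<otimes>\<^sub>M 1) = n * (emb v \<otimes>\<^sub>M 1)"
    by (rule tensor_mult_eqI_left, rule idem_eqI[OF id]) ((intro lin3)+, simp only: r1 that)
  show "m = n" if "\<And>v. m * (1 \<otimes>\<^sub>M emb v) = n * (1 \<otimes>\<^sub>M emb v)"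
    by (rule tensor_mult_eqI_left, rule idem_eqI[OF id]) ((intro lin3)+, simp only: r2 that)
  show "m = n" if "\<And>v. (emb v \<otimes>\<^sub>M 1) * m = (emb v \<otimes>\<^sub>M 1) * n"
    by (rule tensor_mult_eqI_right, rule idem_eqI[OF id]) ((intro lin3)+, simp only: l1 that)
  show "m = n" if "\<And>v. (1 \<otimes>\<^sub>M emb v) * m = (1 \<otimes>\<^sub>M emb v) * n"
    by (rule tensor_mult_eqI_right, rule idem_eqI[OF id]) ((intro lin3)+, simp only: l2 that)
qed

lemma t1_ract: "t1 p (z \<lhd> m) = t1 p z \<lhd> (1 \<otimes>\<^sub>M m)"
  by (rule emb_eq_iff[OF nd2, THEN iffD1])
    (simp add: emb_times[symmetric] emb_t1 mult.assoc mtensor_times)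

lemma t2_lact: "t2 (m \<rhd> z) q = (m \<otimes>\<^sub>M 1) \<rhd> t2 z q"
  by (rule emb_eq_iff[OF nd2, THEN iffD1])
    (simp add: mult_emb[symmetric] emb_t2 mult.assoc[symmetric] mtensor_times)

text \<open>From \<open>(a \<otimes> 1)\<Delta>(y v) = a v_1 \<otimes> y v_2\<close> and
  \<open>S(y v_2) = S(v_2) S(y)\<close>, the factor \<open>S(y)\<close> comes out on the right of
  \<open>t3\<close>. The relation is assumed for left multiplication because the lemma serves both
  elements of the source algebra and images \<open>S(x)\<close> of target elements.\<close>

lemma coprod_source:
  assumes y: "\<And>v. \<Delta> (y \<rhd> v) = (1 \<otimes>\<^sub>M y) * \<Delta> v"
  shows "\<Delta> a * (y \<otimes>\<^sub>M 1) = \<Delta> a * (1 \<otimes>\<^sub>M S\<^sub>M y)"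
proof (rule mult_cancel_right1)
  fix v
  have "emb (t2 a (y \<rhd> v)) = (1 \<otimes>\<^sub>M y) * emb (t2 a v)"
    by (simp add: emb_t2 y mult.assoc[symmetric] mtensor_times)
  then have "t2 a (y \<rhd> v) = (1 \<otimes>\<^sub>M y) \<rhd> t2 a v"
    by (simp add: mult_emb emb_eq_iff[OF nd2])
  then have "t3 a (y \<rhd> v) = tensor_lift (\<lambda>p q. t1 p (\<sigma> q) \<lhd> (1 \<otimes>\<^sub>M S\<^sub>M y)) (t2 a v)"
    unfolding t3_def by (simp only:) (subst tensor_lift_lact, (intro lin3)+, simp add: \<sigma>_act t1_ract)
  also have "\<dots> = t3 a v \<lhd> (1 \<otimes>\<^sub>M S\<^sub>M y)"
    unfolding t3_def by (rule tensor_lift_commute[OF clinear_ract, symmetric])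
  finally have "emb (t3 a (y \<rhd> v)) = emb (t3 a v) * (1 \<otimes>\<^sub>M S\<^sub>M y)" by (simp add: emb_times)
  then show "\<Delta> a * (y \<otimes>\<^sub>M 1) * (emb v \<otimes>\<^sub>M 1) = \<Delta> a * (1 \<otimes>\<^sub>M S\<^sub>M y) * (emb v \<otimes>\<^sub>M 1)"
    by (simp add: emb_t3 mult.assoc mtensor_times mult_emb)
qed

lemma coprod_target:
  assumes x: "At x"
  shows "(1 \<otimes>\<^sub>M x) * \<Delta> a = (S\<^sub>M x \<otimes>\<^sub>M 1) * \<Delta> a"
proof (rule mult_cancel_left2)
  fix v
  have "emb (t1 (v \<lhd> x) a) = emb (t1 v a) * (x \<otimes>\<^sub>M 1)"
    by (simp add: emb_t1 At_right[OF x] mult.assoc mtensor_times)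
  then have "t1 (v \<lhd> x) a = t1 v a \<lhd> (x \<otimes>\<^sub>M 1)"
    by (simp add: emb_times emb_eq_iff[OF nd2])
  then have "t4 (v \<lhd> x) a = tensor_lift (\<lambda>p q. (S\<^sub>M x \<otimes>\<^sub>M 1) \<rhd> t2 (\<sigma> p) q) (t1 v a)"
    unfolding t4_def by (simp only:) (subst tensor_lift_ract, (intro lin3)+, simp add: \<sigma>_act t2_lact)
  also have "\<dots> = (S\<^sub>M x \<otimes>\<^sub>M 1) \<rhd> t4 v a"
    unfolding t4_def by (rule tensor_lift_commute[OF clinear_lact, symmetric])
  finally have "emb (t4 (v \<lhd> x) a) = (S\<^sub>M x \<otimes>\<^sub>M 1) * emb (t4 v a)" by (simp add: mult_emb)
  then show "(1 \<otimes>\<^sub>M emb v) * ((1 \<otimes>\<^sub>M x) * \<Delta> a) = (1 \<otimes>\<^sub>M emb v) * ((S\<^sub>M x \<otimes>\<^sub>M 1) * \<Delta> a)"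
    by (simp add: emb_t4 mult.assoc[symmetric] mtensor_times emb_times)
qed

lemma lact_assoc_sum: "(m \<otimes>\<^sub>M (n \<otimes>\<^sub>M k)) \<rhd> tensor_lift (\<lambda>p q. tensor_assoc (f p q \<otimes> g p q)) z
    = tensor_lift (\<lambda>p q. tensor_assoc (((m \<otimes>\<^sub>M n) \<rhd> f p q) \<otimes> (k \<rhd> g p q))) z"
  by (subst tensor_lift_commute[OF clinear_lact]) (simp add: assoc_lact)

lemma ract_assoc_sum: "tensor_lift (\<lambda>p q. tensor_assoc (f p q \<otimes> g p q)) z \<lhd> (m \<otimes>\<^sub>M (n \<otimes>\<^sub>M k))
    = tensor_lift (\<lambda>p q. tensor_assoc ((f p q \<lhd> (m \<otimes>\<^sub>M n)) \<otimes> (g p q \<lhd> k))) z"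
  by (subst tensor_lift_commute[OF clinear_ract]) (simp add: assoc_ract)

text \<open>Coassociativity gives \<open>a_1 \<otimes> \<Delta>(a_2 x) = a_1 z \<otimes> a_2
  \<otimes> a_3 = a_1 \<otimes> a_2 x \<otimes> a_3\<close>; fullness replaces \<open>a_2\<close> by
  an arbitrary b.\<close>

lemma coprod_ractI:
  assumes zx: "\<And>a. \<Delta> a * (z \<otimes>\<^sub>M 1) = \<Delta> a * (1 \<otimes>\<^sub>M x)"
  shows "\<Delta> (b \<lhd> x) = \<Delta> b * (x \<otimes>\<^sub>M 1)"
proof (rule mult_cancel_right2)
  fix e
  have t2: "t2 c a \<lhd> (1 \<otimes>\<^sub>M x) = t2 c a \<lhd> (z \<otimes>\<^sub>M 1)" for c a
    by (rule emb_eq_iff[OF nd2, THEN iffD1]) (simp add: emb_times[symmetric] emb_t2 mult.assoc zx)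
  have "t1 (b \<lhd> x) e = t1 b e \<lhd> (x \<otimes>\<^sub>M 1)"
  proof (rule right_leg_eqI[OF full_right, where y = b])
    fix a c
    have "tensor_lift (\<lambda>p q. p \<otimes> t1 (q \<lhd> x) e) (t2 c a) = tensor_lift (\<lambda>p q. p \<otimes> t1 q e) (t2 c a \<lhd> (1 \<otimes>\<^sub>M x))"
      by (subst tensor_lift_ract) ((intro lin3)+, simp)
    also have "\<dots> = tensor_lift (\<lambda>p q. p \<otimes> t1 q e) (t2 c a) \<lhd> (z \<otimes>\<^sub>M (1 \<otimes>\<^sub>M 1))"
      unfolding t2 ract_pair by (subst tensor_lift_ract) ((intro lin3)+, simp add: one_mtensor_one)
    also have "\<dots> = tensor_lift (\<lambda>p q. p \<otimes> t1 q e) (t2 c a) \<lhd> (1 \<otimes>\<^sub>M (x \<otimes>\<^sub>M 1))"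
      unfolding coassociative_tensor[symmetric] ract_assoc_sum by (simp add: t2)
    also have "\<dots> = tensor_lift (\<lambda>p q. p \<otimes> (t1 q e \<lhd> (x \<otimes>\<^sub>M 1))) (t2 c a)"
      unfolding ract_pair by simp
    finally show "tensor_lift (\<lambda>p q. p \<otimes> t1 (q \<lhd> x) e) (t2 c a)
      = tensor_lift (\<lambda>p q. p \<otimes> (t1 q e \<lhd> (x \<otimes>\<^sub>M 1))) (t2 c a)" .
  qed (intro lin3)+
  then have "emb (t1 (b \<lhd> x) e) = emb (t1 b e) * (x \<otimes>\<^sub>M 1)" by (simp add: emb_times)
  then show "\<Delta> (b \<lhd> x) * (1 \<otimes>\<^sub>M emb e) = \<Delta> b * (x \<otimes>\<^sub>M 1) * (1 \<otimes>\<^sub>M emb e)"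
    by (simp add: emb_t1 mult.assoc mtensor_times)
qed

text \<open>Moving the multiplier twice along \<open>a_1 \<otimes> a_2 \<otimes> a_3\<close>:
  \<open>\<Delta>(z a_1) \<otimes> a_2\<close> equals
  \<open>a_1 \<otimes> a_2 \<otimes> x a_3\<close>, hence
  \<open>a_1 \<otimes> z a_2 \<otimes> a_3\<close>; likewise
  \<open>a_1 \<otimes> \<Delta>(x a_2)\<close> equals
  \<open>z a_1 \<otimes> a_2 \<otimes> a_3\<close>, hence
  \<open>a_1 \<otimes> x a_2 \<otimes> a_3\<close>.\<close>

lemma
  assumes zx: "\<And>a. (z \<otimes>\<^sub>M 1) * \<Delta> a = (1 \<otimes>\<^sub>M x) * \<Delta> a"
  shows coprod_lactI1: "\<Delta> (z \<rhd> b) = (1 \<otimes>\<^sub>M z) * \<Delta> b"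
    and coprod_lactI2: "At x"
proof -
  have t1: "(z \<otimes>\<^sub>M 1) \<rhd> t1 a e = (1 \<otimes>\<^sub>M x) \<rhd> t1 a e" for a e
    by (rule emb_eq_iff[OF nd2, THEN iffD1])
      (simp add: mult_emb[symmetric] emb_t1 mult.assoc[symmetric] zx)
  show "\<Delta> (z \<rhd> b) = (1 \<otimes>\<^sub>M z) * \<Delta> b"
  proof (rule mult_cancel_left1)
    fix c
    have "t2 c (z \<rhd> b) = (1 \<otimes>\<^sub>M z) \<rhd> t2 c b"
    proof (rule left_leg_eqI[OF full_left, where y = b])
      fix a e
      have "tensor_assoc (tensor_lift (\<lambda>p q. t2 c (z \<rhd> p) \<otimes> q) (t1 a e))
          = tensor_lift (\<lambda>p q. tensor_assoc (t2 c p \<otimes> q)) ((z \<otimes>\<^sub>M 1) \<rhd> t1 a e)"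
        unfolding tensor_lift_commute[OF clinear_tensor_assoc]
        by (subst tensor_lift_lact) ((intro lin3)+, simp)
      also have "\<dots> = (1 \<otimes>\<^sub>M (1 \<otimes>\<^sub>M x)) \<rhd> tensor_lift (\<lambda>p q. tensor_assoc (t2 c p \<otimes> q)) (t1 a e)"
        unfolding t1 lact_assoc_sum by (subst tensor_lift_lact) ((intro lin3)+, simp add: one_mtensor_one)
      also have "\<dots> = (1 \<otimes>\<^sub>M (z \<otimes>\<^sub>M 1)) \<rhd> tensor_lift (\<lambda>p q. tensor_assoc (t2 c p \<otimes> q)) (t1 a e)"
        unfolding coassociative_tensor lact_pair by (simp add: t1)
      also have "\<dots> = tensor_assoc (tensor_lift (\<lambda>p q. ((1 \<otimes>\<^sub>M z) \<rhd> t2 c p) \<otimes> q) (t1 a e))"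
        unfolding tensor_lift_commute[OF clinear_tensor_assoc] lact_assoc_sum by simp
      finally show "tensor_lift (\<lambda>p q. t2 c (z \<rhd> p) \<otimes> q) (t1 a e)
        = tensor_lift (\<lambda>p q. ((1 \<otimes>\<^sub>M z) \<rhd> t2 c p) \<otimes> q) (t1 a e)"
        by (rule injD[OF bij_is_inj[OF bij_tensor_assoc]])
    qed (intro lin3)+
    then have "emb (t2 c (z \<rhd> b)) = (1 \<otimes>\<^sub>M z) * emb (t2 c b)" by (simp add: mult_emb)
    then show "(emb c \<otimes>\<^sub>M 1) * \<Delta> (z \<rhd> b) = (emb c \<otimes>\<^sub>M 1) * ((1 \<otimes>\<^sub>M z) * \<Delta> b)"
      by (simp add: emb_t2 mult.assoc[symmetric] mtensor_times)
  qed
  show "At x"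
    unfolding At_def
  proof (rule allI, rule mult_cancel_right2)
    fix b e
    have t2: "(1 \<otimes>\<^sub>M x) \<rhd> t2 c a = t2 (c \<lhd> z) a" for c a
    proof (rule emb_eq_iff[OF nd2, THEN iffD1])
      have "(1 \<otimes>\<^sub>M x) * ((emb c \<otimes>\<^sub>M 1) * \<Delta> a) = (emb c \<otimes>\<^sub>M 1) * ((1 \<otimes>\<^sub>M x) * \<Delta> a)"
        by (simp add: mult.assoc[symmetric] mtensor_times)
      also have "\<dots> = (emb (c \<lhd> z) \<otimes>\<^sub>M 1) * \<Delta> a"
        unfolding zx[symmetric] by (simp add: mult.assoc[symmetric] mtensor_times emb_times)
      finally show "emb ((1 \<otimes>\<^sub>M x) \<rhd> t2 c a) = emb (t2 (c \<lhd> z) a)"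
        by (simp add: mult_emb[symmetric] emb_t2)
    qed
    have "t1 (x \<rhd> b) e = (x \<otimes>\<^sub>M 1) \<rhd> t1 b e"
    proof (rule right_leg_eqI[OF full_right, where y = b])
      fix a c
      have "tensor_lift (\<lambda>p q. p \<otimes> t1 (x \<rhd> q) e) (t2 c a) = tensor_lift (\<lambda>p q. p \<otimes> t1 q e) ((1 \<otimes>\<^sub>M x) \<rhd> t2 c a)"
        by (subst tensor_lift_lact) ((intro lin3)+, simp)
      also have "\<dots> = (1 \<otimes>\<^sub>M (x \<otimes>\<^sub>M 1)) \<rhd> tensor_lift (\<lambda>p q. p \<otimes> t1 q e) (t2 c a)"
        unfolding t2 coassociative_tensor[symmetric] lact_assoc_sum by (simp add: t2)
      also have "\<dots> = tensor_lift (\<lambda>p q. p \<otimes> ((x \<otimes>\<^sub>M 1) \<rhd> t1 q e)) (t2 c a)"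
        unfolding lact_pair by simp
      finally show "tensor_lift (\<lambda>p q. p \<otimes> t1 (x \<rhd> q) e) (t2 c a)
        = tensor_lift (\<lambda>p q. p \<otimes> ((x \<otimes>\<^sub>M 1) \<rhd> t1 q e)) (t2 c a)" .
    qed (intro lin3)+
    then have "emb (t1 (x \<rhd> b) e) = (x \<otimes>\<^sub>M 1) * emb (t1 b e)" by (simp add: mult_emb)
    then show "\<Delta> (x \<rhd> b) * (1 \<otimes>\<^sub>M emb e) = (x \<otimes>\<^sub>M 1) * \<Delta> b * (1 \<otimes>\<^sub>M emb e)"
      by (simp add: emb_t1 mult.assoc mtensor_times)
  qed
qed

lemma As_coprod_S: "As y \<Longrightarrow> \<Delta> (b \<lhd> S\<^sub>M y) = \<Delta> b * (S\<^sub>M y \<otimes>\<^sub>M 1)"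
  by (rule coprod_ractI[of y]) (rule coprod_source, rule As_left)

lemma At_coprod_S: "At x \<Longrightarrow> \<Delta> (S\<^sub>M x \<rhd> b) = (1 \<otimes>\<^sub>M S\<^sub>M x) * \<Delta> b"
  by (rule coprod_lactI1[of _ x]) (simp add: coprod_target)

text \<open>\<open>At_coprod_S\<close> settles left multiplication by \<open>S(x)\<close>; right
  multiplication follows once \<open>1 \<otimes> S(x)\<close> commutes with E. Now E commutes with
  each \<open>1 \<otimes> \<epsilon>\<^sub>s(a)\<close>, and
  \<open>\<epsilon>\<^sub>s(a x) = S(x) \<epsilon>\<^sub>s(a)\<close>, so \<open>S(x)\<close>
  commutes as well because the values of \<open>cs\<close> span A.\<close>

lemma As_S:
  assumes x: "At x"
  shows "As (S\<^sub>M x)"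
proof -
  let ?y = "S\<^sub>M x"
  have \<epsilon>: "\<epsilon>\<^sub>s (a \<lhd> x) = ?y * \<epsilon>\<^sub>s a" for a
  proof (rule mult_eqI_left[OF nd])
    fix d
    have "emb (t1 (a \<lhd> x) d) = emb (t1 a d) * (x \<otimes>\<^sub>M 1)"
      by (simp add: emb_t1 At_right[OF x] mult.assoc mtensor_times)
    then have t: "t1 (a \<lhd> x) d = t1 a d \<lhd> (x \<otimes>\<^sub>M 1)"
      by (simp add: emb_times emb_eq_iff[OF nd2])
    have "cs (a \<lhd> x) d = ?y \<rhd> cs a d"
      unfolding cs_eq t
      by (subst tensor_lift_ract, (intro lin3)+, subst tensor_lift_commute[OF clinear_lact])
        (simp add: \<sigma>_act lact_mult)
    then show "\<epsilon>\<^sub>s (a \<lhd> x) \<rhd> d = (?y * \<epsilon>\<^sub>s a) \<rhd> d" by (simp add: \<epsilon>\<^sub>s_lact)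
  qed
  have comm: "E * (1 \<otimes>\<^sub>M ?y) = (1 \<otimes>\<^sub>M ?y) * E"
  proof (rule tensor_mult_eqI_left)
    fix b c
    show "(E * (1 \<otimes>\<^sub>M ?y)) \<rhd> (b \<otimes> c) = ((1 \<otimes>\<^sub>M ?y) * E) \<rhd> (b \<otimes> c)"
    proof (rule cs_eqI[where x = c])
      fix a d
      have c1: "E \<rhd> (b \<otimes> (\<epsilon>\<^sub>s a \<rhd> d)) = (1 \<otimes>\<^sub>M \<epsilon>\<^sub>s a) \<rhd> (E \<rhd> (b \<otimes> d))" for a
        using arg_cong[OF E_\<epsilon>\<^sub>s_comm[of a], of "\<lambda>m. m \<rhd> (b \<otimes> d)"] by simp
      have "(E * (1 \<otimes>\<^sub>M ?y)) \<rhd> (b \<otimes> cs a d) = E \<rhd> (b \<otimes> (\<epsilon>\<^sub>s (a \<lhd> x) \<rhd> d))"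
        by (simp add: \<epsilon>[of a] \<epsilon>\<^sub>s_lact[symmetric])
      also have "\<dots> = ((1 \<otimes>\<^sub>M ?y) * (1 \<otimes>\<^sub>M \<epsilon>\<^sub>s a)) \<rhd> (E \<rhd> (b \<otimes> d))"
        unfolding c1 by (simp add: \<epsilon> mtensor_times)
      also have "\<dots> = ((1 \<otimes>\<^sub>M ?y) * E) \<rhd> (b \<otimes> cs a d)"
        by (simp add: c1[symmetric] \<epsilon>\<^sub>s_lact)
      finally show "(E * (1 \<otimes>\<^sub>M ?y)) \<rhd> (b \<otimes> cs a d) = ((1 \<otimes>\<^sub>M ?y) * E) \<rhd> (b \<otimes> cs a d)" .
    qed (intro lin3)+
  qed
  show ?thesis
    unfolding As_def
  proof
    fix b
    have "\<Delta> (b \<lhd> ?y) * E = (\<Delta> b * (1 \<otimes>\<^sub>M ?y)) * E"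
    proof (rule cancel_coprod_right)
      fix a
      have "\<Delta> (b \<lhd> ?y) * \<Delta> a = \<Delta> b * \<Delta> (?y \<rhd> a)"
        by (simp add: coprod_mult[symmetric] mult_lact)
      then show "\<Delta> (b \<lhd> ?y) * \<Delta> a = (\<Delta> b * (1 \<otimes>\<^sub>M ?y)) * \<Delta> a"
        by (simp only: At_coprod_S[OF x] mult.assoc)
    qed
    then show "\<Delta> (b \<lhd> ?y) = \<Delta> b * (1 \<otimes>\<^sub>M ?y)" by (metis comm coprod_E mult.assoc)
  qed
qed

lemma At_coprod_S_right: "At x \<Longrightarrow> \<Delta> (b \<lhd> S\<^sub>M x) = \<Delta> b * (1 \<otimes>\<^sub>M S\<^sub>M x)"
  using As_S by (simp add: As_def)

text \<open>The formula \<open>E\<^sub>(\<^sub>1\<^sub>) S(E\<^sub>(\<^sub>2\<^sub>)) = 1\<close>.\<close>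

lemma \<nu>_E: "tensor_lift (\<lambda>x y. x * \<sigma> y) (t \<lhd> E) = tensor_lift (\<lambda>x y. x * \<sigma> y) t"
proof (rule tensor_eqI[where z = t])
  have bl: "cbilinear (\<lambda>x y. x * \<sigma> y)" by (intro lin3)
  fix c b
  show "tensor_lift (\<lambda>x y. x * \<sigma> y) ((c \<otimes> b) \<lhd> E) = tensor_lift (\<lambda>x y. x * \<sigma> y) (c \<otimes> b)"
  proof (rule idem_eqI[OF id, where x = b])
    fix e a
    have "tensor_lift (\<lambda>x y. \<sigma> x * y) (E \<rhd> (a \<otimes> \<sigma> e)) = tensor_lift (\<lambda>p q. \<epsilon>\<^sub>s p \<rhd> \<sigma> q) (t4 e a)"
      unfolding E_\<sigma>
      by (subst tensor_lift_compose, (intro lin3)+, simp add: \<epsilon>\<^sub>s_lact cs_eq)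
    then have "c * \<sigma> (e * a) = tensor_lift (\<lambda>p q. c * (\<epsilon>\<^sub>s p \<rhd> \<sigma> q)) (t4 e a)"
      unfolding \<sigma>_mult \<mu>_E by (simp only:) (rule tensor_lift_commute, intro lin3)
    then show "tensor_lift (\<lambda>x y. x * \<sigma> y) ((c \<otimes> (e * a)) \<lhd> E) = tensor_lift (\<lambda>x y. x * \<sigma> y) (c \<otimes> (e * a))"
      unfolding E_ract_t4 by (simp add: tensor_lift_compose bl mult_lact)
  qed (intro lin3)+
qed (intro lin3)+

end

section \<open>Weak multiplier Hopf algebras of discrete type\<close>

locale discrete_weak_multiplier_hopf_algebra = regular_weak_multiplier_hopf_algebra +
  assumes discrete: "discrete_type \<Delta> S"
begin

lemma cointegrals_legs: "left_leg \<Delta> (cointegrals \<Delta> S) = UNIV" "right_leg \<Delta> (cointegrals \<Delta> S) = UNIV"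
  using discrete by (simp_all add: discrete_type_def)

text \<open>Both sides stand for \<open>a_1 \<otimes> S(a_2) a_3 b \<otimes> a_4 d\<close>. On the
  right, \<open>S(a_2) a_3 b \<otimes> a_4 d\<close> is read as
  \<open>(1 \<otimes> a_2) E (b \<otimes> d)\<close>.\<close>

lemma G1_T1:
  "tensor_lift (\<lambda>p q. tensor_assoc (G1 (p \<otimes> b) \<otimes> q)) (t1 a d)
    = tensor_lift (\<lambda>\<beta> \<delta>. tensor_lift (\<lambda>p q. p \<otimes> (\<beta> \<otimes> q)) (t1 a \<delta>)) (E \<rhd> (b \<otimes> d))"
proof (rule cancel_lact_left[OF nd nd2 id])
  fix c
  have "(emb c \<otimes>\<^sub>M 1) \<rhd> tensor_lift (\<lambda>p q. tensor_assoc (G1 (p \<otimes> b) \<otimes> q)) (t1 a d)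
      = tensor_lift (\<lambda>p q. tensor_lift (\<lambda>x y. x \<otimes> (cs y b \<otimes> q)) (t2 c p)) (t1 a d)"
    unfolding one_mtensor_one[symmetric] lact_assoc_sum antipode_G1
    by (simp add: tensor_lift_commute[where h = "\<lambda>z. tensor_assoc (z \<otimes> _)"] clinear_tensor_assoc_arg
        clinear_pair_left clinear_id)
  also have "\<dots> = tensor_lift (\<lambda>p q. tensor_lift (\<lambda>x y. p \<otimes> (cs x b \<otimes> y)) (t1 q d)) (t2 c a)"
    by (rule coassoc) (intro lin3)
  also have "\<dots> = tensor_lift (\<lambda>p q. p \<otimes> ((1 \<otimes>\<^sub>M emb q) \<rhd> (E \<rhd> (b \<otimes> d)))) (t2 c a)"
    by (simp add: E_lact_right \<epsilon>\<^sub>s_lact tensor_lift_commute[OF clinear_pair_right[OF clinear_id]])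
  also have "\<dots> = tensor_lift (\<lambda>\<beta> \<delta>. tensor_lift (\<lambda>p q. p \<otimes> (\<beta> \<otimes> (q * \<delta>))) (t2 c a)) (E \<rhd> (b \<otimes> d))"
    by (subst tensor_lift_swap)
      (simp add: mtensor_lact tensor_lift_commute[OF clinear_pair_right[OF clinear_id]])
  also have "\<dots> = (emb c \<otimes>\<^sub>M 1) \<rhd>
      tensor_lift (\<lambda>\<beta> \<delta>. tensor_lift (\<lambda>p q. p \<otimes> (\<beta> \<otimes> q)) (t1 a \<delta>)) (E \<rhd> (b \<otimes> d))"
  proof -
    have "tensor_lift (\<lambda>p q. p \<otimes> (\<beta> \<otimes> (q * \<delta>))) (t2 c a)
        = (emb c \<otimes>\<^sub>M 1) \<rhd> tensor_lift (\<lambda>p q. p \<otimes> (\<beta> \<otimes> q)) (t1 a \<delta>)" for \<beta> \<delta> :: 'a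
    proof -
      have "tensor_lift (\<lambda>p q. p \<otimes> (\<beta> \<otimes> (q * \<delta>))) (t2 c a)
          = tensor_lift (\<lambda>p q. p \<otimes> (\<beta> \<otimes> q)) (t2 c a \<lhd> (1 \<otimes>\<^sub>M emb \<delta>))"
        by (subst tensor_lift_ract) ((intro lin3)+, simp)
      also have "\<dots> = (emb c \<otimes>\<^sub>M 1) \<rhd> tensor_lift (\<lambda>p q. p \<otimes> (\<beta> \<otimes> q)) (t1 a \<delta>)"
        unfolding t1_t2[symmetric] lact_pair by (subst tensor_lift_lact) ((intro lin3)+, simp)
      finally show ?thesis .
    qed
    then show ?thesis by (simp only: tensor_lift_commute[OF clinear_lact])
  qed
  finally show "(emb c \<otimes>\<^sub>M 1) \<rhd> tensor_lift (\<lambda>p q. tensor_assoc (G1 (p \<otimes> b) \<otimes> q)) (t1 a d)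
    = (emb c \<otimes>\<^sub>M 1) \<rhd> tensor_lift (\<lambda>\<beta> \<delta>. tensor_lift (\<lambda>p q. p \<otimes> (\<beta> \<otimes> q)) (t1 a \<delta>)) (E \<rhd> (b \<otimes> d))" .
qed

lemma G1_T1_lift:
  assumes F: "ctrilinear F"
  shows "tensor_lift (\<lambda>p q. tensor_lift (\<lambda>x y. F x y q) (G1 (p \<otimes> b))) (t1 a d)
    = tensor_lift (\<lambda>\<beta> \<delta>. tensor_lift (\<lambda>p q. F p \<beta> q) (t1 a \<delta>)) (E \<rhd> (b \<otimes> d))"
proof -
  let ?F = "tensor_lift (\<lambda>x w. tensor_lift (F x) w)"
  have lin: "clinear ?F" by (rule clinear_tensor_lift[OF ctrilinear_lift[OF F]])
  have "?F (tensor_lift (\<lambda>p q. tensor_assoc (G1 (p \<otimes> b) \<otimes> q)) (t1 a d))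
      = ?F (tensor_lift (\<lambda>\<beta> \<delta>. tensor_lift (\<lambda>p q. p \<otimes> (\<beta> \<otimes> q)) (t1 a \<delta>)) (E \<rhd> (b \<otimes> d)))"
    by (simp only: G1_T1)
  then show ?thesis
    by (simp only: tensor_lift_commute[OF lin] tensor_lift3_assoc[OF F] tensor_lift3_pair[OF F]
        tensor_lift_pair[OF ctrilinearD(4)[OF F]])
qed

text \<open>Left multiplication by \<open>S(c)\<close> on the first leg of \<open>\<Delta>(h)\<close> is left multiplication by c on the
  second one, where it commutes with \<open>G\<^sub>1\<close>; the first legs of the cointegrals exhaust A.\<close>

lemma G1_mult: "G1 ((c * u) \<otimes> b) = (emb c \<otimes>\<^sub>M 1) \<rhd> G1 (u \<otimes> b)"
proof (rule left_leg_eqI[OF cointegrals_legs(1), where y = u])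
  fix h d assume h: "h \<in> cointegrals \<Delta> S"
  define c' where "c' = \<sigma>' c"
  have c: "c = \<sigma> c'" by (simp add: c'_def)
  let ?L = "\<lambda>w. tensor_lift (\<lambda>p q. tensor_assoc (G1 (p \<otimes> b) \<otimes> q)) w"
  have "tensor_assoc (tensor_lift (\<lambda>p q. G1 ((c * p) \<otimes> b) \<otimes> q) (t1 h d)) = ?L ((emb c \<otimes>\<^sub>M 1) \<rhd> t1 h d)"
    unfolding tensor_lift_commute[OF clinear_tensor_assoc] by (subst tensor_lift_lact) ((intro lin3)+, simp)
  also have "\<dots> = ?L ((1 \<otimes>\<^sub>M emb c') \<rhd> t1 h d)" by (simp only: c cointegral_T1_lact[OF h])
  also have "\<dots> = (1 \<otimes>\<^sub>M (1 \<otimes>\<^sub>M emb c')) \<rhd> ?L (t1 h d)"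
    unfolding lact_assoc_sum by (subst tensor_lift_lact) ((intro lin3)+, simp add: one_mtensor_one)
  also have "\<dots> = (emb c \<otimes>\<^sub>M (1 \<otimes>\<^sub>M 1)) \<rhd> ?L (t1 h d)"
  proof -
    have "(1 \<otimes>\<^sub>M (1 \<otimes>\<^sub>M emb c')) \<rhd> tensor_lift (\<lambda>p q. p \<otimes> (\<beta> \<otimes> q)) (t1 h \<delta>)
        = (emb c \<otimes>\<^sub>M (1 \<otimes>\<^sub>M 1)) \<rhd> tensor_lift (\<lambda>p q. p \<otimes> (\<beta> \<otimes> q)) (t1 h \<delta>)" for \<beta> \<delta> :: 'a
    proof -
      have "(1 \<otimes>\<^sub>M (1 \<otimes>\<^sub>M emb c')) \<rhd> tensor_lift (\<lambda>p q. p \<otimes> (\<beta> \<otimes> q)) (t1 h \<delta>)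
          = tensor_lift (\<lambda>p q. p \<otimes> (\<beta> \<otimes> q)) ((1 \<otimes>\<^sub>M emb c') \<rhd> t1 h \<delta>)"
        unfolding lact_pair by (subst tensor_lift_lact) ((intro lin3)+, simp)
      also have "\<dots> = (emb c \<otimes>\<^sub>M (1 \<otimes>\<^sub>M 1)) \<rhd> tensor_lift (\<lambda>p q. p \<otimes> (\<beta> \<otimes> q)) (t1 h \<delta>)"
        unfolding lact_pair cointegral_T1_lact[OF h] c[symmetric]
        by (subst tensor_lift_lact) ((intro lin3)+, simp)
      finally show ?thesis .
    qed
    then show ?thesis unfolding G1_T1 by (simp only: tensor_lift_commute[OF clinear_lact])
  qed
  also have "\<dots> = tensor_assoc (tensor_lift (\<lambda>p q. ((emb c \<otimes>\<^sub>M 1) \<rhd> G1 (p \<otimes> b)) \<otimes> q) (t1 h d))"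
    unfolding tensor_lift_commute[OF clinear_tensor_assoc] lact_assoc_sum by simp
  finally show "tensor_lift (\<lambda>p q. G1 ((c * p) \<otimes> b) \<otimes> q) (t1 h d)
    = tensor_lift (\<lambda>p q. ((emb c \<otimes>\<^sub>M 1) \<rhd> G1 (p \<otimes> b)) \<otimes> q) (t1 h d)"
    by (rule injD[OF bij_is_inj[OF bij_tensor_assoc]])
qed (intro lin3)+

text \<open>\<open>G\<^sub>1(u \<otimes> b) = \<Sum> u S\<^sup>-\<^sup>1(E\<^sub>(\<^sub>2\<^sub>)) \<otimes> E\<^sub>(\<^sub>1\<^sub>) b\<close>\<close>

lemma G1_E: "tensor_lift (\<lambda>x y. y \<otimes> \<sigma> x) (G1 (u \<otimes> b)) = E \<rhd> (b \<otimes> \<sigma> u)"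
proof -
  \<comment> \<open>\<open>G1_mult\<close> makes \<open>\<Lambda>\<close> right linear over A on the
    second leg, so its value at \<open>cs a d\<close>, a sum of products \<open>S(p) q\<close>, can
    be assembled from \<open>G1_T1_lift\<close>. These arguments span A.\<close>
  define \<Lambda> where "\<Lambda> v = tensor_lift (\<lambda>x y. y \<otimes> \<sigma> x) (G1 (\<sigma>' v \<otimes> b))" for v
  have lin\<Lambda>: "clinear \<Lambda>" unfolding \<Lambda>_def by (intro lin3)
  have \<Lambda>: "\<Lambda> (v * w) = \<Lambda> v \<lhd> (1 \<otimes>\<^sub>M emb w)" for v w
    unfolding \<Lambda>_def \<sigma>'_mult G1_mult ract_pair
    by (subst tensor_lift_lact) ((intro lin3)+, simp add: \<sigma>_mult)
  have "\<Lambda> v = E \<rhd> (b \<otimes> v)" for v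
  proof (rule cs_eqI[where x = v])
    fix a d
    define F where "F = (\<lambda>(x::'a) (y::'a) (q::'a). y \<otimes> (\<sigma> x * q))"
    have F: "ctrilinear F" unfolding F_def by (intro lin3)
    have "tensor_lift (\<lambda>x y. F x y q) (G1 (p \<otimes> b)) = \<Lambda> (\<sigma> p * q)" for p q
      unfolding \<Lambda> unfolding \<Lambda>_def ract_pair by (simp add: F_def)
    then have "tensor_lift (\<lambda>p q. tensor_lift (\<lambda>x y. F x y q) (G1 (p \<otimes> b))) (t1 a d) = \<Lambda> (cs a d)"
      by (simp add: tensor_lift_commute[OF lin\<Lambda>] cs_eq)
    moreover have "tensor_lift (\<lambda>p q. F p \<beta> q) (t1 a \<delta>) = \<beta> \<otimes> (\<epsilon>\<^sub>s a \<rhd> \<delta>)" for \<beta> \<delta>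
      unfolding F_def \<epsilon>\<^sub>s_lact cs_eq by (rule tensor_lift_commute[symmetric]) (intro lin3)
    then have "tensor_lift (\<lambda>\<beta> \<delta>. tensor_lift (\<lambda>p q. F p \<beta> q) (t1 a \<delta>)) (E \<rhd> (b \<otimes> d))
        = ((1 \<otimes>\<^sub>M \<epsilon>\<^sub>s a) * E) \<rhd> (b \<otimes> d)"
      by (simp add: mtensor_lact)
    ultimately show "\<Lambda> (cs a d) = E \<rhd> (b \<otimes> cs a d)"
      by (simp add: G1_T1_lift[OF F] E_\<epsilon>\<^sub>s_comm[symmetric] \<epsilon>\<^sub>s_lact)
  qed (intro lin3 lin\<Lambda>)+
  from this[of "\<sigma> u"] show ?thesis by (simp add: \<Lambda>_def)
qed

text \<open>Inserting \<open>G1_E\<close> into \<open>G1_T1\<close> gives \<open>a_1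
  S\<^sup>-\<^sup>1(E_2) \<otimes> E_1 b \<otimes> a_2 d = a_1 \<otimes> E_1 b \<otimes> a_2 E_2
  d\<close>. With the middle leg put in front and covered by c, \<open>E_1 b \<otimes> E_2\<close>
  becomes \<open>c b_1 \<otimes> \<epsilon>\<^sub>t(b_2)\<close>, and fullness isolates each
  \<open>\<epsilon>\<^sub>t r\<close>.\<close>

lemma coprod_S'_\<epsilon>\<^sub>t: "\<Delta> a * (S\<^sub>M' (\<epsilon>\<^sub>t r) \<otimes>\<^sub>M 1) = \<Delta> a * (1 \<otimes>\<^sub>M \<epsilon>\<^sub>t r)"
proof (rule mult_cancel_right2)
  fix d
  have "t1 a d \<lhd> (S\<^sub>M' (\<epsilon>\<^sub>t r) \<otimes>\<^sub>M 1) = t1 a (\<epsilon>\<^sub>t r \<rhd> d)"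
  proof (rule right_leg_eqI[OF full_right, where y = r])
    fix b c
    define F where "F = (\<lambda>(x::'a) (y::'a) (q::'a). (c * y) \<otimes> (x \<otimes> q))"
    have F: "ctrilinear F" unfolding F_def by (intro lin3)
    have "tensor_lift (\<lambda>x y. F x y q) (G1 (p \<otimes> b))
        = tensor_lift (\<lambda>u r. u \<otimes> ((p \<lhd> S\<^sub>M' (\<epsilon>\<^sub>t r)) \<otimes> q)) (t2 c b)" for p q
    proof -
      have "tensor_lift (\<lambda>x y. F x y q) (G1 (p \<otimes> b))
          = tensor_lift (\<lambda>\<beta> \<delta>. (c * \<beta>) \<otimes> (\<sigma>' \<delta> \<otimes> q)) (tensor_lift (\<lambda>x y. y \<otimes> \<sigma> x) (G1 (p \<otimes> b)))"
        by (subst tensor_lift_compose, (intro lin3)+, subst tensor_lift_pair, (intro lin3)+, simp add: F_def)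
      also have "\<dots> = tensor_lift (\<lambda>\<beta> \<delta>. \<beta> \<otimes> (\<sigma>' \<delta> \<otimes> q)) ((emb c \<otimes>\<^sub>M 1) \<rhd> (E \<rhd> (b \<otimes> \<sigma> p)))"
        unfolding G1_E by (subst tensor_lift_lact) ((intro lin3)+, simp)
      also have "\<dots> = tensor_lift (\<lambda>u r. u \<otimes> ((p \<lhd> S\<^sub>M' (\<epsilon>\<^sub>t r)) \<otimes> q)) (t2 c b)"
        unfolding E_lact_left
        by (subst tensor_lift_compose, (intro lin3)+, subst tensor_lift_pair, (intro lin3)+, simp add: \<sigma>'_act)
      finally show ?thesis .
    qed
    then have "tensor_lift (\<lambda>p q. tensor_lift (\<lambda>x y. F x y q) (G1 (p \<otimes> b))) (t1 a d)
        = tensor_lift (\<lambda>u r. u \<otimes> (t1 a d \<lhd> (S\<^sub>M' (\<epsilon>\<^sub>t r) \<otimes>\<^sub>M 1))) (t2 c b)"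
      by (simp only:, subst tensor_lift_swap)
        (simp add: mtensor_ract tensor_lift_commute[OF clinear_pair_right[OF clinear_id]])
    moreover have "tensor_lift (\<lambda>\<beta> \<delta>. tensor_lift (\<lambda>p q. F p \<beta> q) (t1 a \<delta>)) (E \<rhd> (b \<otimes> d))
        = tensor_lift (\<lambda>u r. u \<otimes> t1 a (\<epsilon>\<^sub>t r \<rhd> d)) (t2 c b)"
    proof -
      have "tensor_lift (\<lambda>p q. F p \<beta> q) (t1 a \<delta>) = (c * \<beta>) \<otimes> t1 a \<delta>" for \<beta> \<delta>
        unfolding F_def
        using tensor_lift_commute[OF clinear_pair_right[OF clinear_id], of "c * \<beta>" "(\<otimes>)" "t1 a \<delta>"] by simp
      then have "tensor_lift (\<lambda>\<beta> \<delta>. tensor_lift (\<lambda>p q. F p \<beta> q) (t1 a \<delta>)) (E \<rhd> (b \<otimes> d))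
          = tensor_lift (\<lambda>\<beta> \<delta>. \<beta> \<otimes> t1 a \<delta>) ((emb c \<otimes>\<^sub>M 1) \<rhd> (E \<rhd> (b \<otimes> d)))"
        by (subst tensor_lift_lact) ((intro lin3)+, simp)
      also have "\<dots> = tensor_lift (\<lambda>u r. u \<otimes> t1 a (\<epsilon>\<^sub>t r \<rhd> d)) (t2 c b)"
        unfolding E_lact_left
        by (subst tensor_lift_compose, (intro lin3)+, subst tensor_lift_pair, (intro lin3)+, simp)
      finally show ?thesis .
    qed
    ultimately show "tensor_lift (\<lambda>u r. u \<otimes> (t1 a d \<lhd> (S\<^sub>M' (\<epsilon>\<^sub>t r) \<otimes>\<^sub>M 1))) (t2 c b)
      = tensor_lift (\<lambda>u r. u \<otimes> t1 a (\<epsilon>\<^sub>t r \<rhd> d)) (t2 c b)"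
      by (simp only: G1_T1_lift[OF F])
  qed (intro lin3)+
  then have "emb (t1 a d) * (S\<^sub>M' (\<epsilon>\<^sub>t r) \<otimes>\<^sub>M 1) = emb (t1 a (\<epsilon>\<^sub>t r \<rhd> d))" by (simp add: emb_times)
  then show "\<Delta> a * (S\<^sub>M' (\<epsilon>\<^sub>t r) \<otimes>\<^sub>M 1) * (1 \<otimes>\<^sub>M emb d) = \<Delta> a * (1 \<otimes>\<^sub>M \<epsilon>\<^sub>t r) * (1 \<otimes>\<^sub>M emb d)"
    by (simp add: emb_t1 mult.assoc mtensor_times mult_emb)
qed

subsection \<open>The antipode and the canonical idempotent\<close>

definition \<theta> :: "('a \<Rightarrow> 'a) \<Rightarrow> ('a, 'a) tensor \<Rightarrow> ('a, 'a) tensor"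
  where "\<theta> \<kappa> = tensor_lift (\<lambda>a b. \<kappa> b \<otimes> \<kappa> a)"

lemma
  assumes \<kappa>: "alg_antiaut \<kappa>"
  shows \<theta>_pair: "\<theta> \<kappa> (a \<otimes> b) = \<kappa> b \<otimes> \<kappa> a" and clinear_\<theta>: "clinear (\<theta> \<kappa>)"
    and \<theta>_mult: "\<theta> \<kappa> (s * t) = \<theta> \<kappa> t * \<theta> \<kappa> s" and \<theta>_inv: "\<theta> \<kappa> (\<theta> (inv \<kappa>) s) = s"
proof -
  have bl: "cbilinear (\<lambda>a b. k b \<otimes> k a)" if "alg_antiaut k" for k :: "'a \<Rightarrow> 'a"
    by (intro lin3 clinear_compose[OF antiaut_clinear[OF that]])
  show pair: "\<theta> \<kappa> (a \<otimes> b) = \<kappa> b \<otimes> \<kappa> a" for a b by (simp add: \<theta>_def bl[OF \<kappa>])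
  show lin: "clinear (\<theta> \<kappa>)" unfolding \<theta>_def by (rule clinear_tensor_lift[OF bl[OF \<kappa>]])
  show "\<theta> \<kappa> (s * t) = \<theta> \<kappa> t * \<theta> \<kappa> s"
  proof (induction s rule: tensor_induct)
    case (pair a b)
    show ?case
      by (induction t rule: tensor_induct)
        (simp_all add: \<open>\<And>a b. \<theta> \<kappa> (a \<otimes> b) = \<kappa> b \<otimes> \<kappa> a\<close> antiaut_mult[OF \<kappa>] clinear_add[OF lin] distrib_left distrib_right)
  qed (simp add: clinear_add[OF lin] distrib_left distrib_right)
  have lin': "clinear (\<theta> (inv \<kappa>))"
    unfolding \<theta>_def by (rule clinear_tensor_lift[OF bl[OF alg_antiaut_inv(1)[OF \<kappa>]]])
  show "\<theta> \<kappa> (\<theta> (inv \<kappa>) s) = s"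
    by (rule tensor_eqI[where z = s], rule clinear_compose[OF lin lin'], rule clinear_id)
      (simp add: \<theta>_def bl \<kappa> alg_antiaut_inv(1)[OF \<kappa>] antiaut_inv1[OF \<kappa>])
qed

text \<open>With \<open>\<kappa> = S\<close> and \<open>\<kappa> = S\<^sup>-\<^sup>1\<close> this says \<open>E E' = E\<close> for \<open>E'\<close> the image of E under the flipped
  \<open>\<kappa> \<otimes> \<kappa>\<close>: in \<open>E (\<kappa>(E\<^sub>(\<^sub>2\<^sub>)) \<otimes> \<kappa>(E\<^sub>(\<^sub>1\<^sub>)))\<close> the first factor is moved to the second leg, where it becomes
  \<open>\<kappa>(E\<^sub>(\<^sub>1\<^sub>) S(E\<^sub>(\<^sub>2\<^sub>))) = 1\<close>.\<close>

lemma E_\<theta>: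
  assumes \<kappa>: "alg_antiaut \<kappa>"
    and move: "\<And>a r. \<Delta> a * (mult_anti \<kappa> (\<epsilon>\<^sub>t r) \<otimes>\<^sub>M 1) = \<Delta> a * (1 \<otimes>\<^sub>M mult_anti \<kappa> (S\<^sub>M (\<epsilon>\<^sub>t r)))"
  shows "(z \<lhd> E) * \<theta> \<kappa> (t \<lhd> E) = (z \<lhd> E) * \<theta> \<kappa> t"
proof (rule tensor_eqI[where z = t])
  let ?X = "z \<lhd> E"
  have \<kappa>lin: "clinear (\<lambda>x. \<kappa> (f x))" if "clinear f" for f :: "'b::complex_vector \<Rightarrow> 'a"
    by (rule clinear_compose[OF antiaut_clinear[OF \<kappa>] that])
  note lin = lin3 \<kappa>lin
  have moveX: "?X \<lhd> (mult_anti \<kappa> (\<epsilon>\<^sub>t r) \<otimes>\<^sub>M 1) = ?X \<lhd> (1 \<otimes>\<^sub>M mult_anti \<kappa> (S\<^sub>M (\<epsilon>\<^sub>t r)))" for r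
  proof -
    have "E * (mult_anti \<kappa> (\<epsilon>\<^sub>t r) \<otimes>\<^sub>M 1) = E * (1 \<otimes>\<^sub>M mult_anti \<kappa> (S\<^sub>M (\<epsilon>\<^sub>t r)))"
      by (rule cancel_coprod_left) (rule move)
    then show ?thesis by (metis act_simps(14))
  qed
  fix b v
  \<comment> \<open>Writing \<open>d = \<kappa>(S(\<xi> d))\<close> lets a multiplier
    \<open>\<kappa>(S(\<epsilon>\<^sub>t r))\<close> on the right of d be absorbed as
    \<open>\<epsilon>\<^sub>t r\<close> on the right of \<open>\<xi> d\<close>.\<close>
  define \<xi> where "\<xi> d = \<sigma>' (inv \<kappa> d)" for d
  have \<xi>: "\<kappa> (\<sigma> (\<xi> d)) = d" for d by (simp add: \<xi>_def antiaut_inv1[OF \<kappa>])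
  have \<xi>lin: "clinear (\<lambda>x. \<xi> (f x))" if "clinear f" for f :: "'b::complex_vector \<Rightarrow> 'a"
    unfolding \<xi>_def by (intro lin3 clinear_compose[OF antiaut_clinear[OF alg_antiaut_inv(1)[OF \<kappa>]]] that)
  \<comment> \<open>\<open>J\<close> keeps \<open>\<kappa> \<delta>\<close> and
    \<open>\<beta>\<close> on different legs, so that the second leg of E can be transferred from c
    to d before the factors are multiplied. \<open>J'\<close> is the result of the transfer.\<close>
  define J where "J = tensor_lift (\<lambda>c d. tensor_lift (\<lambda>\<beta> \<delta>. (c * \<kappa> \<delta>) \<otimes> (d \<otimes> \<beta>)) ((b \<otimes> v) \<lhd> E)) ?X"
  define J' where "J' = tensor_lift (\<lambda>c d. tensor_lift (\<lambda>\<beta> \<delta>. (c * \<kappa> v) \<otimes> (\<kappa> (\<sigma> \<delta>) \<otimes> \<beta>)) ((b \<otimes> \<xi> d) \<lhd> E)) ?X"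
  have "J = J'"
  proof (rule cancel_ract_third)
    fix a
    have inner: "tensor_lift (\<lambda>\<beta> \<delta>. f \<delta> \<otimes> (g \<delta> \<otimes> \<beta>)) ((b \<otimes> w) \<lhd> E) \<lhd> (1 \<otimes>\<^sub>M (1 \<otimes>\<^sub>M emb a))
        = tensor_lift (\<lambda>p q. f (w \<lhd> \<epsilon>\<^sub>t q) \<otimes> (g (w \<lhd> \<epsilon>\<^sub>t q) \<otimes> p)) (t2 b a)"
      if bl: "cbilinear (\<lambda>(\<beta> :: 'a) \<delta>. f \<delta> \<otimes> (g \<delta> \<otimes> \<beta>))" for f g :: "'a \<Rightarrow> 'a" and w
    proof -
      have "tensor_lift (\<lambda>\<beta> \<delta>. f \<delta> \<otimes> (g \<delta> \<otimes> \<beta>)) ((b \<otimes> w) \<lhd> E) \<lhd> (1 \<otimes>\<^sub>M (1 \<otimes>\<^sub>M emb a))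
          = tensor_lift (\<lambda>\<beta> \<delta>. f \<delta> \<otimes> (g \<delta> \<otimes> \<beta>)) (((b \<otimes> w) \<lhd> E) \<lhd> (emb a \<otimes>\<^sub>M 1))"
        unfolding ract_pair tensor_lift_ract[OF bl] by simp
      also have "\<dots> = tensor_lift (\<lambda>p q. f (w \<lhd> \<epsilon>\<^sub>t q) \<otimes> (g (w \<lhd> \<epsilon>\<^sub>t q) \<otimes> p)) (t2 b a)"
        unfolding E_ract_left by (simp add: tensor_lift_compose[OF bl] tensor_lift_pair[OF bl])
      finally show ?thesis .
    qed
    have step: "tensor_lift (\<lambda>c d. (c * \<kappa> (v \<lhd> \<epsilon>\<^sub>t q)) \<otimes> (d \<otimes> p)) ?X
        = tensor_lift (\<lambda>c d. (c * \<kappa> v) \<otimes> (\<kappa> (\<sigma> (\<xi> d \<lhd> \<epsilon>\<^sub>t q)) \<otimes> p)) ?X" for p q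
    proof -
      have "tensor_lift (\<lambda>c d. (c * \<kappa> (v \<lhd> \<epsilon>\<^sub>t q)) \<otimes> (d \<otimes> p)) ?X
          = tensor_lift (\<lambda>c d. (c * \<kappa> v) \<otimes> (d \<otimes> p)) (?X \<lhd> (mult_anti \<kappa> (\<epsilon>\<^sub>t q) \<otimes>\<^sub>M 1))"
        by (subst tensor_lift_ract) ((intro lin)+, simp add: antiaut_ract[OF nd \<kappa>] mult_lact)
      also have "\<dots> = tensor_lift (\<lambda>c d. (c * \<kappa> v) \<otimes> (\<kappa> (\<sigma> (\<xi> d \<lhd> \<epsilon>\<^sub>t q)) \<otimes> p)) ?X"
        unfolding moveX
        by (subst tensor_lift_ract) ((intro lin)+, simp add: \<sigma>_act antiaut_lact[OF nd \<kappa>] \<xi>)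
      finally show ?thesis .
    qed
    have "J \<lhd> (1 \<otimes>\<^sub>M (1 \<otimes>\<^sub>M emb a))
        = tensor_lift (\<lambda>c d. tensor_lift (\<lambda>p q. (c * \<kappa> (v \<lhd> \<epsilon>\<^sub>t q)) \<otimes> (d \<otimes> p)) (t2 b a)) ?X"
      unfolding J_def tensor_lift_commute[OF clinear_ract, of _ ?X]
      by (subst inner) ((intro lin)+, simp)
    also have "\<dots> = tensor_lift (\<lambda>c d. tensor_lift (\<lambda>p q. (c * \<kappa> v) \<otimes> (\<kappa> (\<sigma> (\<xi> d \<lhd> \<epsilon>\<^sub>t q)) \<otimes> p)) (t2 b a)) ?X"
      by (subst (1 2) tensor_lift_swap) (simp only: step)
    also have "\<dots> = J' \<lhd> (1 \<otimes>\<^sub>M (1 \<otimes>\<^sub>M emb a))"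
      unfolding J'_def tensor_lift_commute[OF clinear_ract, of _ ?X]
      by (subst inner) ((intro lin)+, simp)
    finally show "J \<lhd> (1 \<otimes>\<^sub>M (1 \<otimes>\<^sub>M emb a)) = J' \<lhd> (1 \<otimes>\<^sub>M (1 \<otimes>\<^sub>M emb a))" .
  qed
  define G where "G = (\<lambda>(c::'a) (d::'a) (\<beta>::'a). c \<otimes> (d * \<kappa> \<beta>))"
  have G: "ctrilinear G" unfolding G_def by (intro lin)
  let ?G = "tensor_lift (\<lambda>x w. tensor_lift (G x) w)"
  have linG: "clinear ?G" by (rule clinear_tensor_lift[OF ctrilinear_lift[OF G]])
  have G3: "?G (x \<otimes> (y \<otimes> w)) = x \<otimes> (y * \<kappa> w)" for x y w
    by (simp add: tensor_lift3_pair[OF G] tensor_lift_pair[OF ctrilinearD(4)[OF G]]) (simp add: G_def)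
  have "?G J = ?X * \<theta> \<kappa> ((b \<otimes> v) \<lhd> E)"
  proof -
    have "tensor_lift (\<lambda>\<beta> \<delta>. (c * \<kappa> \<delta>) \<otimes> (d * \<kappa> \<beta>)) w = (c \<otimes> d) * \<theta> \<kappa> w" for c d w
      unfolding \<theta>_def by (subst tensor_lift_commute[OF clinear_times_right]) simp
    then have "?G J = tensor_lift (\<lambda>c d. (c \<otimes> d) * \<theta> \<kappa> ((b \<otimes> v) \<lhd> E)) ?X"
      unfolding J_def by (simp add: tensor_lift_commute[OF linG] G3)
    then show ?thesis
      using tensor_lift_commute[OF clinear_times_left, of "(\<otimes>)" ?X "\<theta> \<kappa> ((b \<otimes> v) \<lhd> E)"] by simp
  qed
  moreover have "?G J' = ?X * (\<kappa> v \<otimes> \<kappa> b)"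
  proof -
    have "tensor_lift (\<lambda>\<beta> \<delta>. (c * \<kappa> v) \<otimes> (\<kappa> (\<sigma> \<delta>) * \<kappa> \<beta>)) ((b \<otimes> \<xi> d) \<lhd> E) = (c \<otimes> d) * (\<kappa> v \<otimes> \<kappa> b)" for c d
    proof -
      have "tensor_lift (\<lambda>\<beta> \<delta>. (c * \<kappa> v) \<otimes> (\<kappa> (\<sigma> \<delta>) * \<kappa> \<beta>)) ((b \<otimes> \<xi> d) \<lhd> E)
          = (c * \<kappa> v) \<otimes> \<kappa> (tensor_lift (\<lambda>x y. x * \<sigma> y) ((b \<otimes> \<xi> d) \<lhd> E))"
        by (subst tensor_lift_commute[where h = "\<lambda>x. (c * \<kappa> v) \<otimes> \<kappa> x"]) (intro lin, simp add: antiaut_mult[OF \<kappa>])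
      also have "\<dots> = (c \<otimes> d) * (\<kappa> v \<otimes> \<kappa> b)"
        unfolding \<nu>_E by (subst tensor_lift_pair) ((intro lin)+, simp add: antiaut_mult[OF \<kappa>] \<xi>)
      finally show ?thesis .
    qed
    then have "?G J' = tensor_lift (\<lambda>c d. (c \<otimes> d) * (\<kappa> v \<otimes> \<kappa> b)) ?X"
      unfolding J'_def by (simp add: tensor_lift_commute[OF linG] G3 del: tensor_times_pair)
    then show ?thesis
      using tensor_lift_commute[OF clinear_times_left, of "(\<otimes>)" ?X "\<kappa> v \<otimes> \<kappa> b"] by simp
  qed
  ultimately show "?X * \<theta> \<kappa> ((b \<otimes> v) \<lhd> E) = ?X * \<theta> \<kappa> (b \<otimes> v)"
    using \<open>J = J'\<close> by (simp add: \<theta>_pair[OF \<kappa>])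
qed (intro clinear_compose[OF clinear_times_right] clinear_compose[OF clinear_\<theta>[OF \<kappa>]] clinear_\<theta>[OF \<kappa>] clin)+

text \<open>\<open>E_\<theta>\<close> for the antipode shows that E does not distinguish
  \<open>\<theta> \<sigma> (t \<lhd> E)\<close> from \<open>\<theta> \<sigma> t\<close>. Applied to
  the inverse antipode and transported by \<open>\<theta> \<sigma>\<close>, it shows that
  \<open>\<theta> \<sigma> (t \<lhd> E)\<close> is already fixed by E. Two one-sided absorptions
  thus give equality.\<close>

lemma \<theta>_ract_E: "\<theta> \<sigma> (t \<lhd> E) = E \<rhd> \<theta> \<sigma> t"
proof -
  have "E \<rhd> \<theta> \<sigma> (t \<lhd> E) = E \<rhd> \<theta> \<sigma> t"
  proof (rule nondeg_right_eqI[OF nd2])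
    show "c * (E \<rhd> \<theta> \<sigma> (t \<lhd> E)) = c * (E \<rhd> \<theta> \<sigma> t)" for c
      unfolding mult_lact by (rule E_\<theta>[OF antiaut]) (rule coprod_source, rule At_coprod_S, rule At_\<epsilon>\<^sub>t)
  qed
  moreover have "E \<rhd> \<theta> \<sigma> (t \<lhd> E) = \<theta> \<sigma> (t \<lhd> E)"
  proof (rule nondeg_right_eqI[OF nd2])
    fix c
    have "(t \<lhd> E) * \<theta> \<sigma>' (\<theta> \<sigma> c \<lhd> E) = (t \<lhd> E) * \<theta> \<sigma>' (\<theta> \<sigma> c)" for c
      by (rule E_\<theta>[OF antiaut']) (simp add: coprod_S'_\<epsilon>\<^sub>t)
    then have "\<theta> \<sigma> ((t \<lhd> E) * \<theta> \<sigma>' (c \<lhd> E)) = \<theta> \<sigma> ((t \<lhd> E) * \<theta> \<sigma>' c)"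
      using \<theta>_inv[OF antiaut] by metis
    then show "c * (E \<rhd> \<theta> \<sigma> (t \<lhd> E)) = c * \<theta> \<sigma> (t \<lhd> E)"
      by (simp add: \<theta>_mult[OF antiaut] \<theta>_inv[OF antiaut] mult_lact)
  qed
  ultimately show ?thesis by simp
qed

lemma \<theta>_lact_E: "\<theta> \<sigma> (E \<rhd> t) = \<theta> \<sigma> t \<lhd> E"
proof (rule nondeg_left_eqI[OF nd2])
  fix c
  define s where "s = \<theta> \<sigma>' c"
  have c: "c = \<theta> \<sigma> s" by (simp add: s_def \<theta>_inv[OF antiaut])
  have "\<theta> \<sigma> (E \<rhd> t) * c = \<theta> \<sigma> ((s \<lhd> E) * t)"
    by (simp add: c \<theta>_mult[OF antiaut, symmetric] mult_lact)
  then show "\<theta> \<sigma> (E \<rhd> t) * c = (\<theta> \<sigma> t \<lhd> E) * c"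
    by (simp add: c \<theta>_mult[OF antiaut] \<theta>_ract_E mult_lact)
qed

lemma \<theta>_inj: "\<theta> \<sigma> s = \<theta> \<sigma> t \<Longrightarrow> s = t"
  using \<theta>_inv[OF antiaut'] alg_antiaut_inv(2)[OF antiaut] by metis

lemma \<theta>_lact: "\<theta> \<sigma> ((m \<otimes>\<^sub>M n) \<rhd> t) = \<theta> \<sigma> t \<lhd> (S\<^sub>M n \<otimes>\<^sub>M S\<^sub>M m)"
  and \<theta>_ract: "\<theta> \<sigma> (t \<lhd> (m \<otimes>\<^sub>M n)) = (S\<^sub>M n \<otimes>\<^sub>M S\<^sub>M m) \<rhd> \<theta> \<sigma> t"
  by (rule tensor_eqI[where z = t], (intro clin clinear_compose[OF clinear_\<theta>[OF antiaut]] clinear_\<theta>[OF antiaut])+,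
    simp add: \<theta>_pair[OF antiaut] \<sigma>_act)+

text \<open>The flip property identifies a slice of E giving \<open>\<epsilon>\<^sub>s\<close> with
  the antipode of a slice giving \<open>\<epsilon>\<^sub>t\<close>. So
  \<open>\<epsilon>\<^sub>s\<close> of a first-leg slice of the coproduct is
  \<open>S(\<epsilon>\<^sub>t r)\<close> for a suitable r, which \<open>As_S\<close> puts in the
  source algebra.\<close>

lemma As_\<epsilon>\<^sub>s: "As (\<epsilon>\<^sub>s p)"
proof -
  have "p \<in> {p. As (\<epsilon>\<^sub>s p)}"
  proof (rule left_leg_induct[OF full_left])
    show "csubspace {p. As (\<epsilon>\<^sub>s p)}"
      using csubspace_As unfolding cvec.subspace_def
      by (simp add: clinear_zero[OF clinear_\<epsilon>\<^sub>s] clinear_add[OF clinear_\<epsilon>\<^sub>s] clinear_scale[OF clinear_\<epsilon>\<^sub>s])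
    fix x a and \<phi> :: "'a \<Rightarrow> complex" assume \<phi>: "clinear \<phi>"
    define c d where "c = \<sigma>' x" and "d = \<sigma>' a"
    have xa: "x = \<sigma> c" "a = \<sigma> d" by (simp_all add: c_def d_def)
    let ?p = "tensor_lift (\<lambda>p q. \<phi> q *\<^sub>C p) (t1 x a)"
    let ?r = "tensor_lift (\<lambda>p q. \<phi> (\<sigma> p) *\<^sub>C q) (t2 d c)"
    have "\<epsilon>\<^sub>s ?p = S\<^sub>M (\<epsilon>\<^sub>t ?r)"
    proof (rule mult_eqI_left[OF nd])
      fix b
      define b' where "b' = \<sigma>' b"
      have b: "b = \<sigma> b'" by (simp add: b'_def)
      have "tensor_lift (\<lambda>p q. (\<epsilon>\<^sub>s p \<rhd> b) \<otimes> q) (t1 x a) = (1 \<otimes>\<^sub>M emb x) \<rhd> (E \<rhd> \<theta> \<sigma> (d \<otimes> b'))"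
        by (simp add: E_lact_right \<theta>_pair[OF antiaut] xa(2) b)
      also have "\<dots> = \<theta> \<sigma> (((d \<otimes> b') \<lhd> E) \<lhd> (emb c \<otimes>\<^sub>M 1))"
        by (simp add: \<theta>_ract \<theta>_ract_E mult_anti_emb[OF nd antiaut] mult_anti_one[OF nd antiaut] xa(1))
      also have "\<dots> = tensor_lift (\<lambda>p q. (S\<^sub>M (\<epsilon>\<^sub>t q) \<rhd> b) \<otimes> \<sigma> p) (t2 d c)"
        unfolding E_ract_left tensor_lift_commute[OF clinear_\<theta>[OF antiaut]]
        by (simp add: \<theta>_pair[OF antiaut] \<sigma>_act b)
      finally have eq: "tensor_lift (\<lambda>p q. \<phi> q *\<^sub>C p) (tensor_lift (\<lambda>p q. (\<epsilon>\<^sub>s p \<rhd> b) \<otimes> q) (t1 x a))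
        = tensor_lift (\<lambda>p q. \<phi> q *\<^sub>C p) (tensor_lift (\<lambda>p q. (S\<^sub>M (\<epsilon>\<^sub>t q) \<rhd> b) \<otimes> \<sigma> p) (t2 d c))" by simp
      have bl: "cbilinear (\<lambda>p q. \<phi> q *\<^sub>C p)" by (intro clin \<phi>)
      have "\<epsilon>\<^sub>s ?p \<rhd> b = tensor_lift (\<lambda>p q. \<phi> q *\<^sub>C (\<epsilon>\<^sub>s p \<rhd> b)) (t1 x a)"
        by (subst tensor_lift_commute[where h = "\<lambda>p. \<epsilon>\<^sub>s p \<rhd> b"]) (intro lin3, simp add: clinear_scale[OF clinear_\<epsilon>\<^sub>s])
      also have "\<dots> = tensor_lift (\<lambda>p q. \<phi> (\<sigma> p) *\<^sub>C (S\<^sub>M (\<epsilon>\<^sub>t q) \<rhd> b)) (t2 d c)"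
        using eq by (simp add: tensor_lift_compose[OF bl] tensor_lift_pair[OF bl])
      also have "\<dots> = S\<^sub>M (\<epsilon>\<^sub>t ?r) \<rhd> b"
        by (subst tensor_lift_commute[where h = "\<lambda>r. S\<^sub>M (\<epsilon>\<^sub>t r) \<rhd> b"])
          (intro lin3, simp add: clinear_scale[OF clinear_\<epsilon>\<^sub>t] clinear_scale[OF clinear_mult_anti[OF nd antiaut]])
      finally show "\<epsilon>\<^sub>s ?p \<rhd> b = S\<^sub>M (\<epsilon>\<^sub>t ?r) \<rhd> b" .
    qed
    then show "?p \<in> {p. As (\<epsilon>\<^sub>s p)}" by (simp add: As_S At_\<epsilon>\<^sub>t)
  qed
  then show ?thesis by simp
qed

text \<open>Applying the flipped antipode to \<open>coprod_S'_\<epsilon>\<^sub>t\<close> turns right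
  multiplication of E into left multiplication and lowers each power of S by one.
  \<open>target_decomposition\<close> needs this to write
  \<open>S\<^sup>-\<^sup>1(\<epsilon>\<^sub>t q)\<close> as \<open>S(x)\<close> with x in the target
  algebra.\<close>

lemma At_S'_S'_\<epsilon>\<^sub>t: "At (S\<^sub>M' (S\<^sub>M' (\<epsilon>\<^sub>t q)))"
proof (rule coprod_lactI2)
  let ?z = "S\<^sub>M' (\<epsilon>\<^sub>t q)"
  have z: "E * (?z \<otimes>\<^sub>M 1) = E * (1 \<otimes>\<^sub>M \<epsilon>\<^sub>t q)"
    by (rule cancel_coprod_left) (rule coprod_S'_\<epsilon>\<^sub>t)
  have "(?z \<otimes>\<^sub>M 1) * E = (1 \<otimes>\<^sub>M S\<^sub>M' ?z) * E"
  proof (rule mult_eqI_left[OF nd2], rule \<theta>_inj)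
    fix t
    show "\<theta> \<sigma> (((?z \<otimes>\<^sub>M 1) * E) \<rhd> t) = \<theta> \<sigma> (((1 \<otimes>\<^sub>M S\<^sub>M' ?z) * E) \<rhd> t)"
      using arg_cong[OF z, of "\<lambda>m. \<theta> \<sigma> t \<lhd> m"]
      by (simp add: \<theta>_lact \<theta>_lact_E mult_anti_one[OF nd antiaut])
  qed
  then have "((?z \<otimes>\<^sub>M 1) * E) * \<Delta> a = ((1 \<otimes>\<^sub>M S\<^sub>M' ?z) * E) * \<Delta> a" for a by (simp only:)
  then show "(?z \<otimes>\<^sub>M 1) * \<Delta> a = (1 \<otimes>\<^sub>M S\<^sub>M' ?z) * \<Delta> a" for a
    by (simp only: mult.assoc E_coprod)
qed

end

section \<open>Balanced tensor products of subspaces\<close>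

lemma csubspace_projection:
  fixes V :: "'v::complex_vector set"
  assumes "csubspace V"
  obtains \<pi> where "clinear \<pi>" "\<And>x. \<pi> x \<in> V" "\<And>x. x \<in> V \<Longrightarrow> \<pi> x = x"
proof -
  interpret vector_space_pair "scaleC :: complex \<Rightarrow> 'v \<Rightarrow> 'v" "scaleC :: complex \<Rightarrow> 'v \<Rightarrow> 'v" ..
  have "\<exists>g. range g \<subseteq> V \<and> clinear g \<and> (\<forall>v\<in>V. g v = v)"
    using linear_exists_left_inverse_on[OF clinear_id assms[unfolded csubspace_def]] by (simp add: inj_on_def)
  then show thesis using that by blast
qed

text \<open>Turns membership in a subspace into the vanishing of a linear map, to which the
  cancellation and separation arguments apply.\<close>

lemma csubspace_kernel:
  fixes V :: "'v::complex_vector set"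
  assumes "csubspace V"
  obtains k :: "'v \<Rightarrow> 'v" where "clinear k" "\<And>x. k x = 0 \<longleftrightarrow> x \<in> V"
proof -
  obtain \<pi> where \<pi>: "clinear \<pi>" "\<And>x. \<pi> x \<in> V" "\<And>x. x \<in> V \<Longrightarrow> \<pi> x = x"
    by (rule csubspace_projection[OF assms], rule that)
  show thesis
  proof (rule that[of "\<lambda>x. x - \<pi> x"])
    show "clinear (\<lambda>x. x - \<pi> x)" by (intro clin \<pi>(1))
    show "x - \<pi> x = 0 \<longleftrightarrow> x \<in> V" for x using \<pi>(2)[of x] \<pi>(3)[of x] by auto
  qed
qed

lemma free_on_gen: "v \<in> V \<Longrightarrow> w \<in> W \<Longrightarrow> free_gen v w \<in> free_on V W"
  by (auto simp: free_on_def split: if_splits)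

lemma csubspace_free_on: "csubspace (free_on V W)"
proof (rule cvec.subspaceI)
  show "x + y \<in> free_on V W" if "x \<in> free_on V W" "y \<in> free_on V W" for x y
    using that keys_add[of x y] by (auto simp: free_on_def)
  show "c *\<^sub>C x \<in> free_on V W" if "x \<in> free_on V W" for c x
    using that by (auto simp: free_on_def in_keys_iff lookup_scaleC)
qed (simp add: free_on_def)

lemma free_lift_free_gen: "free_lift free_gen p = p"
proof (rule poly_mapping_eqI)
  fix k
  have "Poly_Mapping.lookup (free_lift free_gen p) k
      = (\<Sum>j\<in>Poly_Mapping.keys p. Poly_Mapping.lookup p j * (if j = k then 1 else 0))"
    unfolding free_lift_def lookup_sum
    by (rule sum.cong) (auto simp: lookup_scaleC lookup_single scaleC_complex_def when_def)
  also have "\<dots> = Poly_Mapping.lookup p k"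
    by (simp add: sum.delta' in_keys_iff if_distrib cong: if_cong)
  finally show "Poly_Mapping.lookup (free_lift free_gen p) k = Poly_Mapping.lookup p k" .
qed

lemma free_lift_commute:
  assumes "clinear h"
  shows "h (free_lift f p) = free_lift (\<lambda>a b. h (f a b)) p"
  by (simp add: free_lift_def clinear_sum[OF assms] clinear_scale[OF assms])

lemma free_lift_cong:
  assumes "p \<in> free_on V W" "\<And>v w. v \<in> V \<Longrightarrow> w \<in> W \<Longrightarrow> f v w = g v w"
  shows "free_lift f p = free_lift g p"
  unfolding free_lift_def using assms by (intro sum.cong) (auto simp: free_on_def)

lemma free_lift_in_subspace:
  assumes "csubspace Y" "p \<in> free_on V W" "\<And>v w. v \<in> V \<Longrightarrow> w \<in> W \<Longrightarrow> f v w \<in> Y"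
  shows "free_lift f p \<in> Y"
  unfolding free_lift_def using assms
  by (intro cvec.subspace_sum cvec.subspace_scale) (auto simp: free_on_def)

lemma tensor_lift_in_subspace:
  assumes "csubspace Y" "\<And>v w. f v w \<in> Y"
  shows "tensor_lift f z \<in> Y"
  unfolding tensor_lift_def
  by (rule free_lift_in_subspace[of _ _ UNIV UNIV]) (use assms in \<open>auto simp: free_on_def\<close>)

lemma
  assumes N: "cspan (bilinear_relators V W) \<subseteq> N"
  shows free_gen_add_left: "v \<in> V \<Longrightarrow> v' \<in> V \<Longrightarrow> v + v' \<in> V \<Longrightarrow> w \<in> W \<Longrightarrow>
      free_gen (v + v') w - free_gen v w - free_gen v' w \<in> N"
    and free_gen_add_right: "v \<in> V \<Longrightarrow> w \<in> W \<Longrightarrow> w' \<in> W \<Longrightarrow> w + w' \<in> W \<Longrightarrow>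
      free_gen v (w + w') - free_gen v w - free_gen v w' \<in> N"
    and free_gen_scale_left: "v \<in> V \<Longrightarrow> c *\<^sub>C v \<in> V \<Longrightarrow> w \<in> W \<Longrightarrow>
      free_gen (c *\<^sub>C v) w - c *\<^sub>C free_gen v w \<in> N"
    and free_gen_scale_right: "v \<in> V \<Longrightarrow> w \<in> W \<Longrightarrow> c *\<^sub>C w \<in> W \<Longrightarrow>
      free_gen v (c *\<^sub>C w) - c *\<^sub>C free_gen v w \<in> N"
  by (rule subsetD[OF N], rule cvec.span_base, unfold bilinear_relators_def, blast)+

text \<open>The relations are the kernel of the evaluation: compose a bilinear map into the free space
  modulo relations, extended from \<open>V \<times> W\<close> by projections, with the injective tensor product.\<close>

lemma free_on_eval_zero:
  fixes V :: "('x \<Rightarrow> complex) set" and W :: "'w::complex_vector set"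
  assumes V: "csubspace V" and W: "csubspace W" and p: "p \<in> free_on V W"
    and eval: "\<And>x. free_lift (\<lambda>\<rho> w. \<rho> x *\<^sub>C w) p = 0"
  shows "p \<in> cspan (bilinear_relators V W)"
proof -
  let ?N = "cspan (bilinear_relators V W)"
  obtain k :: "(('x \<Rightarrow> complex) \<times> 'w \<Rightarrow>\<^sub>0 complex) \<Rightarrow> (('x \<Rightarrow> complex) \<times> 'w \<Rightarrow>\<^sub>0 complex)"
    where k: "clinear k" "\<And>q. k q = 0 \<longleftrightarrow> q \<in> ?N"
    by (rule csubspace_kernel[OF cvec.subspace_span], rule that)
  obtain \<pi> where \<pi>: "clinear \<pi>" "\<And>x. \<pi> x \<in> V" "\<And>x. x \<in> V \<Longrightarrow> \<pi> x = x"
    by (rule csubspace_projection[OF V], rule that)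
  obtain \<tau> where \<tau>: "clinear \<tau>" "\<And>x. \<tau> x \<in> W" "\<And>x. x \<in> W \<Longrightarrow> \<tau> x = x"
    by (rule csubspace_projection[OF W], rule that)
  have k_eqI: "k q = k q'" if "q - q' \<in> ?N" for q q'
    using that k(2)[of "q - q'"] by (simp add: clinear_diff[OF k(1)])
  define B where "B \<rho> w = k (free_gen (\<pi> \<rho>) (\<tau> w))" for \<rho> w
  have B: "cbilinear B"
  proof (intro cbilinearI clinearI)
    fix x y :: 'w and \<rho> \<rho>' :: "'x \<Rightarrow> complex" and c
    have "k (free_gen (\<pi> \<rho>) (\<tau> x + \<tau> y)) = k (free_gen (\<pi> \<rho>) (\<tau> x) + free_gen (\<pi> \<rho>) (\<tau> y))"
      by (rule k_eqI, unfold diff_diff_eq[symmetric], rule free_gen_add_right[OF order.refl])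
        (simp_all add: \<pi> \<tau> cvec.subspace_add[OF W])
    then show "B \<rho> (x + y) = B \<rho> x + B \<rho> y"
      by (simp add: B_def clinear_add[OF \<tau>(1)] clinear_add[OF k(1)])
    have "k (free_gen (\<pi> \<rho>) (c *\<^sub>C \<tau> x)) = k (c *\<^sub>C free_gen (\<pi> \<rho>) (\<tau> x))"
      by (rule k_eqI, rule free_gen_scale_right[OF order.refl]) (simp_all add: \<pi> \<tau> cvec.subspace_scale[OF W])
    then show "B \<rho> (c *\<^sub>C x) = c *\<^sub>C B \<rho> x"
      by (simp add: B_def clinear_scale[OF \<tau>(1)] clinear_scale[OF k(1)])
    have "k (free_gen (\<pi> \<rho> + \<pi> \<rho>') (\<tau> x)) = k (free_gen (\<pi> \<rho>) (\<tau> x) + free_gen (\<pi> \<rho>') (\<tau> x))"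
      by (rule k_eqI, unfold diff_diff_eq[symmetric], rule free_gen_add_left[OF order.refl])
        (simp_all add: \<pi> \<tau> cvec.subspace_add[OF V])
    then show "B (\<rho> + \<rho>') x = B \<rho> x + B \<rho>' x"
      by (simp add: B_def clinear_add[OF \<pi>(1)] clinear_add[OF k(1)])
    have "k (free_gen (c *\<^sub>C \<pi> \<rho>) (\<tau> x)) = k (c *\<^sub>C free_gen (\<pi> \<rho>) (\<tau> x))"
      by (rule k_eqI, rule free_gen_scale_left[OF order.refl]) (simp_all add: \<pi> \<tau> cvec.subspace_scale[OF V])
    then show "B (c *\<^sub>C \<rho>) x = c *\<^sub>C B \<rho> x"
      by (simp add: B_def clinear_scale[OF \<pi>(1)] clinear_scale[OF k(1)])
  qed
  have "free_lift (\<otimes>) p = (0 :: ('x \<Rightarrow> complex, 'w) tensor)"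
  proof (rule tensor_eval_zeroI)
    fix x
    have lin: "clinear (\<lambda>g. g x)" for x :: 'x by (rule clinear_fun_apply[OF clinear_id])
    have "tensor_lift (\<lambda>g w. g x *\<^sub>C w) (free_lift (\<otimes>) p) = free_lift (\<lambda>\<rho> w. \<rho> x *\<^sub>C w) p"
      by (subst free_lift_commute[where h = "tensor_lift (\<lambda>g w. g x *\<^sub>C w)"])
        (simp_all add: clinear_tensor_lift cbilinearI clinear_scaleC_left clinear_scaleC_right clinear_id lin)
    then show "tensor_lift (\<lambda>g w. g x *\<^sub>C w) (free_lift (\<otimes>) p) = 0" by (simp only: eval)
  qed
  then have "tensor_lift B (free_lift (\<otimes>) p) = 0" by (simp add: clinear_zero[OF clinear_tensor_lift[OF B]])
  moreover have "tensor_lift B (free_lift (\<otimes>) p) = free_lift B p"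
    by (subst free_lift_commute[OF clinear_tensor_lift[OF B]]) (simp add: B)
  moreover have "free_lift B p = k p"
  proof -
    have "free_lift B p = free_lift (\<lambda>\<rho> w. k (free_gen \<rho> w)) p"
      by (rule free_lift_cong[OF p]) (simp add: B_def \<pi> \<tau>)
    also have "\<dots> = k (free_lift free_gen p)" by (rule free_lift_commute[OF k(1), symmetric])
    finally show ?thesis by (simp only: free_lift_free_gen)
  qed
  ultimately show ?thesis using k(2) by simp
qed

text \<open>Replacing every generator in p by its \<open>P\<close> changes p only modulo
  \<open>N\<close>. The evaluations of the new sum are the values
  \<open>free_lift (K x) p = 0\<close>, so it consists of bilinear relations and lies in
  \<open>N\<close> too.\<close>

lemma free_on_kernel:
  fixes V :: "('x \<Rightarrow> complex) set" and W :: "'w::complex_vector set"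
  assumes V: "csubspace V" and W: "csubspace W"
    and N: "csubspace N" "cspan (bilinear_relators V W) \<subseteq> N"
    and K: "\<And>\<rho> w. \<rho> \<in> V \<Longrightarrow> w \<in> W \<Longrightarrow> \<exists>P \<in> free_on V W. P - free_gen \<rho> w \<in> N
      \<and> (\<forall>x. free_lift (\<lambda>\<rho> w. \<rho> x *\<^sub>C w) P = K x \<rho> w)"
    and p: "p \<in> free_on V W" and zero: "\<And>x. free_lift (K x) p = 0"
  shows "p \<in> N"
proof -
  have "\<forall>\<rho> w. \<exists>P. \<rho> \<in> V \<longrightarrow> w \<in> W \<longrightarrow> P \<in> free_on V W \<and> P - free_gen \<rho> w \<in> N
      \<and> (\<forall>x. free_lift (\<lambda>\<rho> w. \<rho> x *\<^sub>C w) P = K x \<rho> w)"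
    using K by blast
  then obtain P where P: "\<And>\<rho> w. \<rho> \<in> V \<Longrightarrow> w \<in> W \<Longrightarrow> P \<rho> w \<in> free_on V W \<and> P \<rho> w - free_gen \<rho> w \<in> N
      \<and> (\<forall>x. free_lift (\<lambda>\<rho> w. \<rho> x *\<^sub>C w) (P \<rho> w) = K x \<rho> w)"
    by metis
  let ?q = "free_lift P p"
  have "?q \<in> free_on V W"
    by (rule free_lift_in_subspace[OF csubspace_free_on p]) (simp add: P)
  moreover have "free_lift (\<lambda>\<rho> w. \<rho> x *\<^sub>C w) ?q = 0" for x
  proof -
    have "free_lift (\<lambda>\<rho> w. \<rho> x *\<^sub>C w) ?q = free_lift (K x) p"
      by (subst free_lift_commute[OF clinear_free_lift]) (rule free_lift_cong[OF p], simp add: P)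
    then show ?thesis by (simp only: zero)
  qed
  ultimately have "?q \<in> N" using free_on_eval_zero[OF V W] N(2) by blast
  moreover have "?q - p \<in> N"
  proof -
    have "?q - p = free_lift (\<lambda>\<rho> w. P \<rho> w - free_gen \<rho> w) p"
      using free_lift_free_gen[of p] unfolding free_lift_def
      by (simp add: cvec.scale_right_diff_distrib sum_subtractf)
    also have "\<dots> \<in> N" by (rule free_lift_in_subspace[OF N(1) p]) (simp add: P)
    finally show ?thesis .
  qed
  ultimately have "?q - (?q - p) \<in> N" by (rule cvec.subspace_diff[OF N(1)])
  then show ?thesis by simp
qed

text \<open>The first isomorphism theorem in coset form: two formal sums are equivalent exactly when
  \<open>free_lift f\<close> agrees on them.\<close>

lemma balanced_bij:
  fixes f :: "'v::complex_vector \<Rightarrow> 'w::complex_vector \<Rightarrow> 'c::complex_vector"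
  assumes rel: "\<And>q. q \<in> balanced_relators V R W ra la \<Longrightarrow> free_lift f q = 0"
    and inj: "\<And>p. p \<in> free_on V W \<Longrightarrow> free_lift f p = 0 \<Longrightarrow> p \<in> cspan (balanced_relators V R W ra la)"
    and surj: "\<And>x. \<exists>p \<in> free_on V W. free_lift f p = x"
  shows "free_lift f respects balanced_equiv V R W ra la \<and>
    bij_betw (balanced_lift f) (balanced_tensor V R W ra la) UNIV"
proof -
  let ?r = "balanced_equiv V R W ra la"
  have zero: "free_lift f q = 0" if "q \<in> cspan (balanced_relators V R W ra la)" for q
    using that
  proof (rule cvec.span_induct)
    show "csubspace {q. free_lift f q = 0}"
      by (rule cvec.subspaceI) (simp_all add: clinearD[OF clinear_free_lift])
  qed (rule rel)
  have eq: "(p, q) \<in> ?r \<longleftrightarrow> p \<in> free_on V W \<and> q \<in> free_on V W \<and> free_lift f p = free_lift f q" for p q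
  proof -
    have "p - q \<in> cspan (balanced_relators V R W ra la) \<longleftrightarrow> free_lift f p = free_lift f q"
      if "p \<in> free_on V W" "q \<in> free_on V W"
      using zero[of "p - q"] inj[OF cvec.subspace_diff[OF csubspace_free_on that]]
      by (auto simp: clinear_diff[OF clinear_free_lift])
    then show ?thesis by (auto simp: balanced_equiv_def)
  qed
  have lift: "balanced_lift f (?r `` {p}) = free_lift f p" if "p \<in> free_on V W" for p
  proof -
    have "free_lift f ` (?r `` {p}) = {free_lift f p}" using that by (auto simp: eq)
    then show ?thesis by (simp add: balanced_lift_def)
  qed
  have "bij_betw (balanced_lift f) (balanced_tensor V R W ra la) UNIV"
    unfolding bij_betw_def
  proof
    show "inj_on (balanced_lift f) (balanced_tensor V R W ra la)"
    proof (rule inj_onI)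
      fix X Y
      assume "X \<in> balanced_tensor V R W ra la" "Y \<in> balanced_tensor V R W ra la"
        and XY: "balanced_lift f X = balanced_lift f Y"
      then obtain p q where "p \<in> free_on V W" "q \<in> free_on V W" "X = ?r `` {p}" "Y = ?r `` {q}"
        by (auto simp: balanced_tensor_def quotient_def)
      then show "X = Y" using XY by (auto simp: lift eq)
    qed
    show "balanced_lift f ` balanced_tensor V R W ra la = UNIV"
    proof (intro equalityI subset_UNIV subsetI)
      fix x
      obtain p where p: "p \<in> free_on V W" "free_lift f p = x" using surj by blast
      then have "?r `` {p} \<in> balanced_tensor V R W ra la" by (auto simp: balanced_tensor_def quotient_def)
      then show "x \<in> balanced_lift f ` balanced_tensor V R W ra la" using lift[OF p(1)] p(2) by force
    qed
  qed
  then show ?thesis by (auto simp: congruent_def eq)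
qed

section \<open>Separating elements of the source and target algebras\<close>

context discrete_weak_multiplier_hopf_algebra
begin

text \<open>For arguments \<open>S(c v)\<close> the tensor is the flip of
  \<open>G1 ((c * v) \<otimes> b)\<close> with its second leg acted on as in \<open>G1_E\<close>,
  which gives \<open>\<epsilon>\<^sub>s(v_2) b \<otimes> S(c v_1)\<close>. Surjectivity of S and
  idempotency of A cover all a. The last equation is \<open>S(E_1) E_2 = 1\<close>.\<close>

lemma source_decomposition:
  obtains u :: "('a mult, 'a) tensor" where "u \<in> tensor_sub {y. As y} UNIV"
    "\<And>b. E \<rhd> (b \<otimes> a) = tensor_lift (\<lambda>y a'. (y \<rhd> b) \<otimes> a') u"
    "tensor_lift (\<lambda>y a'. S\<^sub>M y \<rhd> a') u = a"
proof -
  have lin: "clinear (tensor_lift (\<lambda>y a'. (y \<rhd> b) \<otimes> a'))" for b :: 'a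
    by (intro clinear_tensor_lift lin3)
  have lin': "clinear (tensor_lift (\<lambda>y a'. S\<^sub>M y \<rhd> a'))"
    by (intro clinear_tensor_lift lin3)
  have "\<exists>u \<in> tensor_sub {y. As y} UNIV. \<forall>b. E \<rhd> (b \<otimes> \<sigma> x) = tensor_lift (\<lambda>y a'. (y \<rhd> b) \<otimes> a') u" for x
    using id
  proof (induction x rule: idem_induct)
    case (mult c v)
    let ?u = "tensor_lift (\<lambda>p q. \<epsilon>\<^sub>s q \<otimes> \<sigma> p) (t2 c v)"
    have "?u \<in> tensor_sub {y. As y} UNIV"
      by (rule tensor_lift_in_subspace[OF csubspace_tensor_sub]) (simp add: tensor_sub_pair As_\<epsilon>\<^sub>s)
    moreover have "E \<rhd> (b \<otimes> \<sigma> (c * v)) = tensor_lift (\<lambda>y a'. (y \<rhd> b) \<otimes> a') ?u" for b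
    proof -
      have "E \<rhd> (b \<otimes> \<sigma> (c * v)) = tensor_lift (\<lambda>x y. y \<otimes> \<sigma> x) (tensor_lift (\<lambda>p q. p \<otimes> cs q b) (t2 c v))"
        unfolding G1_E[symmetric] G1_mult antipode_G1 ..
      also have "\<dots> = tensor_lift (\<lambda>p q. cs q b \<otimes> \<sigma> p) (t2 c v)"
        by (subst tensor_lift_compose, (intro lin3)+, subst tensor_lift_pair, (intro lin3)+, simp)
      also have "\<dots> = tensor_lift (\<lambda>y a'. (y \<rhd> b) \<otimes> a') ?u"
        by (subst tensor_lift_compose, (intro lin3)+, subst tensor_lift_pair, (intro lin3)+, simp add: \<epsilon>\<^sub>s_lact)
      finally show ?thesis .
    qed
    ultimately show ?case by blast
  next
    case (add x y)
    then obtain u w where "u \<in> tensor_sub {y. As y} UNIV" "w \<in> tensor_sub {y. As y} UNIV"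
      "\<And>b. E \<rhd> (b \<otimes> \<sigma> x) = tensor_lift (\<lambda>y a'. (y \<rhd> b) \<otimes> a') u"
      "\<And>b. E \<rhd> (b \<otimes> \<sigma> y) = tensor_lift (\<lambda>y a'. (y \<rhd> b) \<otimes> a') w" by blast
    then show ?case
      by (intro bexI[of _ "u + w"])
        (simp_all add: clinear_add[OF antiaut_clinear[OF antiaut]] tensor_pair_simps act_linear
          clinear_add[OF lin] cvec.subspace_add[OF csubspace_tensor_sub])
  qed
  from this[of "\<sigma>' a"] obtain u where u: "u \<in> tensor_sub {y. As y} UNIV"
    "\<And>b. E \<rhd> (b \<otimes> a) = tensor_lift (\<lambda>y a'. (y \<rhd> b) \<otimes> a') u" by auto
  have "tensor_lift (\<lambda>y a'. S\<^sub>M y \<rhd> a') u = a"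
  proof (rule nondeg_right_eqI[OF nd])
    fix c
    define b where "b = \<sigma>' c"
    have "c * a = tensor_lift (\<lambda>x y. \<sigma> x * y) (tensor_lift (\<lambda>y a'. (y \<rhd> b) \<otimes> a') u)"
      unfolding u(2)[symmetric] \<mu>_E by (simp add: b_def)
    also have "\<dots> = tensor_lift (\<lambda>y a'. c * (S\<^sub>M y \<rhd> a')) u"
      by (subst tensor_lift_compose, (intro lin3)+, subst tensor_lift_pair, (intro lin3)+,
        simp add: \<sigma>_act b_def mult_lact)
    also have "\<dots> = c * tensor_lift (\<lambda>y a'. S\<^sub>M y \<rhd> a') u"
      by (rule tensor_lift_commute[symmetric]) (intro lin3)
    finally show "c * tensor_lift (\<lambda>y a'. S\<^sub>M y \<rhd> a') u = c * a" by simp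
  qed
  then show thesis using that u by blast
qed

lemma E_lact_t3: "E \<rhd> ((a * e) \<otimes> b) = tensor_lift (\<lambda>p q. p \<otimes> (\<epsilon>\<^sub>t q \<rhd> b)) (t3 a e)"
proof (rule cancel_lact_left[OF nd nd id])
  fix c
  have "(emb c \<otimes>\<^sub>M 1) \<rhd> (E \<rhd> ((a * e) \<otimes> b)) = ((emb c \<otimes>\<^sub>M 1) \<rhd> (E \<rhd> (a \<otimes> b))) \<lhd> (emb e \<otimes>\<^sub>M 1)"
    by (simp add: lact_ract[OF nd2])
  also have "\<dots> = tensor_lift (\<lambda>p q. p \<otimes> (\<epsilon>\<^sub>t q \<rhd> b)) (t2 c a \<lhd> (emb e \<otimes>\<^sub>M 1))"
    unfolding E_lact_left ract_pair by (subst tensor_lift_ract) ((intro lin3)+, simp)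
  also have "\<dots> = (emb c \<otimes>\<^sub>M 1) \<rhd> tensor_lift (\<lambda>p q. p \<otimes> (\<epsilon>\<^sub>t q \<rhd> b)) (t3 a e)"
    unfolding t3_t2[symmetric] lact_pair by (subst tensor_lift_lact) ((intro lin3)+, simp)
  finally show "(emb c \<otimes>\<^sub>M 1) \<rhd> (E \<rhd> ((a * e) \<otimes> b))
    = (emb c \<otimes>\<^sub>M 1) \<rhd> tensor_lift (\<lambda>p q. p \<otimes> (\<epsilon>\<^sub>t q \<rhd> b)) (t3 a e)" .
qed

text \<open>By \<open>G1_E\<close> the first leg of \<open>G1 (h \<otimes> a)\<close> is
  \<open>h S\<^sup>-\<^sup>1(E_2)\<close>, and \<open>E_lact_t3\<close> makes \<open>E_2\<close>
  explicit as \<open>\<epsilon>\<^sub>t(a_2)\<close>. The last equation holds because multiplying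
  the legs of \<open>G1 (h \<otimes> a)\<close> returns \<open>h a\<close>.\<close>

lemma target_decomposition:
  obtains u :: "('a mult, 'a) tensor" where "u \<in> tensor_sub {x. At x} UNIV"
    "\<And>h. G1 (h \<otimes> a) = tensor_lift (\<lambda>x a'. (h \<lhd> S\<^sub>M x) \<otimes> a') u"
    "tensor_lift (\<lambda>x a'. S\<^sub>M x \<rhd> a') u = a"
proof -
  have lin: "clinear (tensor_lift (\<lambda>x a'. (h \<lhd> S\<^sub>M x) \<otimes> a'))" for h :: 'a
    by (intro clinear_tensor_lift lin3)
  have "\<exists>u \<in> tensor_sub {x. At x} UNIV. \<forall>h. G1 (h \<otimes> a) = tensor_lift (\<lambda>x a'. (h \<lhd> S\<^sub>M x) \<otimes> a') u"
    using id
  proof (induction a rule: idem_induct)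
    case (mult a e)
    \<comment> \<open>The double inverse is chosen so that \<open>S\<^sub>M\<close> of the first leg
      is \<open>S\<^sub>M' (\<epsilon>\<^sub>t q)\<close>: the coefficient has to act on h as an
      element of the target algebra does on the cointegrals.\<close>
    let ?u = "tensor_lift (\<lambda>p q. S\<^sub>M' (S\<^sub>M' (\<epsilon>\<^sub>t q)) \<otimes> p) (t3 a e)"
    have "?u \<in> tensor_sub {x. At x} UNIV"
      by (rule tensor_lift_in_subspace[OF csubspace_tensor_sub]) (simp add: tensor_sub_pair At_S'_S'_\<epsilon>\<^sub>t)
    moreover have "G1 (h \<otimes> (a * e)) = tensor_lift (\<lambda>x a'. (h \<lhd> S\<^sub>M x) \<otimes> a') ?u" for h
    proof -
      have "G1 (h \<otimes> (a * e)) = tensor_lift (\<lambda>y z. \<sigma>' z \<otimes> y) (tensor_lift (\<lambda>x y. y \<otimes> \<sigma> x) (G1 (h \<otimes> (a * e))))"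
        by (subst tensor_lift_compose, (intro lin3)+, subst tensor_lift_pair, (intro lin3)+, simp)
      also have "\<dots> = tensor_lift (\<lambda>p q. (h \<lhd> S\<^sub>M' (\<epsilon>\<^sub>t q)) \<otimes> p) (t3 a e)"
        unfolding G1_E E_lact_t3
        by (subst tensor_lift_compose, (intro lin3)+, subst tensor_lift_pair, (intro lin3)+, simp add: \<sigma>'_act)
      also have "\<dots> = tensor_lift (\<lambda>x a'. (h \<lhd> S\<^sub>M x) \<otimes> a') ?u"
        by (subst tensor_lift_compose, (intro lin3)+, subst tensor_lift_pair, (intro lin3)+, simp)
      finally show ?thesis .
    qed
    ultimately show ?case by blast
  next
    case (add x y)
    then obtain u w where "u \<in> tensor_sub {y. At y} UNIV" "w \<in> tensor_sub {y. At y} UNIV"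
      "\<And>h. G1 (h \<otimes> x) = tensor_lift (\<lambda>x a'. (h \<lhd> S\<^sub>M x) \<otimes> a') u"
      "\<And>h. G1 (h \<otimes> y) = tensor_lift (\<lambda>x a'. (h \<lhd> S\<^sub>M x) \<otimes> a') w" by blast
    then show ?case
      by (intro bexI[of _ "u + w"])
        (simp_all add: tensor_pair_simps clinear_add[OF G1_linear]
          clinear_add[OF lin] cvec.subspace_add[OF csubspace_tensor_sub])
  qed
  then obtain u where u: "u \<in> tensor_sub {x. At x} UNIV"
    "\<And>h. G1 (h \<otimes> a) = tensor_lift (\<lambda>x a'. (h \<lhd> S\<^sub>M x) \<otimes> a') u" by blast
  have "tensor_lift (\<lambda>x a'. S\<^sub>M x \<rhd> a') u = a"
  proof (rule nondeg_right_eqI[OF nd])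
    fix h
    have "\<sigma> (h * a) = tensor_lift (\<lambda>x y. \<sigma> x * y) (E \<rhd> (a \<otimes> \<sigma> h))" by (simp only: \<mu>_E \<sigma>_mult)
    also have "\<dots> = tensor_lift (\<lambda>x y. \<sigma> (x * y)) (G1 (h \<otimes> a))"
      unfolding G1_E[symmetric]
      by (subst tensor_lift_compose, (intro lin3)+, subst tensor_lift_pair, (intro lin3)+, simp add: \<sigma>_mult)
    also have "\<dots> = tensor_lift (\<lambda>x a'. \<sigma> (h * (S\<^sub>M x \<rhd> a'))) u"
      unfolding u(2)
      by (subst tensor_lift_compose, (intro lin3)+, subst tensor_lift_pair, (intro lin3)+, simp add: mult_lact)
    also have "\<dots> = \<sigma> (h * tensor_lift (\<lambda>x a'. S\<^sub>M x \<rhd> a') u)"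
      by (rule tensor_lift_commute[where h = "\<lambda>x. \<sigma> (h * x)", symmetric]) (intro lin3)
    finally show "h * tensor_lift (\<lambda>x a'. S\<^sub>M x \<rhd> a') u = h * a" by (metis \<sigma>_inv(2))
  qed
  then show thesis using that u by blast
qed

text \<open>The flip property carries the decomposition of left multiplication by E to right
  multiplication.\<close>

lemma E_ract_source:
  assumes u: "\<And>b. E \<rhd> (b \<otimes> a) = tensor_lift (\<lambda>y a'. (y \<rhd> b) \<otimes> a') u"
  shows "(\<sigma> a \<otimes> h) \<lhd> E = tensor_lift (\<lambda>y a'. \<sigma> a' \<otimes> (h \<lhd> S\<^sub>M y)) u"
proof -
  have "(\<sigma> a \<otimes> h) \<lhd> E = \<theta> \<sigma> (E \<rhd> (\<sigma>' h \<otimes> a))" by (simp add: \<theta>_lact_E \<theta>_pair[OF antiaut])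
  then show ?thesis
    unfolding u by (simp add: tensor_lift_commute[OF clinear_\<theta>[OF antiaut]] \<theta>_pair[OF antiaut] \<sigma>_act)
qed

subsection \<open>The slice maps\<close>

lemma functional_times_emb: "functional_times \<omega> (emb a) = (\<lambda>x. \<omega> (x * a))"
  by (simp add: functional_times_def)

lemma reduced_dualI: "clinear \<omega> \<Longrightarrow> (\<lambda>x. \<omega> (x * a)) \<in> reduced_dual"
  unfolding reduced_dual_def functional_times_emb[symmetric] by blast

lemma reduced_dualE:
  assumes "\<rho> \<in> reduced_dual"
  obtains \<omega> a where "clinear \<omega>" "\<rho> = functional_times \<omega> (emb a)"
  using assms unfolding reduced_dual_def by blast

lemma clinear_functional:
  fixes \<omega> :: "'b::complex_vector \<Rightarrow> complex"
  shows "clinear \<omega> \<Longrightarrow> clinear f \<Longrightarrow> clinear (\<lambda>x. \<omega> (f x))"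
  by (rule clinear_compose)

lemma reduced_dual_clinear: "\<rho> \<in> reduced_dual \<Longrightarrow> clinear \<rho>"
  by (erule reduced_dualE) (simp only: functional_times_emb, erule clinear_functional[OF _ clinear_mult_left[OF clinear_id]])

text \<open>On the right \<open>\<omega>\<close> and a occur only in the combination
  \<open>\<omega>(p a)\<close>. Hence the slice depends on the reduced functional alone, as
  \<open>f_s_functional\<close> needs for the \<open>THE\<close> in \<open>f_s\<close>.\<close>

lemma slice_t3:
  assumes \<omega>: "clinear \<omega>"
  shows "slice_left \<omega> (t3 h a) * b = tensor_lift (\<lambda>p q. \<omega> (p * a) *\<^sub>C q) (t1 h b)"
proof -
  note lin = lin3 clinear_functional[OF \<omega>] \<omega>
  have "slice_left \<omega> (t3 h a) * b = tensor_lift (\<lambda>p q. \<omega> p *\<^sub>C q) (t3 h a \<lhd> (1 \<otimes>\<^sub>M emb b))"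
    unfolding slice_left_def
    by (subst tensor_lift_ract, (intro lin)+, subst tensor_lift_commute[where h = "\<lambda>x. x * b"])
      (intro lin, simp add: scaleC_mult_left)
  also have "\<dots> = tensor_lift (\<lambda>p q. \<omega> (p * a) *\<^sub>C q) (t1 h b)"
    unfolding t3_t1[symmetric] by (subst tensor_lift_ract) ((intro lin)+, simp)
  finally show ?thesis .
qed

lemma slice_t1:
  assumes \<omega>: "clinear \<omega>"
  shows "c * slice_right \<omega> (t1 h a) = tensor_lift (\<lambda>p q. \<omega> (q * a) *\<^sub>C p) (t2 c h)"
proof -
  note lin = lin3 clinear_functional[OF \<omega>] \<omega>
  have "c * slice_right \<omega> (t1 h a) = tensor_lift (\<lambda>p q. \<omega> q *\<^sub>C p) ((emb c \<otimes>\<^sub>M 1) \<rhd> t1 h a)"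
    unfolding slice_right_def
    by (subst tensor_lift_lact, (intro lin)+, subst tensor_lift_commute[where h = "\<lambda>x. c * x"])
      (intro lin, simp add: scaleC_mult_right)
  also have "\<dots> = tensor_lift (\<lambda>p q. \<omega> (q * a) *\<^sub>C p) (t2 c h)"
    unfolding t1_t2 by (subst tensor_lift_ract) ((intro lin)+, simp)
  finally show ?thesis .
qed

lemma f_s_functional:
  assumes \<omega>: "clinear \<omega>"
  shows "f_s \<Delta> (functional_times \<omega> (emb a)) h = slice_left \<omega> (t3 h a)"
  unfolding f_s_def
proof (rule the_equality)
  show "\<exists>\<omega>' a' t. clinear \<omega>' \<and> functional_times \<omega> (emb a) = functional_times \<omega>' (emb a') \<and>
      emb t = \<Delta> h * (emb a' \<otimes>\<^sub>M 1) \<and> slice_left \<omega> (t3 h a) = slice_left \<omega>' t"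
    using \<omega> emb_t3 by blast
  fix x
  assume "\<exists>\<omega>' a' t. clinear \<omega>' \<and> functional_times \<omega> (emb a) = functional_times \<omega>' (emb a') \<and>
      emb t = \<Delta> h * (emb a' \<otimes>\<^sub>M 1) \<and> x = slice_left \<omega>' t"
  then obtain \<omega>' a' t where \<omega>': "clinear \<omega>'" "functional_times \<omega> (emb a) = functional_times \<omega>' (emb a')"
    and t: "emb t = emb (t3 h a')" and x: "x = slice_left \<omega>' t" by (auto simp: emb_t3)
  show "x = slice_left \<omega> (t3 h a)"
  proof (rule nondeg_left_eqI[OF nd])
    show "x * b = slice_left \<omega> (t3 h a) * b" for b
      using t \<omega>'(2) by (simp add: x emb_eq_iff[OF nd2] slice_t3[OF \<omega>] slice_t3[OF \<omega>'(1)]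
        functional_times_emb fun_eq_iff)
  qed
qed

lemma f_t_functional:
  assumes \<omega>: "clinear \<omega>"
  shows "f_t \<Delta> (functional_times \<omega> (emb a)) h = slice_right \<omega> (t1 h a)"
  unfolding f_t_def
proof (rule the_equality)
  show "\<exists>\<omega>' a' t. clinear \<omega>' \<and> functional_times \<omega> (emb a) = functional_times \<omega>' (emb a') \<and>
      emb t = \<Delta> h * (1 \<otimes>\<^sub>M emb a') \<and> slice_right \<omega> (t1 h a) = slice_right \<omega>' t"
    using \<omega> emb_t1 by blast
  fix x
  assume "\<exists>\<omega>' a' t. clinear \<omega>' \<and> functional_times \<omega> (emb a) = functional_times \<omega>' (emb a') \<and>
      emb t = \<Delta> h * (1 \<otimes>\<^sub>M emb a') \<and> x = slice_right \<omega>' t"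
  then obtain \<omega>' a' t where \<omega>': "clinear \<omega>'" "functional_times \<omega> (emb a) = functional_times \<omega>' (emb a')"
    and t: "emb t = emb (t1 h a')" and x: "x = slice_right \<omega>' t" by (auto simp: emb_t1)
  show "x = slice_right \<omega> (t1 h a)"
  proof (rule nondeg_right_eqI[OF nd])
    show "c * x = c * slice_right \<omega> (t1 h a)" for c
      using t \<omega>'(2) by (simp add: x emb_eq_iff[OF nd2] slice_t1[OF \<omega>] slice_t1[OF \<omega>'(1)]
        functional_times_emb fun_eq_iff)
  qed
qed

lemma f_s_times:
  assumes "\<rho> \<in> reduced_dual"
  shows "f_s \<Delta> \<rho> h * b = tensor_lift (\<lambda>p q. \<rho> p *\<^sub>C q) (t1 h b)"
proof -
  obtain \<omega> a where \<omega>: "clinear \<omega>" and \<rho>: "\<rho> = functional_times \<omega> (emb a)"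
    using assms by (rule reduced_dualE)
  show ?thesis unfolding \<rho> f_s_functional[OF \<omega>] slice_t3[OF \<omega>] by (simp only: functional_times_emb)
qed

lemma f_t_times:
  assumes "\<rho> \<in> reduced_dual"
  shows "c * f_t \<Delta> \<rho> h = tensor_lift (\<lambda>p q. \<rho> q *\<^sub>C p) (t2 c h)"
proof -
  obtain \<omega> a where \<omega>: "clinear \<omega>" and \<rho>: "\<rho> = functional_times \<omega> (emb a)"
    using assms by (rule reduced_dualE)
  show ?thesis unfolding \<rho> f_t_functional[OF \<omega>] slice_t1[OF \<omega>] by (simp only: functional_times_emb)
qed

subsection \<open>The balanced relations\<close>

lemma csubspace_cointegrals: "csubspace (cointegrals \<Delta> S)"
  by (rule cvec.subspaceI) (simp_all add: cointegrals_iff act_linear distrib_left scaleC_mult_right)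

lemma extend_antihom_S: "extend_antihom S = S\<^sub>M"
  using extend_antihom_eq[OF nd antiaut] by (simp only: emb_\<sigma>)

lemma act_element_eq: "act_element S y h = h \<lhd> S\<^sub>M y"
  by (simp add: act_element_def extend_antihom_S)

lemma act_functional_eq: "act_functional S \<rho> y = (\<lambda>x. \<rho> (x \<lhd> S\<^sub>M y))"
  by (simp add: act_functional_def extend_antihom_S functional_times_def)

lemma act_functional_times: "act_functional S (\<lambda>x. \<omega> (x * a)) y = (\<lambda>x. \<omega> (x * (S\<^sub>M y \<rhd> a)))"
  by (simp add: act_functional_eq mult_lact)

lemma act_element_cointegral: "h \<in> cointegrals \<Delta> S \<Longrightarrow> h \<lhd> m \<in> cointegrals \<Delta> S"
  by (simp add: cointegrals_iff ract_mult[symmetric] lact_ract[OF nd, symmetric])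

lemma act_functional_reduced: "\<rho> \<in> reduced_dual \<Longrightarrow> act_functional S \<rho> y \<in> reduced_dual"
  by (elim reduced_dualE) (simp add: functional_times_emb act_functional_times reduced_dualI)

lemma balanced_relators_zero:
  assumes add1: "\<And>\<rho> \<rho>' h. \<rho> \<in> V \<Longrightarrow> \<rho>' \<in> V \<Longrightarrow> \<rho> + \<rho>' \<in> V \<Longrightarrow> h \<in> H \<Longrightarrow> f (\<rho> + \<rho>') h = f \<rho> h + f \<rho>' h"
    and add2: "\<And>\<rho> h h'. \<rho> \<in> V \<Longrightarrow> h \<in> H \<Longrightarrow> h' \<in> H \<Longrightarrow> f \<rho> (h + h') = f \<rho> h + f \<rho> h'"
    and scale1: "\<And>\<rho> c h. \<rho> \<in> V \<Longrightarrow> c *\<^sub>C \<rho> \<in> V \<Longrightarrow> h \<in> H \<Longrightarrow> f (c *\<^sub>C \<rho>) h = c *\<^sub>C f \<rho> h"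
    and scale2: "\<And>\<rho> c h. \<rho> \<in> V \<Longrightarrow> h \<in> H \<Longrightarrow> f \<rho> (c *\<^sub>C h) = c *\<^sub>C f \<rho> h"
    and act: "\<And>\<rho> r h. \<rho> \<in> V \<Longrightarrow> r \<in> R \<Longrightarrow> h \<in> H \<Longrightarrow> f (ra \<rho> r) h = f \<rho> (la r h)"
    and q: "q \<in> balanced_relators V R H ra la"
  shows "free_lift f q = 0"
  using q unfolding balanced_relators_def bilinear_relators_def
  by (auto simp: clinear_diff[OF clinear_free_lift] clinear_scale[OF clinear_free_lift] free_lift_gen
      add1 add2 scale1 scale2 act)

text \<open>The balancing relation holds because
  \<open>\<Delta>(h S(y)) = \<Delta>(h)(S(y) \<otimes> 1)\<close> for y in the source
  algebra.\<close>

lemma f_s_relators: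
  assumes "q \<in> balanced_relators reduced_dual (source_algebra \<Delta> E) (cointegrals \<Delta> S)
    (act_functional S) (act_element S)"
  shows "free_lift (f_s \<Delta>) q = 0"
proof (rule balanced_relators_zero[OF _ _ _ _ _ assms]; rule nondeg_left_eqI[OF nd])
  fix \<rho> \<rho>' :: "'a \<Rightarrow> complex" and h h' b :: 'a and c assume \<rho>: "\<rho> \<in> reduced_dual"
  have bl: "cbilinear (\<lambda>p q. \<rho> p *\<^sub>C q)" by (intro clin reduced_dual_clinear[OF \<rho>])
  note lin = clinearD[OF clinear_tensor_lift[OF bl]]
  show "f_s \<Delta> (\<rho> + \<rho>') h * b = (f_s \<Delta> \<rho> h + f_s \<Delta> \<rho>' h) * b"
    if "\<rho>' \<in> reduced_dual" "\<rho> + \<rho>' \<in> reduced_dual"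
    using that \<rho> by (simp add: f_s_times distrib_right scaleC_add_left tensor_lift_add)
  show "f_s \<Delta> (c *\<^sub>C \<rho>) h * b = (c *\<^sub>C f_s \<Delta> \<rho> h) * b" if "c *\<^sub>C \<rho> \<in> reduced_dual"
    using that \<rho> by (simp add: f_s_times scaleC_mult_left scaleC_fun_def scaleC_complex_def
      tensor_lift_scale[symmetric] scaleC_scaleC)
  show "f_s \<Delta> \<rho> (h + h') * b = (f_s \<Delta> \<rho> h + f_s \<Delta> \<rho> h') * b"
    using \<rho> by (simp add: f_s_times distrib_right tensor_pair_simps clinear_add[OF clin_T1[OF clinear_id]] lin)
  show "f_s \<Delta> \<rho> (c *\<^sub>C h) * b = (c *\<^sub>C f_s \<Delta> \<rho> h) * b"
    using \<rho> by (simp add: f_s_times scaleC_mult_left tensor_pair_simps clinear_scale[OF clin_T1[OF clinear_id]] lin)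
  show "f_s \<Delta> (act_functional S \<rho> y) h * b = f_s \<Delta> \<rho> (act_element S y h) * b"
    if "y \<in> source_algebra \<Delta> E" for y
  proof -
    have "emb (t1 (h \<lhd> S\<^sub>M y) b) = emb (t1 h b) * (S\<^sub>M y \<otimes>\<^sub>M 1)"
      using that by (simp add: emb_t1 source_algebra_iff As_coprod_S mult.assoc mtensor_times)
    then have "t1 (h \<lhd> S\<^sub>M y) b = t1 h b \<lhd> (S\<^sub>M y \<otimes>\<^sub>M 1)" by (simp add: emb_times emb_eq_iff[OF nd2])
    then show ?thesis
      by (simp add: f_s_times \<rho> act_functional_reduced act_element_eq tensor_lift_ract[OF bl])
        (simp add: act_functional_eq)
  qed
qed

text \<open>Here the balancing relation rests on
  \<open>\<Delta>(h S(y)) = \<Delta>(h)(1 \<otimes> S(y))\<close> for y in the target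
  algebra.\<close>

lemma f_t_relators:
  assumes "q \<in> balanced_relators reduced_dual (target_algebra \<Delta> E) (cointegrals \<Delta> S)
    (act_functional S) (act_element S)"
  shows "free_lift (f_t \<Delta>) q = 0"
proof (rule balanced_relators_zero[OF _ _ _ _ _ assms]; rule nondeg_right_eqI[OF nd])
  fix \<rho> \<rho>' :: "'a \<Rightarrow> complex" and h h' b :: 'a and c assume \<rho>: "\<rho> \<in> reduced_dual"
  have bl: "cbilinear (\<lambda>p q. \<rho> q *\<^sub>C p)" by (intro clin reduced_dual_clinear[OF \<rho>])
  note lin = clinearD[OF clinear_tensor_lift[OF bl]]
  show "b * f_t \<Delta> (\<rho> + \<rho>') h = b * (f_t \<Delta> \<rho> h + f_t \<Delta> \<rho>' h)"
    if "\<rho>' \<in> reduced_dual" "\<rho> + \<rho>' \<in> reduced_dual"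
    using that \<rho> by (simp add: f_t_times distrib_left scaleC_add_left tensor_lift_add)
  show "b * f_t \<Delta> (c *\<^sub>C \<rho>) h = b * (c *\<^sub>C f_t \<Delta> \<rho> h)" if "c *\<^sub>C \<rho> \<in> reduced_dual"
    using that \<rho> by (simp add: f_t_times scaleC_mult_right scaleC_fun_def scaleC_complex_def
      tensor_lift_scale[symmetric] scaleC_scaleC)
  show "b * f_t \<Delta> \<rho> (h + h') = b * (f_t \<Delta> \<rho> h + f_t \<Delta> \<rho> h')"
    using \<rho> by (simp add: f_t_times distrib_left tensor_pair_simps clinear_add[OF clin_T2[OF clinear_id]] lin)
  show "b * f_t \<Delta> \<rho> (c *\<^sub>C h) = b * (c *\<^sub>C f_t \<Delta> \<rho> h)"
    using \<rho> by (simp add: f_t_times scaleC_mult_right tensor_pair_simps clinear_scale[OF clin_T2[OF clinear_id]] lin)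
  show "b * f_t \<Delta> (act_functional S \<rho> y) h = b * f_t \<Delta> \<rho> (act_element S y h)"
    if "y \<in> target_algebra \<Delta> E" for y
  proof -
    have "emb (t2 b (h \<lhd> S\<^sub>M y)) = emb (t2 b h) * (1 \<otimes>\<^sub>M S\<^sub>M y)"
      using that by (simp add: emb_t2 target_algebra_iff At_coprod_S_right mult.assoc)
    then have "t2 b (h \<lhd> S\<^sub>M y) = t2 b h \<lhd> (1 \<otimes>\<^sub>M S\<^sub>M y)" by (simp add: emb_times emb_eq_iff[OF nd2])
    then show ?thesis
      by (simp add: f_t_times \<rho> act_functional_reduced act_element_eq tensor_lift_ract[OF bl])
        (simp add: act_functional_eq)
  qed
qed

subsection \<open>Recovering an element from its slices\<close>

text \<open>Both sides stand for \<open>h_1 a \<otimes> h_2 \<otimes> h_3 b\<close>.\<close>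

lemma T1_t3: "tensor_lift (\<lambda>r w. r \<otimes> t1 w b) (t3 h a) = tensor_lift (\<lambda>p q. tensor_assoc (t3 p a \<otimes> q)) (t1 h b)"
proof (rule cancel_lact_left[OF nd nd2 id])
  fix c
  have "(emb c \<otimes>\<^sub>M 1) \<rhd> tensor_lift (\<lambda>r w. r \<otimes> t1 w b) (t3 h a)
      = tensor_lift (\<lambda>r w. r \<otimes> t1 w b) (t2 c h \<lhd> (emb a \<otimes>\<^sub>M 1))"
    unfolding t3_t2[symmetric] lact_pair by (subst tensor_lift_lact) ((intro lin3)+, simp)
  also have "\<dots> = tensor_lift (\<lambda>r w. r \<otimes> t1 w b) (t2 c h) \<lhd> (emb a \<otimes>\<^sub>M (1 \<otimes>\<^sub>M 1))"
    unfolding ract_pair by (subst tensor_lift_ract) ((intro lin3)+, simp add: one_mtensor_one)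
  also have "\<dots> = (emb c \<otimes>\<^sub>M (1 \<otimes>\<^sub>M 1)) \<rhd> tensor_lift (\<lambda>p q. tensor_assoc (t3 p a \<otimes> q)) (t1 h b)"
    unfolding coassociative_tensor[symmetric] ract_assoc_sum lact_assoc_sum by (simp add: t3_t2)
  finally show "(emb c \<otimes>\<^sub>M 1) \<rhd> tensor_lift (\<lambda>r w. r \<otimes> t1 w b) (t3 h a)
    = (emb c \<otimes>\<^sub>M 1) \<rhd> tensor_lift (\<lambda>p q. tensor_assoc (t3 p a \<otimes> q)) (t1 h b)"
    by (simp only: one_mtensor_one)
qed

lemma T1_t3_lift:
  assumes F: "ctrilinear F"
  shows "tensor_lift (\<lambda>r w. tensor_lift (\<lambda>x y. F r x y) (t1 w b)) (t3 h a)
    = tensor_lift (\<lambda>p q. tensor_lift (\<lambda>x y. F x y q) (t3 p a)) (t1 h b)"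
proof -
  let ?F = "tensor_lift (\<lambda>x w. tensor_lift (F x) w)"
  have lin: "clinear ?F" by (rule clinear_tensor_lift[OF ctrilinear_lift[OF F]])
  have "?F (tensor_lift (\<lambda>r w. r \<otimes> t1 w b) (t3 h a))
      = ?F (tensor_lift (\<lambda>p q. tensor_assoc (t3 p a \<otimes> q)) (t1 h b))" by (simp only: T1_t3)
  then show ?thesis
    by (simp only: tensor_lift_commute[OF lin] tensor_lift3_assoc[OF F] tensor_lift3_pair[OF F])
qed

text \<open>\<open>\<omega>(v h_1 a) h_2\<close> with v left open. Since the functional of v stays a
  tensor leg, v can later be replaced by something built from the other leg.\<close>

definition U\<^sub>s :: "('a \<Rightarrow> complex) \<Rightarrow> 'a \<Rightarrow> 'a \<Rightarrow> ('a \<Rightarrow> complex, 'a) tensor"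
  where "U\<^sub>s \<omega> a h = tensor_lift (\<lambda>r w. (\<lambda>v. \<omega> (v * r)) \<otimes> w) (t3 h a)"

definition U\<^sub>t :: "('a \<Rightarrow> complex) \<Rightarrow> 'a \<Rightarrow> 'a \<Rightarrow> ('a \<Rightarrow> complex, 'a) tensor"
  where "U\<^sub>t \<omega> a h = tensor_lift (\<lambda>p q. (\<lambda>v. \<omega> (v * q)) \<otimes> p) (t1 h a)"

lemma csubspace_functionals: "csubspace {g :: 'a \<Rightarrow> complex. clinear g}"
  by (rule cvec.subspaceI)
    (simp_all add: clinear_0 clinear_plus clinear_scaleC_right plus_fun_def zero_fun_def scaleC_fun_def)

lemma cbilinear_eval: "cbilinear (\<lambda>g w. g x *\<^sub>C w)"
  by (intro clin clinear_fun_apply[OF clinear_id])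

lemma U\<^sub>s_eval: "tensor_lift (\<lambda>g w. g v *\<^sub>C w) (U\<^sub>s \<omega> a h) = tensor_lift (\<lambda>r w. \<omega> (v * r) *\<^sub>C w) (t3 h a)"
  unfolding U\<^sub>s_def tensor_lift_compose[OF cbilinear_eval] tensor_lift_pair[OF cbilinear_eval] ..

lemma U\<^sub>t_eval: "tensor_lift (\<lambda>g w. g v *\<^sub>C w) (U\<^sub>t \<omega> a h) = tensor_lift (\<lambda>p q. \<omega> (v * q) *\<^sub>C p) (t1 h a)"
  unfolding U\<^sub>t_def tensor_lift_compose[OF cbilinear_eval] tensor_lift_pair[OF cbilinear_eval] ..

text \<open>\<open>S(v)\<close> on the first leg of \<open>\<Delta>(h)\<close> is v on the second
  one, where it comes out of the slice. This is the only place where the injectivity of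
  \<open>f_s\<close> uses that h is a cointegral.\<close>

lemma U\<^sub>s_eval_cointegral:
  assumes \<omega>: "clinear \<omega>" and h: "h \<in> cointegrals \<Delta> S"
  shows "tensor_lift (\<lambda>g w. g (\<sigma> v) *\<^sub>C w) (U\<^sub>s \<omega> a h) = v * slice_left \<omega> (t3 h a)"
proof -
  note lin = lin3 clinear_functional[OF \<omega>] \<omega>
  have "tensor_lift (\<lambda>r w. \<omega> (\<sigma> v * r) *\<^sub>C w) (t3 h a)
      = tensor_lift (\<lambda>r w. \<omega> r *\<^sub>C w) ((emb (\<sigma> v) \<otimes>\<^sub>M 1) \<rhd> t3 h a)"
    by (subst tensor_lift_lact) ((rule cbilinearI, rule clinear_scaleC_right, rule clinear_id, rule clinear_scaleC_left, rule \<omega>), simp)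
  also have "\<dots> = v * slice_left \<omega> (t3 h a)"
    unfolding cointegral_t3_lact[OF h, symmetric] slice_left_def
    by (subst tensor_lift_lact, (rule cbilinearI, rule clinear_scaleC_right, rule clinear_id, rule clinear_scaleC_left, rule \<omega>),
      subst tensor_lift_commute[where h = "\<lambda>x. v * x"]) (intro lin3, simp add: scaleC_mult_right)
  finally show ?thesis by (simp only: U\<^sub>s_eval)
qed

lemma U\<^sub>t_eval_cointegral:
  assumes \<omega>: "clinear \<omega>" and h: "h \<in> cointegrals \<Delta> S"
  shows "tensor_lift (\<lambda>g w. g v *\<^sub>C w) (U\<^sub>t \<omega> a h) = \<sigma> v * slice_right \<omega> (t1 h a)"
proof -
  have "tensor_lift (\<lambda>p q. \<omega> (v * q) *\<^sub>C p) (t1 h a)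
      = tensor_lift (\<lambda>p q. \<omega> q *\<^sub>C p) ((1 \<otimes>\<^sub>M emb v) \<rhd> t1 h a)"
    by (subst tensor_lift_lact) ((rule cbilinearI, rule clinear_scaleC_left, rule \<omega>, rule clinear_scaleC_right, rule clinear_id), simp)
  also have "\<dots> = \<sigma> v * slice_right \<omega> (t1 h a)"
    unfolding cointegral_T1_lact[OF h] slice_right_def
    by (subst tensor_lift_lact, (rule cbilinearI, rule clinear_scaleC_left, rule \<omega>, rule clinear_scaleC_right, rule clinear_id),
      subst tensor_lift_commute[where h = "\<lambda>x. \<sigma> v * x"]) (intro lin3, simp add: scaleC_mult_right)
  finally show ?thesis by (simp only: U\<^sub>t_eval)
qed

text \<open>The substitution \<open>v = z S\<^sup>-\<^sup>1(h\<^sub>(\<^sub>2\<^sub>))\<close> in \<open>\<omega>(v h\<^sub>(\<^sub>1\<^sub>) a) h\<^sub>(\<^sub>2\<^sub>) \<otimes> h\<^sub>(\<^sub>3\<^sub>)\<close> produces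
  \<open>S\<^sup>-\<^sup>1(h\<^sub>(\<^sub>2\<^sub>)) h\<^sub>(\<^sub>1\<^sub>) \<otimes> h\<^sub>(\<^sub>3\<^sub>) = (S\<^sup>-\<^sup>1 \<otimes> id)((1 \<otimes> h) E)\<close>, from which h can be recovered.\<close>

lemma source_substitution:
  obtains \<Phi> where "clinear \<Phi>" "\<And>\<omega> a h. clinear \<omega> \<Longrightarrow> \<Phi> (U\<^sub>s \<omega> a h)
      = tensor_lift (\<lambda>x y. \<omega> (z \<rhd> \<sigma>' x) *\<^sub>C y) ((\<sigma> a \<otimes> h) \<lhd> E) * b"
proof -
  \<comment> \<open>The tensor has arbitrary functions as its first leg, but the summand below is
    bilinear only for linear ones. The projection makes \<open>\<Phi>\<close> linear everywhere and
    does nothing to the functionals that occur.\<close>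
  obtain \<pi> :: "('a \<Rightarrow> complex) \<Rightarrow> ('a \<Rightarrow> complex)"
    where \<pi>: "clinear \<pi>" "\<And>g. \<pi> g \<in> {g. clinear g}" "\<And>g. g \<in> {g. clinear g} \<Longrightarrow> \<pi> g = g"
    by (rule csubspace_projection[OF csubspace_functionals], rule that)
  have \<pi>lin: "clinear (\<lambda>x. \<pi> g (f x))" if "clinear f" for g and f :: "'b::complex_vector \<Rightarrow> 'a"
    using clinear_functional[OF _ that] \<pi>(2) by blast
  note lin = lin3 \<pi>lin clinear_fun_apply[OF \<pi>(1)]
  have bl: "cbilinear (\<lambda>g w. tensor_lift (\<lambda>x y. \<pi> g (z \<rhd> \<sigma>' x) *\<^sub>C y) (t1 w b))" by (intro lin)
  show thesis
  proof (rule that)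
    show "clinear (tensor_lift (\<lambda>g w. tensor_lift (\<lambda>x y. \<pi> g (z \<rhd> \<sigma>' x) *\<^sub>C y) (t1 w b)))"
      by (rule clinear_tensor_lift[OF bl])
    fix \<omega> :: "'a \<Rightarrow> complex" and a h :: 'a assume \<omega>: "clinear \<omega>"
    have \<omega>lin: "clinear (\<lambda>x. \<omega> (f x))" if "clinear f" for f :: "'b::complex_vector \<Rightarrow> 'a"
      by (rule clinear_compose[OF \<omega> that])
    note lin = lin3 \<omega>lin
    have \<pi>\<omega>: "\<pi> (\<lambda>v. \<omega> (v * r)) = (\<lambda>v. \<omega> (v * r))" for r
      by (rule \<pi>(3)) (simp, intro lin)
    have "tensor_lift (\<lambda>g w. tensor_lift (\<lambda>x y. \<pi> g (z \<rhd> \<sigma>' x) *\<^sub>C y) (t1 w b)) (U\<^sub>s \<omega> a h)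
        = tensor_lift (\<lambda>r w. tensor_lift (\<lambda>x y. \<omega> ((z \<rhd> \<sigma>' x) * r) *\<^sub>C y) (t1 w b)) (t3 h a)"
      unfolding U\<^sub>s_def tensor_lift_compose[OF bl] tensor_lift_pair[OF bl] \<pi>\<omega> ..
    also have "\<dots> = tensor_lift (\<lambda>p q. tensor_lift (\<lambda>x y. \<omega> ((z \<rhd> \<sigma>' y) * x) *\<^sub>C q) (t3 p a)) (t1 h b)"
      by (rule T1_t3_lift) (intro lin)
    also have "\<dots> = tensor_lift (\<lambda>p q. \<omega> (z \<rhd> \<sigma>' (\<sigma> a \<lhd> \<epsilon>\<^sub>s p)) *\<^sub>C q) (t1 h b)"
    proof -
      have "tensor_lift (\<lambda>x y. \<omega> ((z \<rhd> \<sigma>' y) * x) *\<^sub>C q) (t3 p a) = \<omega> (z \<rhd> \<sigma>' (\<sigma> a \<lhd> \<epsilon>\<^sub>s p)) *\<^sub>C q" for p q :: 'a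
        unfolding \<epsilon>\<^sub>s_ract \<sigma>_inv
        by (subst tensor_lift_commute[where h = "\<lambda>x. \<omega> (z \<rhd> \<sigma>' x) *\<^sub>C q"])
          (intro lin, simp add: \<sigma>'_mult lact_mult)
      then show ?thesis by (simp only:)
    qed
    also have "\<dots> = tensor_lift (\<lambda>x y. \<omega> (z \<rhd> \<sigma>' x) *\<^sub>C y) (((\<sigma> a \<otimes> h) \<lhd> E) \<lhd> (1 \<otimes>\<^sub>M emb b))"
      unfolding E_ract_right
      by (subst tensor_lift_compose, (intro lin)+, subst tensor_lift_pair, (intro lin)+, simp)
    also have "\<dots> = tensor_lift (\<lambda>x y. \<omega> (z \<rhd> \<sigma>' x) *\<^sub>C y) ((\<sigma> a \<otimes> h) \<lhd> E) * b"
      by (subst tensor_lift_ract, (intro lin)+, subst tensor_lift_commute[where h = "\<lambda>x. x * b"])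
        (intro lin, simp add: scaleC_mult_left)
    finally show "tensor_lift (\<lambda>g w. tensor_lift (\<lambda>x y. \<pi> g (z \<rhd> \<sigma>' x) *\<^sub>C y) (t1 w b)) (U\<^sub>s \<omega> a h)
      = tensor_lift (\<lambda>x y. \<omega> (z \<rhd> \<sigma>' x) *\<^sub>C y) ((\<sigma> a \<otimes> h) \<lhd> E) * b" .
  qed
qed

text \<open>Here v becomes \<open>z S(h_2)\<close> in \<open>\<omega>(v h_3 a) c h_1\<close>, and
  \<open>h_1 \<otimes> S(h_2) h_3 a\<close> is \<open>G1 (h \<otimes> a)\<close>.\<close>

lemma target_substitution:
  obtains \<Phi> where "clinear \<Phi>" "\<And>\<omega> a h. clinear \<omega> \<Longrightarrow> \<Phi> (U\<^sub>t \<omega> a h)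
      = c * tensor_lift (\<lambda>x y. \<omega> (z * y) *\<^sub>C x) (G1 (h \<otimes> a))"
proof -
  obtain \<pi> :: "('a \<Rightarrow> complex) \<Rightarrow> ('a \<Rightarrow> complex)"
    where \<pi>: "clinear \<pi>" "\<And>g. \<pi> g \<in> {g. clinear g}" "\<And>g. g \<in> {g. clinear g} \<Longrightarrow> \<pi> g = g"
    by (rule csubspace_projection[OF csubspace_functionals], rule that)
  have \<pi>lin: "clinear (\<lambda>x. \<pi> g (f x))" if "clinear f" for g and f :: "'b::complex_vector \<Rightarrow> 'a"
    using clinear_functional[OF _ that] \<pi>(2) by blast
  note lin = lin3 \<pi>lin clinear_fun_apply[OF \<pi>(1)]
  have bl: "cbilinear (\<lambda>g w. tensor_lift (\<lambda>x y. \<pi> g (z * \<sigma> y) *\<^sub>C x) (t2 c w))" by (intro lin)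
  show thesis
  proof (rule that)
    show "clinear (tensor_lift (\<lambda>g w. tensor_lift (\<lambda>x y. \<pi> g (z * \<sigma> y) *\<^sub>C x) (t2 c w)))"
      by (rule clinear_tensor_lift[OF bl])
    fix \<omega> :: "'a \<Rightarrow> complex" and a h :: 'a assume \<omega>: "clinear \<omega>"
    have \<omega>lin: "clinear (\<lambda>x. \<omega> (f x))" if "clinear f" for f :: "'b::complex_vector \<Rightarrow> 'a"
      by (rule clinear_compose[OF \<omega> that])
    note lin = lin3 \<omega>lin
    have \<pi>\<omega>: "\<pi> (\<lambda>v. \<omega> (v * r)) = (\<lambda>v. \<omega> (v * r))" for r
      by (rule \<pi>(3)) (simp, intro lin)
    have "tensor_lift (\<lambda>g w. tensor_lift (\<lambda>x y. \<pi> g (z * \<sigma> y) *\<^sub>C x) (t2 c w)) (U\<^sub>t \<omega> a h)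
        = tensor_lift (\<lambda>p q. tensor_lift (\<lambda>x y. \<omega> ((z * \<sigma> y) * q) *\<^sub>C x) (t2 c p)) (t1 h a)"
      unfolding U\<^sub>t_def tensor_lift_compose[OF bl] tensor_lift_pair[OF bl] \<pi>\<omega> ..
    also have "\<dots> = tensor_lift (\<lambda>p q. tensor_lift (\<lambda>x y. \<omega> ((z * \<sigma> x) * y) *\<^sub>C p) (t1 q a)) (t2 c h)"
      by (rule coassoc) (intro lin)
    also have "\<dots> = tensor_lift (\<lambda>p q. \<omega> (z * cs q a) *\<^sub>C p) (t2 c h)"
    proof -
      have "tensor_lift (\<lambda>x y. \<omega> ((z * \<sigma> x) * y) *\<^sub>C p) (t1 q a) = \<omega> (z * cs q a) *\<^sub>C p" for p q :: 'a
        unfolding cs_eq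
        by (subst tensor_lift_commute[where h = "\<lambda>x. \<omega> (z * x) *\<^sub>C p"]) (intro lin, simp add: mult.assoc)
      then show ?thesis by (simp only:)
    qed
    also have "\<dots> = tensor_lift (\<lambda>x y. \<omega> (z * y) *\<^sub>C x) ((emb c \<otimes>\<^sub>M 1) \<rhd> G1 (h \<otimes> a))"
      unfolding antipode_G1
      by (subst tensor_lift_compose, (intro lin)+, subst tensor_lift_pair, (intro lin)+, simp)
    also have "\<dots> = c * tensor_lift (\<lambda>x y. \<omega> (z * y) *\<^sub>C x) (G1 (h \<otimes> a))"
      by (subst tensor_lift_lact, (intro lin)+, subst tensor_lift_commute[where h = "\<lambda>x. c * x"])
        (intro lin, simp add: scaleC_mult_right)
    finally show "tensor_lift (\<lambda>g w. tensor_lift (\<lambda>x y. \<pi> g (z * \<sigma> y) *\<^sub>C x) (t2 c w)) (U\<^sub>t \<omega> a h)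
      = c * tensor_lift (\<lambda>x y. \<omega> (z * y) *\<^sub>C x) (G1 (h \<otimes> a))" .
  qed
qed

subsection \<open>Local units\<close>

text \<open>In \<open>U\<^sub>s \<omega> a h\<close> the functional is evaluated only at multiples
  \<open>v h_1 a\<close> of a, so this tensor vanishes for every h in A. The substitution, which
  recovers h from its slices, then forces \<open>\<omega> a = 0\<close>.\<close>

lemma functional_vanishes:
  fixes \<omega> :: "'a \<Rightarrow> complex"
  assumes \<omega>: "clinear \<omega>" and zero: "\<And>b. \<omega> (b * a) = 0"
  shows "\<omega> a = 0"
proof -
  have \<omega>lin: "clinear (\<lambda>x. \<omega> (f x))" if "clinear f" for f :: "'b::complex_vector \<Rightarrow> 'a"
    by (rule clinear_compose[OF \<omega> that])
  have \<omega>scale: "\<omega> (c *\<^sub>C x) = c * \<omega> x" for c x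
    by (simp add: clinear_scale[OF \<omega>] scaleC_complex_def)
  note lin = lin3 \<omega>lin
  obtain u :: "('a mult, 'a) tensor" where u: "\<And>b. E \<rhd> (b \<otimes> a) = tensor_lift (\<lambda>y a'. (y \<rhd> b) \<otimes> a') u"
    "tensor_lift (\<lambda>y a'. S\<^sub>M y \<rhd> a') u = a" by (rule source_decomposition[of a], rule that)
  have U: "U\<^sub>s \<omega> a h = 0" for h
  proof (rule tensor_eval_zeroI)
    fix v
    have "tensor_lift (\<lambda>r w. \<omega> (v * r) *\<^sub>C w) (t3 h a) = 0"
    proof (rule nondeg_left_eqI[OF nd])
      fix b
      have "tensor_lift (\<lambda>r w. \<omega> (v * r) *\<^sub>C w) (t3 h a) * b
          = tensor_lift (\<lambda>r w. \<omega> (v * r) *\<^sub>C w) (t3 h a \<lhd> (1 \<otimes>\<^sub>M emb b))"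
        by (subst tensor_lift_ract, (intro lin)+, subst tensor_lift_commute[where h = "\<lambda>x. x * b"])
          (intro lin, simp add: scaleC_mult_left)
      also have "\<dots> = tensor_lift (\<lambda>p q. \<omega> ((v * p) * a) *\<^sub>C q) (t1 h b)"
        unfolding t3_t1[symmetric] by (subst tensor_lift_ract) ((intro lin)+, simp add: mult.assoc)
      also have "\<dots> = 0" by (simp add: zero)
      finally show "tensor_lift (\<lambda>r w. \<omega> (v * r) *\<^sub>C w) (t3 h a) * b = 0 * b" by simp
    qed
    then show "tensor_lift (\<lambda>g w. g v *\<^sub>C w) (U\<^sub>s \<omega> a h) = 0" by (simp only: U\<^sub>s_eval)
  qed
  define m where "m z = tensor_lift (\<lambda>y a'. \<omega> (z \<rhd> a') *\<^sub>C S\<^sub>M y) u" for z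
  have m: "m z = 0" for z
  proof (rule mult_eqI_right[OF nd], rule nondeg_left_eqI[OF nd])
    fix h b
    obtain \<Phi> where \<Phi>: "clinear \<Phi>" "\<And>\<omega> a h. clinear \<omega> \<Longrightarrow> \<Phi> (U\<^sub>s \<omega> a h)
      = tensor_lift (\<lambda>x y. \<omega> (z \<rhd> \<sigma>' x) *\<^sub>C y) ((\<sigma> a \<otimes> h) \<lhd> E) * b" by (rule source_substitution, rule that)
    have "tensor_lift (\<lambda>x y. \<omega> (z \<rhd> \<sigma>' x) *\<^sub>C y) ((\<sigma> a \<otimes> h) \<lhd> E)
        = tensor_lift (\<lambda>y a'. \<omega> (z \<rhd> a') *\<^sub>C (h \<lhd> S\<^sub>M y)) u"
      unfolding E_ract_source[OF u(1)]
      by (subst tensor_lift_compose, (intro lin)+, subst tensor_lift_pair, (intro lin)+, simp)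
    also have "\<dots> = h \<lhd> m z"
      unfolding m_def by (subst tensor_lift_commute[where h = "\<lambda>m. h \<lhd> m"]) (intro lin, simp)
    finally show "(h \<lhd> m z) * b = (h \<lhd> 0) * b"
      using \<Phi>(2)[OF \<omega>, of a h] by (simp add: U clinear_zero[OF \<Phi>(1)])
  qed
  \<comment> \<open>Writing u as \<open>y_i \<otimes> a_i\<close>, the sum of the
    \<open>\<omega>(z a_i) S(y_i)\<close> is zero for every multiplier z, while that of the
    \<open>\<omega>(S(y_i) a_i)\<close> is wanted. The elements \<open>S(y_i)\<close> are expanded
    in a basis of M(A), and z is taken to be each basis vector in turn.\<close>
  define u' where "u' = tensor_lift (\<lambda>y a'. a' \<otimes> S\<^sub>M y) u"
  obtain B where B: "finite B" "u' = (\<Sum>b\<in>B. tensor_lift (\<lambda>v w. coord b w *\<^sub>C v) u' \<otimes> b)"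
    by (rule tensor_expand_right)
  have blF: "cbilinear (\<lambda>a' m. m \<rhd> a')" by (intro lin)
  note linF = clinear_tensor_lift[OF blF]
  have "\<omega> (b \<rhd> tensor_lift (\<lambda>v w. coord b w *\<^sub>C v) u') = 0" for b
  proof -
    have bl: "cbilinear (\<lambda>(v::'a) w. coord b w *\<^sub>C v)" by (intro lin clinear_coord)
    have "\<omega> (b \<rhd> tensor_lift (\<lambda>v w. coord b w *\<^sub>C v) u') = tensor_lift (\<lambda>y a'. coord b (S\<^sub>M y) * \<omega> (b \<rhd> a')) u"
      unfolding u'_def tensor_lift_compose[OF bl] tensor_lift_pair[OF bl]
      by (subst tensor_lift_commute[where h = "\<lambda>x. \<omega> (b \<rhd> x)"]) (intro lin, simp add: act_linear \<omega>scale)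
    also have "\<dots> = coord b (m b)"
      unfolding m_def by (subst tensor_lift_commute[OF clinear_coord])
        (simp add: clinear_scale[OF clinear_coord] scaleC_complex_def mult.commute)
    finally show ?thesis by (simp add: m clinear_zero[OF clinear_coord])
  qed
  then have "\<omega> (tensor_lift (\<lambda>a' m. m \<rhd> a') u') = 0"
    by (subst B(2)) (simp add: clinear_sum[OF linF] clinear_sum[OF \<omega>] tensor_lift_pair[OF blF])
  moreover have "tensor_lift (\<lambda>a' m. m \<rhd> a') u' = a"
    unfolding u'_def tensor_lift_compose[OF blF] tensor_lift_pair[OF blF] by (rule u(2))
  ultimately show ?thesis by simp
qed

text \<open>Were a outside \<open>A a\<close>, some functional would vanish on \<open>A a\<close>
  but not at a.\<close>

lemma local_unit: "\<exists>e. e * a = (a :: 'a)"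
proof -
  have lin: "clinear (\<lambda>b. b * a)" by (intro lin3)
  have V: "csubspace (range (\<lambda>b. b * a))"
    by (rule cvec.subspaceI)
      (auto simp: clinear_add[OF lin, symmetric] clinear_scale[OF lin, symmetric] intro: range_eqI[of _ _ 0])
  obtain k :: "'a \<Rightarrow> 'a" where k: "clinear k" "\<And>x. k x = 0 \<longleftrightarrow> x \<in> range (\<lambda>b. b * a)"
    by (rule csubspace_kernel[OF V], rule that)
  have "coord b (k a) = 0" for b
  proof (rule functional_vanishes[where \<omega> = "\<lambda>x. coord b (k x)"])
    show "clinear (\<lambda>x. coord b (k x))" by (rule clinear_compose[OF clinear_coord k(1)])
    have "k (c * a) = 0" for c using k(2) by blast
    then show "coord b (k (c * a)) = 0" for c by (simp add: clinear_zero[OF clinear_coord])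
  qed
  moreover obtain B where "finite B" "\<And>B'. finite B' \<Longrightarrow> B \<subseteq> B' \<Longrightarrow> (\<Sum>b\<in>B'. coord b (k a) *\<^sub>C b) = k a"
    by (rule coord_expand[where v = "k a"], rule that)
  ultimately have "k a = 0" by (metis (no_types, lifting) order.refl cvec.scale_zero_left sum.neutral)
  then show ?thesis using k(2) by (metis rangeE)
qed

lemma common_local_unit: "\<exists>e. e * a = a \<and> e * a' = (a' :: 'a)"
proof -
  obtain e where e: "e * a = a" using local_unit by blast
  obtain e' where e': "e' * (a' - e * a') = a' - e * a'" using local_unit by blast
  \<comment> \<open>\<open>1 - ?e = (1 - e')(1 - e)\<close>: e already fixes a, and e' repairs the
    defect \<open>a' - e a'\<close>.\<close>
  let ?e = "e' + e - e' * e"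
  have "?e * a = a" by (simp add: algebra_simps e)
  moreover have "?e * a' = a'" using e' by (simp add: algebra_simps)
  ultimately show ?thesis by blast
qed

text \<open>Closure under addition is the point: \<open>\<omega>(x a) + \<omega>'(x a')\<close> is a
  linear functional of x that does not change when x is replaced by \<open>x e\<close>, for a common
  local unit e of a and a'.\<close>

lemma csubspace_reduced_dual: "csubspace (reduced_dual :: ('a \<Rightarrow> complex) set)"
proof (rule cvec.subspaceI)
  show "0 \<in> (reduced_dual :: ('a \<Rightarrow> complex) set)"
    using reduced_dualI[OF clinear_0] by (simp add: zero_fun_def)
next
  fix \<rho> \<rho>' :: "'a \<Rightarrow> complex" assume "\<rho> \<in> reduced_dual" "\<rho>' \<in> reduced_dual"
  then obtain \<omega> a \<omega>' a' where \<omega>: "clinear \<omega>" "clinear \<omega>'"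
    and \<rho>: "\<rho> = functional_times \<omega> (emb a)" "\<rho>' = functional_times \<omega>' (emb a')"
    by (auto elim!: reduced_dualE)
  obtain e where e: "e * a = a" "e * a' = a'" using common_local_unit by blast
  have "clinear (\<lambda>x. \<omega> (x * a) + \<omega>' (x * a'))"
    by (intro clin clinear_compose[OF \<omega>(1)] clinear_compose[OF \<omega>(2)])
  from reduced_dualI[OF this, of e] show "\<rho> + \<rho>' \<in> reduced_dual"
    by (simp add: \<rho> functional_times_emb plus_fun_def mult.assoc e)
next
  fix \<rho> :: "'a \<Rightarrow> complex" and c assume "\<rho> \<in> reduced_dual"
  then obtain \<omega> a where \<omega>: "clinear \<omega>" and \<rho>: "\<rho> = functional_times \<omega> (emb a)"
    by (rule reduced_dualE)
  from reduced_dualI[OF clinear_scaleC_right[OF \<omega>], of c a] show "c *\<^sub>C \<rho> \<in> reduced_dual"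
    by (simp add: \<rho> functional_times_emb scaleC_fun_def)
qed

subsection \<open>Bijectivity of the slice maps\<close>

text \<open>Modulo the relations, the generator with functional \<open>\<omega>(x S(y) a')\<close>
  and element h equals the one with \<open>\<omega>(x a')\<close> and \<open>h S(y)\<close>. Summed
  over u this gives \<open>P\<close>. Induction over the span is used because the coefficients in
  \<open>R\<close> belong to no distinguished representative of u.\<close>

lemma balanced_expand:
  fixes \<omega> :: "'a \<Rightarrow> complex" and u :: "('a mult, 'a) tensor" and R :: "'a mult set"
  defines "H \<equiv> cointegrals \<Delta> S"
  defines "N \<equiv> cspan (balanced_relators reduced_dual R H (act_functional S) (act_element S))"
  assumes \<omega>: "clinear \<omega>" and h: "h \<in> H" and u: "u \<in> tensor_sub R UNIV"
  shows "\<exists>P \<in> free_on reduced_dual H.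
      P - free_gen (\<lambda>x. \<omega> (x * tensor_lift (\<lambda>y a'. S\<^sub>M y \<rhd> a') u)) h \<in> N
    \<and> (\<forall>z. free_lift (\<lambda>\<rho> h. \<rho> z *\<^sub>C h) P = tensor_lift (\<lambda>y a'. \<omega> (z * a') *\<^sub>C (h \<lhd> S\<^sub>M y)) u)"
proof -
  have \<omega>lin: "clinear (\<lambda>x. \<omega> (f x))" if "clinear f" for f :: "'b::complex_vector \<Rightarrow> 'a"
    by (rule clinear_compose[OF \<omega> that])
  have bl: "cbilinear (\<lambda>y a'. \<omega> (z * a') *\<^sub>C (h \<lhd> S\<^sub>M y))" for z by (intro lin3 \<omega>lin)
  have blD: "cbilinear (\<lambda>y (a' :: 'a). S\<^sub>M y \<rhd> a')" by (intro lin3)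
  let ?D = "tensor_lift (\<lambda>y (a' :: 'a). S\<^sub>M y \<rhd> a')"
  let ?g = "\<lambda>a. free_gen (\<lambda>x. \<omega> (x * a)) h"
  let ?K = "\<lambda>z. tensor_lift (\<lambda>y a'. \<omega> (z * a') *\<^sub>C (h \<lhd> S\<^sub>M y))"
  let ?ev = "\<lambda>z. free_lift (\<lambda>\<rho> (h :: 'a). \<rho> z *\<^sub>C h)"
  note K = clinearD[OF clinear_tensor_lift[OF bl]] and D = clinearD[OF clinear_tensor_lift[OF blD]]
    and ev = clinearD[OF clinear_free_lift]
  let ?good = "\<lambda>u P. P \<in> free_on reduced_dual H \<and> P - ?g (?D u) \<in> N \<and> (\<forall>z. ?ev z P = ?K z u)"
  have N: "csubspace N" unfolding N_def by (rule cvec.subspace_span)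
  have rel: "cspan (bilinear_relators reduced_dual H) \<subseteq> N"
    unfolding N_def balanced_relators_def by (rule cvec.span_mono) blast
  have \<rho>: "(\<lambda>x. \<omega> (x * a)) \<in> reduced_dual" for a by (rule reduced_dualI[OF \<omega>])
  have g_add: "?g (a + a') - ?g a - ?g a' \<in> N" for a a'
  proof -
    have eq: "(\<lambda>x. \<omega> (x * (a + a'))) = (\<lambda>x. \<omega> (x * a)) + (\<lambda>x. \<omega> (x * a'))"
      by (simp add: distrib_left clinear_add[OF \<omega>] plus_fun_def)
    show ?thesis
      unfolding eq by (rule free_gen_add_left[OF rel \<rho> \<rho> _ h]) (simp only: eq[symmetric] \<rho>)
  qed
  have g_scale: "?g (c *\<^sub>C a) - c *\<^sub>C ?g a \<in> N" for a c
  proof -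
    have eq: "(\<lambda>x. \<omega> (x * c *\<^sub>C a)) = c *\<^sub>C (\<lambda>x. \<omega> (x * a))"
      by (simp add: scaleC_mult_right clinear_scale[OF \<omega>] scaleC_fun_def)
    show ?thesis
      unfolding eq by (rule free_gen_scale_left[OF rel \<rho> _ h]) (simp only: eq[symmetric] \<rho>)
  qed
  have "\<exists>P. ?good u P"
    using u unfolding tensor_sub_def
  proof (rule cvec.span_induct)
    show "csubspace {u. \<exists>P. ?good u P}"
    proof (rule cvec.subspaceI)
      have "?g 0 \<in> N" using g_scale[of 0 0] by simp
      then have "?good 0 0"
        using cvec.subspace_neg[OF N] by (simp add: D K ev cvec.subspace_0[OF csubspace_free_on])
      then show "0 \<in> {u. \<exists>P. ?good u P}" by blast
    next
      fix u v assume "u \<in> {u. \<exists>P. ?good u P}" "v \<in> {u. \<exists>P. ?good u P}"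
      then obtain P Q where P: "?good u P" and Q: "?good v Q" by blast
      have "(P + Q) - ?g (?D u + ?D v)
          = (P - ?g (?D u)) + (Q - ?g (?D v)) - (?g (?D u + ?D v) - ?g (?D u) - ?g (?D v))"
        by (simp only: algebra_simps)
      also have "\<dots> \<in> N"
        by (rule cvec.subspace_diff[OF N cvec.subspace_add[OF N] g_add]) (use P Q in blast)+
      finally have "?good (u + v) (P + Q)"
        using P Q by (simp add: D K ev cvec.subspace_add[OF csubspace_free_on])
      then show "u + v \<in> {u. \<exists>P. ?good u P}" by blast
    next
      fix u c assume "u \<in> {u. \<exists>P. ?good u P}"
      then obtain P where P: "?good u P" by blast
      have "c *\<^sub>C P - ?g (c *\<^sub>C ?D u) = c *\<^sub>C (P - ?g (?D u)) - (?g (c *\<^sub>C ?D u) - c *\<^sub>C ?g (?D u))"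
        by (simp add: cvec.scale_right_diff_distrib)
      also have "\<dots> \<in> N"
        by (rule cvec.subspace_diff[OF N cvec.subspace_scale[OF N] g_scale]) (use P in blast)
      finally have "?good (c *\<^sub>C u) (c *\<^sub>C P)"
        using P by (simp add: D K ev cvec.subspace_scale[OF csubspace_free_on])
      then show "c *\<^sub>C u \<in> {u. \<exists>P. ?good u P}" by blast
    qed
    fix t :: "('a mult, 'a) tensor" assume "t \<in> {y \<otimes> a' |y a'. y \<in> R \<and> a' \<in> UNIV}"
    then obtain y a' where y: "y \<in> R" and t: "t = y \<otimes> a'" by blast
    let ?\<rho> = "\<lambda>x. \<omega> (x * a')"
    have "free_gen (act_functional S ?\<rho> y) h - free_gen ?\<rho> (act_element S y h) \<in> N"
      unfolding N_def balanced_relators_def using y h \<rho> by (intro cvec.span_base UnI2) blast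
    then have "- (?g (S\<^sub>M y \<rhd> a') - free_gen ?\<rho> (h \<lhd> S\<^sub>M y)) \<in> N"
      unfolding act_functional_times act_element_eq by (rule cvec.subspace_neg[OF N])
    then have "?good t (free_gen ?\<rho> (h \<lhd> S\<^sub>M y))"
      using h by (simp add: t tensor_lift_pair[OF bl] tensor_lift_pair[OF blD] free_lift_gen free_on_gen \<rho> H_def
        act_element_cointegral)
    then show "\<exists>P. ?good t P" by blast
  qed
  then show ?thesis by blast
qed

lemma reduced_dual_representation:
  obtains \<omega> :: "('a \<Rightarrow> complex) \<Rightarrow> 'a \<Rightarrow> complex" and \<alpha> where
    "\<And>\<rho>. \<rho> \<in> reduced_dual \<Longrightarrow> clinear (\<omega> \<rho>)" "\<And>\<rho>. \<rho> \<in> reduced_dual \<Longrightarrow> (\<lambda>x. \<omega> \<rho> (x * \<alpha> \<rho>)) = \<rho>"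
proof -
  have "\<exists>\<omega> a. \<rho> \<in> reduced_dual \<longrightarrow> clinear \<omega> \<and> (\<lambda>x :: 'a. \<omega> (x * a)) = \<rho>" for \<rho>
    using reduced_dualE[of \<rho>] unfolding functional_times_emb by metis
  then show thesis using that by metis
qed

lemma f_s_injective:
  assumes p: "p \<in> free_on reduced_dual (cointegrals \<Delta> S)" and zero: "free_lift (f_s \<Delta>) p = 0"
  shows "p \<in> cspan (balanced_relators reduced_dual (source_algebra \<Delta> E) (cointegrals \<Delta> S)
    (act_functional S) (act_element S))" (is "p \<in> cspan ?rel")
proof -
  obtain \<omega> :: "('a \<Rightarrow> complex) \<Rightarrow> 'a \<Rightarrow> complex" and \<alpha>
    where \<omega>: "\<And>\<rho>. \<rho> \<in> reduced_dual \<Longrightarrow> clinear (\<omega> \<rho>)"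
      and \<alpha>: "\<And>\<rho>. \<rho> \<in> reduced_dual \<Longrightarrow> (\<lambda>x. \<omega> \<rho> (x * \<alpha> \<rho>)) = \<rho>"
    by (rule reduced_dual_representation, rule that)
  \<comment> \<open>What the substitution makes of the generator for \<open>\<rho>\<close> and h,
    with one fixed representation of each \<open>\<rho>\<close>. By \<open>E_ract_source\<close> it
    is also the evaluation of the expansion given by \<open>balanced_expand\<close>.\<close>
  define K where "K z \<rho> h = tensor_lift (\<lambda>x y. \<omega> \<rho> (z * \<sigma>' x) *\<^sub>C y) ((\<sigma> (\<alpha> \<rho>) \<otimes> h) \<lhd> E)" for z :: 'a and \<rho> and h :: 'a
  have U: "free_lift (\<lambda>\<rho>. U\<^sub>s (\<omega> \<rho>) (\<alpha> \<rho>)) p = 0"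
  proof (rule tensor_eval_zeroI)
    fix v
    \<comment> \<open>Every v is an antipode image, so the cointegral identity reaches all
      evaluation points.\<close>
    define v' where "v' = \<sigma>' v"
    have v: "v = \<sigma> v'" by (simp add: v'_def)
    have "tensor_lift (\<lambda>g w. g v *\<^sub>C w) (free_lift (\<lambda>\<rho>. U\<^sub>s (\<omega> \<rho>) (\<alpha> \<rho>)) p)
        = free_lift (\<lambda>\<rho> h. v' * f_s \<Delta> \<rho> h) p"
      unfolding free_lift_commute[OF clinear_tensor_lift[OF cbilinear_eval]]
    proof (rule free_lift_cong[OF p])
      fix \<rho> :: "'a \<Rightarrow> complex" and h :: 'a assume \<rho>: "\<rho> \<in> reduced_dual" and h: "h \<in> cointegrals \<Delta> S"
      have "f_s \<Delta> \<rho> h = slice_left (\<omega> \<rho>) (t3 h (\<alpha> \<rho>))"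
        using f_s_functional[OF \<omega>[OF \<rho>], of "\<alpha> \<rho>" h] by (simp only: functional_times_emb \<alpha>[OF \<rho>])
      then show "tensor_lift (\<lambda>g w. g v *\<^sub>C w) (U\<^sub>s (\<omega> \<rho>) (\<alpha> \<rho>) h) = v' * f_s \<Delta> \<rho> h"
        unfolding v by (simp only: U\<^sub>s_eval_cointegral[OF \<omega>[OF \<rho>] h])
    qed
    also have "\<dots> = v' * free_lift (f_s \<Delta>) p"
      by (rule free_lift_commute[symmetric]) (intro clin)
    finally show "tensor_lift (\<lambda>g w. g v *\<^sub>C w) (free_lift (\<lambda>\<rho>. U\<^sub>s (\<omega> \<rho>) (\<alpha> \<rho>)) p) = 0" by (simp add: zero)
  qed
  show ?thesis
  proof (rule free_on_kernel[where K = K, OF csubspace_reduced_dual csubspace_cointegrals cvec.subspace_span _ _ p])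
    show "cspan (bilinear_relators reduced_dual (cointegrals \<Delta> S)) \<subseteq> cspan ?rel"
      unfolding balanced_relators_def by (rule cvec.span_mono) blast
  next
    fix \<rho> :: "'a \<Rightarrow> complex" and h :: 'a assume \<rho>: "\<rho> \<in> reduced_dual" and h: "h \<in> cointegrals \<Delta> S"
    obtain u :: "('a mult, 'a) tensor" where u: "u \<in> tensor_sub {y. As y} UNIV"
      "\<And>b. E \<rhd> (b \<otimes> \<alpha> \<rho>) = tensor_lift (\<lambda>y a'. (y \<rhd> b) \<otimes> a') u"
      "tensor_lift (\<lambda>y a'. S\<^sub>M y \<rhd> a') u = \<alpha> \<rho>" by (rule source_decomposition[of "\<alpha> \<rho>"], rule that)
    have \<omega>lin: "clinear (\<lambda>x. \<omega> \<rho> (f x))" if "clinear f" for f :: "'b::complex_vector \<Rightarrow> 'a"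
      by (rule clinear_compose[OF \<omega>[OF \<rho>] that])
    have "K z \<rho> h = tensor_lift (\<lambda>y a'. \<omega> \<rho> (z * a') *\<^sub>C (h \<lhd> S\<^sub>M y)) u" for z
      unfolding K_def E_ract_source[OF u(2)]
      by (subst tensor_lift_compose, (intro lin3 \<omega>lin)+, subst tensor_lift_pair, (intro lin3 \<omega>lin)+, simp)
    moreover have "{y. As y} = source_algebra \<Delta> E" by (auto simp: source_algebra_iff)
    ultimately show "\<exists>P \<in> free_on reduced_dual (cointegrals \<Delta> S). P - free_gen \<rho> h \<in> cspan ?rel
      \<and> (\<forall>z. free_lift (\<lambda>\<rho> h. \<rho> z *\<^sub>C h) P = K z \<rho> h)"
      using balanced_expand[OF \<omega>[OF \<rho>] h, of u "source_algebra \<Delta> E"] u(1) by (simp only: u(3) \<alpha>[OF \<rho>])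
  next
    fix z :: 'a
    show "free_lift (K z) p = 0"
    proof (rule nondeg_left_eqI[OF nd])
      fix b
      obtain \<Phi> where \<Phi>: "clinear \<Phi>" "\<And>\<omega> a h. clinear \<omega> \<Longrightarrow> \<Phi> (U\<^sub>s \<omega> a h)
        = tensor_lift (\<lambda>x y. \<omega> (emb z \<rhd> \<sigma>' x) *\<^sub>C y) ((\<sigma> a \<otimes> h) \<lhd> E) * b"
        by (rule source_substitution, rule that)
      have "free_lift (K z) p * b = free_lift (\<lambda>\<rho> h. K z \<rho> h * b) p"
        by (rule free_lift_commute) (intro clin)
      also have "\<dots> = free_lift (\<lambda>\<rho> h. \<Phi> (U\<^sub>s (\<omega> \<rho>) (\<alpha> \<rho>) h)) p"
        by (rule free_lift_cong[OF p]) (simp add: K_def \<Phi>(2) \<omega>)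
      also have "\<dots> = \<Phi> (free_lift (\<lambda>\<rho>. U\<^sub>s (\<omega> \<rho>) (\<alpha> \<rho>)) p)"
        by (rule free_lift_commute[OF \<Phi>(1), symmetric])
      also have "\<dots> = 0 * b" by (simp add: U clinear_zero[OF \<Phi>(1)])
      finally show "free_lift (K z) p * b = 0 * b" .
    qed
  qed
qed

lemma f_t_injective:
  assumes p: "p \<in> free_on reduced_dual (cointegrals \<Delta> S)" and zero: "free_lift (f_t \<Delta>) p = 0"
  shows "p \<in> cspan (balanced_relators reduced_dual (target_algebra \<Delta> E) (cointegrals \<Delta> S)
    (act_functional S) (act_element S))" (is "p \<in> cspan ?rel")
proof -
  obtain \<omega> :: "('a \<Rightarrow> complex) \<Rightarrow> 'a \<Rightarrow> complex" and \<alpha>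
    where \<omega>: "\<And>\<rho>. \<rho> \<in> reduced_dual \<Longrightarrow> clinear (\<omega> \<rho>)"
      and \<alpha>: "\<And>\<rho>. \<rho> \<in> reduced_dual \<Longrightarrow> (\<lambda>x. \<omega> \<rho> (x * \<alpha> \<rho>)) = \<rho>"
    by (rule reduced_dual_representation, rule that)
  define K where "K z \<rho> h = tensor_lift (\<lambda>x y. \<omega> \<rho> (z * y) *\<^sub>C x) (G1 (h \<otimes> \<alpha> \<rho>))" for z :: 'a and \<rho> and h :: 'a
  have U: "free_lift (\<lambda>\<rho>. U\<^sub>t (\<omega> \<rho>) (\<alpha> \<rho>)) p = 0"
  proof (rule tensor_eval_zeroI)
    fix v
    have "tensor_lift (\<lambda>g w. g v *\<^sub>C w) (free_lift (\<lambda>\<rho>. U\<^sub>t (\<omega> \<rho>) (\<alpha> \<rho>)) p)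
        = free_lift (\<lambda>\<rho> h. \<sigma> v * f_t \<Delta> \<rho> h) p"
      unfolding free_lift_commute[OF clinear_tensor_lift[OF cbilinear_eval]]
    proof (rule free_lift_cong[OF p])
      fix \<rho> :: "'a \<Rightarrow> complex" and h :: 'a assume \<rho>: "\<rho> \<in> reduced_dual" and h: "h \<in> cointegrals \<Delta> S"
      have "f_t \<Delta> \<rho> h = slice_right (\<omega> \<rho>) (t1 h (\<alpha> \<rho>))"
        using f_t_functional[OF \<omega>[OF \<rho>], of "\<alpha> \<rho>" h] by (simp only: functional_times_emb \<alpha>[OF \<rho>])
      then show "tensor_lift (\<lambda>g w. g v *\<^sub>C w) (U\<^sub>t (\<omega> \<rho>) (\<alpha> \<rho>) h) = \<sigma> v * f_t \<Delta> \<rho> h"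
        by (simp only: U\<^sub>t_eval_cointegral[OF \<omega>[OF \<rho>] h])
    qed
    also have "\<dots> = \<sigma> v * free_lift (f_t \<Delta>) p"
      by (rule free_lift_commute[symmetric]) (intro clin)
    finally show "tensor_lift (\<lambda>g w. g v *\<^sub>C w) (free_lift (\<lambda>\<rho>. U\<^sub>t (\<omega> \<rho>) (\<alpha> \<rho>)) p) = 0" by (simp add: zero)
  qed
  show ?thesis
  proof (rule free_on_kernel[where K = K, OF csubspace_reduced_dual csubspace_cointegrals cvec.subspace_span _ _ p])
    show "cspan (bilinear_relators reduced_dual (cointegrals \<Delta> S)) \<subseteq> cspan ?rel"
      unfolding balanced_relators_def by (rule cvec.span_mono) blast
  next
    fix \<rho> :: "'a \<Rightarrow> complex" and h :: 'a assume \<rho>: "\<rho> \<in> reduced_dual" and h: "h \<in> cointegrals \<Delta> S"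
    obtain u :: "('a mult, 'a) tensor" where u: "u \<in> tensor_sub {x. At x} UNIV"
      "\<And>h. G1 (h \<otimes> \<alpha> \<rho>) = tensor_lift (\<lambda>x a'. (h \<lhd> S\<^sub>M x) \<otimes> a') u"
      "tensor_lift (\<lambda>y a'. S\<^sub>M y \<rhd> a') u = \<alpha> \<rho>" by (rule target_decomposition[of "\<alpha> \<rho>"], rule that)
    have \<omega>lin: "clinear (\<lambda>x. \<omega> \<rho> (f x))" if "clinear f" for f :: "'b::complex_vector \<Rightarrow> 'a"
      by (rule clinear_compose[OF \<omega>[OF \<rho>] that])
    have "K z \<rho> h = tensor_lift (\<lambda>y a'. \<omega> \<rho> (z * a') *\<^sub>C (h \<lhd> S\<^sub>M y)) u" for z
      unfolding K_def u(2)
      by (subst tensor_lift_compose, (intro lin3 \<omega>lin)+, subst tensor_lift_pair, (intro lin3 \<omega>lin)+, simp)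
    moreover have "{x. At x} = target_algebra \<Delta> E" by (auto simp: target_algebra_iff)
    ultimately show "\<exists>P \<in> free_on reduced_dual (cointegrals \<Delta> S). P - free_gen \<rho> h \<in> cspan ?rel
      \<and> (\<forall>z. free_lift (\<lambda>\<rho> h. \<rho> z *\<^sub>C h) P = K z \<rho> h)"
      using balanced_expand[OF \<omega>[OF \<rho>] h, of u "target_algebra \<Delta> E"] u(1) by (simp only: u(3) \<alpha>[OF \<rho>])
  next
    fix z :: 'a
    show "free_lift (K z) p = 0"
    proof (rule nondeg_right_eqI[OF nd])
      fix c
      obtain \<Phi> where \<Phi>: "clinear \<Phi>" "\<And>\<omega> a h. clinear \<omega> \<Longrightarrow> \<Phi> (U\<^sub>t \<omega> a h)
        = c * tensor_lift (\<lambda>x y. \<omega> (z * y) *\<^sub>C x) (G1 (h \<otimes> a))"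
        by (rule target_substitution, rule that)
      have "c * free_lift (K z) p = free_lift (\<lambda>\<rho> h. c * K z \<rho> h) p"
        by (rule free_lift_commute) (intro clin)
      also have "\<dots> = free_lift (\<lambda>\<rho> h. \<Phi> (U\<^sub>t (\<omega> \<rho>) (\<alpha> \<rho>) h)) p"
        by (rule free_lift_cong[OF p]) (simp add: K_def \<Phi>(2) \<omega>)
      also have "\<dots> = \<Phi> (free_lift (\<lambda>\<rho>. U\<^sub>t (\<omega> \<rho>) (\<alpha> \<rho>)) p)"
        by (rule free_lift_commute[OF \<Phi>(1), symmetric])
      also have "\<dots> = c * 0" by (simp add: U clinear_zero[OF \<Phi>(1)])
      finally show "c * free_lift (K z) p = c * 0" .
    qed
  qed
qed

section \<open>Surjectivity of the slice maps\<close>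

lemma csubspace_free_lift_image: "csubspace (free_lift f ` free_on V W)"
proof -
  interpret Vector_Spaces.linear scaleC scaleC "free_lift f" by (rule clinear_free_lift)
  show ?thesis unfolding csubspace_def
    by (rule subspace_image[OF csubspace_free_on[unfolded csubspace_def]])
qed

lemma free_lift_image_gen: "v \<in> V \<Longrightarrow> w \<in> W \<Longrightarrow> f v w \<in> free_lift f ` free_on V W"
  by (rule image_eqI[of _ _ "free_gen v w"]) (simp_all add: free_lift_gen free_on_gen)

text \<open>The right leg of \<open>\<Delta>(H)\<close> is measured with
  \<open>(c \<otimes> 1)\<Delta>(h)\<close>, but \<open>f_s\<close> slices
  \<open>\<Delta>(h)(e \<otimes> 1)\<close>. A linear map k whose kernel is the image bridges the
  two: it kills the second leg of \<open>(c \<otimes> 1)\<Delta>(h)(e \<otimes> 1)\<close>, and e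
  can be cancelled. For \<open>f_t\<close> both coverings coincide.\<close>

lemma f_s_surjective: "\<exists>p \<in> free_on reduced_dual (cointegrals \<Delta> S). free_lift (f_s \<Delta>) p = x"
proof -
  let ?Y = "free_lift (f_s \<Delta>) ` free_on reduced_dual (cointegrals \<Delta> S)"
  obtain k :: "'a \<Rightarrow> 'a" where k: "clinear k" "\<And>x. k x = 0 \<longleftrightarrow> x \<in> ?Y"
    by (rule csubspace_kernel[OF csubspace_free_lift_image], rule that)
  note lin = lin3 clinear_compose[OF k(1)]
  have "k x = 0"
  proof (rule right_leg_eqI[OF cointegrals_legs(2), where f = k and g = "\<lambda>_. 0" and y = x])
    fix h c assume h: "h \<in> cointegrals \<Delta> S"
    have "tensor_lift (\<lambda>p q. p \<otimes> k q) (t2 c h) = 0"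
    proof (rule cancel_ract_left[OF nd nd id])
      fix e
      have "tensor_lift (\<lambda>p q. p \<otimes> k q) (t3 h e) = 0"
      proof (rule tensor_zeroI_right)
        fix \<phi> :: "'a \<Rightarrow> complex" assume \<phi>: "clinear \<phi>"
        have bl: "cbilinear (\<lambda>v w :: 'a. \<phi> v *\<^sub>C w)" by (intro clin \<phi>)
        have "tensor_lift (\<lambda>v w. \<phi> v *\<^sub>C w) (tensor_lift (\<lambda>p q. p \<otimes> k q) (t3 h e)) = k (slice_left \<phi> (t3 h e))"
          unfolding slice_left_def tensor_lift_compose[OF bl] tensor_lift_pair[OF bl]
            tensor_lift_commute[OF k(1)] clinear_scale[OF k(1)] ..
        also have "\<dots> = 0"
          unfolding k(2) f_s_functional[OF \<phi>, symmetric]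
          by (rule free_lift_image_gen[OF _ h]) (simp only: functional_times_emb reduced_dualI[OF \<phi>])
        finally show "tensor_lift (\<lambda>v w. \<phi> v *\<^sub>C w) (tensor_lift (\<lambda>p q. p \<otimes> k q) (t3 h e)) = 0" .
      qed
      moreover have "tensor_lift (\<lambda>p q. p \<otimes> k q) (t2 c h) \<lhd> (emb e \<otimes>\<^sub>M 1)
          = (emb c \<otimes>\<^sub>M 1) \<rhd> tensor_lift (\<lambda>p q. p \<otimes> k q) (t3 h e)"
      proof -
        have "tensor_lift (\<lambda>p q. p \<otimes> k q) (t2 c h) \<lhd> (emb e \<otimes>\<^sub>M 1)
            = tensor_lift (\<lambda>p q. p \<otimes> k q) (t2 c h \<lhd> (emb e \<otimes>\<^sub>M 1))"
          unfolding ract_pair by (subst tensor_lift_ract) ((intro lin)+, simp)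
        also have "\<dots> = (emb c \<otimes>\<^sub>M 1) \<rhd> tensor_lift (\<lambda>p q. p \<otimes> k q) (t3 h e)"
          unfolding t3_t2[symmetric] lact_pair by (subst tensor_lift_lact) ((intro lin)+, simp)
        finally show ?thesis .
      qed
      ultimately show "tensor_lift (\<lambda>p q. p \<otimes> k q) (t2 c h) \<lhd> (emb e \<otimes>\<^sub>M 1) = 0 \<lhd> (emb e \<otimes>\<^sub>M 1)"
        by (simp add: act_linear)
    qed
    then show "tensor_lift (\<lambda>p q. p \<otimes> k q) (t2 c h) = tensor_lift (\<lambda>p q. p \<otimes> (0 :: 'a)) (t2 c h)"
      by (simp add: tensor_pair_simps)
  qed (rule k(1) clinear_0)+
  then show ?thesis using k(2) by auto
qed

lemma f_t_surjective: "\<exists>p \<in> free_on reduced_dual (cointegrals \<Delta> S). free_lift (f_t \<Delta>) p = x"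
proof -
  have "x \<in> free_lift (f_t \<Delta>) ` free_on reduced_dual (cointegrals \<Delta> S)"
  proof (rule left_leg_induct[OF cointegrals_legs(1) csubspace_free_lift_image])
    fix h a and \<phi> :: "'a \<Rightarrow> complex" assume h: "h \<in> cointegrals \<Delta> S" and \<phi>: "clinear \<phi>"
    show "tensor_lift (\<lambda>p q. \<phi> q *\<^sub>C p) (t1 h a) \<in> free_lift (f_t \<Delta>) ` free_on reduced_dual (cointegrals \<Delta> S)"
      unfolding slice_right_def[symmetric] f_t_functional[OF \<phi>, symmetric]
      by (rule free_lift_image_gen[OF _ h]) (simp only: functional_times_emb reduced_dualI[OF \<phi>])
  qed
  then show ?thesis by auto
qed

end

theorem proposition3p14:
  fixes \<Delta> :: "'a::complex_algebra coprod"
    and \<epsilon> :: "'a \<Rightarrow> complex"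
    and E :: "('a, 'a) tensor mult"
    and G1 G2 :: "('a, 'a) tensor \<Rightarrow> ('a, 'a) tensor"
    and S :: "'a \<Rightarrow> 'a mult"
  assumes "regular_weak_multiplier_hopf_algebra \<Delta> \<epsilon> E G1 G2 S"
    and "discrete_type \<Delta> S"
  shows "(free_lift (f_s \<Delta>) respects
        balanced_equiv reduced_dual (source_algebra \<Delta> E) (cointegrals \<Delta> S)
          (act_functional S) (act_element S)
      \<and> bij_betw (balanced_lift (f_s \<Delta>))
        (balanced_tensor reduced_dual (source_algebra \<Delta> E) (cointegrals \<Delta> S)
          (act_functional S) (act_element S)) UNIV)
    \<and> (free_lift (f_t \<Delta>) respects
        balanced_equiv reduced_dual (target_algebra \<Delta> E) (cointegrals \<Delta> S)
          (act_functional S) (act_element S)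
      \<and> bij_betw (balanced_lift (f_t \<Delta>))
        (balanced_tensor reduced_dual (target_algebra \<Delta> E) (cointegrals \<Delta> S)
          (act_functional S) (act_element S)) UNIV)"
proof -
  interpret discrete_weak_multiplier_hopf_algebra \<Delta> \<epsilon> E G1 G2 S
    using assms by (simp add: discrete_weak_multiplier_hopf_algebra_def discrete_weak_multiplier_hopf_algebra_axioms_def)
  show ?thesis
    by (rule conjI[OF balanced_bij[OF f_s_relators f_s_injective f_s_surjective]
        balanced_bij[OF f_t_relators f_t_injective f_t_surjective]])
qed

end
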